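(* Let $p$ be a prime, let $F$ be an algebraic field extension of $\mathbb{F}_p$, let $S=\{s_1,\dots,s_\nu\}$ be a finite set of irreducible elements of $\mathbb{F}_p[z]$ which remain irreducible in $F[z]$, let $R=F[z,s_1^{-1},\dots,s_\nu^{-1}]\subseteq F(z)$, and let $\mathcal{R}$ be the $\mathcal{L}_p(z)^e$-structure with universe $R$ described in the context. Then: (1) The $\mathcal{L}_p(z)^e$-theory of $\mathcal{R}$ is effectively model-complete. (2) Every $\mathcal{L}_p(z)^e$-sentence is equivalent in $\mathcal{R}$ to a sentence of the form $P_\sigma$, where $\sigma$ is a sentence of $\mathcal{L}_p$.
   Context: Languages and structures. $\mathcal{L}_p=\{+,\ x\mapsto x^p,\ =,\ 0,\ 1\}$, with $+$ interpreted as addition, $x\mapsto x^p$ as the Frobenius map, and constants $0,1$; the field $F$ is regarded as an $\mathcal{L}_p$-structure in the obvious way. $\mathcal{L}_p(z)=\mathcal{L}_p\cup\{\,\in F,\ x\mapsto zx\}$, where $x\mapsto zx$ is a unary function symbol interpreted as multiplication by $z$ and $\in F$ is a unary predicate interpreted as membership in $F$. $\mathcal{L}_p(z)^e$ is the extension of $\mathcal{L}_p(z)$ by predicate symbols $P_\sigma$, one for each $\mathcal{L}_p$-formula $\sigma(a_1,\dots,a_n)$ (all free variables of $\sigma$ being among $a_1,\dots,a_n$); $P_\sigma$ is interpreted as the $n$-ary relation "$a_1,\dots,a_n\in F$ and $\sigma(a_1,\dots,a_n)$ is true in the $\mathcal{L}_p$-structure $F$". In particular, if $\sigma$ is a sentence,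 $P_\sigma$ is a $0$-ary predicate which holds iff $F\models\sigma$. $\mathcal{R}$ is the $\mathcal{L}_p(z)^e$-structure with universe $R$ and these interpretations. Effectively model-complete means: there is an algorithm which, given any $\mathcal{L}_p(z)^e$-formula, produces an existential $\mathcal{L}_p(z)^e$-formula in the same free variables that is equivalent to it in $\mathcal{R}$ (equivalently, an algorithm which converts any existential formula into a universal formula equivalent to it in $\mathcal{R}$). *)

theory Defs
  imports
    "HOL-Computational_Algebra.Computational_Algebra"
    "HOL-Library.Nat_Bijection"
begin

section \<open>First-order formulas over a type of atomic formulas\<close>

datatype (atoms: 'at) fm =
    Atom 'at
  | Neg "'at fm"
  | Conj "'at fm" "'at fm"
  | Disj "'at fm" "'at fm"
  | Imp "'at fm" "'at fm"
  | Ex nat "'at fm"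
  | All nat "'at fm"

primrec fv :: "('at \<Rightarrow> nat set) \<Rightarrow> 'at fm \<Rightarrow> nat set" where
  "fv av (Atom a) = av a"
| "fv av (Neg \<phi>) = fv av \<phi>"
| "fv av (Conj \<phi> \<psi>) = fv av \<phi> \<union> fv av \<psi>"
| "fv av (Disj \<phi> \<psi>) = fv av \<phi> \<union> fv av \<psi>"
| "fv av (Imp \<phi> \<psi>) = fv av \<phi> \<union> fv av \<psi>"
| "fv av (Ex x \<phi>) = fv av \<phi> - {x}"
| "fv av (All x \<phi>) = fv av \<phi> - {x}"

primrec sat :: "'m set \<Rightarrow> ((nat \<Rightarrow> 'm) \<Rightarrow> 'at \<Rightarrow> bool) \<Rightarrow> (nat \<Rightarrow> 'm) \<Rightarrow> 'at fm \<Rightarrow> bool" where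
  "sat U I e (Atom a) = I e a"
| "sat U I e (Neg \<phi>) = (\<not> sat U I e \<phi>)"
| "sat U I e (Conj \<phi> \<psi>) = (sat U I e \<phi> \<and> sat U I e \<psi>)"
| "sat U I e (Disj \<phi> \<psi>) = (sat U I e \<phi> \<or> sat U I e \<psi>)"
| "sat U I e (Imp \<phi> \<psi>) = (sat U I e \<phi> \<longrightarrow> sat U I e \<psi>)"
| "sat U I e (Ex x \<phi>) = (\<exists>u\<in>U. sat U I (e(x := u)) \<phi>)"
| "sat U I e (All x \<phi>) = (\<forall>u\<in>U. sat U I (e(x := u)) \<phi>)"

primrec quantifier_free :: "'at fm \<Rightarrow> bool" where
  "quantifier_free (Atom a) = True"
| "quantifier_free (Neg \<phi>) = quantifier_free \<phi>"
| "quantifier_free (Conj \<phi> \<psi>) = (quantifier_free \<phi> \<and> quantifier_free \<psi>)"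
| "quantifier_free (Disj \<phi> \<psi>) = (quantifier_free \<phi> \<and> quantifier_free \<psi>)"
| "quantifier_free (Imp \<phi> \<psi>) = (quantifier_free \<phi> \<and> quantifier_free \<psi>)"
| "quantifier_free (Ex x \<phi>) = False"
| "quantifier_free (All x \<phi>) = False"

definition existential :: "'at fm \<Rightarrow> bool" where
  "existential \<phi> \<longleftrightarrow> (\<exists>xs \<psi>. \<phi> = foldr Ex xs \<psi> \<and> quantifier_free \<psi>)"

primrec fm_code :: "('at \<Rightarrow> nat) \<Rightarrow> 'at fm \<Rightarrow> nat" where
  "fm_code c (Atom a) = prod_encode (0, c a)"
| "fm_code c (Neg \<phi>) = prod_encode (1, fm_code c \<phi>)"
| "fm_code c (Conj \<phi> \<psi>) = prod_encode (2, prod_encode (fm_code c \<phi>, fm_code c \<psi>))"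
| "fm_code c (Disj \<phi> \<psi>) = prod_encode (3, prod_encode (fm_code c \<phi>, fm_code c \<psi>))"
| "fm_code c (Imp \<phi> \<psi>) = prod_encode (4, prod_encode (fm_code c \<phi>, fm_code c \<psi>))"
| "fm_code c (Ex x \<phi>) = prod_encode (5, prod_encode (x, fm_code c \<phi>))"
| "fm_code c (All x \<phi>) = prod_encode (6, prod_encode (x, fm_code c \<phi>))"


section \<open>The language \<open>L\<^sub>p\<close>\<close>

text \<open>The prime \<open>p\<close> enters only through the interpretation of the Frobenius symbol, so the
  syntax does not depend on it.\<close>

datatype lp_tm = LVar nat | LZero | LOne | LAdd lp_tm lp_tm | LFrob lp_tm

datatype lp_atom = LEq lp_tm lp_tm

type_synonym lp_fm = "lp_atom fm"

primrec lp_tm_vars :: "lp_tm \<Rightarrow> nat set" where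
  "lp_tm_vars (LVar i) = {i}"
| "lp_tm_vars LZero = {}"
| "lp_tm_vars LOne = {}"
| "lp_tm_vars (LAdd s t) = lp_tm_vars s \<union> lp_tm_vars t"
| "lp_tm_vars (LFrob t) = lp_tm_vars t"

primrec lp_atom_vars :: "lp_atom \<Rightarrow> nat set" where
  "lp_atom_vars (LEq s t) = lp_tm_vars s \<union> lp_tm_vars t"

abbreviation lp_fv :: "lp_fm \<Rightarrow> nat set" where
  "lp_fv \<equiv> fv lp_atom_vars"

definition lp_sentence :: "lp_fm \<Rightarrow> bool" where
  "lp_sentence \<sigma> \<longleftrightarrow> lp_fv \<sigma> = {}"

primrec lp_eval :: "nat \<Rightarrow> (nat \<Rightarrow> 'a::comm_ring_1) \<Rightarrow> lp_tm \<Rightarrow> 'a" where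
  "lp_eval p e (LVar i) = e i"
| "lp_eval p e LZero = 0"
| "lp_eval p e LOne = 1"
| "lp_eval p e (LAdd s t) = lp_eval p e s + lp_eval p e t"
| "lp_eval p e (LFrob t) = lp_eval p e t ^ p"

primrec lp_atom_holds :: "nat \<Rightarrow> (nat \<Rightarrow> 'a::comm_ring_1) \<Rightarrow> lp_atom \<Rightarrow> bool" where
  "lp_atom_holds p e (LEq s t) = (lp_eval p e s = lp_eval p e t)"

text \<open>The field \<open>F\<close> is the whole type \<open>'a\<close>.\<close>

definition lp_sat :: "nat \<Rightarrow> (nat \<Rightarrow> 'a::field) \<Rightarrow> lp_fm \<Rightarrow> bool" where
  "lp_sat p e \<sigma> \<longleftrightarrow> sat UNIV (lp_atom_holds p) e \<sigma>"

primrec lp_tm_code :: "lp_tm \<Rightarrow> nat" where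
  "lp_tm_code (LVar i) = prod_encode (0, i)"
| "lp_tm_code LZero = prod_encode (1, 0)"
| "lp_tm_code LOne = prod_encode (2, 0)"
| "lp_tm_code (LAdd s t) = prod_encode (3, prod_encode (lp_tm_code s, lp_tm_code t))"
| "lp_tm_code (LFrob t) = prod_encode (4, lp_tm_code t)"

primrec lp_atom_code :: "lp_atom \<Rightarrow> nat" where
  "lp_atom_code (LEq s t) = prod_encode (lp_tm_code s, lp_tm_code t)"


section \<open>The language \<open>L\<^sub>p(z)\<^sup>e\<close>\<close>

datatype lpz_tm = Var nat | Zero | One | Add lpz_tm lpz_tm | Frob lpz_tm | MulZ lpz_tm

text \<open>In \<open>P \<sigma> ts\<close> the variable \<open>a\<^sub>i\<close> of \<open>\<sigma>(a\<^sub>1, \<dots>, a\<^sub>n)\<close> is the variable with number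
  \<open>i - 1\<close>, and \<open>n\<close> is the length of \<open>ts\<close>; the same \<open>\<sigma>\<close> with different \<open>n\<close> gives different
  predicate symbols. The condition that the free variables of \<open>\<sigma>\<close> are among
  \<open>a\<^sub>1, \<dots>, a\<^sub>n\<close> is imposed by \<open>wf_atom\<close>.\<close>

datatype lpze_atom = Eq lpz_tm lpz_tm | InF lpz_tm | P lp_fm "lpz_tm list"

type_synonym lpze_fm = "lpze_atom fm"

primrec wf_atom :: "lpze_atom \<Rightarrow> bool" where
  "wf_atom (Eq s t) = True"
| "wf_atom (InF t) = True"
| "wf_atom (P \<sigma> ts) = (lp_fv \<sigma> \<subseteq> {..<length ts})"

definition lpze_formula :: "lpze_fm \<Rightarrow> bool" where
  "lpze_formula \<phi> \<longleftrightarrow> (\<forall>a\<in>atoms \<phi>. wf_atom a)"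

primrec lpz_tm_vars :: "lpz_tm \<Rightarrow> nat set" where
  "lpz_tm_vars (Var i) = {i}"
| "lpz_tm_vars Zero = {}"
| "lpz_tm_vars One = {}"
| "lpz_tm_vars (Add s t) = lpz_tm_vars s \<union> lpz_tm_vars t"
| "lpz_tm_vars (Frob t) = lpz_tm_vars t"
| "lpz_tm_vars (MulZ t) = lpz_tm_vars t"

primrec lpze_atom_vars :: "lpze_atom \<Rightarrow> nat set" where
  "lpze_atom_vars (Eq s t) = lpz_tm_vars s \<union> lpz_tm_vars t"
| "lpze_atom_vars (InF t) = lpz_tm_vars t"
| "lpze_atom_vars (P \<sigma> ts) = (\<Union>t\<in>set ts. lpz_tm_vars t)"

abbreviation lpze_fv :: "lpze_fm \<Rightarrow> nat set" where
  "lpze_fv \<equiv> fv lpze_atom_vars"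

definition lpze_sentence :: "lpze_fm \<Rightarrow> bool" where
  "lpze_sentence \<phi> \<longleftrightarrow> lpze_formula \<phi> \<and> lpze_fv \<phi> = {}"

primrec lpz_tm_code :: "lpz_tm \<Rightarrow> nat" where
  "lpz_tm_code (Var i) = prod_encode (0, i)"
| "lpz_tm_code Zero = prod_encode (1, 0)"
| "lpz_tm_code One = prod_encode (2, 0)"
| "lpz_tm_code (Add s t) = prod_encode (3, prod_encode (lpz_tm_code s, lpz_tm_code t))"
| "lpz_tm_code (Frob t) = prod_encode (4, lpz_tm_code t)"
| "lpz_tm_code (MulZ t) = prod_encode (5, lpz_tm_code t)"

primrec lpze_atom_code :: "lpze_atom \<Rightarrow> nat" where
  "lpze_atom_code (Eq s t) = prod_encode (0, prod_encode (lpz_tm_code s, lpz_tm_code t))"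
| "lpze_atom_code (InF t) = prod_encode (1, lpz_tm_code t)"
| "lpze_atom_code (P \<sigma> ts) =
     prod_encode (2, prod_encode (fm_code lp_atom_code \<sigma>, list_encode (map lpz_tm_code ts)))"

abbreviation lpze_code :: "lpze_fm \<Rightarrow> nat" where
  "lpze_code \<equiv> fm_code lpze_atom_code"

lemma inj_fm_code:
  assumes "inj c"
  shows "inj (fm_code c)"
proof (rule injI)
  fix \<phi> \<psi>
  show "fm_code c \<phi> = fm_code c \<psi> \<Longrightarrow> \<phi> = \<psi>"
  proof (induction \<phi> arbitrary: \<psi>)
    case (Atom a)
    then show ?case using assms by (cases \<psi>) (auto dest: injD)
  qed (case_tac \<psi>; simp)+
qed

lemma inj_lp_tm_code: "inj lp_tm_code"
proof (rule injI)
  fix s t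
  show "lp_tm_code s = lp_tm_code t \<Longrightarrow> s = t"
    by (induction s arbitrary: t) (case_tac t; simp)+
qed

lemma inj_lp_atom_code: "inj lp_atom_code"
proof (rule injI)
  fix a b assume "lp_atom_code a = lp_atom_code b"
  then show "a = b"
    using inj_lp_tm_code by (cases a; cases b) (auto dest: injD)
qed

lemma inj_lpz_tm_code: "inj lpz_tm_code"
proof (rule injI)
  fix s t
  show "lpz_tm_code s = lpz_tm_code t \<Longrightarrow> s = t"
    by (induction s arbitrary: t) (case_tac t; simp)+
qed

lemma inj_lpze_atom_code: "inj lpze_atom_code"
proof (rule injI)
  fix a b assume "lpze_atom_code a = lpze_atom_code b"
  then show "a = b"
    using inj_lpz_tm_code inj_fm_code[OF inj_lp_atom_code]
    by (cases a; cases b) (auto simp: list_encode_eq inj_map_eq_map dest: injD)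
qed

lemma inj_lpze_code: "inj lpze_code"
  by (rule inj_fm_code[OF inj_lpze_atom_code])


section \<open>The ring \<open>R\<close> and the structure on it\<close>

text \<open>In a field of prime characteristic, \<open>\<int>\<close> (the range of \<open>of_int\<close>) is the prime subfield.
  The constant \<open>algebraic\<close> of the library is restricted to characteristic 0.\<close>

definition algebraic_over_prime_field :: "'a::field \<Rightarrow> bool" where
  "algebraic_over_prime_field x \<longleftrightarrow> (\<exists>q. (\<forall>i. coeff q i \<in> \<int>) \<and> q \<noteq> 0 \<and> poly q x = 0)"

definition prime_field_polys :: "'a::field poly set" where
  "prime_field_polys = {q. \<forall>i. coeff q i \<in> \<int>}"

definition unit_in :: "'r::comm_ring_1 set \<Rightarrow> 'r \<Rightarrow> bool" where
  "unit_in A a \<longleftrightarrow> a \<in> A \<and> (\<exists>b\<in>A. a * b = 1)"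

definition irreducible_in :: "'r::comm_ring_1 set \<Rightarrow> 'r \<Rightarrow> bool" where
  "irreducible_in A s \<longleftrightarrow> s \<in> A \<and> s \<noteq> 0 \<and> \<not> unit_in A s \<and>
     (\<forall>a\<in>A. \<forall>b\<in>A. s = a * b \<longrightarrow> unit_in A a \<or> unit_in A b)"

definition const_rf :: "'a::field \<Rightarrow> 'a poly fract" where
  "const_rf c = to_fract [:c:]"

definition z_rf :: "'a::field poly fract" where
  "z_rf = to_fract [:0, 1:]"

text \<open>\<open>F[z, s\<inverse> : s \<in> S]\<close> as the subring of \<open>F(z)\<close> generated by \<open>F\<close>, \<open>z\<close> and the
  inverses; closure under negation comes from the constant \<open>-1\<close>.\<close>

inductive_set localized_ring :: "'a::field poly set \<Rightarrow> 'a poly fract set" for S where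
  const: "const_rf c \<in> localized_ring S"
| z: "z_rf \<in> localized_ring S"
| inv: "s \<in> S \<Longrightarrow> inverse (to_fract s) \<in> localized_ring S"
| add: "f \<in> localized_ring S \<Longrightarrow> g \<in> localized_ring S \<Longrightarrow> f + g \<in> localized_ring S"
| mult: "f \<in> localized_ring S \<Longrightarrow> g \<in> localized_ring S \<Longrightarrow> f * g \<in> localized_ring S"

primrec lpz_eval :: "nat \<Rightarrow> (nat \<Rightarrow> 'a::field poly fract) \<Rightarrow> lpz_tm \<Rightarrow> 'a poly fract" where
  "lpz_eval p e (Var i) = e i"
| "lpz_eval p e Zero = 0"
| "lpz_eval p e One = 1"
| "lpz_eval p e (Add s t) = lpz_eval p e s + lpz_eval p e t"
| "lpz_eval p e (Frob t) = lpz_eval p e t ^ p"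
| "lpz_eval p e (MulZ t) = z_rf * lpz_eval p e t"

text \<open>In the last clause \<open>cs\<close> has the length \<open>n\<close> of \<open>ts\<close>; for a well-formed atom the
  out-of-range values \<open>cs ! i\<close> are irrelevant, as \<open>i\<close> is then not free in \<open>\<sigma>\<close>.\<close>

primrec lpze_atom_holds :: "nat \<Rightarrow> (nat \<Rightarrow> 'a::field poly fract) \<Rightarrow> lpze_atom \<Rightarrow> bool" where
  "lpze_atom_holds p e (Eq s t) = (lpz_eval p e s = lpz_eval p e t)"
| "lpze_atom_holds p e (InF t) = (lpz_eval p e t \<in> range const_rf)"
| "lpze_atom_holds p e (P \<sigma> ts) =
     (\<exists>cs :: 'a list. map (lpz_eval p e) ts = map const_rf cs \<and> lp_sat p (\<lambda>i. cs ! i) \<sigma>)"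

definition lpze_sat ::
    "nat \<Rightarrow> 'a::field poly set \<Rightarrow> (nat \<Rightarrow> 'a poly fract) \<Rightarrow> lpze_fm \<Rightarrow> bool" where
  "lpze_sat p S e \<phi> \<longleftrightarrow> sat (localized_ring S) (lpze_atom_holds p) e \<phi>"

definition equivalent_in :: "nat \<Rightarrow> 'a::field poly set \<Rightarrow> lpze_fm \<Rightarrow> lpze_fm \<Rightarrow> bool" where
  "equivalent_in p S \<phi> \<psi> \<longleftrightarrow>
     (\<forall>e. (\<forall>i. e i \<in> localized_ring S) \<longrightarrow> (lpze_sat p S e \<phi> \<longleftrightarrow> lpze_sat p S e \<psi>))"


section \<open>Algorithms\<close>

text \<open>\<open>recursive_fn k f\<close>: on lists of length \<open>k\<close>, \<open>f\<close> is a total recursive function of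
  \<open>k\<close> arguments. Minimisation is applied only to functions that have a zero for all
  arguments, so all functions stay total; by Kleene's normal form theorem this gives exactly
  the total computable functions.\<close>

inductive recursive_fn :: "nat \<Rightarrow> (nat list \<Rightarrow> nat) \<Rightarrow> bool" where
  zero: "recursive_fn k (\<lambda>xs. 0)"
| suc: "recursive_fn 1 (\<lambda>xs. Suc (hd xs))"
| proj: "i < k \<Longrightarrow> recursive_fn k (\<lambda>xs. xs ! i)"
| comp: "recursive_fn (length gs) f \<Longrightarrow> \<forall>g\<in>set gs. recursive_fn k g \<Longrightarrow>
     recursive_fn k (\<lambda>xs. f (map (\<lambda>g. g xs) gs))"
| prim_rec: "recursive_fn k f \<Longrightarrow> recursive_fn (k + 2) g \<Longrightarrow>
     recursive_fn (k + 1) (\<lambda>xs. rec_nat (f (tl xs)) (\<lambda>n r. g (n # r # tl xs)) (hd xs))"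
| mu: "recursive_fn (k + 1) f \<Longrightarrow> \<forall>xs. length xs = k \<longrightarrow> (\<exists>n. f (n # xs) = 0) \<Longrightarrow>
     recursive_fn k (\<lambda>xs. LEAST n. f (n # xs) = 0)"

definition computable :: "(nat \<Rightarrow> nat) \<Rightarrow> bool" where
  "computable h \<longleftrightarrow> (\<exists>f. recursive_fn 1 f \<and> (\<forall>n. h n = f [n]))"

definition effectively_model_complete :: "nat \<Rightarrow> 'a::field poly set \<Rightarrow> bool" where
  "effectively_model_complete p S \<longleftrightarrow>
     (\<exists>h. computable h \<and>
       (\<forall>\<phi>. lpze_formula \<phi> \<longrightarrow>
         (\<exists>\<psi>. h (lpze_code \<phi>) = lpze_code \<psi> \<and> lpze_formula \<psi> \<and> existential \<psi> \<and>
              lpze_fv \<psi> = lpze_fv \<phi> \<and> equivalent_in p S \<phi> \<psi>)))"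

end

theory Submission
  imports Defs "Jordan_Normal_Form.Determinant"
begin

text \<open>
  Let \<open>D\<close> be the product of \<open>S\<close>, so that \<open>R = F[z, D\<^sup>-\<^sup>1]\<close>. As \<open>F\<close> is perfect, every element of \<open>R\<close> is
  uniquely of the form \<open>\<Sum>\<^sub>l z\<^sup>l c\<^sub>l\<^sup>q\<close> with \<open>l < q = p\<^sup>m\<close> and \<open>c\<^sub>l\<close> in \<open>R\<close>. Every formula is equivalent to a
  disjunction of existentially quantified systems that consist of additive equations
  \<open>\<Sum> z\<^sup>n D\<^sup>-\<^sup>d x\<^sub>v\<^sup>q = 0\<close>, conditions \<open>x\<^sub>v \<notin> F\<close>, and an \<open>L\<^sub>p\<close>-formula about variables for elements of \<open>F\<close>.
  Only the negation of such a system is not immediate.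

  For the negation, the bound variables are eliminated one equation at a time. If the leading coefficients of the
  equation are dependent over the field of \<open>q\<close>-th powers, then a substitution lowers a degree. Otherwise, after
  splitting the variables into components, the leading coefficients can be completed to a basis over the \<open>q\<close>-th
  powers; the resulting additive map is then surjective up to elements of bounded degree and has fibres of bounded
  degree. Hence the equation can be solved for the remaining variables in terms of new parameters that exist for all
  values of the old ones, up to finitely many coordinates in \<open>F\<close>. In the end the system is an
  \<open>L\<^sub>p\<close>-condition on these coordinates and on elements of \<open>F\<close> determined by the parameters, and it is negated there.
  Since the parameters always exist and any choice is as good as another, they are quantified existentially.

  The sequence of elimination steps is found by unbounded search, so that only its existence has to be proved and not
  its computability.
\<close>

section \<open>Computable functions\<close>

text \<open>All coefficients that the procedure handles lie in F_p[z] up to powers of D, since the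
  polynomials in \<open>S\<close> have coefficients in F_p. Such a coefficient is a list of
  exponents of z, where multiplicity stands for an element of F_p. Nothing is computed in F, and
  facts about F stay inside the predicates P_\<sigma>. Sizes are measured by a filtration
  \<open>V n\<close> of R with \<open>V 0\<close> = F. Passing to components over q-th powers
  divides the index by q, while the lower terms of an additive polynomial of degree q multiply it by
  at most q/p. Surjectivity up to bounded elements and boundedness of fibres both come from this
  gap. The obstacle is that the negated system must again be existential: a parameter may be moved
  in front of the negation only if it exists for all values of the free variables and if the truth
  value does not depend on its choice. Conditions x \<notin> F are harmless as long as they contain
  a variable that no equation constrains, because large powers of z satisfy them; the others are
  reduced to coordinates.\<close>

definition rcf :: "nat \<Rightarrow> (nat list \<Rightarrow> nat) \<Rightarrow> bool" where
  "rcf k h \<longleftrightarrow> (\<exists>f. recursive_fn k f \<and> (\<forall>xs. length xs = k \<longrightarrow> h xs = f xs))"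

text \<open>This closure is the purpose of \<open>rcf\<close>: \<open>recursive_fn\<close> fixes a
  function on lists of all lengths, whereas only lists of length \<open>k\<close> are arguments, and
  rewriting is sound only for those.\<close>

lemma rcf_cong: "rcf k f \<Longrightarrow> (\<And>xs. length xs = k \<Longrightarrow> f xs = g xs) \<Longrightarrow> rcf k g"
  unfolding rcf_def by metis

lemma rcf_zero: "rcf k (\<lambda>xs. 0)"
  unfolding rcf_def using recursive_fn.zero by blast

lemma rcf_nth: "i < k \<Longrightarrow> rcf k (\<lambda>xs. xs ! i)"
  unfolding rcf_def using recursive_fn.proj by blast

lemma rcf_comp:
  assumes "rcf (length gs) f" "\<forall>g\<in>set gs. rcf k g"
  shows "rcf k (\<lambda>xs. f (map (\<lambda>g. g xs) gs))"
proof -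
  obtain f' where f': "recursive_fn (length gs) f'" "\<forall>xs. length xs = length gs \<longrightarrow> f xs = f' xs"
    using assms(1) unfolding rcf_def by blast
  obtain G where G: "\<forall>g\<in>set gs. recursive_fn k (G g) \<and> (\<forall>xs. length xs = k \<longrightarrow> g xs = G g xs)"
    using assms(2) unfolding rcf_def by metis
  have "recursive_fn k (\<lambda>xs. f' (map (\<lambda>g. g xs) (map G gs)))"
    using f' G by (intro recursive_fn.comp) auto
  moreover have "f (map (\<lambda>g. g xs) gs) = f' (map (\<lambda>g. g xs) (map G gs))" if "length xs = k" for xs
  proof -
    have "map (\<lambda>g. g xs) gs = map (\<lambda>g. g xs) (map G gs)" using G that by simp
    then show ?thesis using f'(2) by (metis length_map)
  qed
  ultimately show ?thesis unfolding rcf_def by blast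
qed

lemma rcf_suc: "rcf k g \<Longrightarrow> rcf k (\<lambda>xs. Suc (g xs))"
proof -
  assume "rcf k g"
  moreover have "rcf 1 (\<lambda>xs. Suc (hd xs))" unfolding rcf_def using recursive_fn.suc by blast
  ultimately show ?thesis using rcf_comp[of "[g]" "\<lambda>xs. Suc (hd xs)" k] by simp
qed

lemma rcf_comp1: "rcf 1 (\<lambda>xs. f (xs ! 0)) \<Longrightarrow> rcf k g \<Longrightarrow> rcf k (\<lambda>xs. f (g xs))"
  using rcf_comp[of "[g]" "\<lambda>xs. f (xs ! 0)" k] by simp

lemma rcf_comp2: "rcf 2 (\<lambda>xs. f (xs ! 0) (xs ! 1)) \<Longrightarrow> rcf k g \<Longrightarrow> rcf k h \<Longrightarrow> rcf k (\<lambda>xs. f (g xs) (h xs))"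
  using rcf_comp[of "[g, h]" "\<lambda>xs. f (xs ! 0) (xs ! 1)" k] by (simp add: numeral_2_eq_2)

lemma rcf_prim_rec:
  assumes "rcf k a" "rcf (k + 2) g"
  shows "rcf (k + 1) (\<lambda>xs. rec_nat (a (tl xs)) (\<lambda>n r. g (n # r # tl xs)) (hd xs))"
proof -
  obtain a' g' where a': "recursive_fn k a'" "\<forall>xs. length xs = k \<longrightarrow> a xs = a' xs"
    and g': "recursive_fn (k + 2) g'" "\<forall>xs. length xs = k + 2 \<longrightarrow> g xs = g' xs"
    using assms unfolding rcf_def by blast
  have "rec_nat (a (tl xs)) (\<lambda>n r. g (n # r # tl xs)) (hd xs)
      = rec_nat (a' (tl xs)) (\<lambda>n r. g' (n # r # tl xs)) (hd xs)" if "length xs = k + 1" for xs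
    using that a' g' by simp
  then show ?thesis unfolding rcf_def using recursive_fn.prim_rec[OF a'(1) g'(1)] by blast
qed

lemma rcf_rec2:
  assumes "rcf 1 (\<lambda>xs. a (xs ! 0))" "rcf 3 (\<lambda>xs. g (xs ! 0) (xs ! 1) (xs ! 2))"
  shows "rcf 2 (\<lambda>xs. rec_nat (a (xs ! 1)) (\<lambda>n r. g n r (xs ! 1)) (xs ! 0))"
proof -
  have "rcf (1 + 1) (\<lambda>xs. rec_nat (a (tl xs ! 0))
      (\<lambda>n r. g ((n # r # tl xs) ! 0) ((n # r # tl xs) ! 1) ((n # r # tl xs) ! 2)) (hd xs))"
    using assms by (intro rcf_prim_rec) (simp_all add: numeral_3_eq_3)
  then have "rcf 2 (\<lambda>xs. rec_nat (a (tl xs ! 0)) (\<lambda>n r. g n r (tl xs ! 0)) (hd xs))"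
    by (simp add: numeral_2_eq_2)
  then show ?thesis
    by (rule rcf_cong) (auto simp: length_Suc_conv numeral_2_eq_2)
qed

lemma rcf_rec1:
  assumes "rcf 2 (\<lambda>xs. g (xs ! 0) (xs ! 1))"
  shows "rcf 1 (\<lambda>xs. rec_nat 0 (\<lambda>n r. g n r) (xs ! 0))"
proof -
  have "rcf (0 + 1) (\<lambda>xs. rec_nat 0 (\<lambda>n r. g ((n # r # tl xs) ! 0) ((n # r # tl xs) ! 1)) (hd xs))"
    using assms rcf_zero[of 0] by (intro rcf_prim_rec) (simp_all add: numeral_2_eq_2)
  then have "rcf 1 (\<lambda>xs. rec_nat 0 g (hd xs))" by simp
  then show ?thesis
    by (rule rcf_cong) (auto simp: length_Suc_conv)
qed

lemma rcf_mu:
  assumes "rcf 2 (\<lambda>xs. f (xs ! 0) (xs ! 1))" "\<And>x. \<exists>n. f n x = 0"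
  shows "rcf 1 (\<lambda>xs. LEAST n. f n (xs ! 0) = 0)"
proof -
  obtain f' where f': "recursive_fn 2 f'" "\<forall>xs. length xs = 2 \<longrightarrow> f (xs ! 0) (xs ! 1) = f' xs"
    using assms unfolding rcf_def by blast
  have eq: "f n (xs ! 0) = f' (n # xs)" if "length xs = 1" for n xs
    using that f'(2)[rule_format, of "n # xs"] by (simp add: numeral_2_eq_2)
  have "recursive_fn 1 (\<lambda>xs. LEAST n. f' (n # xs) = 0)"
    using f'(1) eq assms(2)
    by (intro recursive_fn.mu) (auto simp: numeral_2_eq_2 simp flip: eq)
  then show ?thesis unfolding rcf_def using eq by (intro exI[of _ "\<lambda>xs. LEAST n. f' (n # xs) = 0"]) auto
qed

lemma rcf_const: "rcf k (\<lambda>xs. c)"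
  by (induction c) (use rcf_zero rcf_suc in auto)

lemma rcf_add: "rcf k f \<Longrightarrow> rcf k g \<Longrightarrow> rcf k (\<lambda>xs. f xs + g xs)"
proof -
  have "rcf 2 (\<lambda>xs. rec_nat (xs ! 1) (\<lambda>n r. Suc r) (xs ! 0))"
    by (rule rcf_rec2[of "\<lambda>x. x" "\<lambda>n r x. Suc r"]) (auto intro!: rcf_suc rcf_nth)
  moreover have "rec_nat y (\<lambda>n r. Suc r) x = x + y" for x y by (induction x) auto
  ultimately have "rcf 2 (\<lambda>xs. xs ! 0 + xs ! 1)" by simp
  then show "rcf k f \<Longrightarrow> rcf k g \<Longrightarrow> rcf k (\<lambda>xs. f xs + g xs)" by (rule rcf_comp2)
qed

lemma rcf_pred: "rcf k f \<Longrightarrow> rcf k (\<lambda>xs. f xs - 1)"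
proof -
  have "rcf 1 (\<lambda>xs. rec_nat 0 (\<lambda>n r. n) (xs ! 0))"
    by (rule rcf_rec1[of "\<lambda>n r. n"]) (auto intro!: rcf_nth)
  moreover have "rec_nat 0 (\<lambda>n r. n) x = x - 1" for x by (induction x) auto
  ultimately have "rcf 1 (\<lambda>xs. xs ! 0 - 1)" by simp
  then show "rcf k f \<Longrightarrow> rcf k (\<lambda>xs. f xs - 1)" by (rule rcf_comp1)
qed

lemma rcf_diff: "rcf k f \<Longrightarrow> rcf k g \<Longrightarrow> rcf k (\<lambda>xs. f xs - g xs)"
proof -
  have "rcf 2 (\<lambda>xs. rec_nat (xs ! 1) (\<lambda>n r. r - 1) (xs ! 0))"
    by (rule rcf_rec2[of "\<lambda>x. x" "\<lambda>n r x. r - 1"]) (auto intro!: rcf_pred[simplified] rcf_nth)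
  moreover have "rec_nat y (\<lambda>n r. r - 1) x = y - x" for x y :: nat by (induction x) auto
  ultimately have "rcf 2 (\<lambda>xs. xs ! 1 - xs ! 0)" by simp
  then show "rcf k f \<Longrightarrow> rcf k g \<Longrightarrow> rcf k (\<lambda>xs. f xs - g xs)" by (rule rcf_comp2[where f = "\<lambda>x y. y - x"])
qed

section \<open>Inverting the Cantor pairing function\<close>

lemma rcf_triangle: "rcf k f \<Longrightarrow> rcf k (\<lambda>xs. triangle (f xs))"
proof -
  have "rcf 1 (\<lambda>xs. rec_nat 0 (\<lambda>n r. r + Suc n) (xs ! 0))"
    by (rule rcf_rec1[of "\<lambda>n r. r + Suc n"]) (auto intro!: rcf_nth rcf_add rcf_suc)
  moreover have "rec_nat 0 (\<lambda>n r. r + Suc n) x = triangle x" for x by (induction x) auto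
  ultimately have "rcf 1 (\<lambda>xs. triangle (xs ! 0))" by simp
  then show "rcf k f \<Longrightarrow> rcf k (\<lambda>xs. triangle (f xs))" by (rule rcf_comp1)
qed

lemma rcf_prod_encode: "rcf k f \<Longrightarrow> rcf k g \<Longrightarrow> rcf k (\<lambda>xs. prod_encode (f xs, g xs))"
  unfolding prod_encode_def by (simp add: rcf_add rcf_triangle)

text \<open>Index of the diagonal of the Cantor pairing that contains \<open>x\<close>: the
  truncated difference vanishes iff x < triangle (n + 1), so the least such n is the sum of the two
  components, and minimisation finds it.\<close>

definition tri_root :: "nat \<Rightarrow> nat" where
  "tri_root x = (LEAST n. Suc x - triangle (Suc n) = 0)"

lemma triangle_mono: "m \<le> n \<Longrightarrow> triangle m \<le> triangle n"
  by (rule lift_Suc_mono_le[of triangle]) simp_all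

lemma le_triangle: "n \<le> triangle n"
  by (induction n) simp_all

lemma tri_root_encode: "tri_root (prod_encode (m, n)) = m + n"
  unfolding tri_root_def
proof (rule Least_equality)
  show "Suc (prod_encode (m, n)) - triangle (Suc (m + n)) = 0"
    by (simp add: prod_encode_def)
next
  fix y assume "Suc (prod_encode (m, n)) - triangle (Suc y) = 0"
  then have "triangle (m + n) + m < triangle (Suc y)" by (simp add: prod_encode_def)
  show "m + n \<le> y"
  proof (rule ccontr)
    assume "\<not> m + n \<le> y"
    then have "triangle (Suc y) \<le> triangle (m + n)" by (intro triangle_mono) auto
    then show False using \<open>triangle (m + n) + m < triangle (Suc y)\<close> by simp
  qed
qed

lemma rcf_tri_root: "rcf k f \<Longrightarrow> rcf k (\<lambda>xs. tri_root (f xs))"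
proof -
  have ex: "\<exists>n. Suc x - triangle (Suc n) = 0" for x
    using le_triangle[of "Suc x"] by (intro exI[of _ x]) auto
  have "rcf 1 (\<lambda>xs. LEAST n. Suc (xs ! 0) - triangle (Suc n) = 0)"
    by (rule rcf_mu[of "\<lambda>n x. Suc x - triangle (Suc n)"])
      (use ex in \<open>auto intro!: rcf_nth rcf_diff rcf_suc rcf_triangle simp del: triangle_Suc\<close>)
  then have "rcf 1 (\<lambda>xs. tri_root (xs ! 0))" unfolding tri_root_def .
  then show "rcf k f \<Longrightarrow> rcf k (\<lambda>xs. tri_root (f xs))" by (rule rcf_comp1)
qed

lemma fst_prod_decode: "fst (prod_decode x) = x - triangle (tri_root x)"
  and snd_prod_decode: "snd (prod_decode x) = tri_root x - (x - triangle (tri_root x))"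
proof -
  obtain m n where "prod_decode x = (m, n)" by fastforce
  moreover from this have "x = prod_encode (m, n)" by (metis prod_decode_inverse)
  ultimately show "fst (prod_decode x) = x - triangle (tri_root x)"
    "snd (prod_decode x) = tri_root x - (x - triangle (tri_root x))"
    by (simp_all add: tri_root_encode) (simp_all add: prod_encode_def)
qed

lemma computable_iff: "computable f \<longleftrightarrow> rcf 1 (\<lambda>xs. f (xs ! 0))"
proof
  assume "computable f"
  then obtain g where g: "recursive_fn 1 g" "\<forall>n. f n = g [n]" unfolding computable_def by blast
  then have "\<forall>xs. length xs = 1 \<longrightarrow> f (xs ! 0) = g xs" by (auto simp: length_Suc_conv)
  then show "rcf 1 (\<lambda>xs. f (xs ! 0))" unfolding rcf_def using g by blast
next
  assume "rcf 1 (\<lambda>xs. f (xs ! 0))"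
  then obtain g where g: "recursive_fn 1 g" "\<forall>xs. length xs = 1 \<longrightarrow> f (xs ! 0) = g xs"
    unfolding rcf_def by blast
  then have "\<forall>n. f n = g [n]" by (metis length_Cons list.size(3) nth_Cons_0 One_nat_def)
  then show "computable f" unfolding computable_def using g by blast
qed

lemma computable_id: "computable (\<lambda>n. n)"
  and computable_const: "computable (\<lambda>n. c)"
  unfolding computable_iff by (rule rcf_nth, simp) (rule rcf_const)

lemma computable_comp: "computable f \<Longrightarrow> computable g \<Longrightarrow> computable (\<lambda>n. f (g n))"
  unfolding computable_iff by (rule rcf_comp1)

lemma computable_Suc: "computable f \<Longrightarrow> computable (\<lambda>n. Suc (f n))"
  and computable_pred: "computable f \<Longrightarrow> computable (\<lambda>n. f n - 1)"
  and computable_pair: "computable f \<Longrightarrow> computable g \<Longrightarrow> computable (\<lambda>n. prod_encode (f n, g n))"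
  and computable_fst: "computable f \<Longrightarrow> computable (\<lambda>n. fst (prod_decode (f n)))"
  and computable_snd: "computable f \<Longrightarrow> computable (\<lambda>n. snd (prod_decode (f n)))"
  unfolding computable_iff fst_prod_decode snd_prod_decode
  by (rule rcf_suc rcf_pred rcf_prod_encode; assumption)+
    (intro rcf_diff rcf_triangle rcf_tri_root; assumption)+

text \<open>Primitive recursion with one parameter. Parameter, counter and previous value are packed
  into one number because \<open>computable\<close> speaks of unary functions only.\<close>

lemma computable_rec:
  assumes "computable a" "computable g" "computable x" "computable n"
  shows "computable (\<lambda>m. rec_nat (a (x m)) (\<lambda>k r. g (prod_encode (x m, prod_encode (k, r)))) (n m))"
proof -
  have "rcf 2 (\<lambda>xs. rec_nat (a (xs ! 1)) (\<lambda>k r. g (prod_encode (xs ! 1, prod_encode (k, r)))) (xs ! 0))"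
    using assms(1) unfolding computable_iff
    by (rule rcf_rec2[where g = "\<lambda>k r x. g (prod_encode (x, prod_encode (k, r)))"])
      (rule rcf_comp1[OF assms(2)[unfolded computable_iff]], intro rcf_prod_encode rcf_nth; simp)
  from rcf_comp2[OF this assms(4)[unfolded computable_iff] assms(3)[unfolded computable_iff]]
  show ?thesis unfolding computable_iff .
qed

lemma computable_search:
  assumes "computable t" "\<And>x. \<exists>y. t (prod_encode (y, x)) = 0"
  shows "computable (\<lambda>x. LEAST y. t (prod_encode (y, x)) = 0)"
  unfolding computable_iff
  by (rule rcf_mu[of "\<lambda>y x. t (prod_encode (y, x))"],
      rule rcf_comp1[OF assms(1)[unfolded computable_iff]], intro rcf_prod_encode rcf_nth)
    (simp_all add: assms(2))

subsection \<open>Computability for encoded types\<close>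

class enc =
  fixes enc :: "'a \<Rightarrow> nat"
  assumes inj_enc: "inj enc"

lemma enc_eq [simp]: "enc x = enc y \<longleftrightarrow> x = y"
  using inj_enc by (auto dest: injD)

text \<open>Every number is a code. Unbounded search ranges over all numbers, so that a hit has to
  decode to a value, and a hit has to exist for every number given as input.\<close>

class benc = enc +
  assumes surj_enc: "surj enc"

instantiation nat :: benc begin
definition [simp]: "enc (n::nat) = n"
instance by standard (auto simp: inj_def)
end

instantiation bool :: enc begin
definition "enc b = (if b then 1 else (0::nat))"
instance by standard (auto simp: inj_def enc_bool_def split: if_splits)
end

instantiation prod :: (enc, enc) enc begin
definition "enc p = prod_encode (enc (fst p), enc (snd p))"
instance by standard (auto simp: inj_def enc_prod_def)
end

instance prod :: (benc, benc) benc
proof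
  show "surj (enc :: 'a \<times> 'b \<Rightarrow> nat)"
  proof (rule surj_def[THEN iffD2], intro allI)
    fix y
    obtain a b where "enc (a::'a) = fst (prod_decode y)" "enc (b::'b) = snd (prod_decode y)"
      using surj_enc by (metis surjD)
    then show "\<exists>x::'a \<times> 'b. y = enc x" by (intro exI[of _ "(a, b)"]) (simp add: enc_prod_def)
  qed
qed

instantiation list :: (enc) enc begin
definition "enc xs = list_encode (map enc xs)"
instance by standard (auto simp: inj_def enc_list_def list_encode_eq inj_map_eq_map inj_enc)
end

instance list :: (benc) benc
proof
  show "surj (enc :: 'a list \<Rightarrow> nat)"
  proof (rule surj_def[THEN iffD2], intro allI)
    fix y
    obtain f where f: "\<And>n. enc (f n :: 'a) = n" using surj_enc by (metis surjD)
    then show "\<exists>x::'a list. y = enc x"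
      by (intro exI[of _ "map f (list_decode y)"]) (simp add: enc_list_def comp_def)
  qed
qed

text \<open>The function on codes is unconstrained at numbers that code nothing, so no decidability
  of the set of codes enters.\<close>

definition cmp :: "('a::enc \<Rightarrow> 'b::enc) \<Rightarrow> bool" where
  "cmp f \<longleftrightarrow> (\<exists>g. computable g \<and> (\<forall>x. g (enc x) = enc (f x)))"

named_theorems cmp_intros

lemma cmpI: "computable g \<Longrightarrow> (\<And>x. g (enc x) = enc (f x)) \<Longrightarrow> cmp f"
  unfolding cmp_def by blast

lemma cmp_id [cmp_intros]: "cmp (\<lambda>x. x)"
  by (rule cmpI[OF computable_id]) simp

lemma cmp_const [cmp_intros]: "cmp (\<lambda>x. c)"
  by (rule cmpI[OF computable_const]) simp

lemma cmpE:
  assumes "cmp f"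
  obtains g where "computable g" "\<And>x. g (enc x) = enc (f x)"
  using assms unfolding cmp_def by blast

lemma cmp_comp:
  assumes "cmp f" "cmp g"
  shows "cmp (\<lambda>x. f (g x))"
proof -
  obtain f' g' where "computable f'" "\<And>x. f' (enc x) = enc (f x)"
    "computable g'" "\<And>x. g' (enc x) = enc (g x)"
    using assms by (metis cmpE)
  then show ?thesis by (intro cmpI[of "\<lambda>n. f' (g' n)"]) (simp_all add: computable_comp)
qed

lemma cmp_Pair [cmp_intros]:
  assumes "cmp f" "cmp g"
  shows "cmp (\<lambda>x. (f x, g x))"
proof -
  obtain f' g' where "computable f'" "\<And>x. f' (enc x) = enc (f x)"
    "computable g'" "\<And>x. g' (enc x) = enc (g x)"
    using assms by (metis cmpE)
  then show ?thesis
    by (intro cmpI[of "\<lambda>n. prod_encode (f' n, g' n)"]) (simp_all add: computable_pair enc_prod_def)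
qed

lemma cmp_fst [cmp_intros]: "cmp f \<Longrightarrow> cmp (\<lambda>x. fst (f x))"
  and cmp_snd [cmp_intros]: "cmp f \<Longrightarrow> cmp (\<lambda>x. snd (f x))"
  using cmp_comp[of fst f] cmp_comp[of snd f]
    cmpI[OF computable_fst[OF computable_id], of fst] cmpI[OF computable_snd[OF computable_id], of snd]
  by (simp_all add: enc_prod_def)

lemma cmp_nat_iff: "cmp (f :: nat \<Rightarrow> nat) \<longleftrightarrow> computable f"
proof
  assume "cmp f"
  then obtain g where g: "computable g" "\<And>x. g (enc x) = enc (f x)" by (rule cmpE) blast
  then have "g = f" by (intro ext) simp
  then show "computable f" using g by simp
qed (rule cmpI, auto)

lemma cmp_Suc [cmp_intros]: "cmp f \<Longrightarrow> cmp (\<lambda>x. Suc (f x))"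
  and cmp_pred: "cmp f \<Longrightarrow> cmp (\<lambda>x. f x - (1::nat))"
  using cmp_comp[of Suc f] cmp_comp[of "\<lambda>n. n - 1" f]
  by (simp_all only: cmp_nat_iff computable_Suc computable_pred computable_id)

text \<open>As \<open>cmp\<close> is unary, functions under binders appear in the premises applied
  to the projections of nested pairs. The recursion is carried out on codes and follows the encoded
  values by induction.\<close>

lemma cmp_rec_nat [cmp_intros]:
  fixes a :: "'a::enc \<Rightarrow> 'b::enc"
  assumes "cmp n" "cmp a" "cmp (\<lambda>p. g (fst p) (fst (snd p)) (snd (snd p)))"
  shows "cmp (\<lambda>x. rec_nat (a x) (\<lambda>k r. g x k r) (n x))"
proof -
  obtain n' a' g' where n': "computable n'" "\<And>x. n' (enc x) = n x"
    and a': "computable a'" "\<And>x. a' (enc x) = enc (a x)"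
    and g': "computable g'" "\<And>p. g' (enc p) = enc (g (fst p) (fst (snd p)) (snd (snd p)))"
    using assms unfolding cmp_def by auto
  have "rec_nat (a' (enc x)) (\<lambda>k r. g' (prod_encode (enc x, prod_encode (k, r)))) m
      = enc (rec_nat (a x) (\<lambda>k r. g x k r) m)" for x m
  proof (induction m)
    case (Suc m)
    then show ?case using g'(2)[of "(x, m, rec_nat (a x) (\<lambda>k r. g x k r) m)"]
      by (simp add: enc_prod_def)
  qed (simp add: a')
  then show ?thesis
    by (intro cmpI[OF computable_rec[OF a'(1) g'(1) computable_id n'(1)]]) (simp add: n')
qed

lemma cmp_If [cmp_intros]:
  assumes "cmp b" "cmp f" "cmp g"
  shows "cmp (\<lambda>x. if b x then f x else g x)"
proof -
  have *: "cmp (\<lambda>x. enc (b x))"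
    using assms(1) unfolding cmp_def by (metis enc_nat_def)
  have "cmp (\<lambda>x. rec_nat (g x) (\<lambda>k r. f x) (enc (b x)))"
    by (intro cmp_rec_nat assms * assms(2)[THEN cmp_comp] cmp_fst cmp_id)
  moreover have "rec_nat (g x) (\<lambda>k r. f x) (enc (b x)) = (if b x then f x else g x)" for x
    by (simp add: enc_bool_def)
  ultimately show ?thesis by simp
qed

lemma cmp_comp2:
  assumes "cmp (\<lambda>p. g (fst p) (snd p))" "cmp f1" "cmp f2"
  shows "cmp (\<lambda>x. g (f1 x) (f2 x))"
  using cmp_comp[OF assms(1) cmp_Pair[OF assms(2,3)]] by simp

lemma cmp_comp3:
  assumes "cmp (\<lambda>p. g (fst p) (fst (snd p)) (snd (snd p)))" "cmp f1" "cmp f2" "cmp f3"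
  shows "cmp (\<lambda>x. g (f1 x) (f2 x) (f3 x))"
  using cmp_comp[OF assms(1) cmp_Pair[OF assms(2) cmp_Pair[OF assms(3,4)]]] by simp

lemma cmp_prod_encode [cmp_intros]: "cmp f \<Longrightarrow> cmp g \<Longrightarrow> cmp (\<lambda>x. prod_encode (f x, g x))"
proof -
  assume "cmp f" "cmp g"
  from cmp_Pair[OF this] obtain h where "computable h" "\<And>x. h (enc x) = enc (f x, g x)"
    by (rule cmpE) blast
  then show ?thesis by (intro cmpI[of h]) (simp_all add: enc_prod_def)
qed

lemma cmp_enc [cmp_intros]: "cmp f \<Longrightarrow> cmp (\<lambda>x. enc (f x))"
  unfolding cmp_def by simp

section \<open>Arithmetic and Boolean operations\<close>

lemma cmp_add [cmp_intros]: "cmp f \<Longrightarrow> cmp g \<Longrightarrow> cmp (\<lambda>x. (f x :: nat) + g x)"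
proof -
  assume a: "cmp f" "cmp g"
  have "cmp (\<lambda>x. rec_nat (g x) (\<lambda>k r. Suc r) (f x))"
    by (intro cmp_intros a)
  moreover have "rec_nat m (\<lambda>k r. Suc r) n = n + m" for m n by (induction n) auto
  ultimately show ?thesis by simp
qed

lemma cmp_diff [cmp_intros]: "cmp f \<Longrightarrow> cmp g \<Longrightarrow> cmp (\<lambda>x. (f x :: nat) - g x)"
proof -
  assume a: "cmp f" "cmp g"
  have "cmp (\<lambda>x. rec_nat (f x) (\<lambda>k r. r - 1) (g x))"
    by (intro cmp_intros cmp_pred a)
  moreover have "rec_nat m (\<lambda>k r. r - 1) n = m - n" for m n :: nat by (induction n) auto
  ultimately show ?thesis by simp
qed

lemma cmp_mult [cmp_intros]: "cmp f \<Longrightarrow> cmp g \<Longrightarrow> cmp (\<lambda>x. (f x :: nat) * g x)"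
proof -
  assume a: "cmp f" "cmp g"
  have "cmp (\<lambda>x. rec_nat 0 (\<lambda>k r. r + g x) (f x))"
    by (intro cmp_intros a a[THEN cmp_comp])
  moreover have "rec_nat 0 (\<lambda>k r. r + m) n = n * m" for m n :: nat by (induction n) auto
  ultimately show ?thesis by simp
qed

lemma cmp_power [cmp_intros]: "cmp f \<Longrightarrow> cmp g \<Longrightarrow> cmp (\<lambda>x. (f x :: nat) ^ g x)"
proof -
  assume a: "cmp f" "cmp g"
  have "cmp (\<lambda>x. rec_nat 1 (\<lambda>k r. f x * r) (g x))"
    by (intro cmp_intros a a[THEN cmp_comp])
  moreover have "rec_nat 1 (\<lambda>k r. m * r) n = m ^ n" for m n :: nat by (induction n) auto
  ultimately show ?thesis by simp
qed

lemma cmp_not [cmp_intros]: "cmp f \<Longrightarrow> cmp (\<lambda>x. \<not> f x)"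
proof -
  assume a: "cmp f"
  have "cmp (\<lambda>x. if f x then False else True)" by (intro cmp_intros a)
  moreover have "(\<lambda>x. if f x then False else True) = (\<lambda>x. \<not> f x)" by auto
  ultimately show ?thesis by simp
qed

lemma cmp_conj [cmp_intros]: "cmp f \<Longrightarrow> cmp g \<Longrightarrow> cmp (\<lambda>x. f x \<and> g x)"
proof -
  assume a: "cmp f" "cmp g"
  have "cmp (\<lambda>x. if f x then g x else False)" by (intro cmp_intros a)
  moreover have "(\<lambda>x. if f x then g x else False) = (\<lambda>x. f x \<and> g x)" by auto
  ultimately show ?thesis by simp
qed

lemma cmp_is_zero: "cmp f \<Longrightarrow> cmp (\<lambda>x. f x = (0::nat))"
proof -
  assume a: "cmp f"
  have "cmp (\<lambda>x. rec_nat True (\<lambda>k r. False) (f x))" by (intro cmp_intros a)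
  moreover have "rec_nat True (\<lambda>k r. False) n = (n = 0)" for n by (cases n) auto
  ultimately show ?thesis by simp
qed

lemma cmp_less [cmp_intros]: "cmp f \<Longrightarrow> cmp g \<Longrightarrow> cmp (\<lambda>x. (f x :: nat) < g x)"
  and cmp_le [cmp_intros]: "cmp f \<Longrightarrow> cmp g \<Longrightarrow> cmp (\<lambda>x. (f x :: nat) \<le> g x)"
proof -
  assume a: "cmp f" "cmp g"
  have "cmp (\<lambda>x. \<not> (g x - f x = 0))" "cmp (\<lambda>x. f x - g x = 0)"
    by (intro cmp_intros cmp_is_zero a)+
  then show "cmp (\<lambda>x. f x < g x)" "cmp (\<lambda>x. f x \<le> g x)" by (simp_all add: not_le)
qed

lemma cmp_eq [cmp_intros]: "cmp f \<Longrightarrow> cmp g \<Longrightarrow> cmp (\<lambda>x. f x = g x)"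
proof -
  assume a: "cmp f" "cmp g"
  have "cmp (\<lambda>x. enc (f x) \<le> enc (g x) \<and> enc (g x) \<le> enc (f x))"
    by (intro cmp_intros a)
  then show ?thesis by (simp flip: eq_iff)
qed

lemma cmp_mod [cmp_intros]: "cmp f \<Longrightarrow> cmp g \<Longrightarrow> cmp (\<lambda>x. (f x :: nat) mod g x)"
proof -
  assume a: "cmp f" "cmp g"
  have "cmp (\<lambda>x. rec_nat 0 (\<lambda>k r. if Suc r = g x then 0 else Suc r) (f x))"
    by (intro cmp_intros a a[THEN cmp_comp])
  moreover have "rec_nat 0 (\<lambda>k r. if Suc r = m then 0 else Suc r) n = n mod m" for m n :: nat
    by (induction n) (simp_all add: mod_Suc)
  ultimately show ?thesis by simp
qed

lemma cmp_div [cmp_intros]: "cmp f \<Longrightarrow> cmp g \<Longrightarrow> cmp (\<lambda>x. (f x :: nat) div g x)"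
proof -
  assume a: "cmp f" "cmp g"
  have "cmp (\<lambda>x. rec_nat 0 (\<lambda>k r. if Suc k mod g x = 0 then Suc r else r) (f x))"
    by (intro cmp_intros a a[THEN cmp_comp])
  moreover have "rec_nat 0 (\<lambda>k r. if Suc k mod m = 0 then Suc r else r) n = n div m" for m n :: nat
    by (induction n) (simp_all add: div_Suc)
  ultimately show ?thesis by simp
qed

lemma cmp_max [cmp_intros]: "cmp f \<Longrightarrow> cmp g \<Longrightarrow> cmp (\<lambda>x. max (f x) (g x :: nat))"
  unfolding max_def by (intro cmp_intros)

subsection \<open>Lists\<close>

lemma enc_Nil: "enc [] = 0"
  and enc_Cons: "enc (y # ys) = Suc (prod_encode (enc y, enc ys))"
  by (simp_all add: enc_list_def)

lemma cmp_Cons [cmp_intros]: "cmp f \<Longrightarrow> cmp g \<Longrightarrow> cmp (\<lambda>x. f x # g x)"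
proof -
  assume "cmp f" "cmp g"
  then have "cmp (\<lambda>x. Suc (prod_encode (enc (f x), enc (g x))))" by (intro cmp_intros)
  then show ?thesis by (auto elim!: cmpE intro!: cmpI simp: enc_Cons)
qed

lemma cmp_case_list [cmp_intros]:
  fixes a :: "'a::enc \<Rightarrow> 'b::enc" and l :: "'a \<Rightarrow> 'c::enc list"
  assumes "cmp l" "cmp a" "cmp (\<lambda>p. g (fst p) (fst (snd p)) (snd (snd p)))"
  shows "cmp (\<lambda>x. case l x of [] \<Rightarrow> a x | y # ys \<Rightarrow> g x y ys)"
proof -
  obtain l' a' g' where l': "computable l'" "\<And>x. l' (enc x) = enc (l x)"
    and a': "computable a'" "\<And>x. a' (enc x) = enc (a x)"
    and g': "computable g'" "\<And>p. g' (enc p) = enc (g (fst p) (fst (snd p)) (snd (snd p)))"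
    using assms unfolding cmp_def by auto
  have "cmp (\<lambda>n. if l' n = 0 then a' n else g' (prod_encode (n, l' n - 1)))"
    by (intro cmp_intros cmp_nat_iff[THEN iffD2, OF g'(1), THEN cmp_comp]
        cmp_nat_iff[THEN iffD2, OF a'(1)] cmp_nat_iff[THEN iffD2, OF l'(1)])
  then show ?thesis unfolding cmp_nat_iff
  proof (rule cmpI)
    fix x
    show "(if l' (enc x) = 0 then a' (enc x) else g' (prod_encode (enc x, l' (enc x) - 1)))
        = enc (case l x of [] \<Rightarrow> a x | y # ys \<Rightarrow> g x y ys)"
    proof (cases "l x")
      case (Cons y ys)
      then show ?thesis using g'(2)[of "(x, y, ys)"] by (simp add: l' enc_Cons enc_prod_def)
    qed (simp add: l' a' enc_Nil)
  qed
qed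

lemma length_le_enc: "length xs \<le> enc xs"
proof (induction xs)
  case (Cons y ys)
  then show ?case using le_prod_encode_2[of "enc ys" "enc y"] by (simp add: enc_Cons)
qed (simp add: enc_Nil)

text \<open>Folding as iteration on pairs of remaining list and accumulator. At the empty list the
  step is idle, so any number of iterations from the length on yields the fold; the code of the list
  is such a number (\<open>length_le_enc\<close>).\<close>

definition fold_step :: "('a \<Rightarrow> 'b \<Rightarrow> 'b) \<Rightarrow> 'a list \<times> 'b \<Rightarrow> 'a list \<times> 'b" where
  "fold_step g s = (case fst s of [] \<Rightarrow> s | y # ys \<Rightarrow> (ys, g y (snd s)))"

lemma fold_step_iterate:
  "length l \<le> n \<Longrightarrow> rec_nat (l, a) (\<lambda>_ s. fold_step g s) n = ([], fold g l a)"
proof (induction n arbitrary: l a)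
  case (Suc n)
  have shift: "fold_step g (rec_nat s (\<lambda>_ s. fold_step g s) k)
      = rec_nat (fold_step g s) (\<lambda>_ s. fold_step g s) k" for s k
    by (induction k) auto
  show ?case
  proof (cases l)
    case Nil
    then have "rec_nat (l, a) (\<lambda>_ s. fold_step g s) k = (l, a)" for k
      by (induction k) (auto simp: fold_step_def)
    from this[of "Suc n"] show ?thesis using Nil by simp
  next
    case (Cons y ys)
    then have "fold_step g (l, a) = (ys, g y a)" by (simp add: fold_step_def)
    then show ?thesis using Suc.prems Cons by (simp add: shift Suc.IH)
  qed
qed simp

lemma cmp_fold [cmp_intros]:
  fixes a :: "'a::enc \<Rightarrow> 'b::enc" and l :: "'a \<Rightarrow> 'c::enc list"
  assumes "cmp l" "cmp a" "cmp (\<lambda>p. g (fst p) (fst (snd p)) (snd (snd p)))"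
  shows "cmp (\<lambda>x. fold (g x) (l x) (a x))"
proof -
  have "cmp (\<lambda>x. snd (rec_nat (l x, a x) (\<lambda>_ s. fold_step (g x) s) (enc (l x))))"
    unfolding fold_step_def
    by (intro cmp_intros assms(1,2) cmp_comp3[OF assms(3)])
  then show ?thesis by (simp add: fold_step_iterate length_le_enc)
qed

lemma cmp_rev [cmp_intros]:
  fixes l :: "'a::enc \<Rightarrow> 'c::enc list"
  assumes "cmp l"
  shows "cmp (\<lambda>x. rev (l x))"
proof -
  have "cmp (\<lambda>x. fold (#) (l x) [])" by (intro cmp_intros assms)
  then show ?thesis by (simp add: fold_Cons_rev)
qed

lemma cmp_foldr [cmp_intros]:
  fixes a :: "'a::enc \<Rightarrow> 'b::enc" and l :: "'a \<Rightarrow> 'c::enc list"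
  assumes "cmp l" "cmp a" "cmp (\<lambda>p. g (fst p) (fst (snd p)) (snd (snd p)))"
  shows "cmp (\<lambda>x. foldr (g x) (l x) (a x))"
  unfolding foldr_conv_fold by (intro cmp_intros assms)

lemma foldr_simps:
  "foldr (#) xs ys = xs @ ys"
  "foldr (\<lambda>y r. h y # r) xs [] = map h xs"
  "foldr (\<lambda>y r. if b y then y # r else r) xs [] = filter b xs"
  "foldr (\<lambda>y. Suc) xs 0 = length xs"
  "foldr (\<lambda>y r. if y \<in> set r then r else y # r) xs [] = remdups xs"
  by (induction xs) auto

lemma filter_Nil_iff:
  "filter (\<lambda>y. \<not> b y) xs = [] \<longleftrightarrow> list_all b xs"
  "filter ((=) v) xs = [] \<longleftrightarrow> v \<notin> set xs"
  by (induction xs) auto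

lemma cmp_append [cmp_intros]: "cmp f \<Longrightarrow> cmp g \<Longrightarrow> cmp (\<lambda>x. f x @ g x)"
proof -
  assume a: "cmp f" "cmp g"
  have "cmp (\<lambda>x. foldr (#) (f x) (g x))" by (intro cmp_intros a)
  then show ?thesis by (simp add: foldr_simps filter_Nil_iff)
qed

lemma cmp_map [cmp_intros]:
  assumes "cmp l" "cmp (\<lambda>p. f (fst p) (snd p))"
  shows "cmp (\<lambda>x. map (f x) (l x))"
proof -
  have "cmp (\<lambda>x. foldr (\<lambda>y r. f x y # r) (l x) [])"
    by (intro cmp_intros assms(1) cmp_comp2[OF assms(2)])
  then show ?thesis by (simp add: foldr_simps filter_Nil_iff)
qed

lemma cmp_filter [cmp_intros]:
  assumes "cmp l" "cmp (\<lambda>p. f (fst p) (snd p))"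
  shows "cmp (\<lambda>x. filter (f x) (l x))"
proof -
  have "cmp (\<lambda>x. foldr (\<lambda>y r. if f x y then y # r else r) (l x) [])"
    by (intro cmp_intros assms(1) cmp_comp2[OF assms(2)])
  then show ?thesis by (simp add: foldr_simps filter_Nil_iff)
qed

lemma cmp_concat [cmp_intros]: "cmp l \<Longrightarrow> cmp (\<lambda>x. concat (l x))"
  unfolding concat_conv_foldr by (intro cmp_intros)

lemma cmp_length [cmp_intros]: "cmp l \<Longrightarrow> cmp (\<lambda>x. length (l x))"
proof -
  assume a: "cmp l"
  have "cmp (\<lambda>x. foldr (\<lambda>y r. Suc r) (l x) 0)" by (intro cmp_intros a)
  then show ?thesis by (simp add: foldr_simps filter_Nil_iff)
qed

lemma cmp_sum_list [cmp_intros]: "cmp l \<Longrightarrow> cmp (\<lambda>x. sum_list (l x :: nat list))"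
  unfolding sum_list.eq_foldr by (intro cmp_intros)

lemma cmp_list_all [cmp_intros]:
  assumes "cmp l" "cmp (\<lambda>p. f (fst p) (snd p))"
  shows "cmp (\<lambda>x. list_all (f x) (l x))"
proof -
  have "cmp (\<lambda>x. filter (\<lambda>y. \<not> f x y) (l x) = [])"
    by (intro cmp_intros assms(1) cmp_comp2[OF assms(2)])
  then show ?thesis by (simp add: foldr_simps filter_Nil_iff)
qed

lemma cmp_count_list [cmp_intros]: "cmp l \<Longrightarrow> cmp y \<Longrightarrow> cmp (\<lambda>x. count_list (l x) (y x))"
proof -
  assume a: "cmp l" "cmp y"
  have "cmp (\<lambda>x. length (filter (\<lambda>z. y x = z) (l x)))"
    by (intro cmp_intros a a[THEN cmp_comp])
  then show ?thesis by (simp add: count_list_eq_length_filter)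
qed

lemma cmp_upt [cmp_intros]: "cmp f \<Longrightarrow> cmp g \<Longrightarrow> cmp (\<lambda>x. [f x..<g x])"
proof -
  assume a: "cmp f" "cmp g"
  have "cmp (\<lambda>x. filter (\<lambda>k. f x \<le> k) (rec_nat [] (\<lambda>k r. r @ [k]) (g x)))"
    by (intro cmp_intros a a[THEN cmp_comp])
  moreover have "filter (\<lambda>k. m \<le> k) (rec_nat [] (\<lambda>k r. r @ [k]) n) = [m..<n]" for m n
    by (induction n) auto
  ultimately show ?thesis by simp
qed

lemma cmp_replicate [cmp_intros]: "cmp f \<Longrightarrow> cmp g \<Longrightarrow> cmp (\<lambda>x. replicate (f x) (g x))"
proof -
  assume a: "cmp f" "cmp g"
  have "cmp (\<lambda>x. map (\<lambda>i. g x) [0..<f x])"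
    by (intro cmp_intros a a[THEN cmp_comp])
  then show ?thesis by (simp add: map_replicate_const)
qed

lemma cmp_mem [cmp_intros]: "cmp y \<Longrightarrow> cmp l \<Longrightarrow> cmp (\<lambda>x. y x \<in> set (l x))"
proof -
  assume a: "cmp y" "cmp l"
  have "cmp (\<lambda>x. \<not> filter (\<lambda>z. y x = z) (l x) = [])"
    by (intro cmp_intros a a[THEN cmp_comp])
  then show ?thesis by (simp add: filter_Nil_iff)
qed

lemma cmp_remdups [cmp_intros]: "cmp l \<Longrightarrow> cmp (\<lambda>x. remdups (l x))"
proof -
  assume a: "cmp l"
  have "cmp (\<lambda>x. foldr (\<lambda>y r. if y \<in> set r then r else y # r) (l x) [])"
    by (intro cmp_intros a)
  then show ?thesis by (simp add: foldr_simps filter_Nil_iff)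
qed

lemma cmp_distinct [cmp_intros]: "cmp l \<Longrightarrow> cmp (\<lambda>x. distinct (l x))"
proof -
  assume a: "cmp l"
  have "cmp (\<lambda>x. remdups (l x) = l x)"
    by (intro cmp_intros a)
  then show ?thesis by (simp add: remdups_id_iff_distinct)
qed

text \<open>A variant of \<open>nth\<close> with the defined value \<open>d\<close> out of range,
  built from iterated \<open>tl\<close> so that the rules for lists give its computability.\<close>

definition lnth :: "'x \<Rightarrow> 'x list \<Rightarrow> nat \<Rightarrow> 'x" where
  "lnth d xs i = (case rec_nat xs (\<lambda>_ r. tl r) i of [] \<Rightarrow> d | y # ys \<Rightarrow> y)"

lemma lnth_eq: "i < length xs \<Longrightarrow> lnth d xs i = xs ! i"
proof -
  have "rec_nat xs (\<lambda>_ r. tl r) i = drop i xs" by (induction i) (auto simp: drop_Suc tl_drop)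
  moreover assume "i < length xs"
  ultimately show ?thesis unfolding lnth_def using Cons_nth_drop_Suc[of i xs] by (auto split: list.split)
qed

lemma cmp_tl [cmp_intros]: "cmp l \<Longrightarrow> cmp (\<lambda>x. tl (l x))"
  unfolding tl_def by (intro cmp_intros)

lemma cmp_lnth [cmp_intros]: "cmp l \<Longrightarrow> cmp i \<Longrightarrow> cmp (\<lambda>x. lnth d (l x) (i x))"
  by (rule cmp_comp2[where g = "lnth d"], unfold lnth_def, intro cmp_intros)

subsection \<open>Recursion over encoded datatypes\<close>

text \<open>Course-of-values recursion. All earlier values are kept in a list with the newest in
  front, which is why the value at \<open>i\<close> sits at position \<open>n - 1 - i\<close>. The
  list itself stays existentially quantified, as only these entries matter.\<close>

lemma cov_recursion:
  fixes G :: "'a::enc \<Rightarrow> nat \<Rightarrow> nat list \<Rightarrow> nat"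
  assumes "cmp (\<lambda>p. G (fst p) (fst (snd p)) (snd (snd p)))"
  obtains H where "cmp (\<lambda>p. H (fst p) (snd p))"
    "\<And>x n. \<exists>h. H x n = G x n h \<and> (\<forall>i<n. lnth 0 h (n - 1 - i) = H x i)"
proof -
  define hist where "hist x n = rec_nat [] (\<lambda>k h. G x k h # h) n" for x n
  define H where "H x n = G x n (hist x n)" for x n
  have len: "length (hist x n) = n" for x n unfolding hist_def by (induction n) auto
  have nth: "i < n \<Longrightarrow> hist x n ! (n - 1 - i) = H x i" for x n i
  proof (induction n)
    case (Suc n)
    have "hist x (Suc n) = H x n # hist x n" by (simp add: hist_def H_def)
    then show ?case using Suc by (auto simp: nth_Cons' less_Suc_eq)
  qed simp
  have "cmp (\<lambda>p. H (fst p) (snd p))"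
    unfolding H_def hist_def by (intro cmp_comp3[OF assms] cmp_intros)
  moreover have "\<exists>h. H x n = G x n h \<and> (\<forall>i<n. lnth 0 h (n - 1 - i) = H x i)" for x n
    using nth len by (intro exI[of _ "hist x n"]) (auto simp: lnth_eq H_def)
  ultimately show ?thesis by (rule that)
qed

text \<open>Syntax is coded as a pair of a tag and a body. For a positive tag the body and its two
  components are smaller than the whole code, so their values are available. For tag 0 this can
  fail, since the pair (0, 0) has code 0; there the three recursive arguments are arbitrary, and the
  clauses for leaves ignore them.\<close>

lemma tag_recursion:
  fixes G :: "nat \<Rightarrow> nat \<Rightarrow> nat \<Rightarrow> nat \<Rightarrow> nat \<Rightarrow> nat \<Rightarrow> nat"
  assumes G: "cmp (\<lambda>p. G (fst p) (fst (snd p)) (fst (snd (snd p))) (fst (snd (snd (snd p))))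
    (fst (snd (snd (snd (snd p))))) (snd (snd (snd (snd (snd p))))))"
  obtains H where "cmp (\<lambda>p. H (fst p) (snd p))"
    "\<And>x b. \<exists>r1 r2 r3. H x (prod_encode (0, b)) = G x 0 b r1 r2 r3"
    "\<And>x t b. t > 0 \<Longrightarrow> H x (prod_encode (t, b))
      = G x t b (H x b) (H x (fst (prod_decode b))) (H x (snd (prod_decode b)))"
proof -
  define t where "t n = fst (prod_decode n)" for n
  define b where "b n = snd (prod_decode n)" for n
  define G' where "G' x n h = G x (t n) (b n) (lnth 0 h (n - 1 - b n)) (lnth 0 h (n - 1 - t (b n)))
     (lnth 0 h (n - 1 - b (b n)))" for x n h
  have dec: "cmp (\<lambda>n. t n)" "cmp (\<lambda>n. b n)"
    using computable_fst[OF computable_id] computable_snd[OF computable_id]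
    by (simp_all add: cmp_nat_iff t_def b_def)
  have G6: "cmp (\<lambda>x. G (f1 x) (f2 x) (f3 x) (f4 x) (f5 x) (f6 x))"
    if "cmp f1" "cmp f2" "cmp f3" "cmp f4" "cmp f5" "cmp f6" for f1 f2 f3 f4 f5 f6 :: "nat \<times> nat \<times> nat list \<Rightarrow> nat"
    using cmp_comp[OF G cmp_Pair[OF that(1) cmp_Pair[OF that(2) cmp_Pair[OF that(3)
      cmp_Pair[OF that(4) cmp_Pair[OF that(5) that(6)]]]]]] by simp
  have "cmp (\<lambda>p. G' (fst p) (fst (snd p)) (snd (snd p)))"
    unfolding G'_def by (intro G6 cmp_intros dec[THEN cmp_comp])
  then obtain H where H: "cmp (\<lambda>p. H (fst p) (snd p))"
    "\<And>x n. \<exists>h. H x n = G' x n h \<and> (\<forall>i<n. lnth 0 h (n - 1 - i) = H x i)"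
    by (rule cov_recursion) blast
  have tb: "t (prod_encode (u, v)) = u" "b (prod_encode (u, v)) = v" for u v
    by (simp_all add: t_def b_def)
  have "H x (prod_encode (u, v)) = G x u v (H x v) (H x (fst (prod_decode v))) (H x (snd (prod_decode v)))"
    if "u > 0" for x u v
  proof -
    have "triangle u + triangle v \<le> triangle (u + v)"
      by (induction v) auto
    with that have less: "v < prod_encode (u, v)" using le_triangle[of v] le_triangle[of u]
      by (simp add: prod_encode_def)
    have "t v \<le> v" "b v \<le> v"
      using le_prod_encode_1[of "t v" "b v"] le_prod_encode_2[of "b v" "t v"] by (simp_all add: t_def b_def)
    moreover obtain h where "H x (prod_encode (u, v)) = G' x (prod_encode (u, v)) h"
      "\<forall>i<prod_encode (u, v). lnth 0 h (prod_encode (u, v) - 1 - i) = H x i"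
      using H(2) by blast
    ultimately show ?thesis using less unfolding G'_def tb by (simp add: t_def b_def)
  qed
  moreover have "\<exists>r1 r2 r3. H x (prod_encode (0, v)) = G x 0 v r1 r2 r3" for x v
    using H(2)[of x "prod_encode (0, v)"] unfolding G'_def tb by blast
  ultimately show ?thesis using H(1) that by blast
qed

section \<open>Codes of terms, atoms and formulas, and recursion over them\<close>

instantiation lp_tm :: enc begin
definition "enc t = lp_tm_code t"
instance by standard (auto simp: enc_lp_tm_def intro!: inj_lp_tm_code[THEN inj_eq[THEN iffD1]] injI)
end

instantiation lp_atom :: enc begin
definition "enc t = lp_atom_code t"
instance by standard (auto simp: enc_lp_atom_def intro!: inj_lp_atom_code[THEN inj_eq[THEN iffD1]] injI)
end

instantiation lpz_tm :: enc begin
definition "enc t = lpz_tm_code t"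
instance by standard (auto simp: enc_lpz_tm_def intro!: inj_lpz_tm_code[THEN inj_eq[THEN iffD1]] injI)
end

instantiation lpze_atom :: enc begin
definition "enc t = lpze_atom_code t"
instance by standard (auto simp: enc_lpze_atom_def intro!: inj_lpze_atom_code[THEN inj_eq[THEN iffD1]] injI)
end

instantiation fm :: (enc) enc begin
definition "enc t = fm_code enc t"
instance by standard (auto simp: enc_fm_def intro!: inj_fm_code[OF inj_enc, THEN inj_eq[THEN iffD1]] injI)
end

lemma enc_fm_simps:
  "enc (Atom a) = prod_encode (0, enc a)"
  "enc (Neg \<phi>) = prod_encode (1, enc \<phi>)"
  "enc (Conj \<phi> \<psi>) = prod_encode (2, prod_encode (enc \<phi>, enc \<psi>))"
  "enc (Disj \<phi> \<psi>) = prod_encode (3, prod_encode (enc \<phi>, enc \<psi>))"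
  "enc (Imp \<phi> \<psi>) = prod_encode (4, prod_encode (enc \<phi>, enc \<psi>))"
  "enc (Ex x \<phi>) = prod_encode (5, prod_encode (x, enc \<phi>))"
  "enc (All x \<phi>) = prod_encode (6, prod_encode (x, enc \<phi>))"
  by (simp_all add: enc_fm_def)

lemma enc_lp_tm_simps:
  "enc (LVar i) = prod_encode (0, i)"
  "enc LZero = prod_encode (1, 0)"
  "enc LOne = prod_encode (2, 0)"
  "enc (LAdd s t) = prod_encode (3, prod_encode (enc s, enc t))"
  "enc (LFrob t) = prod_encode (4, enc t)"
  by (simp_all add: enc_lp_tm_def)

lemma enc_lpz_tm_simps:
  "enc (Var i) = prod_encode (0, i)"
  "enc Zero = prod_encode (1, 0)"
  "enc One = prod_encode (2, 0)"
  "enc (Add s t) = prod_encode (3, prod_encode (enc s, enc t))"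
  "enc (Frob t) = prod_encode (4, enc t)"
  "enc (MulZ t) = prod_encode (5, enc t)"
  by (simp_all add: enc_lpz_tm_def)

lemma enc_fun_eq: "enc = lp_tm_code" "enc = lp_atom_code" "enc = lpz_tm_code" "enc = lpze_atom_code"
  by (rule ext, simp only: enc_lp_tm_def enc_lp_atom_def enc_lpz_tm_def enc_lpze_atom_def)+

lemma enc_atom_simps:
  "enc (LEq u v) = prod_encode (enc u, enc v)"
  "enc (Eq s t) = prod_encode (0, prod_encode (enc s, enc t))"
  "enc (InF t) = prod_encode (1, enc t)"
  "enc (P \<sigma> ts) = prod_encode (2, prod_encode (enc \<sigma>, enc ts))"
  by (simp_all add: enc_fun_eq enc_fm_def enc_list_def)

lemma enc_lpze_code: "enc \<phi> = lpze_code \<phi>"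
  by (simp add: enc_fm_def enc_fun_eq)

lemma cmp_encI: "cmp (\<lambda>x. enc (f x)) \<Longrightarrow> cmp f"
  unfolding cmp_def by simp

lemma cmp_fm_constructors [cmp_intros]:
  "cmp a \<Longrightarrow> cmp (\<lambda>x. Atom (a x))"
  "cmp f \<Longrightarrow> cmp (\<lambda>x. Neg (f x))"
  "cmp f \<Longrightarrow> cmp g \<Longrightarrow> cmp (\<lambda>x. Conj (f x) (g x))"
  "cmp f \<Longrightarrow> cmp g \<Longrightarrow> cmp (\<lambda>x. Disj (f x) (g x))"
  "cmp f \<Longrightarrow> cmp g \<Longrightarrow> cmp (\<lambda>x. Imp (f x) (g x))"
  "cmp n \<Longrightarrow> cmp f \<Longrightarrow> cmp (\<lambda>x. Ex (n x) (f x))"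
  "cmp n \<Longrightarrow> cmp f \<Longrightarrow> cmp (\<lambda>x. All (n x) (f x))"
  by (rule cmp_encI, unfold enc_fm_simps, intro cmp_intros; assumption)+

lemma cmp_term_constructors [cmp_intros]:
  "cmp n \<Longrightarrow> cmp (\<lambda>x. LVar (n x))"
  "cmp s \<Longrightarrow> cmp t \<Longrightarrow> cmp (\<lambda>x. LAdd (s x) (t x))"
  "cmp t \<Longrightarrow> cmp (\<lambda>x. LFrob (t x))"
  "cmp s \<Longrightarrow> cmp t \<Longrightarrow> cmp (\<lambda>x. LEq (s x) (t x))"
  "cmp n \<Longrightarrow> cmp (\<lambda>x. Var (n x))"
  "cmp s' \<Longrightarrow> cmp t' \<Longrightarrow> cmp (\<lambda>x. Add (s' x) (t' x))"
  "cmp t' \<Longrightarrow> cmp (\<lambda>x. Frob (t' x))"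
  "cmp t' \<Longrightarrow> cmp (\<lambda>x. MulZ (t' x))"
  "cmp s' \<Longrightarrow> cmp t' \<Longrightarrow> cmp (\<lambda>x. Eq (s' x) (t' x))"
  "cmp t' \<Longrightarrow> cmp (\<lambda>x. InF (t' x))"
  "cmp f \<Longrightarrow> cmp ts \<Longrightarrow> cmp (\<lambda>x. P (f x) (ts x))"
  by (rule cmp_encI, unfold enc_lp_tm_simps enc_lpz_tm_simps enc_atom_simps, intro cmp_intros; assumption)+

lemma cmp_nat_fun:
  assumes "cmp (f :: 'a::enc \<Rightarrow> 'b::enc)"
  obtains g :: "nat \<Rightarrow> nat" where "cmp g" "\<And>x. g (enc x) = enc (f x)"
  using assms by (metis cmpE cmp_nat_iff)

text \<open>The clauses receive the recursive values but not the subformulas, which is all that the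
  recursive functions on formulas below use. On codes the clauses are selected by the tag, and the
  recursion is an instance of \<open>tag_recursion\<close>.\<close>

lemma cmp_rec_fm [cmp_intros]:
  fixes a1 :: "'x::enc \<Rightarrow> 'at::enc \<Rightarrow> 'b::enc"
  assumes "cmp t"
    and f: "cmp (\<lambda>p. a1 (fst p) (snd p))" "cmp (\<lambda>p. a2 (fst p) (snd p))"
    "cmp (\<lambda>p. a3 (fst p) (fst (snd p)) (snd (snd p)))"
    "cmp (\<lambda>p. a4 (fst p) (fst (snd p)) (snd (snd p)))"
    "cmp (\<lambda>p. a5 (fst p) (fst (snd p)) (snd (snd p)))"
    "cmp (\<lambda>p. a6 (fst p) (fst (snd p)) (snd (snd p)))"
    "cmp (\<lambda>p. a7 (fst p) (fst (snd p)) (snd (snd p)))"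
  shows "cmp (\<lambda>x. rec_fm (a1 x) (\<lambda>_ r. a2 x r) (\<lambda>_ _ r s. a3 x r s) (\<lambda>_ _ r s. a4 x r s)
    (\<lambda>_ _ r s. a5 x r s) (\<lambda>n _ r. a6 x n r) (\<lambda>n _ r. a7 x n r) (t x))"
proof -
  let ?rec = "\<lambda>x. rec_fm (a1 x) (\<lambda>_ r. a2 x r) (\<lambda>_ _ r s. a3 x r s) (\<lambda>_ _ r s. a4 x r s)
    (\<lambda>_ _ r s. a5 x r s) (\<lambda>n _ r. a6 x n r) (\<lambda>n _ r. a7 x n r)"
  obtain b1 where b1: "cmp b1" "\<And>p. b1 (enc p) = enc (a1 (fst p) (snd p))"
    using f(1) by (rule cmp_nat_fun) blast
  obtain b2 where b2: "cmp b2" "\<And>p. b2 (enc p) = enc (a2 (fst p) (snd p))"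
    using f(2) by (rule cmp_nat_fun) blast
  obtain b3 where b3: "cmp b3" "\<And>p. b3 (enc p) = enc (a3 (fst p) (fst (snd p)) (snd (snd p)))"
    using f(3) by (rule cmp_nat_fun) blast
  obtain b4 where b4: "cmp b4" "\<And>p. b4 (enc p) = enc (a4 (fst p) (fst (snd p)) (snd (snd p)))"
    using f(4) by (rule cmp_nat_fun) blast
  obtain b5 where b5: "cmp b5" "\<And>p. b5 (enc p) = enc (a5 (fst p) (fst (snd p)) (snd (snd p)))"
    using f(5) by (rule cmp_nat_fun) blast
  obtain b6 where b6: "cmp b6" "\<And>p. b6 (enc p) = enc (a6 (fst p) (fst (snd p)) (snd (snd p)))"
    using f(6) by (rule cmp_nat_fun) blast
  obtain b7 where b7: "cmp b7" "\<And>p. b7 (enc p) = enc (a7 (fst p) (fst (snd p)) (snd (snd p)))"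
    using f(7) by (rule cmp_nat_fun) blast
  define G where "G x tag b r0 r1 r2 =
     (if tag = 0 then b1 (prod_encode (x, b))
      else if tag = 1 then b2 (prod_encode (x, r0))
      else if tag = 2 then b3 (prod_encode (x, prod_encode (r1, r2)))
      else if tag = 3 then b4 (prod_encode (x, prod_encode (r1, r2)))
      else if tag = 4 then b5 (prod_encode (x, prod_encode (r1, r2)))
      else if tag = 5 then b6 (prod_encode (x, prod_encode (fst (prod_decode b), r2)))
      else b7 (prod_encode (x, prod_encode (fst (prod_decode b), r2))))" for x tag b r0 r1 r2 :: nat
  have fd: "cmp (\<lambda>n. fst (prod_decode n))"
    using computable_fst[OF computable_id] by (simp add: cmp_nat_iff)
  have "cmp (\<lambda>p. G (fst p) (fst (snd p)) (fst (snd (snd p))) (fst (snd (snd (snd p))))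
    (fst (snd (snd (snd (snd p))))) (snd (snd (snd (snd (snd p))))))"
    unfolding G_def by (intro cmp_If b1(1)[THEN cmp_comp] b2(1)[THEN cmp_comp] b3(1)[THEN cmp_comp] b4(1)[THEN cmp_comp] b5(1)[THEN cmp_comp] b6(1)[THEN cmp_comp] b7(1)[THEN cmp_comp] fd[THEN cmp_comp] cmp_intros)
  then obtain H where H: "cmp (\<lambda>p. H (fst p) (snd p))"
    "\<And>x b. \<exists>r1 r2 r3. H x (prod_encode (0, b)) = G x 0 b r1 r2 r3"
    "\<And>x t b. t > 0 \<Longrightarrow> H x (prod_encode (t, b))
      = G x t b (H x b) (H x (fst (prod_decode b))) (H x (snd (prod_decode b)))"
    by (rule tag_recursion) blast
  have b: "b1 (prod_encode (enc x, enc u)) = enc (a1 x u)"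
    "b2 (prod_encode (enc x, enc v)) = enc (a2 x v)"
    "b3 (prod_encode (enc x, prod_encode (enc v, enc w))) = enc (a3 x v w)"
    "b4 (prod_encode (enc x, prod_encode (enc v, enc w))) = enc (a4 x v w)"
    "b5 (prod_encode (enc x, prod_encode (enc v, enc w))) = enc (a5 x v w)"
    "b6 (prod_encode (enc x, prod_encode (n, enc v))) = enc (a6 x n v)"
    "b7 (prod_encode (enc x, prod_encode (n, enc v))) = enc (a7 x n v)" for x u v w n
    using b1(2)[of "(x, u)"] b2(2)[of "(x, v)"] b3(2)[of "(x, v, w)"] b4(2)[of "(x, v, w)"]
      b5(2)[of "(x, v, w)"] b6(2)[of "(x, n, v)"] b7(2)[of "(x, n, v)"] by (simp_all add: enc_prod_def)
  have H_enc: "H (enc x) (enc \<phi>) = enc (?rec x \<phi>)" for x \<phi>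
  proof (induction \<phi>)
    case (Atom u)
    then show ?case using H(2)[of "enc x" "enc u"] by (auto simp: enc_fm_simps G_def b)
  qed (simp_all add: enc_fm_simps H(3) G_def b)
  have "cmp (\<lambda>x. H (enc x) (enc (t x)))"
    by (intro cmp_comp2[OF H(1)] cmp_intros assms(1))
  then show ?thesis by (auto simp: H_enc intro: cmp_encI)
qed

lemma cmp_rec_lpz_tm [cmp_intros]:
  fixes a1 :: "'x::enc \<Rightarrow> nat \<Rightarrow> 'b::enc"
  assumes "cmp t"
    and f: "cmp (\<lambda>p. a1 (fst p) (snd p))" "cmp a2" "cmp a3"
    "cmp (\<lambda>p. a4 (fst p) (fst (snd p)) (snd (snd p)))"
    "cmp (\<lambda>p. a5 (fst p) (snd p))" "cmp (\<lambda>p. a6 (fst p) (snd p))"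
  shows "cmp (\<lambda>x. rec_lpz_tm (a1 x) (a2 x) (a3 x) (\<lambda>_ _ r s. a4 x r s)
    (\<lambda>_ r. a5 x r) (\<lambda>_ r. a6 x r) (t x))"
proof -
  let ?rec = "\<lambda>x. rec_lpz_tm (a1 x) (a2 x) (a3 x) (\<lambda>_ _ r s. a4 x r s) (\<lambda>_ r. a5 x r) (\<lambda>_ r. a6 x r)"
  obtain b1 where b1: "cmp b1" "\<And>p. b1 (enc p) = enc (a1 (fst p) (snd p))"
    using f(1) by (rule cmp_nat_fun) blast
  obtain b2 where b2: "cmp b2" "\<And>p. b2 (enc p) = enc (a2 p)"
    using f(2) by (rule cmp_nat_fun) blast
  obtain b3 where b3: "cmp b3" "\<And>p. b3 (enc p) = enc (a3 p)"
    using f(3) by (rule cmp_nat_fun) blast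
  obtain b4 where b4: "cmp b4" "\<And>p. b4 (enc p) = enc (a4 (fst p) (fst (snd p)) (snd (snd p)))"
    using f(4) by (rule cmp_nat_fun) blast
  obtain b5 where b5: "cmp b5" "\<And>p. b5 (enc p) = enc (a5 (fst p) (snd p))"
    using f(5) by (rule cmp_nat_fun) blast
  obtain b6 where b6: "cmp b6" "\<And>p. b6 (enc p) = enc (a6 (fst p) (snd p))"
    using f(6) by (rule cmp_nat_fun) blast
  define G where "G x tag b r0 r1 r2 =
     (if tag = 0 then b1 (prod_encode (x, b))
      else if tag = 1 then b2 x
      else if tag = 2 then b3 x
      else if tag = 3 then b4 (prod_encode (x, prod_encode (r1, r2)))
      else if tag = 4 then b5 (prod_encode (x, r0))
      else b6 (prod_encode (x, r0)))" for x tag b r0 r1 r2 :: nat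
  have "cmp (\<lambda>p. G (fst p) (fst (snd p)) (fst (snd (snd p))) (fst (snd (snd (snd p))))
    (fst (snd (snd (snd (snd p))))) (snd (snd (snd (snd (snd p))))))"
    unfolding G_def by (intro cmp_If b1(1)[THEN cmp_comp] b2(1)[THEN cmp_comp] b3(1)[THEN cmp_comp] b4(1)[THEN cmp_comp] b5(1)[THEN cmp_comp] b6(1)[THEN cmp_comp] cmp_intros)
  then obtain H where H: "cmp (\<lambda>p. H (fst p) (snd p))"
    "\<And>x b. \<exists>r1 r2 r3. H x (prod_encode (0, b)) = G x 0 b r1 r2 r3"
    "\<And>x t b. t > 0 \<Longrightarrow> H x (prod_encode (t, b))
      = G x t b (H x b) (H x (fst (prod_decode b))) (H x (snd (prod_decode b)))"
    by (rule tag_recursion) blast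
  have b: "b1 (prod_encode (enc x, n)) = enc (a1 x n)"
    "b4 (prod_encode (enc x, prod_encode (enc v, enc w))) = enc (a4 x v w)"
    "b5 (prod_encode (enc x, enc v)) = enc (a5 x v)"
    "b6 (prod_encode (enc x, enc v)) = enc (a6 x v)" for x n v w
    using b1(2)[of "(x, n)"] b4(2)[of "(x, v, w)"] b5(2)[of "(x, v)"] b6(2)[of "(x, v)"]
    by (simp_all add: enc_prod_def)
  have H_enc: "H (enc x) (enc \<phi>) = enc (?rec x \<phi>)" for x \<phi>
  proof (induction \<phi>)
    case (Var u)
    then show ?case using H(2)[of "enc x" u] by (auto simp: enc_lpz_tm_simps G_def b)
  qed (simp_all add: enc_lpz_tm_simps H(3) G_def b b2(2) b3(2))
  have "cmp (\<lambda>x. H (enc x) (enc (t x)))"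
    by (intro cmp_comp2[OF H(1)] cmp_intros assms(1))
  then show ?thesis by (auto simp: H_enc intro: cmp_encI)
qed

text \<open>Terms of L_p have the same codes as their images among the terms of L_p(z), so the
  embedding is the identity on codes and the recursion over \<open>lpz_tm\<close> can be
  reused.\<close>

lemma cmp_rec_lp_tm [cmp_intros]:
  fixes a1 :: "'x::enc \<Rightarrow> nat \<Rightarrow> 'b::enc"
  assumes "cmp t"
    and f: "cmp (\<lambda>p. a1 (fst p) (snd p))" "cmp a2" "cmp a3"
    "cmp (\<lambda>p. a4 (fst p) (fst (snd p)) (snd (snd p)))" "cmp (\<lambda>p. a5 (fst p) (snd p))"
  shows "cmp (\<lambda>x. rec_lp_tm (a1 x) (a2 x) (a3 x) (\<lambda>_ _ r s. a4 x r s) (\<lambda>_ r. a5 x r) (t x))"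
proof -
  have tr: "cmp (\<lambda>x. rec_lpz_tm (a1 x) (a2 x) (a3 x) (\<lambda>_ _ r s. a4 x r s) (\<lambda>_ r. a5 x r) (\<lambda>_ r. r) (u x))"
    if "cmp u" for u :: "'x \<Rightarrow> lpz_tm"
    by (intro cmp_rec_lpz_tm that f cmp_intros)
  define emb where "emb = rec_lp_tm Var Zero One (\<lambda>_ _ r s. Add r s) (\<lambda>_ r. Frob r)"
  have emb: "enc (emb u) = enc u" for u
    by (induction u) (simp_all add: emb_def enc_lp_tm_simps enc_lpz_tm_simps)
  have "cmp emb" by (rule cmpI[OF computable_id]) (simp add: emb)
  from tr[OF cmp_comp[OF this assms(1)]]
  have "cmp (\<lambda>x. rec_lpz_tm (a1 x) (a2 x) (a3 x) (\<lambda>_ _ r s. a4 x r s) (\<lambda>_ r. a5 x r) (\<lambda>_ r. r) (emb (t x)))" .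
  moreover have "rec_lpz_tm c1 c2 c3 (\<lambda>_ _ r s. c4 r s) (\<lambda>_ r. c5 r) (\<lambda>_ r. r) (emb u)
     = rec_lp_tm c1 c2 c3 (\<lambda>_ _ r s. c4 r s) (\<lambda>_ r. c5 r) u" for c1 and c2 c3 :: 'b and c4 c5 u
    by (induction u) (simp_all add: emb_def)
  ultimately show ?thesis by simp
qed

lemma cmp_case_lp_atom [cmp_intros]:
  assumes "cmp t" "cmp (\<lambda>p. f (fst p) (fst (snd p)) (snd (snd p)))"
  shows "cmp (\<lambda>x. case t x of LEq u v \<Rightarrow> f x u v)"
proof -
  define dest where "dest a = (case a of LEq u v \<Rightarrow> (u, v))" for a
  have "enc (dest a) = enc a" for a by (cases a) (simp add: dest_def enc_atom_simps enc_prod_def)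
  then have dest: "cmp dest" by (intro cmpI[OF computable_id]) simp
  have "cmp (\<lambda>x. f x (fst (dest (t x))) (snd (dest (t x))))"
    by (intro cmp_comp3[OF assms(2)] cmp_fst cmp_snd cmp_id dest[THEN cmp_comp] assms(1))
  moreover have "f x (fst (dest (t x))) (snd (dest (t x))) = (case t x of LEq u v \<Rightarrow> f x u v)" for x
    by (simp add: dest_def split: lp_atom.split)
  ultimately show ?thesis by simp
qed

lemma cmp_case_lpze_atom [cmp_intros]:
  fixes f1 :: "'x::enc \<Rightarrow> lpz_tm \<Rightarrow> lpz_tm \<Rightarrow> 'b::enc"
  assumes t: "cmp t" and f: "cmp (\<lambda>p. f1 (fst p) (fst (snd p)) (snd (snd p)))"
    "cmp (\<lambda>p. f2 (fst p) (snd p))" "cmp (\<lambda>p. f3 (fst p) (fst (snd p)) (snd (snd p)))"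
  shows "cmp (\<lambda>x. case t x of Eq u v \<Rightarrow> f1 x u v | InF u \<Rightarrow> f2 x u | P \<sigma> ts \<Rightarrow> f3 x \<sigma> ts)"
proof -
  obtain b0 where b0: "computable b0" "\<And>x. b0 (enc x) = enc (t x)" using t by (rule cmpE) blast
  obtain b1 where b1: "computable b1" "\<And>p. b1 (enc p) = enc (f1 (fst p) (fst (snd p)) (snd (snd p)))"
    using f(1) by (rule cmpE) blast
  obtain b2 where b2: "computable b2" "\<And>p. b2 (enc p) = enc (f2 (fst p) (snd p))"
    using f(2) by (rule cmpE) blast
  obtain b3 where b3: "computable b3" "\<And>p. b3 (enc p) = enc (f3 (fst p) (fst (snd p)) (snd (snd p)))"
    using f(3) by (rule cmpE) blast
  have dec: "cmp (\<lambda>n. fst (prod_decode (b0 n)))" "cmp (\<lambda>n. snd (prod_decode (b0 n)))"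
    using computable_fst[OF b0(1)] computable_snd[OF b0(1)] by (simp_all add: cmp_nat_iff)
  have "cmp (\<lambda>n. if fst (prod_decode (b0 n)) = 0 then b1 (prod_encode (n, snd (prod_decode (b0 n))))
     else if fst (prod_decode (b0 n)) = 1 then b2 (prod_encode (n, snd (prod_decode (b0 n))))
     else b3 (prod_encode (n, snd (prod_decode (b0 n)))))"
    by (intro cmp_If cmp_nat_iff[THEN iffD2, OF b1(1), THEN cmp_comp] cmp_nat_iff[THEN iffD2, OF b2(1), THEN cmp_comp]
       cmp_nat_iff[THEN iffD2, OF b3(1), THEN cmp_comp] dec cmp_prod_encode cmp_eq cmp_id cmp_const)
  then show ?thesis unfolding cmp_nat_iff
  proof (rule cmpI, goal_cases)
    case (1 x)
    then show ?case
      using b1(2)[of "(x, u)" for u] b2(2)[of "(x, u)" for u] b3(2)[of "(x, u)" for u]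
      by (cases "t x") (auto simp: b0 enc_atom_simps enc_prod_def)
  qed
qed

subsection \<open>Unbounded search\<close>

text \<open>Minimisation runs on codes. Surjectivity of the encoding of inputs supplies the required
  zero for every number, and surjectivity of the encoding of outputs turns the least hit into a
  value.\<close>

lemma cmp_search:
  fixes Q :: "'a::benc \<Rightarrow> 'b::benc \<Rightarrow> bool"
  assumes "cmp (\<lambda>p. Q (fst p) (snd p))" "\<And>x. \<exists>y. Q x y"
  obtains f where "cmp f" "\<And>x. Q x (f x)"
proof -
  have "cmp (\<lambda>p. if Q (snd p) (fst p) then 0 else 1::nat)"
    by (intro cmp_intros cmp_comp2[OF assms(1)])
  then obtain t where t: "computable t" "\<And>p. t (enc p) = enc (if Q (snd p) (fst p) then 0 else 1::nat)"
    by (rule cmpE) blast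
  have t': "t (prod_encode (enc y, enc x)) = 0 \<longleftrightarrow> Q x y" for x y
    using t(2)[of "(y, x)"] by (simp add: enc_prod_def)
  have ex: "\<exists>y. t (prod_encode (y, n)) = 0" for n
  proof -
    obtain x :: 'a where "n = enc x" using surj_enc by (metis surjD)
    then show ?thesis using t' assms(2) by metis
  qed
  define h where "h n = (LEAST y. t (prod_encode (y, n)) = 0)" for n
  have h: "computable h" unfolding h_def using computable_search[OF t(1) ex] .
  define f where "f x = (SOME y :: 'b. enc y = h (enc x))" for x :: 'a
  have f: "enc (f x) = h (enc x)" for x
    unfolding f_def using surj_enc by (metis (mono_tags) someI_ex surjD)
  have "t (prod_encode (h n, n)) = 0" for n unfolding h_def by (rule LeastI_ex) (rule ex)
  then have "Q x (f x)" for x using t'[of "f x" x] f[of x] by metis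
  moreover have "cmp f" using h f by (intro cmpI[of h]) auto
  ultimately show ?thesis using that by blast
qed

section \<open>The ring \<open>R\<close>\<close>

lemma const_rf_hom [simp]:
  "const_rf 0 = 0" "const_rf 1 = 1" "const_rf (a + b) = const_rf a + const_rf b"
  "const_rf (a * b) = const_rf a * const_rf b" "const_rf (- a) = - const_rf a"
  "const_rf (a - b) = const_rf a - const_rf b"
  by (simp_all add: const_rf_def flip: to_fract_add to_fract_mult to_fract_uminus to_fract_diff)
    (simp flip: one_pCons)

lemma const_rf_inj [simp]: "const_rf a = const_rf b \<longleftrightarrow> a = b"
  by (simp add: const_rf_def)

lemma const_rf_power [simp]: "const_rf (a ^ n) = const_rf a ^ n"
  by (induction n) simp_all

lemma to_fract_power [simp]: "to_fract (x ^ n) = to_fract x ^ n"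
  by (induction n) simp_all

lemma to_fract_prod: "to_fract (prod f A) = (\<Prod>x\<in>A. to_fract (f x))"
  by (induction A rule: infinite_finite_induct) simp_all

lemma z_rf_nonzero [simp]: "z_rf \<noteq> 0"
  by (simp add: z_rf_def)

lemma to_fract_pCons: "to_fract (pCons a g) = const_rf a + z_rf * to_fract g"
  by (simp add: const_rf_def z_rf_def flip: to_fract_add to_fract_mult)

lemma to_fract_monom: "to_fract (monom a n) = const_rf a * z_rf ^ n"
  by (induction n) (simp_all add: monom_0 monom_Suc to_fract_pCons)

text \<open>In characteristic p a list of exponents denotes the polynomial whose coefficient of z^n
  is the multiplicity of n modulo p. All elements of F_p[z] arise in this way
  (\<open>prime_field_pl\<close>), so this is the finite representation of coefficients.\<close>

definition pl :: "nat list \<Rightarrow> 'a::field poly fract" where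
  "pl ns = (\<Sum>n\<leftarrow>ns. z_rf ^ n)"

lemma pl_simps [simp]:
  "pl [] = 0" "pl (n # ns) = z_rf ^ n + pl ns" "pl (ns @ ms) = pl ns + pl ms"
  by (simp_all add: pl_def)

definition plp :: "nat list \<Rightarrow> 'a::field poly" where
  "plp ns = (\<Sum>n\<leftarrow>ns. monom 1 n)"

lemma pl_conv_plp: "pl ns = to_fract (plp ns)"
  by (induction ns) (simp_all add: plp_def to_fract_monom)

lemma degree_plp_le: "(\<And>n. n \<in> set ns \<Longrightarrow> n \<le> N) \<Longrightarrow> degree (plp ns :: 'a::field poly) \<le> N"
proof (induction ns)
  case (Cons n ns)
  then show ?case
    by (auto simp: plp_def intro!: degree_add_le order.trans[OF degree_monom_le])
qed (simp add: plp_def)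

lemma pigeonhole_nat:
  fixes f :: "nat \<Rightarrow> 'a"
  assumes "finite W" "\<And>n. f n \<in> W"
  obtains i k where "f i = f (i + Suc k)"
proof -
  have "\<not> inj f"
    using range_inj_infinite[of f] finite_subset[of "range f" W] assms by blast
  then obtain i j where "f i = f j" "i < j"
    unfolding inj_def by (metis linorder_neqE_nat)
  then show ?thesis using that less_iff_Suc_add[of i j] by auto
qed

locale setting =
  fixes p :: nat and S :: "'a::field poly set"
  assumes prime_p: "prime p"
    and char_p: "CHAR('a) = p"
    and alg: "\<forall>x::'a. algebraic_over_prime_field x"
    and finite_S: "finite S"
    and S_prime_field: "s \<in> S \<Longrightarrow> s \<in> prime_field_polys"
    and S_nonzero: "s \<in> S \<Longrightarrow> s \<noteq> 0"
begin

section \<open>Characteristic p and additivity of the Frobenius map\<close>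

lemma p_gt_1: "p > 1" and p_gt_0 [simp]: "p > 0"
  using prime_gt_1_nat[OF prime_p] by auto

lemma p_nonzero [simp]: "p \<noteq> 0"
  using p_gt_0 by simp

lemma p_power_gt_0 [simp]: "0 < p ^ n"
  by simp

lemma char_fract: "CHAR('a poly fract) = p"
proof (rule CHAR_eqI)
  show "of_nat p = (0 :: 'a poly fract)"
    using of_nat_CHAR[where 'a = "'a poly"] by (simp add: char_p of_nat_fract Zero_fract_def)
  fix n assume "of_nat n = (0 :: 'a poly fract)"
  then have "of_nat n = (0 :: 'a poly)" by (simp add: of_nat_fract flip: to_fract_def)
  then show "p dvd n" by (simp add: of_nat_eq_0_iff_char_dvd char_p)
qed

lemma frob_add: "(x + y) ^ (p ^ m) = x ^ (p ^ m) + (y :: 'a poly fract) ^ (p ^ m)"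
  using freshmans_dream'[of "p ^ m" m x y] char_fract prime_p by simp

lemma frob_sum: "(sum f A) ^ (p ^ m) = (\<Sum>x\<in>A. (f x :: 'a poly fract) ^ (p ^ m))"
  by (induction A rule: infinite_finite_induct) (simp_all add: frob_add)

lemma frob_minus: "(- x) ^ (p ^ m) = - ((x :: 'a poly fract) ^ (p ^ m))"
  using frob_add[of x "- x" m] by (simp add: eq_neg_iff_add_eq_0 add.commute power_0_left)

lemma frob_diff: "(x - y) ^ (p ^ m) = x ^ (p ^ m) - (y :: 'a poly fract) ^ (p ^ m)"
  using frob_add[of x "- y" m] by (simp add: frob_minus)

lemma of_nat_p [simp]: "of_nat p = (0 :: 'a poly fract)"
  by (metis char_fract of_nat_CHAR)

subsection \<open>Perfectness of \<open>F\<close>\<close>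

lemma frob_inj: "(x :: 'a) ^ (p ^ m) = y ^ (p ^ m) \<Longrightarrow> x = y"
proof -
  assume "x ^ (p ^ m) = y ^ (p ^ m)"
  moreover have "(x - y + y) ^ (p ^ m) = (x - y) ^ (p ^ m) + y ^ (p ^ m)"
    using freshmans_dream'[of "p ^ m" m "x - y" y] char_p prime_p by simp
  ultimately show "x = y" by simp
qed

lemma Ints_eq_of_nat: "(c :: 'a) \<in> \<int> \<Longrightarrow> \<exists>k<p. c = of_nat k"
proof -
  assume "c \<in> \<int>"
  then obtain i where i: "c = of_int i" by (auto elim: Ints_cases)
  have "of_int (int p) = (0 :: 'a)" using of_nat_CHAR[where 'a = 'a] char_p by simp
  have "of_int i = (of_int (int p * (i div int p) + i mod int p) :: 'a)" by simp
  also have "\<dots> = of_int (i mod int p)"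
    unfolding of_int_add of_int_mult \<open>of_int (int p) = 0\<close> by simp
  finally have "of_int i = (of_int (i mod int p) :: 'a)" .
  moreover have "of_int (i mod int p) = (of_nat (nat (i mod int p)) :: 'a)"
    by (subst of_int_of_nat_eq[symmetric]) simp
  moreover have "nat (i mod int p) < p" by (simp add: nat_less_iff)
  ultimately show ?thesis using i by metis
qed

lemma finite_Ints: "finite (\<int> :: 'a set)"
  by (rule finite_subset[of _ "of_nat ` {..<p}"]) (use Ints_eq_of_nat in auto)

text \<open>The powers of \<open>c\<close> lie in a finite set, so two of them coincide; cancelling
  shows that the inverse is itself a power of \<open>c\<close>.\<close>

lemma Ints_inverse: "(c :: 'a) \<in> \<int> \<Longrightarrow> inverse c \<in> \<int>"
proof (cases "c = 0")
  case False
  assume "c \<in> \<int>"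
  obtain m k where "c ^ m = c ^ (m + Suc k)"
    using pigeonhole_nat[OF finite_Ints, of "\<lambda>n. c ^ n"] \<open>c \<in> \<int>\<close> by auto
  then have "c * c ^ k = 1" using False by (simp add: power_add)
  then have "inverse c = c ^ k" by (rule inverse_unique)
  then show ?thesis using \<open>c \<in> \<int>\<close> by simp
qed simp

text \<open>All powers of \<open>x\<close> lie in the span of 1, ..., x^(d-1) over the finite prime
  field, which is the finite set \<open>W\<close>. Hence two of the iterated p^m-th powers of
  \<open>x\<close> coincide, and injectivity of Frobenius cancels the common iterations, leaving
  \<open>x\<close> as a p^m-th power.\<close>

lemma frob_surj: "\<exists>b :: 'a. b ^ (p ^ m) = x"
proof -
  obtain q where q: "\<forall>i. coeff q i \<in> \<int>" "q \<noteq> 0" "poly q x = 0"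
    using alg unfolding algebraic_over_prime_field_def by blast
  define d where "d = degree q"
  define W where "W = (\<lambda>c. \<Sum>i<d. c i * x ^ i) ` ({..<d} \<rightarrow>\<^sub>E \<int>)"
  have fin: "finite W" unfolding W_def by (intro finite_imageI finite_PiE finite_Ints) auto
  have W_iff: "w \<in> W \<longleftrightarrow> (\<exists>c. (\<forall>i<d. c i \<in> \<int>) \<and> w = (\<Sum>i<d. c i * x ^ i))" for w
  proof
    assume "\<exists>c. (\<forall>i<d. c i \<in> \<int>) \<and> w = (\<Sum>i<d. c i * x ^ i)"
    then obtain c where "\<forall>i<d. c i \<in> \<int>" "w = (\<Sum>i<d. c i * x ^ i)" by blast
    then show "w \<in> W" unfolding W_def
      by (intro image_eqI[of _ _ "restrict c {..<d}"]) auto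
  qed (auto simp: W_def PiE_iff)
  have d: "d > 0"
  proof (rule ccontr)
    assume "\<not> d > 0"
    then obtain c where "q = [:c:]" unfolding d_def by (metis degree_eq_zeroE gr0I)
    then show False using q by simp
  qed
  \<comment> \<open>Coefficients of x^d in terms of the lower powers, from the relation
    \<open>q\<close> made monic.\<close>
  define e where "e i = - (coeff q i * inverse (lead_coeff q))" for i
  have e: "e i \<in> \<int>" for i unfolding e_def using q Ints_inverse by auto
  have xd: "x ^ d = (\<Sum>i<d. e i * x ^ i)"
  proof -
    have "0 = (\<Sum>i<d. coeff q i * x ^ i) + lead_coeff q * x ^ d"
      using q(3) by (simp add: poly_altdef d_def flip: lessThan_Suc_atMost)
    then have "x ^ d = - (\<Sum>i<d. coeff q i * x ^ i) * inverse (lead_coeff q)"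
      using q(2) by (simp add: field_simps add_eq_0_iff2)
    then show ?thesis by (simp add: e_def sum_distrib_left sum_negf mult_ac)
  qed
  have pow: "x ^ n \<in> W" for n
  proof (induction n)
    case 0
    show ?case unfolding W_iff
      by (rule exI[of _ "\<lambda>i. if i = 0 then 1 else 0"]) (use d in \<open>simp add: if_distrib[of "\<lambda>u. u * _"] cong: if_cong\<close>)
  next
    case (Suc n)
    then obtain c where c: "\<forall>i<d. c i \<in> \<int>" "x ^ n = (\<Sum>i<d. c i * x ^ i)" unfolding W_iff by blast
    obtain d' where d': "d = Suc d'" using d by (metis Suc_pred)
    have "x ^ Suc n = (\<Sum>i<d. c i * x ^ Suc i)" using c(2) by (simp add: sum_distrib_left mult_ac)
    also have "\<dots> = (\<Sum>i<d'. c i * x ^ Suc i) + c d' * x ^ d" by (simp add: d')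
    also have "(\<Sum>i<d'. c i * x ^ Suc i) = (\<Sum>i<d. (if i = 0 then 0 else c (i - 1)) * x ^ i)"
      unfolding d' by (subst sum.lessThan_Suc_shift) simp
    also have "\<dots> + c d' * x ^ d = (\<Sum>i<d. ((if i = 0 then 0 else c (i - 1)) + c d' * e i) * x ^ i)"
      unfolding xd by (simp add: sum_distrib_left sum.distrib algebra_simps)
    finally show ?case unfolding W_iff using c(1) e d'
      by (intro exI[of _ "\<lambda>i. (if i = 0 then 0 else c (i - 1)) + c d' * e i"]) auto
  qed
  obtain i k where ij: "x ^ (p ^ (m * i)) = x ^ (p ^ (m * (i + Suc k)))"
    using pigeonhole_nat[OF fin, of "\<lambda>n. x ^ (p ^ (m * n))"] pow by auto
  have "p ^ (m * (i + Suc k)) = p ^ (m * k) * p ^ m * p ^ (m * i)"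
    by (simp add: power_add algebra_simps)
  then have "(x ^ (p ^ (m * k) * p ^ m)) ^ (p ^ (m * i)) = x ^ (p ^ (m * i))"
    using ij by (simp add: power_mult)
  then have "x ^ (p ^ (m * k) * p ^ m) = x" by (rule frob_inj)
  then show ?thesis by (auto simp: power_mult)
qed

definition rt :: "nat \<Rightarrow> 'a \<Rightarrow> 'a" where
  "rt m x = (SOME b. b ^ (p ^ m) = x)"

lemma rt_power [simp]: "rt m x ^ (p ^ m) = x"
  unfolding rt_def using someI_ex[OF frob_surj] .

lemma rt_0 [simp]: "rt m 0 = 0"
  using rt_power[of m 0] by (simp del: rt_power)

subsection \<open>Localisation at one polynomial\<close>

definition DD :: "'a poly" where "DD = \<Prod>S"
definition D :: "'a poly fract" where "D = to_fract DD"
abbreviation R :: "'a poly fract set" where "R \<equiv> localized_ring S"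
abbreviation F :: "'a poly fract set" where "F \<equiv> range const_rf"

lemma DD_nonzero [simp]: "DD \<noteq> 0"
  unfolding DD_def using finite_S S_nonzero by auto

lemma D_nonzero [simp]: "D \<noteq> 0"
  by (simp add: D_def)

lemma R_0 [simp]: "0 \<in> R" and R_1 [simp]: "1 \<in> R"
  using localized_ring.const[of 0 S] localized_ring.const[of 1 S] by simp_all

lemma R_const [simp]: "const_rf c \<in> R" by (rule localized_ring.const)
lemma R_z [simp]: "z_rf \<in> R" by (rule localized_ring.z)
lemma R_add [simp]: "x \<in> R \<Longrightarrow> y \<in> R \<Longrightarrow> x + y \<in> R" by (rule localized_ring.add)
lemma R_mult [simp]: "x \<in> R \<Longrightarrow> y \<in> R \<Longrightarrow> x * y \<in> R" by (rule localized_ring.mult)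

lemma R_uminus [simp]: "x \<in> R \<Longrightarrow> - x \<in> R"
  using R_mult[OF R_const[of "-1"], of x] by simp

lemma R_diff [simp]: "x \<in> R \<Longrightarrow> y \<in> R \<Longrightarrow> x - y \<in> R"
  using R_add[of x "- y"] by simp

lemma R_power [simp]: "x \<in> R \<Longrightarrow> x ^ n \<in> R"
  by (induction n) auto

lemma R_sum [simp]: "(\<And>i. i \<in> A \<Longrightarrow> f i \<in> R) \<Longrightarrow> sum f A \<in> R"
  by (induction A rule: infinite_finite_induct) auto

lemma R_prod: "(\<And>i. i \<in> A \<Longrightarrow> f i \<in> R) \<Longrightarrow> prod f A \<in> R"
  by (induction A rule: infinite_finite_induct) auto

lemma F_R: "x \<in> F \<Longrightarrow> x \<in> R"
  by auto

lemma R_poly [simp]: "to_fract g \<in> R"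
  by (induction g) (simp_all add: to_fract_pCons)

lemma R_invD [simp]: "inverse D \<in> R"
  unfolding D_def DD_def
  by (auto simp: to_fract_prod prod_inversef[symmetric] comp_def intro!: R_prod localized_ring.inv)

lemma R_D [simp]: "D \<in> R"
  unfolding D_def by simp

lemma R_iff: "x \<in> R \<longleftrightarrow> (\<exists>g n. x * D ^ n = to_fract g)"
proof
  assume "x \<in> R"
  then show "\<exists>g n. x * D ^ n = to_fract g"
  proof induction
    case (const c)
    show ?case by (intro exI[of _ "[:c:]"] exI[of _ 0]) (simp add: const_rf_def)
  next
    case z
    show ?case by (intro exI[of _ "[:0, 1:]"] exI[of _ 0]) (simp add: z_rf_def)
  next
    case (inv s)
    then have "DD = s * \<Prod>(S - {s})" unfolding DD_def using finite_S by (simp add: prod.remove)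
    then have "inverse (to_fract s) * D ^ 1 = to_fract (\<Prod>(S - {s}))"
      unfolding D_def using S_nonzero[OF inv] by simp
    then show ?case by blast
  next
    case (add f g)
    then obtain a m b n where "f * D ^ m = to_fract a" "g * D ^ n = to_fract b" by blast
    moreover have "(f + g) * D ^ (m + n) = (f * D ^ m) * D ^ n + (g * D ^ n) * D ^ m"
      by (simp add: power_add algebra_simps)
    ultimately have "(f + g) * D ^ (m + n) = to_fract (a * DD ^ n + b * DD ^ m)"
      by (simp add: D_def)
    then show ?case by blast
  next
    case (mult f g)
    then obtain a m b n where "f * D ^ m = to_fract a" "g * D ^ n = to_fract b" by blast
    moreover have "(f * g) * D ^ (m + n) = (f * D ^ m) * (g * D ^ n)"
      by (simp add: power_add algebra_simps)
    ultimately have "(f * g) * D ^ (m + n) = to_fract (a * b)" by simp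
    then show ?case by blast
  qed
next
  assume "\<exists>g n. x * D ^ n = to_fract g"
  then obtain g n where "x * D ^ n = to_fract g" by blast
  then have "x = to_fract g * inverse D ^ n" by (simp add: field_simps)
  then show "x \<in> R" by simp
qed

subsection \<open>Bounded elements\<close>

text \<open>Growth of degrees per index of the filtration. It exceeds the degree of
  \<open>DD\<close>, so that multiplication by \<open>DD\<close> is absorbed when the index grows by
  one, and polynomials of degree \<open>n\<close> lie in \<open>V n\<close>.\<close>

definition E :: nat where "E = 2 * degree DD + 1"

text \<open>A filtration of R by finite-dimensional spaces over F: one index bounds both the power
  of D in the denominator and the degree. It is multiplicative (\<open>V_mult\<close>), starts with
  F (\<open>V_zero_eq\<close>) and exhausts R (\<open>R_V\<close>).\<close>

definition V :: "nat \<Rightarrow> 'a poly fract set" where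
  "V n = {x. \<exists>g. degree g \<le> n * E \<and> x * D ^ n = to_fract g}"

lemma V_R: "x \<in> V n \<Longrightarrow> x \<in> R"
  unfolding V_def R_iff by blast

lemma V_mono: "m \<le> n \<Longrightarrow> x \<in> V m \<Longrightarrow> x \<in> V n"
proof -
  assume "m \<le> n" "x \<in> V m"
  then obtain g where g: "degree g \<le> m * E" "x * D ^ m = to_fract g" unfolding V_def by blast
  have "x * D ^ n = (x * D ^ m) * D ^ (n - m)"
    using \<open>m \<le> n\<close> by (simp add: mult.assoc flip: power_add)
  then have "x * D ^ n = to_fract (g * DD ^ (n - m))"
    using g(2) by (simp only: to_fract_mult to_fract_power flip: D_def)
  moreover have "degree (g * DD ^ (n - m)) \<le> m * E + (n - m) * degree DD"
    using g(1) by (intro order.trans[OF degree_mult_le] add_mono order.trans[OF degree_power_le]) (auto simp: mult.commute)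
  moreover have "m * E + (n - m) * degree DD \<le> m * E + (n - m) * E"
    unfolding E_def by (intro add_left_mono mult_left_mono) auto
  moreover have "m * E + (n - m) * E = n * E" using \<open>m \<le> n\<close> by (simp flip: add_mult_distrib)
  ultimately show "x \<in> V n" unfolding V_def by (metis (mono_tags, lifting) mem_Collect_eq order.trans)
qed

lemma V_add: "x \<in> V n \<Longrightarrow> y \<in> V n \<Longrightarrow> x + y \<in> V n"
  unfolding V_def
proof (clarify)
  fix g h assume *: "degree g \<le> n * E" "x * D ^ n = to_fract g" "degree h \<le> n * E" "y * D ^ n = to_fract h"
  then show "\<exists>f. degree f \<le> n * E \<and> (x + y) * D ^ n = to_fract f"
    by (intro exI[of _ "g + h"]) (simp add: degree_add_le distrib_right)
qed

lemma V_0 [simp]: "0 \<in> V n"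
  unfolding V_def by (auto intro!: exI[of _ 0])

lemma V_uminus: "x \<in> V n \<Longrightarrow> - x \<in> V n"
  unfolding V_def
proof (clarify)
  fix g assume *: "degree g \<le> n * E" "x * D ^ n = to_fract g"
  then show "\<exists>f. degree f \<le> n * E \<and> - x * D ^ n = to_fract f"
    by (intro exI[of _ "- g"]) simp
qed

lemma V_diff: "x \<in> V n \<Longrightarrow> y \<in> V n \<Longrightarrow> x - y \<in> V n"
  using V_add[of x n "- y"] V_uminus by simp

lemma V_sum: "(\<And>i. i \<in> A \<Longrightarrow> f i \<in> V n) \<Longrightarrow> sum f A \<in> V n"
  by (induction A rule: infinite_finite_induct) (auto intro: V_add)

lemma V_mult: "x \<in> V m \<Longrightarrow> y \<in> V n \<Longrightarrow> x * y \<in> V (m + n)"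
proof -
  assume "x \<in> V m" "y \<in> V n"
  then obtain g h where "degree g \<le> m * E" "x * D ^ m = to_fract g" "degree h \<le> n * E" "y * D ^ n = to_fract h"
    unfolding V_def by blast
  moreover have "x * y * D ^ (m + n) = (x * D ^ m) * (y * D ^ n)"
    by (simp add: power_add algebra_simps)
  moreover have "degree (g * h) \<le> degree g + degree h" by (rule degree_mult_le)
  ultimately have "x * y * D ^ (m + n) = to_fract (g * h)" "degree (g * h) \<le> (m + n) * E"
    by (simp_all add: add_mult_distrib)
  then show ?thesis unfolding V_def by blast
qed

lemma V_zero_eq: "V 0 = F"
proof
  show "V 0 \<subseteq> F" unfolding V_def const_rf_def by (auto elim!: degree_eq_zeroE)
  show "F \<subseteq> V 0" unfolding V_def const_rf_def by (auto intro!: exI[of _ "[:_:]"])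
qed

lemma V_F: "x \<in> F \<Longrightarrow> x \<in> V n"
  using V_mono[of 0 n x] V_zero_eq by auto

lemma V_power: "x \<in> V n \<Longrightarrow> x ^ k \<in> V (k * n)"
proof (induction k)
  case 0
  then show ?case using V_F[of 1 0] by (simp add: image_iff) (metis const_rf_hom(2))
next
  case (Suc k)
  then show ?case using V_mult[of x n "x ^ k" "k * n"] by simp
qed

lemma V_poly: "degree g \<le> n \<Longrightarrow> to_fract g \<in> V n"
proof -
  assume "degree g \<le> n"
  then have "degree (g * DD ^ n) \<le> n + n * degree DD"
    by (intro order.trans[OF degree_mult_le] add_mono order.trans[OF degree_power_le]) (auto simp: mult.commute)
  also have "\<dots> \<le> n * E" by (simp add: E_def algebra_simps)
  finally show ?thesis unfolding V_def by (auto simp: D_def intro!: exI[of _ "g * DD ^ n"])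
qed

lemma V_z: "z_rf ^ n \<in> V n"
  using V_poly[of "monom 1 n" n] by (simp add: to_fract_monom degree_monom_le)

lemma V_invD: "inverse D ^ n \<in> V n"
  unfolding V_def by (auto intro!: exI[of _ 1] simp: field_simps)

lemma R_V: "x \<in> R \<Longrightarrow> \<exists>n. x \<in> V n"
proof -
  assume "x \<in> R"
  then obtain g n where "x * D ^ n = to_fract g" unfolding R_iff by blast
  then have "x = to_fract g * inverse D ^ n" by (simp add: field_simps)
  then show ?thesis using V_mult[OF V_poly[of g "degree g"] V_invD[of n]] by auto
qed

text \<open>The polynomial x D^n is expanded in powers of z. An element of bounded size thus amounts
  to a fixed number of elements of F, and in this form bounded elements enter the formulas.\<close>

lemma V_coords: "x \<in> V n \<longleftrightarrow> (\<exists>d. x = (\<Sum>l\<le>n * E. z_rf ^ l * inverse D ^ n * const_rf (d l)))"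
proof
  assume "x \<in> V n"
  then obtain g where g: "degree g \<le> n * E" "x * D ^ n = to_fract g" unfolding V_def by blast
  have "g = (\<Sum>l\<le>n * E. monom (coeff g l) l)" using g(1) by (rule poly_as_sum_of_monoms'[symmetric])
  then have "to_fract g = (\<Sum>l\<le>n * E. const_rf (coeff g l) * z_rf ^ l)"
    by (metis (no_types, lifting) sum.cong to_fract_monom to_fract_sum)
  moreover have "x = inverse D ^ n * to_fract g" using g(2) by (simp add: field_simps)
  ultimately have "x = (\<Sum>l\<le>n * E. z_rf ^ l * inverse D ^ n * const_rf (coeff g l))"
    by (simp add: sum_distrib_left mult_ac)
  then show "\<exists>d. x = (\<Sum>l\<le>n * E. z_rf ^ l * inverse D ^ n * const_rf (d l))"
    by (rule exI[of _ "coeff g"])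
next
  assume "\<exists>d. x = (\<Sum>l\<le>n * E. z_rf ^ l * inverse D ^ n * const_rf (d l))"
  then obtain d where d: "x = (\<Sum>l\<le>n * E. z_rf ^ l * inverse D ^ n * const_rf (d l))" by blast
  have "x * D ^ n = to_fract (\<Sum>l\<le>n * E. monom (d l) l)"
    unfolding d sum_distrib_right to_fract_sum to_fract_monom
    by (intro sum.cong refl) (simp add: field_simps)
  moreover have "degree (\<Sum>l\<le>n * E. monom (d l) l) \<le> n * E"
    by (intro degree_sum_le) (auto intro: order.trans[OF degree_monom_le])
  ultimately show "x \<in> V n" unfolding V_def by blast
qed

lemma coords_unique:
  assumes "(\<Sum>l<N. z_rf ^ l * const_rf (d l)) = 0" "l < N"
  shows "d l = (0 :: 'a)"
proof -
  have "to_fract (\<Sum>l<N. monom (d l) l) = 0"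
    using assms(1) by (simp add: to_fract_monom mult.commute)
  then have "(\<Sum>l<N. monom (d l) l) = 0" by (simp only: to_fract_eq_0_iff)
  then have "coeff (\<Sum>l<N. monom (d l) l) l = 0" by simp
  then show ?thesis using assms(2) by (simp add: coeff_sum)
qed

subsection \<open>Components with respect to \<open>q\<close>-th powers\<close>

text \<open>Collects the coefficients at exponents congruent to \<open>l\<close> modulo p^m and
  takes their p^m-th roots, which exist because F is perfect.\<close>

definition pcomp :: "nat \<Rightarrow> nat \<Rightarrow> 'a poly \<Rightarrow> 'a poly" where
  "pcomp m l g = (\<Sum>k\<le>degree g. monom (rt m (coeff g (l + p ^ m * k))) k)"

lemma frob_poly_sum: "(sum f A) ^ (p ^ m) = (\<Sum>x\<in>A. (f x :: 'a poly) ^ (p ^ m))"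
  using freshmans_dream_sum'[of "p ^ m" m f A] char_p prime_p by simp

lemma pcomp_decomposition: "g = (\<Sum>l<p ^ m. monom 1 l * pcomp m l g ^ (p ^ m))"
proof -
  let ?q = "p ^ m" and ?n = "Suc (degree g)"
  define f where "f j = monom (coeff g j) j" for j
  have "(\<Sum>l<?q. monom 1 l * pcomp m l g ^ ?q) = (\<Sum>l<?q. \<Sum>k<?n. f (l + ?q * k))"
    unfolding pcomp_def frob_poly_sum f_def
    by (simp add: monom_power sum_distrib_left mult_monom lessThan_Suc_atMost mult.commute)
  also have "\<dots> = (\<Sum>k<?n. \<Sum>l<?q. f (l + ?q * k))" by (rule sum.swap)
  also have "\<dots> = (\<Sum>k<?n. sum f {k * ?q..<k * ?q + ?q})"
  proof (rule sum.cong[OF refl])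
    fix k
    show "(\<Sum>l<?q. f (l + ?q * k)) = sum f {k * ?q..<k * ?q + ?q}"
      using sum.shift_bounds_nat_ivl[of f 0 "k * ?q" ?q]
      by (simp add: atLeast0LessThan add.commute mult.commute)
  qed
  also have "\<dots> = sum f {..<?n * ?q}" by (rule sum.nat_group)
  also have "\<dots> = sum f {..degree g}"
  proof (rule sum.mono_neutral_right)
    have "?n * 1 \<le> ?n * ?q" by (intro mult_left_mono) (simp_all add: Suc_leI)
    then show "{..degree g} \<subseteq> {..<?n * ?q}" by auto
  qed (auto simp: f_def coeff_eq_0)
  also have "\<dots> = g" unfolding f_def by (rule poly_as_sum_of_monoms)
  finally show ?thesis by simp
qed

lemma degree_pcomp: "degree g \<le> p ^ m * N \<Longrightarrow> degree (pcomp m l g) \<le> N"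
proof (rule degree_le, intro allI impI)
  fix i assume *: "degree g \<le> p ^ m * N" "N < i"
  have "p ^ m * N < p ^ m * i" using * by simp
  then have "coeff g (l + p ^ m * i) = 0" using * by (intro coeff_eq_0) linarith
  then show "coeff (pcomp m l g) i = 0" by (simp add: pcomp_def coeff_sum)
qed

lemma coeff_frob: "coeff (h ^ (p ^ m) :: 'a poly) n
    = (if p ^ m dvd n then coeff h (n div p ^ m) ^ (p ^ m) else 0)"
proof -
  have "h ^ (p ^ m) = (\<Sum>k\<le>degree h. monom (coeff h k) k) ^ (p ^ m)"
    by (simp add: poly_as_sum_of_monoms)
  also have "\<dots> = (\<Sum>k\<le>degree h. monom (coeff h k ^ (p ^ m)) (p ^ m * k))"
    by (simp add: frob_poly_sum monom_power mult.commute)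
  finally have "coeff (h ^ (p ^ m)) n
      = (\<Sum>k\<le>degree h. if p ^ m * k = n then coeff h k ^ (p ^ m) else 0)"
    by (simp add: coeff_sum)
  also have "\<dots> = (if p ^ m dvd n then coeff h (n div p ^ m) ^ (p ^ m) else 0)"
  proof (cases "p ^ m dvd n")
    case True
    then obtain k where k: "n = p ^ m * k" by auto
    show ?thesis unfolding k
      by (simp add: coeff_eq_0 power_0_left cong: if_cong)
  qed (auto intro!: sum.neutral)
  finally show ?thesis .
qed

text \<open>The exponents in z^l h_l^q are congruent to l modulo q, so the summands for different l
  have disjoint supports and cannot cancel.\<close>

lemma pcomp_unique:
  assumes "(\<Sum>l<p ^ m. monom 1 l * h l ^ (p ^ m)) = (0 :: 'a poly)" "l < p ^ m"
  shows "h l = 0"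
proof (rule poly_eqI)
  fix k
  let ?n = "l + p ^ m * k"
  have "coeff (monom 1 i * h i ^ (p ^ m)) ?n
      = (if i = l then coeff (h l) k ^ (p ^ m) else 0)" if "i < p ^ m" for i
  proof -
    have dvd: "p ^ m dvd ?n - i \<longleftrightarrow> i = l" if "i \<le> ?n"
    proof
      assume "p ^ m dvd ?n - i"
      then have "?n mod p ^ m = i mod p ^ m" using that
        by (metis mod_eq_dvd_iff_nat)
      then show "i = l" using \<open>i < p ^ m\<close> assms(2) by simp
    qed auto
    show ?thesis
      by (cases "i \<le> ?n") (auto simp: coeff_monom_mult coeff_frob dvd)
  qed
  then have "coeff (\<Sum>l<p ^ m. monom 1 l * h l ^ (p ^ m)) ?n
     = coeff (h l) k ^ (p ^ m)"
    using assms(2) by (simp add: coeff_sum)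
  then show "coeff (h l) k = coeff 0 k" using assms(1) by simp
qed

text \<open>The index drops by the factor q because the denominator D^(q t) is the q-th power of D^t
  and taking q-th roots divides degrees by q.\<close>

lemma components:
  assumes "x \<in> V s" "s \<le> p ^ m * t"
  obtains c where "\<And>l. c l \<in> V t" "x = (\<Sum>l<p ^ m. z_rf ^ l * c l ^ (p ^ m))"
proof -
  have "x \<in> V (p ^ m * t)" using V_mono assms by blast
  then obtain g where g: "degree g \<le> p ^ m * (t * E)" "x * D ^ (p ^ m * t) = to_fract g"
    unfolding V_def by (auto simp: mult.assoc)
  define c where "c l = to_fract (pcomp m l g) * inverse D ^ t" for l
  have "c l \<in> V t" for l
    using degree_pcomp[OF g(1), of l] unfolding c_def V_def by (auto simp: field_simps)
  moreover have "x = (\<Sum>l<p ^ m. z_rf ^ l * c l ^ (p ^ m))"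
  proof -
    have "x = to_fract g * inverse D ^ (p ^ m * t)" using g(2) by (simp add: field_simps)
    also have "to_fract g = (\<Sum>l<p ^ m. z_rf ^ l * to_fract (pcomp m l g) ^ (p ^ m))"
      by (subst pcomp_decomposition[of g m]) (simp add: to_fract_monom)
    also have "\<dots> * inverse D ^ (p ^ m * t) = (\<Sum>l<p ^ m. z_rf ^ l * c l ^ (p ^ m))"
      unfolding sum_distrib_right
      by (intro sum.cong refl) (simp add: c_def power_mult_distrib mult_ac flip: power_mult)
    finally show ?thesis .
  qed
  ultimately show ?thesis using that by blast
qed

text \<open>Multiplying by the q-th power of a common denominator D^N multiplies each component by
  D^N, so the claim reduces to polynomials.\<close>

lemma components_unique:
  assumes "(\<Sum>l<p ^ m. z_rf ^ l * c l ^ (p ^ m)) = 0" "\<And>l. l < p ^ m \<Longrightarrow> c l \<in> R" "l < p ^ m"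
  shows "c l = 0"
proof -
  have "\<forall>l. \<exists>n. l < p ^ m \<longrightarrow> c l \<in> V n" using R_V assms(2) by blast
  from choice[OF this] obtain n where n: "\<And>l. l < p ^ m \<Longrightarrow> c l \<in> V (n l)" by blast
  define N where "N = Max (n ` {..<p ^ m})"
  have "c l \<in> V N" if "l < p ^ m" for l
    using V_mono[OF _ n[OF that]] that unfolding N_def by auto
  then have "\<forall>l. \<exists>g. l < p ^ m \<longrightarrow> c l * D ^ N = to_fract g" unfolding V_def by blast
  from choice[OF this] obtain h where h: "\<And>l. l < p ^ m \<Longrightarrow> c l * D ^ N = to_fract (h l)" by blast
  have "to_fract (\<Sum>l<p ^ m. monom 1 l * h l ^ (p ^ m)) = (\<Sum>l<p ^ m. z_rf ^ l * (c l * D ^ N) ^ (p ^ m))"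
    by (simp add: to_fract_monom h)
  also have "\<dots> = (\<Sum>l<p ^ m. z_rf ^ l * c l ^ (p ^ m)) * D ^ (N * p ^ m)"
    unfolding sum_distrib_right
    by (intro sum.cong refl) (simp add: power_mult_distrib mult_ac flip: power_mult)
  finally have "(\<Sum>l<p ^ m. monom 1 l * h l ^ (p ^ m)) = 0"
    unfolding assms(1) by (simp only: mult_zero_left to_fract_eq_0_iff)
  then have "h l = 0" using pcomp_unique assms(3) by blast
  then show ?thesis using h[OF assms(3)] by simp
qed

lemma components_unique2:
  assumes "(\<Sum>l<p ^ m. z_rf ^ l * c l ^ (p ^ m)) = (\<Sum>l<p ^ m. z_rf ^ l * d l ^ (p ^ m))"
    "\<And>l. l < p ^ m \<Longrightarrow> c l \<in> R" "\<And>l. l < p ^ m \<Longrightarrow> d l \<in> R" "l < p ^ m"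
  shows "c l = d l"
  using components_unique[where c = "\<lambda>l. c l - d l" and m = m and l = l] assms
  by (simp add: frob_diff right_diff_distrib sum_subtractf)

text \<open>The polynomial x D^n has degree below q, hence its decomposition over q-th powers has
  constant components, and uniqueness identifies them with the given ones. A component outside F
  therefore certifies that an element is not in \<open>V n\<close>.\<close>

lemma bounded_components:
  assumes "x \<in> V n" "x = inverse D ^ n * (\<Sum>l<p ^ m. z_rf ^ l * y l ^ (p ^ m))" "n * E < p ^ m"
    "\<And>l. l < p ^ m \<Longrightarrow> y l \<in> R" "l < p ^ m"
  shows "y l \<in> F"
proof -
  obtain g where g: "degree g \<le> n * E" "x * D ^ n = to_fract g"
    using assms(1) unfolding V_def by blast
  have "(\<Sum>l<p ^ m. z_rf ^ l * y l ^ (p ^ m)) = to_fract g"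
    using g(2) unfolding assms(2) by (simp add: field_simps)
  also have "g = (\<Sum>l<p ^ m. monom (coeff g l) l)"
  proof -
    have "g = (\<Sum>l\<le>p ^ m - 1. monom (coeff g l) l)"
      by (rule poly_as_sum_of_monoms'[symmetric]) (use g(1) assms(3) in linarith)
    also have "{..p ^ m - 1} = {..<p ^ m}" using p_power_gt_0[of m] by (auto intro: Suc_leI simp: less_Suc_eq_le[symmetric])
    finally show ?thesis .
  qed
  also have "to_fract \<dots> = (\<Sum>l<p ^ m. z_rf ^ l * const_rf (rt m (coeff g l)) ^ (p ^ m))"
    by (simp add: to_fract_monom mult.commute flip: const_rf_power)
  finally have "y l = const_rf (rt m (coeff g l))"
    by (rule components_unique2) (use assms in auto)
  then show ?thesis by blast
qed

subsection \<open>Division\<close>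

lemma common_divisor_or_bezout:
  fixes b d :: "'a poly"
  assumes "b \<noteq> 0"
  obtains (divisor) e where "degree e > 0" "e dvd b" "e dvd d"
    | (bezout) u v where "u * b + v * d = 1"
proof -
  define I where "I = {w. w \<noteq> 0 \<and> (\<exists>u v. w = u * b + v * d)}"
  have "b = 1 * b + 0 * d" by simp
  then have "b \<in> I" unfolding I_def using assms by blast
  then obtain w where w: "w \<in> I" "\<And>y. y \<in> I \<Longrightarrow> degree w \<le> degree y"
    using ex_has_least_nat[of "\<lambda>w. w \<in> I" b degree] by blast
  then obtain u v where uv: "w = u * b + v * d" "w \<noteq> 0" unfolding I_def by blast
  have dvd: "w dvd x" if "x = u' * b + v' * d" for x u' v'
  proof (rule ccontr)
    assume "\<not> w dvd x"
    then have "x mod w \<noteq> 0" by (simp add: dvd_eq_mod_eq_0)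
    moreover have "x mod w = (u' - x div w * u) * b + (v' - x div w * v) * d"
      unfolding minus_div_mult_eq_mod[symmetric] uv(1)[symmetric]
      by (simp add: that uv(1) algebra_simps)
    ultimately have "x mod w \<in> I" unfolding I_def by blast
    then have "degree w \<le> degree (x mod w)" by (rule w(2))
    then show False using degree_mod_less[OF uv(2), of x] \<open>x mod w \<noteq> 0\<close> by simp
  qed
  have wd: "w dvd b" "w dvd d" using dvd[of b 1 0] dvd[of d 0 1] by simp_all
  show ?thesis
  proof (cases "degree w = 0")
    case True
    then obtain c where "w = [:c:]" by (rule degree_eq_zeroE)
    then have "[:inverse c:] * w = 1" using uv(2) by (simp add: one_pCons)
    then have "([:inverse c:] * u) * b + ([:inverse c:] * v) * d = 1"
      unfolding uv(1) by (simp only: distrib_left mult.assoc)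
    then show ?thesis by (rule bezout)
  qed (use wd divisor in auto)
qed

text \<open>As in Fitting's lemma for multiplication by \<open>DD\<close> on F[z]/(b),
  \<open>b\<close> splits into a divisor of a power of \<open>DD\<close> and a part modulo which
  \<open>DD\<close> has the inverse \<open>h\<close>. Common factors with \<open>DD\<close> are
  removed one at a time; each costs one power of \<open>DD\<close> and lowers the degree, whence the
  bound on \<open>N\<close>. The coprime rest is handled by Bezout.\<close>

lemma fitting:
  fixes b :: "'a poly"
  shows "b \<noteq> 0 \<Longrightarrow> \<exists>h N. N \<le> degree b \<and> b dvd DD ^ N * (1 - DD * h)"
proof (induction "degree b" arbitrary: b rule: less_induct)
  case less
  show ?case
  proof (rule common_divisor_or_bezout[OF less.prems, of DD])
    fix e assume e: "degree e > 0" "e dvd b" "e dvd DD"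
    then obtain b' d' where b': "b = e * b'" "DD = e * d'" by (auto elim!: dvdE)
    have deg: "degree b = degree e + degree b'"
      using less.prems b' by (metis degree_mult_eq mult_eq_0_iff)
    moreover have "b' \<noteq> 0" using less.prems b' by auto
    ultimately obtain h N where hN: "N \<le> degree b'" "b' dvd DD ^ N * (1 - DD * h)"
      using less.hyps[of b'] e(1) by auto
    have "b dvd DD * (DD ^ N * (1 - DD * h))"
      unfolding b'(1) using hN(2) e(3) by (rule mult_dvd_mono[rotated])
    then have "b dvd DD ^ Suc N * (1 - DD * h)" by (simp add: mult.assoc)
    then show ?thesis using hN(1) deg e(1) by (intro exI[of _ h] exI[of _ "Suc N"]) auto
  next
    fix u v assume "u * b + v * DD = 1"
    then have "1 - DD * v = b * u" by (simp add: algebra_simps)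
    then have "b dvd DD ^ 0 * (1 - DD * v)" by simp
    then show ?thesis by blast
  qed
qed

text \<open>Modulo b R the inverse of D is a polynomial: dividing the identity of
  \<open>fitting\<close> by D^(N+1) exhibits D^-1 - h as a multiple of \<open>b\<close> in
  R.\<close>

lemma invD_power_mod:
  assumes "b \<noteq> 0"
  obtains h t where "t \<in> R" "inverse D ^ n = to_fract h + to_fract b * t"
proof -
  obtain h N where "b dvd DD ^ N * (1 - DD * h)" using fitting assms by blast
  then obtain c where c: "DD ^ N * (1 - DD * h) = b * c" by (auto elim: dvdE)
  have "to_fract (DD ^ N * (1 - DD * h)) = to_fract (b * c)" using c by simp
  then have "D ^ N * (1 - D * to_fract h) = to_fract b * to_fract c"
    by (simp only: to_fract_mult to_fract_power to_fract_diff to_fract_1 flip: D_def)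
  then have e1: "inverse D ^ Suc N * (D ^ N * (1 - D * to_fract h)) = to_fract b * (inverse D ^ Suc N * to_fract c)"
    by (simp only: mult.left_commute)
  have e2: "inverse D ^ Suc N * (D ^ N * (1 - D * to_fract h)) = inverse D - to_fract h"
    by (simp add: field_simps)
  have inv: "inverse D = to_fract h + to_fract b * (inverse D ^ Suc N * to_fract c)"
    using trans[OF e2[symmetric] e1] by (simp only: diff_eq_eq add.commute)
  define t where "t = inverse D ^ Suc N * to_fract c"
  have tR: "t \<in> R" unfolding t_def by (intro R_mult R_power R_invD R_poly)
  have "\<exists>t'\<in>R. inverse D ^ n = to_fract (h ^ n) + to_fract b * t'"
  proof (induction n)
    case (Suc n)
    then obtain t' where t': "t' \<in> R" "inverse D ^ n = to_fract (h ^ n) + to_fract b * t'" by blast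
    have "inverse D ^ Suc n = (to_fract h + to_fract b * t) * inverse D ^ n"
      using inv unfolding t_def by simp
    also have "\<dots> = to_fract h * (to_fract (h ^ n) + to_fract b * t') + to_fract b * (t * inverse D ^ n)"
      unfolding t'(2)[symmetric] by (simp add: algebra_simps)
    also have "\<dots> = to_fract (h ^ Suc n) + to_fract b * (to_fract h * t' + t * inverse D ^ n)"
      by (simp add: algebra_simps)
    finally show ?case using t'(1) tR by (intro bexI[of _ "to_fract h * t' + t * inverse D ^ n"]) auto
  qed (auto intro!: bexI[of _ 0])
  then show ?thesis using that by blast
qed

text \<open>The denominator is replaced by a polynomial modulo \<open>b\<close>, after which
  division of polynomials applies. The remainder is a polynomial of bounded degree, whatever
  denominator \<open>x\<close> has.\<close>

lemma R_division:
  assumes "b \<noteq> 0" "x \<in> R"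
  obtains t r where "t \<in> R" "x = to_fract b * t + to_fract r" "degree r \<le> degree b"
proof -
  obtain g n where g: "x * D ^ n = to_fract g" using assms(2) unfolding R_iff by blast
  obtain h t where ht: "t \<in> R" "inverse D ^ n = to_fract h + to_fract b * t"
    using invD_power_mod[OF assms(1)] by blast
  define u where "u = g * h"
  have "x = to_fract g * inverse D ^ n" using g by (simp add: field_simps)
  also have "\<dots> = to_fract u + to_fract b * (to_fract g * t)"
    unfolding ht(2) by (simp add: u_def algebra_simps)
  also have "to_fract u = to_fract (u div b * b + u mod b)" by simp
  also have "\<dots> + to_fract b * (to_fract g * t) = to_fract b * (to_fract (u div b) + to_fract g * t) + to_fract (u mod b)"
    by (simp only: to_fract_add to_fract_mult) (simp add: algebra_simps)
  finally have "x = to_fract b * (to_fract (u div b) + to_fract g * t) + to_fract (u mod b)" .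
  moreover have "degree (u mod b) \<le> degree b"
    using degree_mod_less[OF assms(1), of u] by auto
  ultimately show ?thesis using ht(1) that by (metis R_add R_mult R_poly)
qed

text \<open>The identity of \<open>fitting\<close> gives X = c k + h D X for X = x D^(n+N).
  Iterating it brings out a power of D that clears the denominator of X, so X is a polynomial, and
  its degree is read off from b X = k DD^N. Thus cancelling \<open>b\<close> costs an amount that
  depends on its degree only.\<close>

lemma V_cancel:
  assumes "b \<noteq> 0" "x \<in> R" "to_fract b * x \<in> V n"
  shows "x \<in> V (n + degree b)"
proof -
  obtain h N where N: "N \<le> degree b" "b dvd DD ^ N * (1 - DD * h)" using fitting assms by blast
  then obtain c where c: "DD ^ N * (1 - DD * h) = b * c" by (auto elim: dvdE)
  have "to_fract (DD ^ N * (1 - DD * h)) = to_fract (b * c)" using c by simp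
  then have c': "D ^ N * (1 - D * to_fract h) = to_fract b * to_fract c"
    by (simp only: to_fract_mult to_fract_power to_fract_diff to_fract_1 flip: D_def)
  obtain k where k: "degree k \<le> n * E" "to_fract b * x * D ^ n = to_fract k"
    using assms(3) unfolding V_def by blast
  obtain g m where g: "x * D ^ m = to_fract g" using assms(2) unfolding R_iff by blast
  define X where "X = x * D ^ (n + N)"
  have X: "X = to_fract (c * k) + to_fract h * D * X"
  proof -
    have "X * (1 - D * to_fract h) = x * D ^ n * (D ^ N * (1 - D * to_fract h))"
      by (simp add: X_def power_add mult_ac)
    also have "\<dots> = to_fract c * (to_fract b * x * D ^ n)" unfolding c' by (simp add: mult_ac)
    also have "\<dots> = to_fract (c * k)" unfolding k(2) by simp
    finally show ?thesis by (simp add: algebra_simps)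
  qed
  have "\<exists>G. X = to_fract G + to_fract (h ^ j) * D ^ j * X" for j
  proof (induction j)
    case (Suc j)
    then obtain G where G: "X = to_fract G + to_fract (h ^ j) * D ^ j * X" by blast
    also have "to_fract (h ^ j) * D ^ j * X = to_fract (h ^ j) * D ^ j * (to_fract (c * k) + to_fract h * D * X)"
      using X by simp
    also have "to_fract G + \<dots> = to_fract (G + h ^ j * DD ^ j * (c * k)) + to_fract (h ^ Suc j) * D ^ Suc j * X"
      by (simp add: D_def algebra_simps)
    finally show ?case by blast
  qed (auto intro!: exI[of _ 0])
  then obtain G where "X = to_fract G + to_fract (h ^ m) * D ^ m * X" by blast
  moreover have "D ^ m * X = to_fract (g * DD ^ (n + N))"
    unfolding X_def using g by (simp only: to_fract_mult to_fract_power flip: D_def) (simp add: mult_ac)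
  ultimately have "X = to_fract (G + h ^ m * (g * DD ^ (n + N)))"
    by (simp only: mult.assoc to_fract_add to_fract_mult)
  then obtain G where G: "X = to_fract G" by blast
  have "to_fract (b * G) = to_fract b * x * D ^ n * D ^ N"
    by (simp add: X_def power_add mult_ac flip: G)
  also have "\<dots> = to_fract (k * DD ^ N)" unfolding k(2) by (simp add: D_def)
  finally have bG: "b * G = k * DD ^ N" by (simp only: to_fract_eq_iff)
  have "degree G \<le> (n + N) * E"
  proof (cases "G = 0")
    case False
    then have "degree G \<le> degree (b * G)" using assms(1) by (simp add: degree_mult_eq)
    also have "\<dots> \<le> n * E + N * degree DD" unfolding bG
      by (intro order.trans[OF degree_mult_le] add_mono k(1) order.trans[OF degree_power_le]) (simp add: mult.commute)
    also have "\<dots> \<le> (n + N) * E" by (simp add: E_def algebra_simps)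
    finally show ?thesis .
  qed simp
  then have "x \<in> V (n + N)" unfolding V_def using G X_def by auto
  then show ?thesis using V_mono[of "n + N" "n + degree b"] N(1) by simp
qed

end

subsection \<open>Charts\<close>

lemma square_right_inverse:
  fixes A B :: "nat \<Rightarrow> nat \<Rightarrow> 'b::field"
  assumes "\<And>i j. i < n \<Longrightarrow> j < n \<Longrightarrow> (\<Sum>k<n. A i k * B k j) = (if i = j then 1 else 0)"
    and "i < n" "j < n"
  shows "(\<Sum>k<n. B i k * A k j) = (if i = j then 1 else 0)"
proof -
  let ?A = "mat n n (\<lambda>(i, j). A i j)" and ?B = "mat n n (\<lambda>(i, j). B i j)"
  have "?A * ?B = 1\<^sub>m n"
    by (rule eq_matI) (simp_all add: scalar_prod_def assms(1) atLeast0LessThan)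
  then have "?B * ?A = 1\<^sub>m n"
    by (intro mat_mult_left_right_inverse[of ?A n ?B]) auto
  then have "(?B * ?A) $$ (i, j) = 1\<^sub>m n $$ (i, j)" by simp
  then show ?thesis using assms(2,3) by (simp add: scalar_prod_def atLeast0LessThan)
qed

text \<open>An additive map \<Sum> f_i(x_i) in q = p^m variables with leading terms a_i x^q; the
  lower parts \<open>L i\<close> grow like powers of exponent at most q/p. \<open>B\<close> and
  \<delta> witness, with denominators cleared, that the a_i form a basis of F(z) over its field of
  q-th powers. A single constant \<kappa> bounds all sizes.\<close>

locale chart = setting p S for p :: nat and S :: "'a::field poly set" +
  fixes m \<kappa> :: nat and a :: "nat \<Rightarrow> 'a poly fract" and L :: "nat \<Rightarrow> 'a poly fract \<Rightarrow> 'a poly fract"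
    and B :: "nat \<Rightarrow> nat \<Rightarrow> 'a poly fract" and \<delta> :: "'a poly"
  assumes a: "\<And>i. i < p ^ m \<Longrightarrow> a i \<in> V \<kappa>"
    and L_add: "\<And>i x y. i < p ^ m \<Longrightarrow> L i (x + y) = L i x + L i y"
    and L_R: "\<And>i x. i < p ^ m \<Longrightarrow> x \<in> R \<Longrightarrow> L i x \<in> R"
    and L_V: "\<And>i n x. i < p ^ m \<Longrightarrow> x \<in> V n \<Longrightarrow> L i x \<in> V (\<kappa> + (p ^ m div p) * n)"
    and B: "\<And>l i. l < p ^ m \<Longrightarrow> i < p ^ m \<Longrightarrow> B l i \<in> V \<kappa>"
    and \<delta>: "\<delta> \<noteq> 0" "degree \<delta> \<le> \<kappa>"
    and span: "\<And>l. l < p ^ m \<Longrightarrow> (\<Sum>i<p ^ m. a i * B l i ^ (p ^ m)) = to_fract \<delta> ^ (p ^ m) * z_rf ^ l"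
begin

abbreviation q :: nat where "q \<equiv> p ^ m"

definition f :: "nat \<Rightarrow> 'a poly fract \<Rightarrow> 'a poly fract" where
  "f i x = a i * x ^ q + L i x"

lemma f_add: "i < q \<Longrightarrow> f i (x + y) = f i x + f i y"
  by (simp add: f_def frob_add L_add algebra_simps)

lemma a_components:
  obtains A where "\<And>l i. A l i \<in> R" "\<And>i. i < q \<Longrightarrow> a i = (\<Sum>l<q. z_rf ^ l * A l i ^ q)"
proof -
  have "\<forall>i. \<exists>c. (\<forall>l. c l \<in> R) \<and> (i < q \<longrightarrow> a i = (\<Sum>l<q. z_rf ^ l * c l ^ q))"
  proof
    fix i
    show "\<exists>c. (\<forall>l. c l \<in> R) \<and> (i < q \<longrightarrow> a i = (\<Sum>l<q. z_rf ^ l * c l ^ q))"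
    proof (cases "i < q")
      case True
      have "\<kappa> \<le> q * \<kappa>" by (simp add: Suc_leI)
      from components[OF a[OF True] this] show ?thesis using V_R by metis
    qed (auto intro!: exI[of _ "\<lambda>_. 0"])
  qed
  then obtain C where "\<forall>i. (\<forall>l. C i l \<in> R) \<and> (i < q \<longrightarrow> a i = (\<Sum>l<q. z_rf ^ l * C i l ^ q))"
    by metis
  then show ?thesis by (intro that[of "\<lambda>l i. C i l"]) auto
qed

text \<open>After taking components, \<open>span\<close> says that the matrix A of components of the
  a_i times the transpose of \<open>B\<close> is \<delta> times the identity. For square matrices
  the two factors may then be interchanged.\<close>

lemma left_inverse:
  assumes A: "\<And>l i. A l i \<in> R" "\<And>i. i < q \<Longrightarrow> a i = (\<Sum>l<q. z_rf ^ l * A l i ^ q)"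
    and ij: "i < q" "j < q"
  shows "(\<Sum>l<q. B l i * A l j) = (if i = j then to_fract \<delta> else 0)"
proof -
  have AB: "(\<Sum>i<q. A k i * B l i) = (if k = l then to_fract \<delta> else 0)" if kl: "k < q" "l < q" for k l
  proof (rule components_unique2[where m = m and l = k and
        c = "\<lambda>k. \<Sum>i<q. A k i * B l i" and d = "\<lambda>k. if k = l then to_fract \<delta> else 0"])
    have "(\<Sum>k<q. z_rf ^ k * (\<Sum>i<q. A k i * B l i) ^ q) = (\<Sum>k<q. \<Sum>i<q. z_rf ^ k * A k i ^ q * B l i ^ q)"
      by (simp add: frob_sum sum_distrib_left power_mult_distrib mult.assoc)
    also have "\<dots> = (\<Sum>i<q. \<Sum>k<q. z_rf ^ k * A k i ^ q * B l i ^ q)" by (rule sum.swap)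
    also have "\<dots> = (\<Sum>i<q. a i * B l i ^ q)"
      by (intro sum.cong[OF refl]) (simp add: A(2) sum_distrib_right)
    also have "\<dots> = to_fract \<delta> ^ q * z_rf ^ l" using span kl by blast
    also have "\<dots> = (\<Sum>k<q. z_rf ^ k * (if k = l then to_fract \<delta> else 0) ^ q)"
      using kl by (simp add: power_0_left if_distrib[of "\<lambda>x. _ * x"] if_distrib[of "\<lambda>x. x ^ q"] mult.commute cong: if_cong)
    finally show "(\<Sum>k<q. z_rf ^ k * (\<Sum>i<q. A k i * B l i) ^ q)
       = (\<Sum>k<q. z_rf ^ k * (if k = l then to_fract \<delta> else 0) ^ q)" .
  qed (use A(1) V_R[OF B] kl in \<open>auto intro!: R_sum R_mult\<close>)
  have \<delta>0: "to_fract \<delta> \<noteq> 0" using \<delta>(1) by simp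
  have "(\<Sum>l<q. (B l i / to_fract \<delta>) * A l j) = (if i = j then 1 else 0)"
  proof (rule square_right_inverse[where A = A and B = "\<lambda>i l. B l i / to_fract \<delta>"])
    fix i j assume "i < q" "j < q"
    have "(\<Sum>k<q. A i k * (B j k / to_fract \<delta>)) = (\<Sum>k<q. A i k * B j k) / to_fract \<delta>"
      by (simp add: sum_divide_distrib)
    then show "(\<Sum>k<q. A i k * (B j k / to_fract \<delta>)) = (if i = j then 1 else 0)"
      using AB[OF \<open>i < q\<close> \<open>j < q\<close>] \<delta>0 by simp
  qed (use ij in auto)
  moreover have "(\<Sum>l<q. (B l i / to_fract \<delta>) * A l j) = (\<Sum>l<q. B l i * A l j) / to_fract \<delta>"
    by (simp add: sum_divide_distrib)
  ultimately show ?thesis using \<delta>0 by (auto simp: field_simps split: if_splits)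
qed

text \<open>Let \<open>n0\<close> be the least common index of the y_i. The leading sum has index at
  most s + \<kappa> + (q/p) n0, so its components have index about n0/p, and inverting with
  \<open>B\<close> and cancelling \<delta> gives such an index for the y_i as well. Minimality
  yields n0 \<le> 3 \<kappa> + s + 1 + n0/2, and solving for n0 gives the bound.\<close>

lemma chart_bound:
  assumes y: "\<And>i. i < q \<Longrightarrow> y i \<in> R" and sum: "(\<Sum>i<q. f i (y i)) \<in> V s" and "i < q"
  shows "y i \<in> V (6 * \<kappa> + 2 * s + 2)"
proof -
  have "\<exists>n. \<forall>i<q. y i \<in> V n"
  proof -
    have "\<forall>i. \<exists>n. i < q \<longrightarrow> y i \<in> V n" using R_V y by blast
    from choice[OF this] obtain n where n: "\<And>i. i < q \<Longrightarrow> y i \<in> V (n i)" by blast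
    have "y i \<in> V (Max (n ` {..<q}))" if "i < q" for i
      using V_mono[OF _ n[OF that]] that by auto
    then show ?thesis by blast
  qed
  define n0 where "n0 = (LEAST n. \<forall>i<q. y i \<in> V n)"
  have n0: "\<forall>i<q. y i \<in> V n0" unfolding n0_def by (rule LeastI_ex) fact
  \<comment> \<open>The added 1 rounds n0/p up, so that (q/p) n0 is at most q (n0 div p +
    1).\<close>
  define t where "t = s + \<kappa> + n0 div p + 1"
  have "s + \<kappa> + (q div p) * n0 \<le> q * t"
  proof -
    have "n0 \<le> p * (n0 div p + 1)"
      by (simp add: less_imp_le dividend_less_times_div)
    then have "(q div p) * n0 \<le> (q div p) * (p * (n0 div p + 1))" by (rule mult_left_mono) simp
    also have "\<dots> = (q div p * p) * (n0 div p + 1)" by (simp only: mult.assoc)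
    also have "\<dots> \<le> q * (n0 div p + 1)" by (intro mult_right_mono) auto
    finally have "(q div p) * n0 \<le> q * (n0 div p + 1)" .
    moreover have "s + \<kappa> \<le> q * (s + \<kappa>)" by (simp add: Suc_leI)
    ultimately show ?thesis unfolding t_def by (simp add: algebra_simps)
  qed
  moreover define x where "x = (\<Sum>i<q. f i (y i)) - (\<Sum>i<q. L i (y i))"
  have "x \<in> V (s + \<kappa> + (q div p) * n0)"
    unfolding x_def
  proof (rule V_diff)
    show "(\<Sum>i<q. f i (y i)) \<in> V (s + \<kappa> + (q div p) * n0)" using V_mono[OF _ sum] by simp
    have "L i (y i) \<in> V (s + \<kappa> + (q div p) * n0)" if "i < q" for i
      using V_mono[OF _ L_V[of i "y i" n0]] n0 that by simp
    then show "(\<Sum>i<q. L i (y i)) \<in> V (s + \<kappa> + (q div p) * n0)" by (intro V_sum) simp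
  qed
  ultimately obtain c where c: "\<And>l. c l \<in> V t" "x = (\<Sum>l<q. z_rf ^ l * c l ^ q)"
    using components by blast
  obtain A where A: "\<And>l i. A l i \<in> R" "\<And>i. i < q \<Longrightarrow> a i = (\<Sum>l<q. z_rf ^ l * A l i ^ q)"
    using a_components by blast
  have "x = (\<Sum>i<q. a i * y i ^ q)" unfolding x_def by (simp add: f_def sum.distrib)
  also have "\<dots> = (\<Sum>i<q. \<Sum>l<q. z_rf ^ l * A l i ^ q * y i ^ q)"
    by (intro sum.cong[OF refl]) (simp add: A(2) sum_distrib_right)
  also have "\<dots> = (\<Sum>l<q. \<Sum>i<q. z_rf ^ l * A l i ^ q * y i ^ q)" by (rule sum.swap)
  also have "\<dots> = (\<Sum>l<q. z_rf ^ l * (\<Sum>i<q. A l i * y i) ^ q)"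
    by (simp add: frob_sum sum_distrib_left power_mult_distrib mult.assoc)
  finally have "(\<Sum>l<q. z_rf ^ l * c l ^ q) = (\<Sum>l<q. z_rf ^ l * (\<Sum>i<q. A l i * y i) ^ q)"
    using c(2) by simp
  then have cl: "c l = (\<Sum>i<q. A l i * y i)" if "l < q" for l
    by (rule components_unique2) (use V_R[OF c(1)] A(1) y that in \<open>auto intro!: R_sum R_mult\<close>)
  have y': "y j \<in> V (3 * \<kappa> + s + 1 + n0 div p)" if j: "j < q" for j
  proof -
    have "(\<Sum>l<q. B l j * c l) = (\<Sum>l<q. \<Sum>i<q. B l j * A l i * y i)"
      by (simp add: cl sum_distrib_left mult.assoc)
    also have "\<dots> = (\<Sum>i<q. (\<Sum>l<q. B l j * A l i) * y i)"
      by (subst sum.swap) (simp add: sum_distrib_right)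
    also have "\<dots> = (\<Sum>i<q. if j = i then to_fract \<delta> * y i else 0)"
      by (intro sum.cong[OF refl]) (simp add: left_inverse[OF A j])
    also have "\<dots> = to_fract \<delta> * y j" using j by simp
    finally have "to_fract \<delta> * y j \<in> V (\<kappa> + t)"
      using V_sum[of "{..<q}" "\<lambda>l. B l j * c l" "\<kappa> + t"] V_mult[OF B c(1)] j by simp
    from V_mono[OF _ V_cancel[OF \<delta>(1) y[OF j] this], of "3 * \<kappa> + s + 1 + n0 div p"] show ?thesis
      using \<delta>(2) by (simp add: t_def)
  qed
  then have "n0 \<le> 3 * \<kappa> + s + 1 + n0 div p" unfolding n0_def by (intro Least_le) (auto simp: n0_def)
  moreover have "n0 div p \<le> n0 div 2" using p_gt_1 by (intro div_le_mono2) auto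
  ultimately have "n0 \<le> 6 * \<kappa> + 2 * s + 2" by linarith
  then show ?thesis using V_mono n0 \<open>i < q\<close> by blast
qed

text \<open>Twice the constant part of the index \<open>n'\<close> of the remainder in
  \<open>chart_surj_V\<close>. If n exceeds it, the constant part is below n/2, and the part that
  depends on n is at most n/2 because q/p \<le> q/2.\<close>

definition s0 :: nat where "s0 = 2 * (2 * q + 4 * q * \<kappa> + \<kappa>)"

text \<open>Successive approximation. The components of \<open>w\<close> are divided by \<delta>,
  and the quotients, combined through \<open>B\<close>, give y_i whose leading terms reproduce
  \<open>w\<close> up to remainders of bounded degree. What is left consists of these remainders and
  of the L_i(y_i), whose index is about n/p; this is repeated down to \<open>s0\<close>.\<close>

lemma chart_surj_V: "w \<in> V n \<Longrightarrow> \<exists>y v. (\<forall>i<q. y i \<in> R) \<and> v \<in> V s0 \<and> w = (\<Sum>i<q. f i (y i)) + v"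
proof (induction n arbitrary: w rule: less_induct)
  case (less n)
  have f0: "f i 0 = 0" if "i < q" for i
    using f_add[OF that, of 0 0] by (metis add_0 add_cancel_right_right)
  show ?case
  proof (cases "n \<le> s0")
    case True
    then show ?thesis using V_mono[OF True less.prems] f0
      by (intro exI[of _ "\<lambda>_. 0"] exI[of _ w]) simp
  next
    case False
    define t where "t = n div q + 1"
    have "n \<le> q * t" unfolding t_def by (simp add: less_imp_le dividend_less_times_div)
    then obtain c where c: "\<And>l. c l \<in> V t" "w = (\<Sum>l<q. z_rf ^ l * c l ^ q)"
      using components less.prems by blast
    have "\<forall>l. \<exists>u r. u \<in> R \<and> c l = to_fract \<delta> * u + to_fract r \<and> degree r \<le> degree \<delta>"
      using R_division[OF \<delta>(1)] V_R[OF c(1)] by metis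
    then obtain u r where ur: "\<And>l. u l \<in> R" "\<And>l. c l = to_fract \<delta> * u l + to_fract (r l)"
      "\<And>l. degree (r l) \<le> degree \<delta>" by metis
    have r: "to_fract (r l) \<in> V \<kappa>" for l using V_poly[of "r l" \<kappa>] ur(3)[of l] \<delta>(2) by simp
    have u: "u l \<in> V (t + 2 * \<kappa>)" for l
    proof -
      have "to_fract \<delta> * u l = c l - to_fract (r l)" using ur(2) by simp
      also have "\<dots> \<in> V (t + \<kappa>)" using V_mono[OF _ c(1)[of l]] V_mono[OF _ r[of l]] by (intro V_diff) auto
      finally show ?thesis using V_mono[OF _ V_cancel[OF \<delta>(1) ur(1)], of "t + \<kappa>" "t + 2 * \<kappa>"] \<delta>(2) by simp
    qed
    define y where "y i = (\<Sum>l<q. B l i * u l)" for i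
    have y: "y i \<in> V (t + 3 * \<kappa>)" if "i < q" for i
      unfolding y_def using V_mult[OF B u] that by (intro V_sum) (auto simp: algebra_simps)
    have "(\<Sum>i<q. a i * y i ^ q) = (\<Sum>i<q. \<Sum>l<q. a i * B l i ^ q * u l ^ q)"
      by (simp add: y_def frob_sum sum_distrib_left power_mult_distrib mult.assoc)
    also have "\<dots> = (\<Sum>l<q. (\<Sum>i<q. a i * B l i ^ q) * u l ^ q)"
      by (subst sum.swap) (simp add: sum_distrib_right)
    also have "\<dots> = (\<Sum>l<q. z_rf ^ l * (to_fract \<delta> * u l) ^ q)"
      by (intro sum.cong[OF refl]) (simp add: span power_mult_distrib mult_ac)
    finally have lead: "(\<Sum>i<q. a i * y i ^ q) = (\<Sum>l<q. z_rf ^ l * (to_fract \<delta> * u l) ^ q)" .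
    define w' where "w' = w - (\<Sum>i<q. f i (y i))"
    have "w' = (\<Sum>l<q. z_rf ^ l * (c l ^ q - (to_fract \<delta> * u l) ^ q)) - (\<Sum>i<q. L i (y i))"
      unfolding w'_def f_def sum.distrib lead c(2) by (simp add: right_diff_distrib sum_subtractf)
    also have "\<dots> = (\<Sum>l<q. z_rf ^ l * to_fract (r l) ^ q) - (\<Sum>i<q. L i (y i))"
      by (simp add: frob_diff[symmetric] ur(2))
    finally have w': "w' = (\<Sum>l<q. z_rf ^ l * to_fract (r l) ^ q) - (\<Sum>i<q. L i (y i))" .
    have "n div q * (q div p) * 2 \<le> n div q * q"
    proof -
      have "q div p * 2 \<le> q div p * p" using p_gt_1 by (intro mult_left_mono) auto
      also have "\<dots> \<le> q" by simp
      finally have "n div q * (q div p * 2) \<le> n div q * q" by (rule mult_left_mono) simp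
      then show ?thesis by (simp add: mult.assoc)
    qed
    also have "\<dots> \<le> n" by simp
    finally have half: "2 * (q div p * (n div q)) \<le> n" by (simp add: mult_ac)
    have qp: "q div p * (1 + 3 * \<kappa>) \<le> q * (1 + 3 * \<kappa>)" by (intro mult_right_mono) auto
    define n' where "n' = (q + q * \<kappa>) + (\<kappa> + (q div p) * (t + 3 * \<kappa>))"
    have "n' = q + q * \<kappa> + \<kappa> + q div p * (1 + 3 * \<kappa>) + q div p * (n div q)"
      unfolding n'_def t_def by (simp add: algebra_simps)
    then have "n' < n" using half qp False unfolding s0_def by (simp add: algebra_simps)
    have "w' \<in> V n'" unfolding w'
    proof (intro V_diff V_sum)
      fix l assume "l \<in> {..<q}"
      then show "z_rf ^ l * to_fract (r l) ^ q \<in> V n'"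
        using V_mono[OF _ V_mult[OF V_z[of l] V_power[OF r[of l], of q]]] by (simp add: n'_def)
    next
      fix i assume "i \<in> {..<q}"
      then show "L i (y i) \<in> V n'"
        using V_mono[OF _ L_V[OF _ y]] by (simp add: n'_def)
    qed
    then obtain y' v where y': "\<forall>i<q. y' i \<in> R" "v \<in> V s0" "w' = (\<Sum>i<q. f i (y' i)) + v"
      using less.IH[OF \<open>n' < n\<close>] by blast
    have "w = (\<Sum>i<q. f i (y i)) + (\<Sum>i<q. f i (y' i)) + v"
      using y'(3) unfolding w'_def by (simp add: algebra_simps)
    also have "\<dots> = (\<Sum>i<q. f i (y i + y' i)) + v" by (simp add: f_add sum.distrib)
    finally show ?thesis using y' V_R[OF y] by (intro exI[of _ "\<lambda>i. y i + y' i"] exI[of _ v]) auto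
  qed
qed

lemma chart_surj:
  assumes "w \<in> R"
  obtains y v where "\<And>i. i < q \<Longrightarrow> y i \<in> R" "v \<in> V s0" "w = (\<Sum>i<q. f i (y i)) + v"
  using R_V[OF assms] chart_surj_V by blast

end

section \<open>Linear forms\<close>

text \<open>The monomial \<open>(v, i, n, d)\<close> stands for \<open>z\<^sup>n D\<^sup>-\<^sup>d x\<^sub>v\<^sup>q\<close> with \<open>q = p\<^sup>i\<close>. The kind of a variable
  \<open>v\<close> is \<open>v mod 5\<close>: 0 free variable of the formula, 1 and 2 existentially quantified over \<open>R\<close> and \<open>F\<close>,
  3 and 4 existentially quantified over \<open>R\<close> and \<open>F\<close> in the scope of the negation that is being eliminated.\<close>

type_synonym mon = "nat \<times> nat \<times> nat \<times> nat"
type_synonym form = "mon list"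

abbreviation mv :: "mon \<Rightarrow> nat" where "mv m \<equiv> fst m"
abbreviation mi :: "mon \<Rightarrow> nat" where "mi m \<equiv> fst (snd m)"
abbreviation mn :: "mon \<Rightarrow> nat" where "mn m \<equiv> fst (snd (snd m))"
abbreviation md :: "mon \<Rightarrow> nat" where "md m \<equiv> snd (snd (snd m))"

definition xpart :: "form \<Rightarrow> form" where "xpart f = filter (\<lambda>m. mv m mod 5 = 3) f"
definition fpart :: "form \<Rightarrow> form" where "fpart f = filter (\<lambda>m. mv m mod 5 = 2 \<or> mv m mod 5 = 4) f"
definition upart :: "form \<Rightarrow> form" where "upart f = filter (\<lambda>m. mv m mod 5 = 0 \<or> mv m mod 5 = 1) f"

definition fbound :: "form \<Rightarrow> nat" where "fbound f = sum_list (map (\<lambda>m. Suc (mv m)) f)"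

lemma sum_list_ge: "y \<in> set xs \<Longrightarrow> (y::nat) \<le> sum_list xs"
  by (induction xs) auto

lemma fbound: "m \<in> set f \<Longrightarrow> mv m < fbound f"
  unfolding fbound_def using sum_list_ge[of "Suc (mv m)" "map (\<lambda>m. Suc (mv m)) f"] by auto

context setting
begin

section \<open>Evaluation of forms and substitution\<close>

definition Dl :: "nat list" where "Dl = (SOME ns. pl ns = D)"

lemma prime_field_pl:
  assumes "g \<in> prime_field_polys"
  shows "\<exists>ns. pl ns = to_fract (g :: 'a poly)"
proof -
  have "\<exists>k. coeff g i = of_nat k" for i
    using assms Ints_eq_of_nat[of "coeff g i"] unfolding prime_field_polys_def by auto
  then obtain k where k: "\<And>i. coeff g i = of_nat (k i)" by metis
  have rep: "pl (replicate j n) = of_nat j * z_rf ^ n" for j n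
    by (induction j) (simp_all add: algebra_simps)
  have cst: "const_rf (of_nat j :: 'a) = of_nat j" for j
    by (induction j) simp_all
  have "pl (concat (map (\<lambda>i. replicate (k i) i) [0..<n])) = (\<Sum>i<n. const_rf (coeff g i) * z_rf ^ i)" for n
    by (induction n) (simp_all add: rep k cst)
  from this[of "Suc (degree g)"] have
    "pl (concat (map (\<lambda>i. replicate (k i) i) [0..<Suc (degree g)])) = to_fract (\<Sum>i\<le>degree g. monom (coeff g i) i)"
    by (simp add: lessThan_Suc_atMost to_fract_monom del: upt_Suc)
  then show ?thesis unfolding poly_as_sum_of_monoms by blast
qed

lemma DD_prime_field: "DD \<in> prime_field_polys"
proof -
  have "prod f A \<in> prime_field_polys" if "\<And>x. x \<in> A \<Longrightarrow> (f x :: 'a poly) \<in> prime_field_polys" for f :: "'a poly \<Rightarrow> 'a poly" and A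
    using that
  proof (induction A rule: infinite_finite_induct)
    case (insert x A)
    then have "f x \<in> prime_field_polys" "prod f A \<in> prime_field_polys" by auto
    then have "f x * prod f A \<in> prime_field_polys"
      unfolding prime_field_polys_def by (auto simp: coeff_mult intro!: Ints_sum Ints_mult)
    then show ?case using insert by simp
  qed (auto simp: prime_field_polys_def coeff_1 coeff_pCons split: nat.split)
  then show ?thesis unfolding DD_def using S_prime_field by simp
qed

lemma pl_Dl: "pl Dl = D"
  unfolding Dl_def D_def using prime_field_pl[OF DD_prime_field] by (rule someI_ex)

lemma pl_R [simp]: "pl ns \<in> R"
  by (induction ns) auto

definition emon :: "(nat \<Rightarrow> 'a poly fract) \<Rightarrow> mon \<Rightarrow> 'a poly fract" where
  "emon e m = z_rf ^ mn m * inverse D ^ md m * e (mv m) ^ (p ^ mi m)"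

definition ev :: "(nat \<Rightarrow> 'a poly fract) \<Rightarrow> form \<Rightarrow> 'a poly fract" where
  "ev e f = (\<Sum>m\<leftarrow>f. emon e m)"

lemma ev_simps [simp]:
  "ev e [] = 0" "ev e (m # f) = emon e m + ev e f" "ev e (f @ g) = ev e f + ev e g"
  by (simp_all add: ev_def)

lemma ev_concat: "ev e (concat fs) = (\<Sum>f\<leftarrow>fs. ev e f)"
  by (induction fs) auto

lemma ev_map: "ev e (map h xs) = (\<Sum>x\<leftarrow>xs. emon e (h x))"
  by (simp add: ev_def comp_def)

lemma ev_map_upt: "ev e (map h [0..<n]) = (\<Sum>l<n. emon e (h l))"
  by (simp add: ev_map interv_sum_list_conv_sum_set_nat atLeast0LessThan)

lemma ev_R: "(\<And>v. e v \<in> R) \<Longrightarrow> ev e f \<in> R"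
  by (induction f) (auto simp: emon_def)

lemma ev_cong: "(\<And>m. m \<in> set f \<Longrightarrow> e (mv m) = e' (mv m)) \<Longrightarrow> ev e f = ev e' f"
  by (induction f) (auto simp: emon_def)

lemma ev_parts: "ev e f = ev e (xpart f) + ev e (fpart f) + ev e (upart f)"
proof (induction f)
  case (Cons m f)
  have "mv m mod 5 < 5" by simp
  then have "mv m mod 5 = 0 \<or> mv m mod 5 = 1 \<or> mv m mod 5 = 2 \<or> mv m mod 5 = 3 \<or> mv m mod 5 = 4" by linarith
  then show ?case using Cons by (auto simp: xpart_def fpart_def upart_def)
qed (simp add: xpart_def fpart_def upart_def)

text \<open>Substitution inside x_v^q is linear because Frobenius is additive: each monomial
  substituted for x_v is raised to the q-th power, which multiplies its exponents of z and D^-1 by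
  q.\<close>

definition subst :: "(nat \<Rightarrow> form) \<Rightarrow> form \<Rightarrow> form" where
  "subst \<theta> f = concat (map (\<lambda>m. map (\<lambda>u. (mv u, mi u + mi m, mn m + p ^ mi m * mn u, md m + p ^ mi m * md u))
     (\<theta> (mv m))) f)"

lemma ev_subst: "ev e (subst \<theta> f) = ev (\<lambda>v. ev e (\<theta> v)) f"
proof (induction f)
  case (Cons m f)
  have "ev e (map (\<lambda>u. (mv u, mi u + mi m, mn m + p ^ mi m * mn u, md m + p ^ mi m * md u)) g)
      = z_rf ^ mn m * inverse D ^ md m * (ev e g) ^ (p ^ mi m)" for g
  proof (induction g)
    case (Cons u g)
    have "emon e (mv u, mi u + mi m, mn m + p ^ mi m * mn u, md m + p ^ mi m * md u)
        = z_rf ^ mn m * inverse D ^ md m * (emon e u) ^ (p ^ mi m)"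
      by (simp add: emon_def power_add power_mult_distrib power_mult mult_ac)
         (simp add: mult_ac flip: power_mult)
    then show ?case using Cons by (simp add: frob_add algebra_simps)
  qed simp
  then show ?case using Cons by (simp add: subst_def emon_def)
qed (simp add: subst_def)

lemma subst_id: "(\<And>m. m \<in> set f \<Longrightarrow> \<theta> (mv m) = [(mv m, 0, 0, 0)]) \<Longrightarrow> subst \<theta> f = f"
  by (induction f) (auto simp: subst_def)

text \<open>Lists have no coefficients, so -1 = p - 1 is realised by repetition.\<close>

definition negf :: "'x list \<Rightarrow> 'x list" where
  "negf f = concat (replicate (p - 1) f)"

lemma p_minus_1: "of_nat (p - 1) = (- 1 :: 'a poly fract)"
proof -
  have "of_nat (p - 1) + 1 = (of_nat p :: 'a poly fract)"
    using p_gt_0 by (metis Suc_diff_1 add.commute of_nat_Suc)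
  then show ?thesis by (simp add: eq_neg_iff_add_eq_0)
qed

lemma ev_negf [simp]: "ev e (negf f) = - ev e f"
proof -
  have "ev e (concat (replicate k f)) = of_nat k * ev e f" for k
    by (induction k) (simp_all add: algebra_simps)
  from this[of "p - 1"] show ?thesis unfolding negf_def p_minus_1 by simp
qed

lemma pl_negf [simp]: "pl (negf ns) = (- pl ns :: 'a poly fract)"
proof -
  have "pl (concat (replicate k ns)) = of_nat k * (pl ns :: 'a poly fract)" for k
    by (induction k) (simp_all add: algebra_simps)
  from this[of "p - 1"] show ?thesis unfolding negf_def p_minus_1 by simp
qed

lemma set_negf: "set (negf f) \<subseteq> set f"
  unfolding negf_def by auto

subsection \<open>Normal forms\<close>

definition Dpow :: "nat \<Rightarrow> nat list" where
  "Dpow j = rec_nat [0] (\<lambda>_ r. concat (map (\<lambda>n. map (\<lambda>k. n + k) Dl) r)) j"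

lemma pl_concat_add: "pl (concat (map (\<lambda>n. map (\<lambda>k. n + k) ms) ns)) = pl ns * (pl ms :: 'a poly fract)"
proof (induction ns)
  case (Cons n ns)
  have "pl (map (\<lambda>k. n + k) ms) = z_rf ^ n * (pl ms :: 'a poly fract)"
    by (induction ms) (simp_all add: power_add distrib_left)
  then show ?case using Cons by (simp add: distrib_right)
qed simp

lemma pl_Dpow: "pl (Dpow j) = D ^ j"
  by (induction j) (simp_all add: Dpow_def pl_concat_add pl_Dl mult.commute)

definition clr :: "nat \<Rightarrow> form \<Rightarrow> form" where
  "clr N f = concat (map (\<lambda>m. map (\<lambda>k. (mv m, mi m, mn m + k, 0)) (Dpow (N - md m))) f)"

lemma ev_clr: "(\<And>m. m \<in> set f \<Longrightarrow> md m \<le> N) \<Longrightarrow> ev e (clr N f) = D ^ N * ev e f"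
proof (induction f)
  case (Cons m f)
  have "ev e (map (\<lambda>k. (mv m, mi m, mn m + k, 0)) ns) = pl ns * z_rf ^ mn m * e (mv m) ^ (p ^ mi m)" for ns
    by (induction ns) (simp_all add: emon_def power_add algebra_simps)
  moreover have "D ^ (N - md m) = D ^ N * inverse D ^ md m"
    using Cons.prems[of m] by (simp add: power_diff field_simps)
  ultimately show ?case using Cons by (simp add: clr_def pl_Dpow emon_def algebra_simps)
qed (simp add: clr_def)

definition maxd :: "form \<Rightarrow> nat" where "maxd f = sum_list (map md f)"

lemma maxd: "m \<in> set f \<Longrightarrow> md m \<le> maxd f"
  unfolding maxd_def by (rule sum_list_ge) auto

text \<open>Multiplicities are elements of F_p and are reduced modulo p; a monomial that occurs a
  multiple of p times disappears.\<close>

definition nrm :: "form \<Rightarrow> form" where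
  "nrm f = concat (map (\<lambda>m. replicate (count_list f m mod p) m) (remdups f))"

lemma of_nat_mod_p: "(of_nat (n mod p) :: 'a poly fract) = of_nat n"
proof -
  have "(of_nat n :: 'a poly fract) = of_nat (p * (n div p) + n mod p)" by simp
  also have "\<dots> = of_nat (n mod p)" unfolding of_nat_add of_nat_mult by simp
  finally show ?thesis by simp
qed

lemma sum_list_count: "(\<Sum>x\<leftarrow>xs. h x) = (\<Sum>x\<in>set xs. of_nat (count_list xs x) * (h x :: 'a poly fract))"
proof (induction xs)
  case (Cons y xs)
  have "(\<Sum>x\<in>set (y # xs). of_nat (count_list (y # xs) x) * h x)
      = (\<Sum>x\<in>insert y (set xs). of_nat (count_list xs x) * h x + (if x = y then h x else 0))"
    by (intro sum.cong) (auto simp: algebra_simps)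
  also have "\<dots> = (\<Sum>x\<in>insert y (set xs). of_nat (count_list xs x) * h x) + h y"
    by (simp add: sum.distrib)
  also have "(\<Sum>x\<in>insert y (set xs). of_nat (count_list xs x) * h x) = (\<Sum>x\<in>set xs. of_nat (count_list xs x) * h x)"
    by (cases "y \<in> set xs") (auto simp: insert_absorb)
  finally show ?case using Cons by simp
qed simp

lemma ev_nrm: "ev e (nrm f) = ev e f"
proof -
  have rep: "ev e (replicate k m) = of_nat k * emon e m" for k m
    by (induction k) (simp_all add: algebra_simps)
  have "ev e (nrm f) = (\<Sum>m\<leftarrow>remdups f. of_nat (count_list f m) * emon e m)"
    unfolding nrm_def ev_concat by (simp add: comp_def rep of_nat_mod_p)
  also have "\<dots> = (\<Sum>m\<in>set f. of_nat (count_list f m) * emon e m)"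
    by (simp add: sum_list_distinct_conv_sum_set)
  finally show ?thesis by (simp add: ev_def sum_list_count)
qed

text \<open>Normal form of an equation, without denominators and with reduced multiplicities. The
  value changes by a power of D, which does not affect its vanishing.\<close>

definition rown :: "form \<Rightarrow> form" where "rown f = nrm (clr (maxd f) f)"

lemma ev_rown: "ev e (rown f) = D ^ maxd f * ev e f"
  by (simp add: rown_def ev_nrm ev_clr maxd)

lemma ev_rown_0 [simp]: "ev e (rown f) = 0 \<longleftrightarrow> ev e f = 0"
  by (simp add: ev_rown)

lemma set_nrm: "set (nrm f) \<subseteq> set f"
  unfolding nrm_def by auto

lemma set_clr: "m \<in> set (clr N f) \<Longrightarrow> md m = 0 \<and> (\<exists>m'\<in>set f. mv m = mv m')"
  unfolding clr_def by force

lemma set_rown: "m \<in> set (rown f) \<Longrightarrow> md m = 0 \<and> (\<exists>m'\<in>set f. mv m = mv m')"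
  unfolding rown_def using set_nrm set_clr by blast

text \<open>Puts the denominator back, for the conditions t \<notin> F, where the value itself
  matters and not only its vanishing.\<close>

definition canon :: "form \<Rightarrow> form" where
  "canon f = map (\<lambda>m. (mv m, mi m, mn m, maxd f)) (rown f)"

lemma ev_canon: "ev e (canon f) = ev e f"
proof -
  have "ev e (map (\<lambda>m. (mv m, mi m, mn m, N)) g) = inverse D ^ N * ev e g"
    if "\<And>m. m \<in> set g \<Longrightarrow> md m = 0" for N g
    using that by (induction g) (auto simp: emon_def algebra_simps)
  then have "ev e (canon f) = inverse D ^ maxd f * ev e (rown f)"
    unfolding canon_def using set_rown by blast
  then show ?thesis by (simp add: ev_rown field_simps)
qed

subsection \<open>Coefficients\<close>

text \<open>The coefficient of x_v^(p^i) in the additive polynomial \<open>f\<close>.\<close>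

definition cf :: "form \<Rightarrow> nat \<Rightarrow> nat \<Rightarrow> 'a poly fract" where
  "cf f v i = (\<Sum>m\<leftarrow>f. if mv m = v \<and> mi m = i then z_rf ^ mn m * inverse D ^ md m else 0)"

lemma cf_simps [simp]:
  "cf [] v i = 0"
  "cf (m # f) v i = (if mv m = v \<and> mi m = i then z_rf ^ mn m * inverse D ^ md m else 0) + cf f v i"
  "cf (f @ g) v i = cf f v i + cf g v i"
  by (simp_all add: cf_def)

lemma cf_notin: "(\<And>m. m \<in> set f \<Longrightarrow> \<not> (mv m = v \<and> mi m = i)) \<Longrightarrow> cf f v i = 0"
  by (induction f) auto

text \<open>Decidable form of \<open>pl ns = 0\<close>: by transcendence of z the multiplicity of
  each exponent has to vanish modulo p.\<close>

definition plz :: "nat list \<Rightarrow> bool" where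
  "plz ns = list_all (\<lambda>n. count_list ns n mod p = 0) ns"

lemma z_powers_independent:
  assumes "finite A" "(\<Sum>n\<in>A. of_nat (k n) * z_rf ^ n) = (0 :: 'a poly fract)" "n \<in> A"
  shows "k n mod p = 0"
proof -
  obtain N where N: "A \<subseteq> {..<N}" using finite_nat_iff_bounded assms(1) by blast
  have cst: "const_rf (of_nat j :: 'a) = of_nat j" for j
    by (induction j) simp_all
  define d where "d n = (if n \<in> A then of_nat (k n) else 0 :: 'a)" for n
  have "(\<Sum>n<N. z_rf ^ n * const_rf (d n)) = (\<Sum>n\<in>A. of_nat (k n) * z_rf ^ n)"
    by (rule sum.mono_neutral_cong_right) (use N in \<open>auto simp: d_def cst mult.commute\<close>)
  then have "d n = 0" using coords_unique[where N = N and d = d and l = n] assms N by auto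
  then have "of_nat (k n) = (0 :: 'a)" using assms(3) by (simp add: d_def)
  then show ?thesis by (simp add: of_nat_eq_0_iff_char_dvd char_p mod_eq_0_iff_dvd)
qed

lemma plz_iff: "plz ns \<longleftrightarrow> pl ns = (0 :: 'a poly fract)"
proof
  assume "plz ns"
  then have "of_nat (count_list ns n) = (0 :: 'a poly fract)" if "n \<in> set ns" for n
    using that of_nat_mod_p[of "count_list ns n"] unfolding plz_def list_all_iff by simp
  then show "pl ns = (0 :: 'a poly fract)" by (simp add: pl_def sum_list_count)
next
  assume "pl ns = (0 :: 'a poly fract)"
  then show "plz ns" unfolding plz_def list_all_iff pl_def sum_list_count
    using z_powers_independent[of "set ns" "count_list ns"] by blast
qed

lemma cf_conv_sum:
  assumes "\<And>m. m \<in> set f \<Longrightarrow> md m = 0"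
  shows "cf f v i = (\<Sum>n\<in>(\<lambda>m. mn m) ` set f. of_nat (count_list f (v, i, n, 0)) * z_rf ^ n)"
proof -
  have d0: "d = 0" if "(a, b, c, d) \<in> set f" for a b c d using assms[OF that] by simp
  have "cf f v i = (\<Sum>m\<in>set f. of_nat (count_list f m) * (if mv m = v \<and> mi m = i then z_rf ^ mn m * inverse D ^ md m else 0))"
    unfolding cf_def by (rule sum_list_count)
  also have "\<dots> = (\<Sum>m\<in>{m\<in>set f. mv m = v \<and> mi m = i}. of_nat (count_list f m) * z_rf ^ mn m)"
    by (rule sum.mono_neutral_cong_right) (use assms in auto)
  also have "\<dots> = (\<Sum>n\<in>(\<lambda>m. mn m) ` {m\<in>set f. mv m = v \<and> mi m = i}. of_nat (count_list f (v, i, n, 0)) * z_rf ^ n)"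
    by (rule sum.reindex_cong[symmetric, where l = "\<lambda>m. mn m"])
      (auto simp: inj_on_def dest: d0)
  also have "\<dots> = (\<Sum>n\<in>(\<lambda>m. mn m) ` set f. of_nat (count_list f (v, i, n, 0)) * z_rf ^ n)"
  proof (rule sum.mono_neutral_left)
    show "\<forall>n\<in>(\<lambda>m. mn m) ` set f - (\<lambda>m. mn m) ` {m \<in> set f. mv m = v \<and> mi m = i}.
        of_nat (count_list f (v, i, n, 0)) * z_rf ^ n = (0 :: 'a poly fract)"
    proof
      fix n assume "n \<in> (\<lambda>m. mn m) ` set f - (\<lambda>m. mn m) ` {m \<in> set f. mv m = v \<and> mi m = i}"
      moreover have "n \<in> (\<lambda>m. mn m) ` {m \<in> set f. mv m = v \<and> mi m = i}" if "(v, i, n, 0) \<in> set f"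
        using that by (intro image_eqI[of _ _ "(v, i, n, 0)"]) auto
      ultimately have "(v, i, n, 0) \<notin> set f" by blast
      then show "of_nat (count_list f (v, i, n, 0)) * z_rf ^ n = (0 :: 'a poly fract)"
        by (simp add: count_list_0_iff)
    qed
  qed auto
  finally show ?thesis .
qed

lemma count_list_nrm: "count_list (nrm f) m = count_list f m mod p"
proof -
  have "count_list (concat (map (\<lambda>m. replicate (g m) m) xs)) m = (if m \<in> set xs then g m else 0)"
    if "distinct xs" for g :: "mon \<Rightarrow> nat" and xs
    using that by (induction xs) (auto simp: count_list_eq_length_filter filter_replicate)
  from this[of "remdups f" "\<lambda>m. count_list f m mod p"] show ?thesis
    unfolding nrm_def by (simp add: count_list_0_iff)
qed

text \<open>Without denominators, the monomials in one x_v^(p^i) differ only in the exponent of z,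
  and in a normal row their multiplicities lie strictly between 0 and p. Linear independence of the
  powers of z over F excludes cancellation, so what occurs syntactically has a nonzero
  coefficient.\<close>

lemma cf_rown_0:
  assumes "cf (rown f) v i = 0" "m \<in> set (rown f)" "mv m = v" "mi m = i"
  shows False
proof -
  let ?g = "rown f"
  have d0: "\<And>m. m \<in> set ?g \<Longrightarrow> md m = 0" using set_rown by blast
  have m: "m = (v, i, mn m, 0)" using assms d0[OF assms(2)] by (auto intro!: prod_eqI)
  have "count_list ?g (v, i, mn m, 0) mod p = 0"
    by (rule z_powers_independent[of "(\<lambda>m. mn m) ` set ?g" "\<lambda>n. count_list ?g (v, i, n, 0)"])
      (use assms cf_conv_sum[OF d0, of ?g v i] in auto)
  then have "count_list ?g m = 0" using m unfolding rown_def by (metis count_list_nrm mod_mod_trivial)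
  then show False using assms(2) by (simp add: count_list_0_iff)
qed

lemma cf_nrm: "cf (nrm f) v i = cf f v i"
proof -
  define h where "h m = (if mv m = v \<and> mi m = i then z_rf ^ mn m * inverse D ^ md m else 0)" for m :: mon
  have rep: "cf (replicate k m) v i = of_nat k * h m" for k m
    by (induction k) (simp_all add: h_def algebra_simps)
  have conc: "cf (concat (map g xs)) v i = (\<Sum>x\<leftarrow>xs. cf (g x) v i)" for g and xs :: "mon list"
    by (induction xs) auto
  have "cf (nrm f) v i = (\<Sum>m\<leftarrow>remdups f. of_nat (count_list f m) * h m)"
    unfolding nrm_def conc rep of_nat_mod_p ..
  also have "\<dots> = (\<Sum>m\<in>set f. of_nat (count_list f m) * h m)"
    by (simp add: sum_list_distinct_conv_sum_set)
  also have "\<dots> = cf f v i" unfolding cf_def h_def by (rule sum_list_count[symmetric])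
  finally show ?thesis .
qed

lemma cf_clr: "(\<And>m. m \<in> set f \<Longrightarrow> md m \<le> N) \<Longrightarrow> cf (clr N f) v i = D ^ N * cf f v i"
proof (induction f)
  case (Cons m f)
  have "cf (map (\<lambda>k. (mv m, mi m, mn m + k, 0)) ns) v i
      = (if mv m = v \<and> mi m = i then pl ns * z_rf ^ mn m else 0)" for ns
    by (induction ns) (simp_all add: power_add algebra_simps)
  moreover have "D ^ (N - md m) = D ^ N * inverse D ^ md m"
    using Cons.prems[of m] by (simp add: power_diff field_simps)
  ultimately show ?case using Cons by (simp add: clr_def pl_Dpow algebra_simps)
qed (simp add: clr_def)

lemma cf_rown: "cf (rown f) v i = D ^ maxd f * cf f v i"
  by (simp add: rown_def cf_nrm cf_clr maxd)

lemma ev_cf: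
  assumes "finite A" "\<And>m. m \<in> set f \<Longrightarrow> (mv m, mi m) \<in> A"
  shows "ev e f = (\<Sum>(v, i)\<in>A. cf f v i * e v ^ (p ^ i))"
  using assms(2)
proof (induction f)
  case (Cons m f)
  have "(\<Sum>(v, i)\<in>A. cf (m # f) v i * e v ^ (p ^ i))
     = (\<Sum>(v, i)\<in>A. (if (v, i) = (mv m, mi m) then z_rf ^ mn m * inverse D ^ md m * e v ^ (p ^ i) else 0) + cf f v i * e v ^ (p ^ i))"
    by (intro sum.cong) (auto simp: algebra_simps)
  also have "\<dots> = (\<Sum>u\<in>A. (if u = (mv m, mi m) then z_rf ^ mn m * inverse D ^ md m * e (fst u) ^ (p ^ snd u) else 0))
     + (\<Sum>(v, i)\<in>A. cf f v i * e v ^ (p ^ i))"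
    by (simp add: split_beta sum.distrib prod_eq_iff)
  also have "\<dots> = emon e m + ev e f"
    using Cons assms(1) by (simp add: emon_def)
  finally show ?case by simp
qed simp

end

section \<open>Elimination steps\<close>

text \<open>A condition on parameters: forms that vanish, variables outside F, variables equal to
  1.\<close>

type_synonym alt = "form list \<times> nat list \<times> nat list"
text \<open>Rows still to be treated; rows already treated; forms required to lie outside F; the
  disjunction of alternatives imposed on the parameters; a number below which variables count as
  used.\<close>

type_synonym state = "form list \<times> form list \<times> form list \<times> alt list \<times> nat"

definition abound :: "alt \<Rightarrow> nat" where
  "abound a = sum_list (map fbound (fst a)) + sum_list (map Suc (fst (snd a))) + sum_list (map Suc (snd (snd a)))"

text \<open>New variables are numbered 5 (K + i) + kind with this bound as K, so that they have the
  intended kind and clash with nothing in use.\<close>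

definition sbound :: "state \<Rightarrow> nat" where
  "sbound s = sum_list (map fbound (fst s)) + sum_list (map fbound (fst (snd s)))
     + sum_list (map fbound (fst (snd (snd s)))) + sum_list (map abound (fst (snd (snd (snd s)))))
     + snd (snd (snd (snd s)))"

lemma sbound:
  "r \<in> set todo \<Longrightarrow> m \<in> set r \<Longrightarrow> mv m < sbound (todo, fin, ineqs, alts, k)"
  "r \<in> set fin \<Longrightarrow> m \<in> set r \<Longrightarrow> mv m < sbound (todo, fin, ineqs, alts, k)"
  "r \<in> set ineqs \<Longrightarrow> m \<in> set r \<Longrightarrow> mv m < sbound (todo, fin, ineqs, alts, k)"
  "k \<le> sbound (todo, fin, ineqs, alts, k)"
proof -
  have *: "r \<in> set rs \<Longrightarrow> m \<in> set r \<Longrightarrow> mv m < sum_list (map fbound rs)" for rs r m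
    using fbound[of m r] sum_list_ge[of "fbound r" "map fbound rs"] by auto
  show "r \<in> set todo \<Longrightarrow> m \<in> set r \<Longrightarrow> mv m < sbound (todo, fin, ineqs, alts, k)"
    "r \<in> set fin \<Longrightarrow> m \<in> set r \<Longrightarrow> mv m < sbound (todo, fin, ineqs, alts, k)"
    "r \<in> set ineqs \<Longrightarrow> m \<in> set r \<Longrightarrow> mv m < sbound (todo, fin, ineqs, alts, k)"
    "k \<le> sbound (todo, fin, ineqs, alts, k)"
    using *[of r todo m] *[of r fin m] *[of r ineqs m] unfolding sbound_def by auto
qed

lemma abound:
  assumes "(es, iv, os) \<in> set alts"
  shows "r \<in> set es \<Longrightarrow> m \<in> set r \<Longrightarrow> mv m < sbound (todo, fin, ineqs, alts, k)"
    "v \<in> set iv \<Longrightarrow> v < sbound (todo, fin, ineqs, alts, k)"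
    "v \<in> set os \<Longrightarrow> v < sbound (todo, fin, ineqs, alts, k)"
proof -
  have a: "abound (es, iv, os) \<le> sbound (todo, fin, ineqs, alts, k)"
    using sum_list_ge[of "abound (es, iv, os)" "map abound alts"] assms unfolding sbound_def by auto
  have *: "r \<in> set rs \<Longrightarrow> m \<in> set r \<Longrightarrow> mv m < sum_list (map fbound rs)" for rs r m
    using fbound[of m r] sum_list_ge[of "fbound r" "map fbound rs"] by auto
  show "r \<in> set es \<Longrightarrow> m \<in> set r \<Longrightarrow> mv m < sbound (todo, fin, ineqs, alts, k)"
    "v \<in> set iv \<Longrightarrow> v < sbound (todo, fin, ineqs, alts, k)"
    "v \<in> set os \<Longrightarrow> v < sbound (todo, fin, ineqs, alts, k)"
    using *[of r es m] a sum_list_ge[of "Suc v" "map Suc iv"] sum_list_ge[of "Suc v" "map Suc os"]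
    unfolding abound_def by auto
qed

lemma mod5: "r < 5 \<Longrightarrow> (5 * x + r) mod 5 = r" "r < 5 \<Longrightarrow> (5 * x + r) div 5 = (x::nat)"
  "5 * x \<le> 5 * (x + y) + (r::nat)"
  by simp_all

context setting
begin

section \<open>Meaning of states, and the two steps that change variables\<close>

definition valid :: "(nat \<Rightarrow> 'a poly fract) \<Rightarrow> bool" where
  "valid e \<longleftrightarrow> (\<forall>v. e v \<in> R) \<and> (\<forall>v. v mod 5 = 2 \<or> v mod 5 = 4 \<longrightarrow> e v \<in> F)"

definition agree :: "(nat \<Rightarrow> 'a poly fract) \<Rightarrow> (nat \<Rightarrow> 'a poly fract) \<Rightarrow> bool" where
  "agree e e' \<longleftrightarrow> (\<forall>v. v mod 5 \<noteq> 3 \<longrightarrow> v mod 5 \<noteq> 4 \<longrightarrow> e' v = e v)"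

definition altsem :: "(nat \<Rightarrow> 'a poly fract) \<Rightarrow> alt \<Rightarrow> bool" where
  "altsem e a \<longleftrightarrow> (\<forall>r\<in>set (fst a). ev e r = 0) \<and> (\<forall>v\<in>set (fst (snd a)). e v \<notin> F)
     \<and> (\<forall>v\<in>set (snd (snd a)). e v = 1)"

fun hold :: "state \<Rightarrow> (nat \<Rightarrow> 'a poly fract) \<Rightarrow> bool" where
  "hold (todo, fin, ineqs, alts, k) e \<longleftrightarrow> (\<forall>r\<in>set todo. ev e r = 0) \<and> (\<forall>r\<in>set fin. ev e r = 0)
     \<and> (\<forall>t\<in>set ineqs. ev e t \<notin> F)"

lemma validD: "valid e \<Longrightarrow> e v \<in> R" "valid e \<Longrightarrow> v mod 5 = 2 \<or> v mod 5 = 4 \<Longrightarrow> e v \<in> F"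
  unfolding valid_def by blast+

text \<open>Change of variables for lowering a degree: x_(v0) becomes b x_(v0) + r, and x_v becomes
  x_v + \<Sum> z^n x_(v0)^(p^i) over the entries (v, i, n) of \<open>gs\<close>. The polynomial r,
  with coefficients in new variables of kind 4, is there because an element of R need not be
  divisible by b; \<open>R_division\<close> bounds its degree by that of b, hence by
  \<open>sum_list b\<close>.\<close>

definition thA :: "nat \<Rightarrow> nat \<Rightarrow> nat list \<Rightarrow> (nat \<times> nat \<times> nat) list \<Rightarrow> nat \<Rightarrow> form" where
  "thA K v0 b gs v = (if v = v0 then map (\<lambda>n. (v0, 0, n, 0)) b @ map (\<lambda>l. (5 * (K + l) + 4, 0, l, 0)) [0..<Suc (sum_list b)]
     else if v mod 5 = 3 then (v, 0, 0, 0) # map (\<lambda>g. (v0, fst (snd g), snd (snd g), 0)) (filter (\<lambda>g. fst g = v) gs)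
     else [(v, 0, 0, 0)])"

text \<open>The leading exponent index of x_v: the largest i for which x_v^(p^i) occurs.\<close>

definition dg :: "nat \<Rightarrow> form \<Rightarrow> nat" where
  "dg v r = foldr max (map (\<lambda>m. mi m) (filter (\<lambda>m. mv m = v) r)) 0"

text \<open>Replaces x_v by its components over p^(m-d)-th powers, where d is the leading exponent
  index of x_v in the row. All new variables then enter the row with leading power p^m, so that
  their leading coefficients can be compared over one field of q-th powers.\<close>

definition thS :: "nat \<Rightarrow> nat \<Rightarrow> form \<Rightarrow> nat \<Rightarrow> form" where
  "thS K m r v = (if v mod 5 = 3
     then map (\<lambda>j. (5 * (K + (v * p ^ m + j)) + 3, m - dg v r, j, 0)) [0..<p ^ (m - dg v r)]
     else [(v, 0, 0, 0)])"

definition subst_state :: "(nat \<Rightarrow> form) \<Rightarrow> state \<Rightarrow> state" where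
  "subst_state \<theta> s = (map (\<lambda>r. rown (subst \<theta> r)) (fst s), map (subst \<theta>) (fst (snd s)),
     map (subst \<theta>) (fst (snd (snd s))), fst (snd (snd (snd s))), sbound s)"

definition stepA :: "nat \<Rightarrow> nat list \<Rightarrow> (nat \<times> nat \<times> nat) list \<Rightarrow> state \<Rightarrow> state" where
  "stepA v0 b gs s = (if v0 mod 5 = 3 \<and> \<not> plz b then subst_state (thA (sbound s) v0 b gs) s else s)"

definition stepS :: "nat \<Rightarrow> state \<Rightarrow> state" where
  "stepS m s = subst_state (thS (sbound s) m (case fst s of [] \<Rightarrow> [] | r # rs \<Rightarrow> r)) s"

end

text \<open>\<open>sg\<close> is the condition on F that accompanies the system. It reads only
  F-variables below \<open>k0\<close>; substitutions leave these alone, and new variables lie above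
  them.\<close>

locale elimination = setting p S for p :: nat and S :: "'a::field poly set" +
  fixes k0 :: nat and sg :: "(nat \<Rightarrow> 'a poly fract) \<Rightarrow> bool"
  assumes sg_cong: "\<And>e e'. (\<And>v. v < k0 \<Longrightarrow> v mod 5 = 2 \<or> v mod 5 = 4 \<Longrightarrow> e v = e' v) \<Longrightarrow> sg e = sg e'"
begin

definition St :: "state \<Rightarrow> (nat \<Rightarrow> 'a poly fract) \<Rightarrow> bool" where
  "St s e \<longleftrightarrow> (\<exists>e'. valid e' \<and> agree e e' \<and> hold s e' \<and> sg e')"

text \<open>A substitution that moves only variables of kind 3 and is onto valuations preserves
  solvability for fixed parameters: \<open>T2\<close> supplies the preimage of a solution, and
  conversely evaluating \<theta> gives back a solution.\<close>

lemma St_subst: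
  assumes s: "s = (todo, fin, ineqs, alts, k)" "k0 \<le> k"
    and T1: "\<And>v. v mod 5 \<noteq> 3 \<Longrightarrow> \<theta> v = [(v, 0, 0, 0)]"
    and T2: "\<And>e. valid e \<Longrightarrow> \<exists>e'. valid e' \<and> agree e e' \<and> (\<forall>v<sbound s. ev e' (\<theta> v) = e v)"
  shows "St (subst_state \<theta> s) e \<longleftrightarrow> St s e"
proof
  assume "St s e"
  then obtain e1 where e1: "valid e1" "agree e e1" "hold s e1" "sg e1" unfolding St_def by blast
  obtain e2 where e2: "valid e2" "agree e1 e2" "\<And>v. v < sbound s \<Longrightarrow> ev e2 (\<theta> v) = e1 v"
    using T2[OF e1(1)] by blast
  have "ev e2 (subst \<theta> f) = ev e1 f" if "f \<in> set todo \<union> set fin \<union> set ineqs" for f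
    unfolding ev_subst
  proof (rule ev_cong)
    fix m assume "m \<in> set f"
    then have "mv m < sbound s" using that unfolding s by (auto intro: sbound(1) sbound(2) sbound(3))
    then show "ev e2 (\<theta> (mv m)) = e1 (mv m)" by (rule e2(3))
  qed
  then have "hold (subst_state \<theta> s) e2"
    using e1(3) unfolding s subst_state_def by auto
  moreover have "sg e2 = sg e1"
  proof (rule sg_cong)
    fix v assume v: "v < k0" "v mod 5 = 2 \<or> v mod 5 = 4"
    then have "v < sbound s" using sbound(4)[of k todo fin ineqs alts] s by simp
    then show "e2 v = e1 v" using e2(3)[of v] T1[of v] v by (auto simp: emon_def)
  qed
  moreover have "agree e e2" using e1(2) e2(2) unfolding agree_def by auto
  ultimately show "St (subst_state \<theta> s) e" unfolding St_def using e2(1) e1(4) by blast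
next
  assume "St (subst_state \<theta> s) e"
  then obtain e2 where e2: "valid e2" "agree e e2" "hold (subst_state \<theta> s) e2" "sg e2" unfolding St_def by blast
  define e1 where "e1 v = ev e2 (\<theta> v)" for v
  have id: "e1 v = e2 v" if "v mod 5 \<noteq> 3" for v
    using T1[OF that] by (simp add: e1_def emon_def)
  have "valid e1" unfolding valid_def
  proof (intro conjI allI impI)
    show "e1 v \<in> R" for v unfolding e1_def by (intro ev_R validD(1)[OF e2(1)])
    show "v mod 5 = 2 \<or> v mod 5 = 4 \<Longrightarrow> e1 v \<in> F" for v using id[of v] validD(2)[OF e2(1), of v] by auto
  qed
  moreover have "agree e e1" using e2(2) id unfolding agree_def by auto
  moreover have "hold s e1" using e2(3) unfolding s subst_state_def by (simp add: ev_subst e1_def[abs_def])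
  moreover have "sg e1 = sg e2" by (rule sg_cong) (use id in auto)
  ultimately show "St s e" unfolding St_def using e2(4) by blast
qed

lemma St_stepA:
  assumes s: "s = (todo, fin, ineqs, alts, k)" "k0 \<le> k"
  shows "St (stepA v0 b gs s) e \<longleftrightarrow> St s e"
proof (cases "v0 mod 5 = 3 \<and> \<not> plz b")
  case True
  let ?K = "sbound s" and ?\<theta> = "thA (sbound s) v0 b gs"
  have b: "plp b \<noteq> (0 :: 'a poly)" using True plz_iff[of b] pl_conv_plp[where 'a = 'a, of b] by auto
  have deg: "degree (plp b :: 'a poly) \<le> sum_list b" by (rule degree_plp_le) (rule sum_list_ge)
  have "St (subst_state ?\<theta> s) e \<longleftrightarrow> St s e"
  proof (rule St_subst[OF s])
    fix v :: nat assume "v mod 5 \<noteq> 3"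
    then show "?\<theta> v = [(v, 0, 0, 0)]" using True by (auto simp: thA_def)
  next
    fix e :: "nat \<Rightarrow> 'a poly fract" assume e: "valid e"
    obtain t r where t: "t \<in> R" "e v0 = to_fract (plp b) * t + to_fract r" "degree r \<le> degree (plp b :: 'a poly)"
      using R_division[OF b validD(1)[OF e, of v0]] by blast
    define G where "G v = (\<Sum>g\<leftarrow>filter (\<lambda>g. fst g = v) gs. z_rf ^ snd (snd g) * t ^ (p ^ fst (snd g)))" for v
    \<comment> \<open>The inverse change of variables: the quotient of the division for
      \<open>v0\<close>, translated values for the other variables of kind 3, and the coefficients
      of the remainder for the new variables of kind 4.\<close>
    define e' where "e' v = (if v = v0 then t else if v mod 5 = 3 then e v - G v
       else if v mod 5 = 4 \<and> 5 * ?K \<le> v then const_rf (coeff r (v div 5 - ?K)) else e v)" for v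
    have GR: "G v \<in> R" for v
    proof -
      have "(\<Sum>g\<leftarrow>xs. z_rf ^ snd (snd g) * t ^ (p ^ fst (snd g))) \<in> R" for xs :: "(nat \<times> nat \<times> nat) list"
        using t(1) by (induction xs) auto
      then show ?thesis unfolding G_def .
    qed
    have "valid e'" using e True t(1) GR unfolding valid_def e'_def by auto
    moreover have "agree e e'" using True unfolding agree_def e'_def by auto
    moreover have "ev e' (?\<theta> v) = e v" if v: "v < ?K" for v
    proof -
      have "ev e' (map (\<lambda>n. (v0, 0, n, 0)) b) = pl b * t"
      proof -
        have "ev e' (map (\<lambda>n. (v0, 0, n, 0)) ns) = pl ns * t" for ns
          by (induction ns) (simp_all add: emon_def e'_def algebra_simps)
        then show ?thesis .
      qed
      moreover have "ev e' (map (\<lambda>l. (5 * (?K + l) + 4, 0, l, 0)) [0..<Suc (sum_list b)]) = to_fract r"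
      proof -
        have "r = (\<Sum>l\<le>sum_list b. monom (coeff r l) l)"
          using t(3) deg by (intro poly_as_sum_of_monoms'[symmetric]) simp
        then have "to_fract r = (\<Sum>l<Suc (sum_list b). const_rf (coeff r l) * z_rf ^ l)"
          by (metis (no_types, lifting) lessThan_Suc_atMost sum.cong to_fract_monom to_fract_sum)
        moreover have "emon e' (5 * (?K + l) + 4, 0, l, 0) = const_rf (coeff r l) * z_rf ^ l" for l
        proof -
          have "5 * (?K + l) + 4 \<noteq> v0" using True mod5(1)[of 4 "?K + l"] by auto
          then have "e' (5 * (?K + l) + 4) = const_rf (coeff r l)"
            unfolding e'_def by (simp add: mod5 del: distrib_left_numeral)
          then show ?thesis by (simp add: emon_def mult.commute)
        qed
        ultimately show ?thesis by (simp only: ev_map_upt)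
      qed
      moreover have "ev e' ((v, 0, 0, 0) # map (\<lambda>g. (v0, fst (snd g), snd (snd g), 0)) (filter (\<lambda>g. fst g = v) gs)) = e v"
        if "v \<noteq> v0" "v mod 5 = 3"
      proof -
        have "ev e' (map (\<lambda>g. (v0, fst (snd g), snd (snd g), 0)) (filter (\<lambda>g. fst g = v) gs)) = G v"
          unfolding ev_map G_def by (simp add: emon_def e'_def)
        then show ?thesis using that by (simp add: emon_def e'_def)
      qed
      moreover have "e' v = e v" if "v \<noteq> v0" "v mod 5 \<noteq> 3"
        using that v unfolding e'_def by auto
      ultimately show ?thesis using t(2)
        by (auto simp: thA_def emon_def pl_conv_plp simp del: upt_Suc)
    qed
    ultimately show "\<exists>e'. valid e' \<and> agree e e' \<and> (\<forall>v<?K. ev e' (?\<theta> v) = e v)" by blast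
  qed
  then show ?thesis using True by (simp add: stepA_def)
qed (auto simp: stepA_def)

lemma St_stepS:
  assumes s: "s = (todo, fin, ineqs, alts, k)" "k0 \<le> k"
  shows "St (stepS m s) e \<longleftrightarrow> St s e"
  unfolding stepS_def
proof (rule St_subst[OF s])
  let ?K = "sbound s" and ?r = "case fst s of [] \<Rightarrow> [] | r # rs \<Rightarrow> r"
  fix e :: "nat \<Rightarrow> 'a poly fract" assume e: "valid e"
  have "\<exists>c. (\<forall>l. c l \<in> R) \<and> e v = (\<Sum>l<p ^ n. z_rf ^ l * c l ^ (p ^ n))" for v n
  proof -
    obtain s where "e v \<in> V s" using R_V validD(1)[OF e] by blast
    moreover have "s \<le> p ^ n * s" by (simp add: Suc_leI)
    ultimately obtain c where "\<And>l. c l \<in> V s" "e v = (\<Sum>l<p ^ n. z_rf ^ l * c l ^ (p ^ n))"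
      using components by blast
    then show ?thesis using V_R by blast
  qed
  note ex = this
  define c where "c v n = (SOME c. (\<forall>l. c l \<in> R) \<and> e v = (\<Sum>l<p ^ n. z_rf ^ l * c l ^ (p ^ n)))" for v n
  have "(\<forall>l. c v n l \<in> R) \<and> e v = (\<Sum>l<p ^ n. z_rf ^ l * c v n l ^ (p ^ n))" for v n
    unfolding c_def by (rule someI_ex[OF ex])
  then have c: "\<And>v n l. c v n l \<in> R" "\<And>v n. e v = (\<Sum>l<p ^ n. z_rf ^ l * c v n l ^ (p ^ n))"
    by blast+
  \<comment> \<open>The pair (v, j) is numbered v p^m + j with j < p^m; quotient and remainder
    recover it.\<close>
  define e' where "e' w = (if w mod 5 = 3 \<and> 5 * ?K \<le> w
     then let t = w div 5 - ?K; v = t div p ^ m in c v (m - dg v ?r) (t mod p ^ m) else e w)" for w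
  have "valid e'" using e c(1) unfolding valid_def e'_def Let_def by auto
  moreover have "agree e e'" unfolding agree_def e'_def by auto
  moreover have "ev e' (thS ?K m ?r v) = e v" if v: "v < ?K" for v
  proof (cases "v mod 5 = 3")
    case True
    have "emon e' (5 * (?K + (v * p ^ m + j)) + 3, m - dg v ?r, j, 0)
        = z_rf ^ j * c v (m - dg v ?r) j ^ (p ^ (m - dg v ?r))" if "j < p ^ (m - dg v ?r)" for j
    proof -
      have "p ^ (m - dg v ?r) \<le> p ^ m" using p_gt_1 by (intro power_increasing) auto
      then have j: "j < p ^ m" using that by simp
      then have "(v * p ^ m + j) div p ^ m = v" "(v * p ^ m + j) mod p ^ m = j" by simp_all
      moreover have "(5 * (?K + (v * p ^ m + j)) + 3) mod 5 = 3" "(5 * (?K + (v * p ^ m + j)) + 3) div 5 - ?K = v * p ^ m + j"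
        by (simp_all add: mod5 del: distrib_left_numeral)
      ultimately have "e' (5 * (?K + (v * p ^ m + j)) + 3) = c v (m - dg v ?r) j"
        unfolding e'_def Let_def by (simp add: mod5(3) del: distrib_left_numeral)
      then show ?thesis by (simp add: emon_def)
    qed
    then have "ev e' (thS ?K m ?r v) = (\<Sum>l<p ^ (m - dg v ?r). z_rf ^ l * c v (m - dg v ?r) l ^ (p ^ (m - dg v ?r)))"
      using True by (simp add: thS_def ev_map_upt)
    then show ?thesis using c(2) by simp
  next
    case False
    then show ?thesis by (simp add: thS_def emon_def e'_def)
  qed
  ultimately show "\<exists>e'. valid e' \<and> agree e e' \<and> (\<forall>v<?K. ev e' (thS ?K m ?r v) = e v)" by blast
qed (simp add: thS_def)

end

section \<open>Charts as finite data, and the elimination of one row\<close>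

lemma div_mod_mult_add: "l < T \<Longrightarrow> (v * T + l) div T = v" "l < T \<Longrightarrow> (v * T + l) mod T = (l::nat)"
  by simp_all

context setting
begin

text \<open>Variables whose leading coefficients begin the basis, exponents e whose powers z^e
  complete it, and the witnesses \<open>B\<close> and \<delta> as lists of exponents.\<close>

type_synonym chart_data = "nat list \<times> nat list \<times> nat list list list \<times> nat list"

definition conv :: "nat \<Rightarrow> nat list \<Rightarrow> nat list \<Rightarrow> nat list" where
  "conv q a b = concat (map (\<lambda>n. map (\<lambda>k. n + q * k) b) a)"

lemma pl_map_add: "pl (map (\<lambda>k. n + p ^ m * k) b) = z_rf ^ n * (pl b :: 'a poly fract) ^ (p ^ m)"
  by (induction b) (simp_all add: frob_add distrib_left power_add mult.commute[of "p ^ m"] power_mult)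

lemma pl_conv: "pl (conv (p ^ m) a b) = pl a * (pl b :: 'a poly fract) ^ (p ^ m)"
  by (induction a) (simp_all add: conv_def pl_map_add distrib_right)

lemma pl_concat_map: "pl (concat (map h xs)) = (\<Sum>x\<leftarrow>xs. pl (h x))"
  by (induction xs) auto

definition fam :: "form \<Rightarrow> nat \<Rightarrow> nat list \<Rightarrow> nat list \<Rightarrow> nat \<Rightarrow> nat list" where
  "fam r m xs es i = (if i < length xs
     then map (\<lambda>u. mn u) (filter (\<lambda>u. mv u = lnth 0 xs i \<and> mi u = m) r)
     else [lnth 0 es (i - length xs)])"

text \<open>A finite test from which \<open>stepC_sound\<close> derives the axioms of
  \<open>chart\<close>. The spanning identity becomes the vanishing of a list of exponents, so a
  proposed chart can be verified without saying how it was found.\<close>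

definition chart_ok :: "form \<Rightarrow> nat \<Rightarrow> chart_data \<Rightarrow> bool" where
  "chart_ok r m ch \<longleftrightarrow> (let xs = fst ch; es = fst (snd ch); B = fst (snd (snd ch)); \<delta> = snd (snd (snd ch)) in
     distinct xs \<and> list_all (\<lambda>v. v mod 5 = 3) xs
   \<and> list_all (\<lambda>u. mv u \<in> set xs \<and> mi u \<le> m) (xpart r) \<and> list_all (\<lambda>u. md u = 0) r
   \<and> length xs + length es = p ^ m \<and> \<not> plz \<delta>
   \<and> list_all (\<lambda>l. plz (concat (map (\<lambda>i. conv (p ^ m) (fam r m xs es i) (lnth [] (lnth [] B l) i)) [0..<p ^ m])
        @ negf (map (\<lambda>k. l + p ^ m * k) \<delta>))) [0..<p ^ m])"

text \<open>A sum that dominates every exponent in sight; it plays the role of \<kappa>.\<close>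

definition kap :: "form \<Rightarrow> chart_data \<Rightarrow> nat" where
  "kap r ch = sum_list (map (\<lambda>u. mn u) r) + sum_list (fst (snd ch))
     + sum_list (concat (concat (fst (snd (snd ch))))) + sum_list (snd (snd (snd ch)))"

text \<open>\<open>s00\<close> is the number \<open>s0\<close> of the locale \<open>chart\<close>,
  and \<open>n00\<close> is the bound of \<open>chart_bound\<close> for s = \<open>s00\<close>, both
  with explicit arguments so that the procedure can compute them.\<close>

definition s00 :: "nat \<Rightarrow> nat \<Rightarrow> nat" where "s00 m \<kappa> = 2 * (2 * p ^ m + 4 * p ^ m * \<kappa> + \<kappa>)"
definition n00 :: "nat \<Rightarrow> nat \<Rightarrow> nat" where "n00 m \<kappa> = 6 * \<kappa> + 2 * s00 m \<kappa> + 2"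

text \<open>Unknowns of the chart that are not variables of the row, as parameters over R. Their
  offset K + j separates them from the parameters y_v of \<open>xyf\<close>, which sit at offset v <
  K.\<close>

definition exf :: "nat \<Rightarrow> nat \<Rightarrow> nat list \<Rightarrow> form" where
  "exf K m es = map (\<lambda>j. (5 * (K + (K + j)) + 1, m, lnth 0 es j, 0)) [0..<length es]"

text \<open>The bounded error term of \<open>chart_surj\<close>, given by coordinates of kind
  2.\<close>

definition vfm :: "nat \<Rightarrow> nat \<Rightarrow> form" where
  "vfm K s = map (\<lambda>l. (5 * (K + l) + 2, 0, l, s)) [0..<Suc (s * E)]"

definition xyf :: "nat \<Rightarrow> form \<Rightarrow> form" where
  "xyf K r = subst (\<lambda>v. [(5 * (K + v) + 1, 0, 0, 0)]) (xpart r)"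

text \<open>An element of \<open>V n\<close> for each v, given by coordinates of kind 4; the stride
  n E + 1 keeps the coordinates for different v apart.\<close>

definition bxf :: "nat \<Rightarrow> nat \<Rightarrow> nat \<Rightarrow> form" where
  "bxf K n v = map (\<lambda>l. (5 * (K + (v * Suc (n * E) + l)) + 4, 0, l, n)) [0..<Suc (n * E)]"

lemma mod5_Suc: "Suc (5 * x) mod 5 = 1" "Suc (Suc (5 * x)) mod 5 = 2"
  using mod5(1)[of 1 x] mod5(1)[of 2 x] by simp_all

lemma kind_exf: "u \<in> set (exf K m es) \<Longrightarrow> mv u mod 5 = 1"
  and kind_vfm: "u \<in> set (vfm K s) \<Longrightarrow> mv u mod 5 = 2"
  and kind_xyf: "u \<in> set (xyf K r) \<Longrightarrow> mv u mod 5 = 1"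
  and kind_bxf: "u \<in> set (bxf K n v) \<Longrightarrow> mv u mod 5 = 4"
  by (auto simp: exf_def vfm_def xyf_def bxf_def subst_def mod5 mod5_Suc simp del: distrib_left_numeral upt_Suc)

definition thC :: "nat \<Rightarrow> nat \<Rightarrow> nat list \<Rightarrow> nat \<Rightarrow> form" where
  "thC K n xs v = (if v \<in> set xs then negf [(5 * (K + v) + 1, 0, 0, 0)] @ bxf K n v else [(v, 0, 0, 0)])"

text \<open>Ties the new parameters to the old ones: the parameter part of the row is \<Sum>
  f_i(y_i) over the whole chart plus a bounded error.\<close>

definition altrow :: "nat \<Rightarrow> form \<Rightarrow> nat \<Rightarrow> chart_data \<Rightarrow> form" where
  "altrow K r m ch = upart r @ negf (xyf K r @ exf K m (fst (snd ch)) @ vfm K (s00 m (kap r ch)))"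

text \<open>The row after x_v = b_v - y_v with b_v bounded (\<open>thC\<close>). The terms f_v(y_v)
  cancel against those in the parameter part, and only F-variables and the extra parameters
  remain.\<close>

definition newrow :: "nat \<Rightarrow> form \<Rightarrow> nat \<Rightarrow> chart_data \<Rightarrow> form" where
  "newrow K r m ch = subst (bxf K (n00 m (kap r ch))) (xpart r) @ fpart r @ exf K m (fst (snd ch)) @ vfm K (s00 m (kap r ch))"

definition chart_state :: "nat \<Rightarrow> form \<Rightarrow> nat \<Rightarrow> chart_data \<Rightarrow> state \<Rightarrow> state" where
  "chart_state K r m ch s = (let \<theta> = thC K (n00 m (kap r ch)) (fst ch) in
     (map (\<lambda>r. rown (subst \<theta> r)) (tl (fst s)), newrow K r m ch # map (subst \<theta>) (fst (snd s)),
      map (subst \<theta>) (fst (snd (snd s))),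
      map (\<lambda>a. (altrow K r m ch # fst a, snd a)) (fst (snd (snd (snd s)))), K))"

definition stepC :: "nat \<Rightarrow> chart_data \<Rightarrow> state \<Rightarrow> state" where
  "stepC m ch s = (case fst s of [] \<Rightarrow> s | r # rs \<Rightarrow> if chart_ok r m ch then chart_state (sbound s) r m ch s else s)"

lemma ev_V:
  assumes "\<And>u. u \<in> set f \<Longrightarrow> mn u + md u \<le> N \<and> e (mv u) \<in> F"
  shows "ev e f \<in> V N"
  using assms
proof (induction f)
  case (Cons u f)
  have "z_rf ^ mn u * inverse D ^ md u * e (mv u) ^ (p ^ mi u) \<in> V (mn u + md u + 0)"
    using V_F[of "e (mv u)" 0] V_power[of "e (mv u)" 0 "p ^ mi u"] Cons.prems[of u]
    by (intro V_mult V_z V_invD) simp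
  then have "emon e u \<in> V N" using V_mono[of "mn u + md u" N] Cons.prems[of u] unfolding emon_def by simp
  then show ?case using Cons by (auto intro: V_add)
qed simp

lemma pl_V: "(\<And>n. n \<in> set ns \<Longrightarrow> n \<le> N) \<Longrightarrow> pl ns \<in> V N"
  by (induction ns) (auto intro!: V_add V_mono[OF _ V_z])

lemma emon_bound_sum:
  "(\<Sum>l<Suc (n * E). emon e (w l, 0, l, n)) = (\<Sum>l\<le>n * E. z_rf ^ l * inverse D ^ n * e (w l))"
  by (simp add: emon_def lessThan_Suc_atMost)

lemma V_coords_F:
  assumes "x \<in> V n"
  obtains d where "\<And>l. d l \<in> F" "x = (\<Sum>l\<le>n * E. z_rf ^ l * inverse D ^ n * d l)"
proof -
  obtain d where "x = (\<Sum>l\<le>n * E. z_rf ^ l * inverse D ^ n * const_rf (d l))" using assms unfolding V_coords by blast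
  then show ?thesis by (intro that[of "\<lambda>l. const_rf (d l)"]) auto
qed

lemma sum_coords_V: "(\<And>l. d l \<in> F) \<Longrightarrow> (\<Sum>l\<le>n * E. z_rf ^ l * inverse D ^ n * d l) \<in> V n"
proof -
  assume "\<And>l. d l \<in> F"
  then have "\<forall>l. \<exists>c. d l = const_rf c" by blast
  from choice[OF this] obtain c where "\<And>l. d l = const_rf (c l)" by blast
  then show ?thesis unfolding V_coords by auto
qed

end

context elimination
begin

text \<open>The row is \<open>\<Sum>f\<^sub>i(x\<^sub>i) + w + L(c) = 0\<close> with \<open>w\<close> depending on the parameters only. Surjectivity of the
  chart gives \<open>w = \<Sum>f\<^sub>i(y\<^sub>i) + v\<close> with \<open>v\<close> bounded, and the bound of the chart shows that
  \<open>x\<^sub>i + y\<^sub>i\<close> is bounded, hence given by coordinates in \<open>F\<close>.\<close>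

lemma stepC_sound:
  assumes s: "s = (r # todo, fin, ineqs, alts, k)" "k0 \<le> k" and ok: "chart_ok r m ch"
  defines "K \<equiv> sbound s"
  shows "\<And>e. valid e \<Longrightarrow> \<exists>e'. valid e' \<and> (\<forall>v. v < K \<or> v mod 5 = 0 \<longrightarrow> e' v = e v) \<and> ev e' (altrow K r m ch) = 0"
    and "\<And>e. valid e \<Longrightarrow> ev e (altrow K r m ch) = 0 \<Longrightarrow> St (chart_state K r m ch s) e \<longleftrightarrow> St s e"
proof -
  obtain xs es B \<delta> where ch: "ch = (xs, es, B, \<delta>)" by (cases ch) auto
  define \<kappa> where "\<kappa> = kap r ch"
  define q where "q = p ^ m"
  have c1: "distinct xs" "\<And>v. v \<in> set xs \<Longrightarrow> v mod 5 = 3"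
    and c2: "\<And>u. u \<in> set r \<Longrightarrow> mv u mod 5 = 3 \<Longrightarrow> mv u \<in> set xs" "\<And>u. u \<in> set r \<Longrightarrow> mv u mod 5 = 3 \<Longrightarrow> mi u \<le> m"
      "\<And>u. u \<in> set r \<Longrightarrow> md u = 0"
    and c3: "length xs + length es = p ^ m" "\<not> plz \<delta>"
    and c4: "\<And>l. l < p ^ m \<Longrightarrow> plz (concat (map (\<lambda>i. conv (p ^ m) (fam r m xs es i) (lnth [] (lnth [] B l) i)) [0..<p ^ m])
        @ negf (map (\<lambda>k. l + p ^ m * k) \<delta>))"
  proof -
    have *: "distinct xs" "\<forall>v\<in>set xs. v mod 5 = 3" "\<forall>u\<in>set (xpart r). mv u \<in> set xs \<and> mi u \<le> m"
      "\<forall>u\<in>set r. md u = 0" "length xs + length es = p ^ m" "\<not> plz \<delta>"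
      "\<forall>l\<in>set [0..<p ^ m]. plz (concat (map (\<lambda>i. conv (p ^ m) (fam r m xs es i) (lnth [] (lnth [] B l) i)) [0..<p ^ m])
        @ negf (map (\<lambda>k. l + p ^ m * k) \<delta>))"
      using ok unfolding chart_ok_def ch Let_def list_all_iff fst_conv snd_conv by blast+
    show "distinct xs" "length xs + length es = p ^ m" "\<not> plz \<delta>" by fact+
    show "v \<in> set xs \<Longrightarrow> v mod 5 = 3" for v using *(2) by blast
    show "u \<in> set r \<Longrightarrow> md u = 0" for u using *(4) by blast
    show "u \<in> set r \<Longrightarrow> mv u mod 5 = 3 \<Longrightarrow> mv u \<in> set xs" "u \<in> set r \<Longrightarrow> mv u mod 5 = 3 \<Longrightarrow> mi u \<le> m" for u
      using *(3) unfolding xpart_def set_filter by blast+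
    show "l < p ^ m \<Longrightarrow> plz (concat (map (\<lambda>i. conv (p ^ m) (fam r m xs es i) (lnth [] (lnth [] B l) i)) [0..<p ^ m])
        @ negf (map (\<lambda>k. l + p ^ m * k) \<delta>))" for l using *(7) by (simp only: set_upt atLeastLessThan_iff) simp
  qed
  have \<kappa>: "u \<in> set r \<Longrightarrow> mn u \<le> \<kappa>" "e \<in> set es \<Longrightarrow> e \<le> \<kappa>" "b \<in> set (concat (concat B)) \<Longrightarrow> b \<le> \<kappa>" "d \<in> set \<delta> \<Longrightarrow> d \<le> \<kappa>"
    for u e b d
    unfolding \<kappa>_def kap_def ch
    using sum_list_ge[of "mn u" "map (\<lambda>u. mn u) r"] sum_list_ge[of e es] sum_list_ge[of b "concat (concat B)"]
      sum_list_ge[of d \<delta>] by auto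
  define a where "a i = (pl (fam r m xs es i) :: 'a poly fract)" for i
  define L where "L i y = (if i < length xs then ev (\<lambda>_. y) (filter (\<lambda>u. mv u = xs ! i \<and> mi u \<noteq> m) r) else 0)" for i y
  define Bf where "Bf l i = (pl (lnth [] (lnth [] B l) i) :: 'a poly fract)" for l i
  interpret ch: chart p S m \<kappa> a L Bf "plp \<delta>"
  proof
    fix i assume i: "i < p ^ m"
    show "a i \<in> V \<kappa>" unfolding a_def
    proof (rule pl_V)
      fix n assume "n \<in> set (fam r m xs es i)"
      then show "n \<le> \<kappa>"
        using \<kappa>(1) \<kappa>(2)[of "es ! (i - length xs)"] i c3(1)
        by (auto simp: fam_def lnth_eq split: if_splits)
    qed
    have ev_add: "ev (\<lambda>_. x + y) g = ev (\<lambda>_. x) g + ev (\<lambda>_. y) g" for x y g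
      by (induction g) (simp_all add: emon_def frob_add algebra_simps)
    show "L i (x + y) = L i x + L i y" for x y unfolding L_def by (simp add: ev_add)
    show "x \<in> R \<Longrightarrow> L i x \<in> R" for x unfolding L_def by (simp add: ev_R)
    show "x \<in> V n \<Longrightarrow> L i x \<in> V (\<kappa> + p ^ m div p * n)" for n x
    proof (cases "i < length xs")
      case True
      assume x: "x \<in> V n"
      have "ev (\<lambda>_. x) g \<in> V (\<kappa> + p ^ m div p * n)"
        if "\<And>u. u \<in> set g \<Longrightarrow> u \<in> set r \<and> mv u = xs ! i \<and> mi u \<noteq> m" for g
        using that
      proof (induction g)
        case (Cons u g)
        have u: "u \<in> set r" "mv u mod 5 = 3" "mi u \<noteq> m" using Cons.prems[of u] c1(2) True by auto
        then have "mi u < m" using c2(2)[of u] by simp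
        \<comment> \<open>A power p^i with i < m is at most q/p; this is the gap on which the chart
          rests.\<close>
        have "p ^ mi u \<le> p ^ m div p"
        proof -
          obtain m' where m': "m = Suc m'" using \<open>mi u < m\<close> by (cases m) auto
          then have "p ^ mi u \<le> p ^ m'" using \<open>mi u < m\<close> p_gt_1 by (intro power_increasing) auto
          then show ?thesis unfolding m' by simp
        qed
        moreover have "emon (\<lambda>_. x) u \<in> V (mn u + p ^ mi u * n)"
          using V_mult[OF V_z V_power[OF x]] u c2(3)[of u] by (simp add: emon_def)
        moreover have "mn u + p ^ mi u * n \<le> \<kappa> + p ^ m div p * n"
          using \<kappa>(1)[OF u(1)] \<open>p ^ mi u \<le> p ^ m div p\<close> by (intro add_mono mult_right_mono) auto
        ultimately have "emon (\<lambda>_. x) u \<in> V (\<kappa> + p ^ m div p * n)" using V_mono by blast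
        then show ?case using Cons by (auto intro: V_add)
      qed simp
      note gen = this
      have "ev (\<lambda>_. x) (filter (\<lambda>u. mv u = xs ! i \<and> mi u \<noteq> m) r) \<in> V (\<kappa> + p ^ m div p * n)"
        by (rule gen) auto
      then show "L i x \<in> V (\<kappa> + p ^ m div p * n)" using True unfolding L_def by simp
    qed (simp add: L_def)
    fix l assume "l < p ^ m"
    have "lnth [] Bs j \<in> set Bs \<or> lnth [] Bs j = []" for Bs :: "nat list list" and j
    proof (cases "j < length Bs")
      case False
      have "rec_nat Bs (\<lambda>_ r. tl r) j = drop j Bs" by (induction j) (auto simp: drop_Suc tl_drop)
      then show ?thesis using False by (simp add: lnth_def)
    qed (simp add: lnth_eq)
    moreover have "lnth [] B j \<in> set B \<or> lnth [] B j = []" for j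
    proof (cases "j < length B")
      case False
      have "rec_nat B (\<lambda>_ r. tl r) j = drop j B" by (induction j) (auto simp: drop_Suc tl_drop)
      then show ?thesis using False by (simp add: lnth_def)
    qed (simp add: lnth_eq)
    ultimately have "lnth [] (lnth [] B l) i \<in> set (concat B) \<or> lnth [] (lnth [] B l) i = []"
      by (metis UN_I empty_iff list.set(1) set_concat)
    then show "Bf l i \<in> V \<kappa>" unfolding Bf_def using \<kappa>(3) by (intro pl_V) auto
  next
    show "plp \<delta> \<noteq> (0 :: 'a poly)" using c3(2) plz_iff[of \<delta>] pl_conv_plp[where 'a = 'a, of \<delta>] by auto
    show "degree (plp \<delta> :: 'a poly) \<le> \<kappa>" by (rule degree_plp_le) (rule \<kappa>(4))
  next
    fix l assume l: "l < p ^ m"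
    have "(\<Sum>i<p ^ m. a i * Bf l i ^ (p ^ m)) - z_rf ^ l * pl \<delta> ^ (p ^ m) = 0"
      using c4[OF l] unfolding plz_iff
      by (simp add: pl_concat_map pl_conv pl_map_add a_def Bf_def interv_sum_list_conv_sum_set_nat atLeast0LessThan)
    then show "(\<Sum>i<p ^ m. a i * Bf l i ^ (p ^ m)) = to_fract (plp \<delta>) ^ (p ^ m) * z_rf ^ l"
      by (simp add: pl_conv_plp mult.commute)
  qed
  have f_xs: "ch.f i y = ev (\<lambda>_. y) (filter (\<lambda>u. mv u = xs ! i) r)" if "i < length xs" for i y
  proof -
    have "u \<in> set r \<Longrightarrow> md u = 0" for u using c2(3) by blast
    then have "ev (\<lambda>_. y) (filter (\<lambda>u. mv u = xs ! i) r)
      = pl (map (\<lambda>u. mn u) (filter (\<lambda>u. mv u = xs ! i \<and> mi u = m) r)) * y ^ (p ^ m) + ev (\<lambda>_. y) (filter (\<lambda>u. mv u = xs ! i \<and> mi u \<noteq> m) r)"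
      by (induction r) (auto simp: emon_def algebra_simps)
    then show ?thesis using that by (simp add: ch.f_def a_def fam_def L_def lnth_eq)
  qed
  have f_es: "ch.f (length xs + j) y = z_rf ^ (lnth 0 es j) * y ^ (p ^ m)" for j y
    by (simp add: ch.f_def a_def fam_def L_def)
  have ev_xpart: "ev e (xpart r) = (\<Sum>i<length xs. ch.f i (e (xs ! i)))" for e
  proof -
    have "ev e (xpart g) = (\<Sum>v\<in>set xs. ev (\<lambda>_. e v) (filter (\<lambda>u. mv u = v) g))"
      if "\<And>u. u \<in> set g \<Longrightarrow> mv u mod 5 = 3 \<Longrightarrow> mv u \<in> set xs" for g
      using that
    proof (induction g)
      case (Cons u g)
      have "(\<Sum>v\<in>set xs. ev (\<lambda>_. e v) (filter (\<lambda>u. mv u = v) (u # g)))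
        = (\<Sum>v\<in>set xs. (if v = mv u then emon e u else 0) + ev (\<lambda>_. e v) (filter (\<lambda>u. mv u = v) g))"
        by (intro sum.cong) (auto simp: emon_def)
      also have "\<dots> = (if mv u \<in> set xs then emon e u else 0) + ev e (xpart g)"
        using Cons by (simp add: sum.distrib)
      also have "\<dots> = ev e (xpart (u # g))"
        using Cons.prems[of u] c1(2)[of "mv u"] by (auto simp: xpart_def)
      finally show ?case by simp
    qed (simp add: xpart_def)
    from this[OF c2(1)] have "ev e (xpart r) = (\<Sum>v\<in>set xs. ev (\<lambda>_. e v) (filter (\<lambda>u. mv u = v) r))" by blast
    also have "\<dots> = (\<Sum>i<length xs. ev (\<lambda>_. e (xs ! i)) (filter (\<lambda>u. mv u = xs ! i) r))"
      by (rule sum.reindex_bij_betw[OF bij_betw_nth[OF c1(1)], symmetric]) auto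
    also have "\<dots> = (\<Sum>i<length xs. ch.f i (e (xs ! i)))"
      by (intro sum.cong) (simp_all add: f_xs)
    finally show ?thesis .
  qed
  define sv where "sv = s00 m \<kappa>"
  define n where "n = n00 m \<kappa>"
  have sv: "sv = ch.s0" unfolding sv_def s00_def ch.s0_def ..
  have n: "n = 6 * \<kappa> + 2 * sv + 2" unfolding n_def n00_def sv_def ..
  have \<kappa>s: "\<kappa> \<le> sv" unfolding sv_def s00_def by simp
  let ?ex = "exf K m es" and ?vf = "vfm K sv" and ?xy = "xyf K r"
  have exf: "ev e ?ex = (\<Sum>j<length es. ch.f (length xs + j) (e (5 * (K + (K + j)) + 1)))" for e
    unfolding exf_def ev_map_upt f_es by (simp add: emon_def)
  have vfm: "ev e ?vf = (\<Sum>l\<le>sv * E. z_rf ^ l * inverse D ^ sv * e (5 * (K + l) + 2))" for e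
    unfolding vfm_def ev_map_upt emon_bound_sum ..
  have xyf: "ev e ?xy = (\<Sum>i<length xs. ch.f i (e (5 * (K + xs ! i) + 1)))" for e
    unfolding xyf_def ev_subst ev_xpart by (simp add: emon_def)
  have split: "(\<Sum>i<p ^ m. h i) = (\<Sum>i<length xs. h i) + (\<Sum>j<length es. h (length xs + j))" for h :: "nat \<Rightarrow> 'a poly fract"
  proof -
    have "(\<Sum>i<length xs + b. h i) = (\<Sum>i<length xs. h i) + (\<Sum>j<b. h (length xs + j))" for b
      by (induction b) (simp_all add: add.assoc)
    then show ?thesis using c3(1) by metis
  qed
  have alt: "ev e (altrow K r m ch) = ev e (upart r) - (ev e ?xy + ev e ?ex + ev e ?vf)" for e
    unfolding altrow_def by (simp add: sv_def \<kappa>_def ch algebra_simps)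
  have new: "ev e (newrow K r m ch) = ev e (subst (bxf K n) (xpart r)) + ev e (fpart r) + ev e ?ex + ev e ?vf" for e
    unfolding newrow_def by (simp add: sv_def n_def \<kappa>_def ch algebra_simps)
  have rK: "u \<in> set r \<Longrightarrow> mv u < K" for u unfolding K_def s by (rule sbound(1)) auto
  show "\<exists>e'. valid e' \<and> (\<forall>v. v < K \<or> v mod 5 = 0 \<longrightarrow> e' v = e v) \<and> ev e' (altrow K r m ch) = 0" if e: "valid e" for e
  proof -
    have upR: "ev e (upart r) \<in> R" by (rule ev_R) (rule validD(1)[OF e])
    obtain y0 v where y0: "\<And>i. i < p ^ m \<Longrightarrow> y0 i \<in> R" "v \<in> V ch.s0" "ev e (upart r) = (\<Sum>i<p ^ m. ch.f i (y0 i)) + v"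
      by (rule ch.chart_surj[OF upR], rule that)
    define y where "y i = (if i < p ^ m then y0 i else 0)" for i
    have y: "\<And>i. y i \<in> R" "v \<in> V ch.s0" "ev e (upart r) = (\<Sum>i<p ^ m. ch.f i (y i)) + v"
      using y0 by (simp_all add: y_def)
    obtain d where d: "\<And>l. d l \<in> F" "v = (\<Sum>l\<le>sv * E. z_rf ^ l * inverse D ^ sv * d l)"
      by (rule V_coords_F[OF y(2)[folded sv]], rule that)
    \<comment> \<open>Kind 1 receives y_i, at the offset of the variable of the row for i <
      \<open>length xs\<close> and beyond K for the extra unknowns; kind 2 receives the coordinates
      of the error. Everything below 5 K, and so every variable in use, keeps its value.\<close>
    define e' where "e' w = (if w < 5 * K then e w
      else let t = w div 5 - K in
        if w mod 5 = 1 then (if t < K then (if \<exists>i<length xs. xs ! i = t then y (THE i. i < length xs \<and> xs ! i = t) else e w)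
           else if t - K < length es then y (length xs + (t - K)) else e w)
        else if w mod 5 = 2 then d t else e w)" for w
    have ix: "(THE j. j < length xs \<and> xs ! j = xs ! i) = i" if "i < length xs" for i
      using that c1(1) by (intro the_equality) (auto simp: nth_eq_iff_index_eq)
    have e'1: "e' (5 * (K + t) + 1) = (if t < K then (if \<exists>i<length xs. xs ! i = t then y (THE i. i < length xs \<and> xs ! i = t)
          else e (5 * (K + t) + 1)) else if t - K < length es then y (length xs + (t - K)) else e (5 * (K + t) + 1))" for t
    proof -
      have "(5 * (K + t) + 1) div 5 - K = t" "(5 * (K + t) + 1) mod 5 = 1"
        by (simp_all only: mod5 diff_add_inverse)
      moreover have "\<not> 5 * (K + t) + 1 < 5 * K" using mod5(3)[of K t 1] by (simp only: not_less)
      ultimately show ?thesis unfolding e'_def Let_def by (simp only: simp_thms if_True if_False)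
    qed
    have e'2: "e' (5 * (K + t) + 2) = d t" for t
    proof -
      have "(5 * (K + t) + 2) div 5 - K = t" "(5 * (K + t) + 2) mod 5 = 2"
        by (simp_all only: mod5 diff_add_inverse)
      moreover have "\<not> 5 * (K + t) + 2 < 5 * K" using mod5(3)[of K t 2] by (simp only: not_less)
      ultimately show ?thesis unfolding e'_def Let_def by simp
    qed
    have "e' w \<in> R \<and> (w mod 5 = 2 \<or> w mod 5 = 4 \<longrightarrow> e' w \<in> F)" for w
    proof -
      show ?thesis
        using validD[OF e, of w] d(1)[of "w div 5 - K"] F_R[OF d(1)[of "w div 5 - K"]] y(1)
        unfolding e'_def Let_def by (simp del: image_iff)
    qed
    then have "valid e'" unfolding valid_def by blast
    moreover have same: "e' v = e v" if "v < K \<or> v mod 5 = 0" for v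
      using that unfolding e'_def Let_def by auto
    moreover have "ev e' (altrow K r m ch) = 0"
    proof -
      have "ev e' (upart r) = ev e (upart r)"
        by (rule ev_cong) (use rK same in \<open>auto simp: upart_def\<close>)
      moreover have h1: "e' (5 * (K + xs ! i) + 1) = y i" if "i < length xs" "xs ! i < K" for i
      proof -
        have "\<exists>j<length xs. xs ! j = xs ! i" using that(1) by blast
        then show ?thesis using that(2) unfolding e'1 ix[OF that(1)] by simp
      qed
      \<comment> \<open>An entry of \<open>xs\<close> that is not below K does not occur in the row,
        so its f_i is zero and the value of its parameter is irrelevant.\<close>
      moreover have h2: "ch.f i y1 = 0" if "i < length xs" "\<not> xs ! i < K" for i y1
      proof -
        have "filter (\<lambda>u. mv u = xs ! i) r = []" unfolding filter_empty_conv by (metis that(2) rK)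
        then show ?thesis using f_xs[OF that(1)] by simp
      qed
      moreover have h3: "e' (5 * (K + (K + j)) + 1) = y (length xs + j)" if "j < length es" for j
        unfolding e'1 using that by simp
      moreover have "ev e' ?xy = (\<Sum>i<length xs. ch.f i (y i))"
        unfolding xyf
      proof (rule sum.cong[OF refl])
        fix i assume "i \<in> {..<length xs}"
        then have i: "i < length xs" by simp
        show "ch.f i (e' (5 * (K + xs ! i) + 1)) = ch.f i (y i)"
          using h1[OF i] h2[OF i] by (cases "xs ! i < K") (simp_all only: simp_thms)
      qed
      moreover have "ev e' ?ex = (\<Sum>j<length es. ch.f (length xs + j) (y (length xs + j)))"
        unfolding exf by (rule sum.cong[OF refl]) (simp only: lessThan_iff h3)
      moreover have "ev e' ?vf = v" unfolding vfm d(2) e'2 ..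
      ultimately have "ev e' ?xy = (\<Sum>i<length xs. ch.f i (y i))"
         "ev e' ?ex = (\<Sum>j<length es. ch.f (length xs + j) (y (length xs + j)))" "ev e' ?vf = v"
        "ev e' (upart r) = ev e (upart r)"
        by blast+
      then show ?thesis unfolding alt using y(3) unfolding split by simp
    qed
    ultimately show ?thesis by blast
  qed
  have th_other: "thC K n xs v = [(v, 0, 0, 0)]" if "v mod 5 \<noteq> 3" for v
    using that c1(2) by (auto simp: thC_def)
  have bx: "ev e (bxf K n v) = (\<Sum>l\<le>n * E. z_rf ^ l * inverse D ^ n * e (5 * (K + (v * Suc (n * E) + l)) + 4))" for e v
    unfolding bxf_def ev_map_upt emon_bound_sum ..
  have th_xs: "ev e (thC K n xs v) = ev e (bxf K n v) - e (5 * (K + v) + 1)" if "v \<in> set xs" for e v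
    using that by (simp add: thC_def emon_def)
  have cs: "chart_state K r m ch s = (map (\<lambda>r. rown (subst (thC K n xs) r)) todo, newrow K r m ch # map (subst (thC K n xs)) fin,
      map (subst (thC K n xs)) ineqs, map (\<lambda>a. (altrow K r m ch # fst a, snd a)) alts, K)"
    unfolding chart_state_def s ch by (simp add: n_def \<kappa>_def ch Let_def)
  have f_diff: "ch.f i (x - y) = ch.f i x - ch.f i y" if "i < p ^ m" for i x y
    using ch.f_add[OF that, of "x - y" y] by simp
  have agr: "ev e1 g = ev e g" if "agree e e1" "\<And>u. u \<in> set g \<Longrightarrow> mv u mod 5 \<noteq> 3 \<and> mv u mod 5 \<noteq> 4" for e e1 g
    by (rule ev_cong) (use that in \<open>auto simp: agree_def\<close>)
  have params: "ev e1 (upart r) = ev e1 ?xy + ev e1 ?ex + ev e1 ?vf" if "agree e e1" "ev e (altrow K r m ch) = 0" for e e1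
  proof -
    have "ev e1 (upart r) = ev e (upart r)" "ev e1 ?xy = ev e ?xy" "ev e1 ?ex = ev e ?ex" "ev e1 ?vf = ev e ?vf"
      by (rule agr[OF that(1)]; auto simp: upart_def dest: kind_exf kind_vfm kind_xyf)+
    then show ?thesis using that(2) unfolding alt by simp
  qed
  show "St (chart_state K r m ch s) e \<longleftrightarrow> St s e" if e: "valid e" "ev e (altrow K r m ch) = 0" for e
  proof
    assume "St s e"
    then obtain e1 where e1: "valid e1" "agree e e1" "hold s e1" "sg e1" unfolding St_def by blast
    note up = params[OF e1(2) e(2)]
    \<comment> \<open>Inserting the equation of the parameters into the row gives \<Sum> f_i(Y_i) =
      -(v + L(c)), where the right-hand side is bounded; the extra unknowns enter with their
      parameter alone.\<close>
    define Y where "Y i = (if i < length xs then e1 (xs ! i) + e1 (5 * (K + xs ! i) + 1)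
      else e1 (5 * (K + (K + (i - length xs))) + 1))" for i
    have YR: "Y i \<in> R" for i unfolding Y_def using validD(1)[OF e1(1)] by simp
    have "ev e1 r = 0" using e1(3) unfolding s by simp
    then have "(\<Sum>i<p ^ m. ch.f i (Y i)) = - (ev e1 ?vf + ev e1 (fpart r))"
      unfolding ev_parts[of e1 r] up ev_xpart xyf exf split Y_def using c3(1)
      by (simp add: ch.f_add sum.distrib) (simp add: algebra_simps eq_neg_iff_add_eq_0)
    moreover have "- (ev e1 ?vf + ev e1 (fpart r)) \<in> V sv"
    proof (intro V_uminus V_add)
      show "ev e1 ?vf \<in> V sv" unfolding vfm
        by (rule sum_coords_V) (rule validD(2)[OF e1(1)], simp add: mod5_Suc del: distrib_left_numeral)
      have "ev e1 (fpart r) \<in> V \<kappa>"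
        by (rule ev_V) (use \<kappa>(1) c2(3) validD(2)[OF e1(1)] in \<open>auto simp: fpart_def\<close>)
      then show "ev e1 (fpart r) \<in> V sv" using V_mono[OF \<kappa>s] by blast
    qed
    ultimately have "Y i \<in> V n" if "i < p ^ m" for i
      using ch.chart_bound[of Y sv i] YR that unfolding n by simp
    then have "e1 v + e1 (5 * (K + v) + 1) \<in> V n" if "v \<in> set xs" for v
      using that c3(1) unfolding in_set_conv_nth Y_def by (metis trans_less_add1)
    note bdd = this
    have "\<forall>v. \<exists>d. (\<forall>l. d l \<in> F) \<and> (v \<in> set xs \<longrightarrow>
        e1 v + e1 (5 * (K + v) + 1) = (\<Sum>l\<le>n * E. z_rf ^ l * inverse D ^ n * d l))"
    proof
      fix v
      show "\<exists>d. (\<forall>l. d l \<in> F) \<and> (v \<in> set xs \<longrightarrow>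
        e1 v + e1 (5 * (K + v) + 1) = (\<Sum>l\<le>n * E. z_rf ^ l * inverse D ^ n * d l))"
      proof (cases "v \<in> set xs")
        case True
        from V_coords_F[OF bdd[OF True]] show ?thesis by (metis (no_types))
      qed (use rangeI[of const_rf 0] in \<open>auto intro!: exI[of _ "\<lambda>_. const_rf 0"]\<close>)
    qed
    from choice[OF this] obtain dd where dd: "\<And>v l. dd v l \<in> F"
      "\<And>v. v \<in> set xs \<Longrightarrow> e1 v + e1 (5 * (K + v) + 1) = (\<Sum>l\<le>n * E. z_rf ^ l * inverse D ^ n * dd v l)"
      by blast
    define e2 where "e2 w = (if w mod 5 = 4 \<and> 5 * K \<le> w
      then let t = w div 5 - K in dd (t div Suc (n * E)) (t mod Suc (n * E)) else e1 w)" for w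
    have e2_val: "valid e2" using e1(1) dd(1) F_R[OF dd(1)] unfolding valid_def e2_def Let_def by auto
    have e2_agr: "agree e1 e2" unfolding agree_def e2_def by auto
    have e2_lt: "e2 v = e1 v" if "v < K" for v using that unfolding e2_def by auto
    have bx2: "ev e2 (bxf K n v) = (\<Sum>l\<le>n * E. z_rf ^ l * inverse D ^ n * dd v l)" for v
      unfolding bx
    proof (rule sum.cong[OF refl])
      fix l assume "l \<in> {..n * E}"
      then have l: "l < Suc (n * E)" by simp
      have "e2 (5 * (K + (v * Suc (n * E) + l)) + 4)
         = dd ((v * Suc (n * E) + l) div Suc (n * E)) ((v * Suc (n * E) + l) mod Suc (n * E))"
        unfolding e2_def Let_def by (simp add: mod5 del: distrib_left_numeral mult_Suc_right)
      also have "(v * Suc (n * E) + l) div Suc (n * E) = v" by (rule div_mod_mult_add(1)[OF l])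
      also have "(v * Suc (n * E) + l) mod Suc (n * E) = l" by (rule div_mod_mult_add(2)[OF l])
      finally show "z_rf ^ l * inverse D ^ n * e2 (5 * (K + (v * Suc (n * E) + l)) + 4)
         = z_rf ^ l * inverse D ^ n * dd v l" by simp
    qed
    have th2: "ev e2 (thC K n xs v) = e1 v" if "v < K" for v
    proof (cases "v \<in> set xs")
      case True
      have "e2 (5 * (K + v) + 1) = e1 (5 * (K + v) + 1)"
        unfolding e2_def by (simp add: mod5 del: distrib_left_numeral)
      then show ?thesis unfolding th_xs[OF True] bx2 dd(2)[OF True, symmetric] by simp
    next
      case False
      then show ?thesis using e2_lt[OF that] by (simp add: thC_def emon_def)
    qed
    have sub: "ev e2 (subst (thC K n xs) f) = ev e1 f" if "f \<in> set todo \<union> set fin \<union> set ineqs" for f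
      unfolding ev_subst
    proof (rule ev_cong)
      fix u assume "u \<in> set f"
      then have "mv u < K" using that unfolding K_def s by (auto intro: sbound(1) sbound(2) sbound(3))
      then show "ev e2 (thC K n xs (mv u)) = e1 (mv u)" by (rule th2)
    qed
    have "ev e2 (newrow K r m ch) = 0"
    proof -
      have "ev e2 (subst (bxf K n) (xpart r)) = (\<Sum>i<length xs. ch.f i (Y i))"
        unfolding ev_subst ev_xpart by (rule sum.cong) (simp_all add: bx2 dd(2)[symmetric] Y_def)
      moreover have "ev e2 (fpart r) = ev e1 (fpart r)"
        by (rule ev_cong) (use e2_lt rK in \<open>auto simp: fpart_def\<close>)
      moreover have "ev e2 ?ex = ev e1 ?ex" "ev e2 ?vf = ev e1 ?vf"
        by (rule agr[OF e2_agr]; auto dest: kind_exf kind_vfm)+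
      moreover have "ev e1 ?ex = (\<Sum>j<length es. ch.f (length xs + j) (Y (length xs + j)))"
        unfolding exf Y_def by simp
      ultimately show ?thesis unfolding new
        using \<open>(\<Sum>i<p ^ m. ch.f i (Y i)) = - (ev e1 ?vf + ev e1 (fpart r))\<close> unfolding split
        by (simp add: algebra_simps eq_neg_iff_add_eq_0)
    qed
    then have "hold (chart_state K r m ch s) e2" unfolding cs using e1(3) sub unfolding s by auto
    moreover have "sg e2 = sg e1"
    proof (rule sg_cong)
      fix v assume "v < k0" "v mod 5 = 2 \<or> v mod 5 = 4"
      then show "e2 v = e1 v" using e2_lt[of v] sbound(4)[of k "r # todo" fin ineqs alts] s unfolding K_def by auto
    qed
    moreover have "agree e e2" using e1(2) e2_agr unfolding agree_def by auto
    ultimately show "St (chart_state K r m ch s) e" unfolding St_def using e2_val e1(4) by blast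
  next
    assume "St (chart_state K r m ch s) e"
    then obtain e2 where e2: "valid e2" "agree e e2" "hold (chart_state K r m ch s) e2" "sg e2" unfolding St_def by blast
    note up = params[OF e2(2) e(2)]
    define e1 where "e1 v = ev e2 (thC K n xs v)" for v
    have id: "e1 v = e2 v" if "v mod 5 \<noteq> 3" for v
      using th_other[OF that] by (simp add: e1_def emon_def)
    have "valid e1" unfolding valid_def
    proof (intro conjI allI impI)
      show "e1 v \<in> R" for v unfolding e1_def by (intro ev_R validD(1)[OF e2(1)])
      show "v mod 5 = 2 \<or> v mod 5 = 4 \<Longrightarrow> e1 v \<in> F" for v using id[of v] validD(2)[OF e2(1), of v] by auto
    qed
    moreover have "agree e e1" using e2(2) id unfolding agree_def by auto
    moreover have "hold s e1"
    proof -
      have "ev e1 (xpart r) = (\<Sum>i<length xs. ch.f i (ev e2 (bxf K n (xs ! i)))) - ev e2 ?xy"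
        unfolding ev_xpart xyf using c3(1) by (simp add: e1_def th_xs f_diff sum_subtractf)
      moreover have "ev e1 (upart r) = ev e2 (upart r)" "ev e1 (fpart r) = ev e2 (fpart r)"
        by (rule ev_cong; use id in \<open>auto simp: fpart_def upart_def\<close>)+
      moreover have "ev e2 (newrow K r m ch) = 0" using e2(3) unfolding cs by simp
      ultimately have "ev e1 r = 0" unfolding ev_parts[of e1 r] new ev_subst ev_xpart up
        by (simp add: algebra_simps)
      then show ?thesis using e2(3)[unfolded cs] unfolding s by (simp add: ev_subst e1_def[abs_def])
    qed
    moreover have "sg e1 = sg e2" by (rule sg_cong) (use id in auto)
    ultimately show "St s e" unfolding St_def using e2(4) by blast
  qed
qed

end

section \<open>The final stage of the elimination\<close>

context setting
begin

text \<open>For the largest e with C_e \<noteq> 0 the term has degree at least M p^e, which exceeds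
  the exponents M p^(e') of the smaller ones by at least M. Once M beats the degrees of all
  coefficients, nothing can cancel it.\<close>

lemma degree_dominant:
  fixes C :: "nat \<Rightarrow> 'a poly"
  assumes "finite I" "e0 \<in> I" "C e0 \<noteq> 0"
  shows "\<exists>M0. \<forall>M\<ge>M0. degree ((\<Sum>e\<in>I. C e * monom 1 (M * p ^ e)) + G) > N"
proof -
  define e1 where "e1 = Max {e \<in> I. C e \<noteq> 0}"
  have e1: "e1 \<in> I" "C e1 \<noteq> 0" and max: "\<And>e. e \<in> I \<Longrightarrow> C e \<noteq> 0 \<Longrightarrow> e \<le> e1"
    using Max_in[of "{e \<in> I. C e \<noteq> 0}"] Max_ge[of "{e \<in> I. C e \<noteq> 0}"] assms unfolding e1_def by auto
  define c where "c = degree G + (\<Sum>e\<in>I. degree (C e))"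
  have c: "degree G \<le> c" "\<And>e. e \<in> I \<Longrightarrow> degree (C e) \<le> c"
    unfolding c_def using member_le_sum[of _ I "\<lambda>e. degree (C e)"] assms(1) by (auto intro: trans_le_add2)
  have "degree ((\<Sum>e\<in>I. C e * monom 1 (M * p ^ e)) + G) > N" if M: "M \<ge> c + N + 1" for M
  proof -
    let ?t = "\<lambda>e. C e * monom 1 (M * p ^ e)"
    have deg1: "degree (?t e1) = degree (C e1) + M * p ^ e1"
      using e1(2) by (simp add: degree_mult_eq degree_monom_eq)
    have ge: "M \<le> M * p ^ e1" by (simp add: Suc_leI)
    have "degree (?t e) < M * p ^ e1" if e: "e \<in> I - {e1}" for e
    proof (cases "C e = 0")
      case False
      then have "e < e1" using max[of e] e by auto
      then have "p ^ e < p ^ e1" using p_gt_1 by (rule power_strict_increasing)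
      then have "M * p ^ e \<le> M * (p ^ e1 - 1)" by (intro mult_left_mono) auto
      also have "\<dots> = M * p ^ e1 - M" by (simp add: diff_mult_distrib2)
      finally have "M * p ^ e + c < M * p ^ e1" using M ge by linarith
      moreover have "degree (?t e) = degree (C e) + M * p ^ e"
        using False by (simp add: degree_mult_eq degree_monom_eq)
      ultimately show ?thesis using c(2)[of e] e by simp
    qed (use M ge in simp)
    then have "degree (\<Sum>e\<in>I - {e1}. ?t e) < M * p ^ e1"
      using M ge by (intro degree_sum_less) auto
    moreover have "degree G < M * p ^ e1" using c(1) M ge by linarith
    ultimately have "degree ((\<Sum>e\<in>I - {e1}. ?t e) + G) < degree (?t e1)"
      unfolding deg1 by (intro le_less_trans[OF degree_add_le_max]) auto
    then have "degree (?t e1 + ((\<Sum>e\<in>I - {e1}. ?t e) + G)) = degree (?t e1)"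
      by (rule degree_add_eq_left)
    moreover have "(\<Sum>e\<in>I. ?t e) + G = ?t e1 + ((\<Sum>e\<in>I - {e1}. ?t e) + G)"
      using assms(1) e1(1) by (simp add: sum.remove add.assoc)
    ultimately have "degree ((\<Sum>e\<in>I. ?t e) + G) = degree (C e1) + M * p ^ e1" by (simp only: deg1)
    then show ?thesis using M ge by linarith
  qed
  then show ?thesis by blast
qed

lemma R_common_denominator:
  assumes "finite A" "\<And>i. i \<in> A \<Longrightarrow> c i \<in> R"
  shows "\<exists>n C. \<forall>i\<in>A. D ^ n * c i = to_fract (C i)"
proof -
  have "\<forall>i. \<exists>n. i \<in> A \<longrightarrow> c i \<in> V n" using R_V assms(2) by blast
  from choice[OF this] obtain n where n: "\<And>i. i \<in> A \<Longrightarrow> c i \<in> V (n i)" by blast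
  define N where "N = Max (n ` A)"
  have "c i \<in> V N" if "i \<in> A" for i
    using V_mono[OF _ n[OF that]] assms(1) that unfolding N_def by auto
  then have "\<forall>i. \<exists>g. i \<in> A \<longrightarrow> D ^ N * c i = to_fract g" unfolding V_def by (auto simp: mult.commute)
  from choice[OF this] show ?thesis by blast
qed

lemma cf_R: "cf f v i \<in> R"
  by (induction f) auto

text \<open>With x_v = z^(M p^(s v)) the power x_v^(p^i) becomes z^(M p^(s v + i)). As i < s, the
  numbers s v + i are distinct for distinct pairs (v, i), and \<open>degree_dominant\<close> makes
  the degree too large for a constant, also after multiplication by the common denominator.\<close>

lemma large_values:
  assumes e: "\<And>v. e v \<in> R" and t: "cf t v i \<noteq> 0" "v mod 5 = 3" and s: "\<And>u. u \<in> set t \<Longrightarrow> mi u < s"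
  shows "\<exists>M0. \<forall>M\<ge>M0. ev (\<lambda>v. if v mod 5 = 3 then z_rf ^ (M * p ^ (s * v)) else e v) t \<notin> F"
proof -
  define A where "A = (\<lambda>u. (mv u, mi u)) ` set t"
  have fin: "finite A" unfolding A_def by simp
  define A3 where "A3 = {a \<in> A. fst a mod 5 = 3}"
  have fin3: "finite A3" unfolding A3_def using fin by simp
  have As: "snd a < s" if "a \<in> A" for a using that s unfolding A_def by auto
  have viA: "(v, i) \<in> A3"
  proof -
    have "\<exists>u\<in>set t. mv u = v \<and> mi u = i" using cf_notin[of t v i] t(1) by blast
    then show ?thesis using t(2) unfolding A3_def A_def by force
  qed
  define g where "g = (\<Sum>a\<in>A - A3. cf t (fst a) (snd a) * e (fst a) ^ (p ^ snd a))"
  have gR: "g \<in> R" unfolding g_def using e cf_R by (intro R_sum R_mult R_power)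
  \<comment> \<open>One denominator for all coefficients; \<open>None\<close> stands for the part
    free of variables of kind 3.\<close>
  obtain n C where C: "\<forall>a\<in>insert None (Some ` A3). D ^ n * (case a of None \<Rightarrow> g | Some a \<Rightarrow> cf t (fst a) (snd a)) = to_fract (C a)"
  proof -
    have "(case a of None \<Rightarrow> g | Some a \<Rightarrow> cf t (fst a) (snd a)) \<in> R" for a
      using gR cf_R by (cases a) auto
    then have "\<exists>n C. \<forall>a\<in>insert None (Some ` A3). D ^ n * (case a of None \<Rightarrow> g | Some a \<Rightarrow> cf t (fst a) (snd a)) = to_fract (C a)"
      using fin3 by (intro R_common_denominator) auto
    then show ?thesis using that by blast
  qed
  define h where "h a = s * fst a + snd a" for a :: "nat \<times> nat"
  have inj: "inj_on h A3"
  proof (rule inj_onI)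
    fix a b assume ab: "a \<in> A3" "b \<in> A3" "h a = h b"
    then have "snd a < s" "snd b < s" using As unfolding A3_def by auto
    moreover have "(fst a * s + snd a) div s = (fst b * s + snd b) div s" "(fst a * s + snd a) mod s = (fst b * s + snd b) mod s"
      using ab(3) by (simp_all add: h_def mult.commute)
    ultimately show "a = b" by (simp only: div_mod_mult_add prod_eq_iff)
  qed
  define C' where "C' e = C (Some (the_inv_into A3 h e))" for e
  have C'h: "C' (h a) = C (Some a)" if "a \<in> A3" for a
    unfolding C'_def using the_inv_into_f_f[OF inj that] by simp
  have main: "D ^ n * ev (\<lambda>v. if v mod 5 = 3 then z_rf ^ (M * p ^ (s * v)) else e v) t
      = to_fract ((\<Sum>e\<in>h ` A3. C' e * monom 1 (M * p ^ e)) + C None)" for M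
  proof -
    let ?e = "\<lambda>v. if v mod 5 = 3 then z_rf ^ (M * p ^ (s * v)) else e v"
    have sub: "sum k A = sum k A3 + sum k (A - A3)" for k :: "nat \<times> nat \<Rightarrow> 'a poly fract"
      using sum.subset_diff[of A3 A k] fin unfolding A3_def by (simp add: add.commute)
    have "ev ?e t = (\<Sum>a\<in>A. cf t (fst a) (snd a) * ?e (fst a) ^ (p ^ snd a))"
      using ev_cf[OF fin, of t ?e] unfolding A_def by (simp add: split_beta)
    also have "\<dots> = (\<Sum>a\<in>A3. cf t (fst a) (snd a) * ?e (fst a) ^ (p ^ snd a))
        + (\<Sum>a\<in>A - A3. cf t (fst a) (snd a) * ?e (fst a) ^ (p ^ snd a))"
      by (rule sub)
    also have "(\<Sum>a\<in>A - A3. cf t (fst a) (snd a) * ?e (fst a) ^ (p ^ snd a)) = g"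
      unfolding g_def by (intro sum.cong) (auto simp: A3_def)
    also have "(\<Sum>a\<in>A3. cf t (fst a) (snd a) * ?e (fst a) ^ (p ^ snd a))
        = (\<Sum>a\<in>A3. cf t (fst a) (snd a) * z_rf ^ (M * p ^ h a))"
      by (intro sum.cong) (auto simp: A3_def h_def power_add mult.assoc simp flip: power_mult)
    finally have "D ^ n * ev ?e t = (\<Sum>a\<in>A3. (D ^ n * cf t (fst a) (snd a)) * z_rf ^ (M * p ^ h a)) + D ^ n * g"
      by (simp add: distrib_left sum_distrib_left mult.assoc)
    also have "\<dots> = (\<Sum>a\<in>A3. to_fract (C (Some a)) * z_rf ^ (M * p ^ h a)) + to_fract (C None)"
      using C by auto
    also have "\<dots> = (\<Sum>e\<in>h ` A3. to_fract (C' e) * z_rf ^ (M * p ^ e)) + to_fract (C None)"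
      by (simp add: sum.reindex[OF inj] C'h)
    finally show ?thesis by (simp add: to_fract_monom)
  qed
  have "C' (h (v, i)) \<noteq> 0"
  proof
    assume "C' (h (v, i)) = 0"
    then have "to_fract (C (Some (v, i))) = 0" using C'h[OF viA] by simp
    moreover have "D ^ n * cf t v i = to_fract (C (Some (v, i)))" using C viA by auto
    ultimately show False using t(1) by simp
  qed
  then obtain M0 where M0: "\<And>M. M \<ge> M0 \<Longrightarrow> degree ((\<Sum>e\<in>h ` A3. C' e * monom 1 (M * p ^ e)) + C None) > n * degree DD"
    using degree_dominant[of "h ` A3" "h (v, i)" C' "n * degree DD" "C None"] fin3 viA by blast
  have "ev (\<lambda>v. if v mod 5 = 3 then z_rf ^ (M * p ^ (s * v)) else e v) t \<notin> F" if "M \<ge> M0" for M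
  proof
    assume "ev (\<lambda>v. if v mod 5 = 3 then z_rf ^ (M * p ^ (s * v)) else e v) t \<in> F"
    then obtain c where "ev (\<lambda>v. if v mod 5 = 3 then z_rf ^ (M * p ^ (s * v)) else e v) t = const_rf c" by blast
    then have "to_fract ((\<Sum>e\<in>h ` A3. C' e * monom 1 (M * p ^ e)) + C None) = to_fract (DD ^ n * [:c:])"
      unfolding main[symmetric] to_fract_mult to_fract_power by (simp add: D_def const_rf_def)
    then have "(\<Sum>e\<in>h ` A3. C' e * monom 1 (M * p ^ e)) + C None = DD ^ n * [:c:]" by (simp only: to_fract_eq_iff)
    moreover have "degree (DD ^ n * [:c:]) \<le> n * degree DD"
      using degree_mult_le[of "DD ^ n" "[:c:]"] degree_power_le[of DD n] by (simp add: mult.commute)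
    ultimately show False using M0[OF that] by simp
  qed
  then show ?thesis by blast
qed

lemma xpart_canon_cf: "xpart (canon f) \<noteq> [] \<Longrightarrow> \<exists>v i. v mod 5 = 3 \<and> cf f v i \<noteq> 0"
proof -
  assume "xpart (canon f) \<noteq> []"
  then obtain u where u: "u \<in> set (rown f)" "mv u mod 5 = 3"
    unfolding xpart_def filter_empty_conv canon_def by auto
  have "cf (rown f) (mv u) (mi u) \<noteq> 0" using cf_rown_0[OF _ u(1) refl refl] by blast
  then have "cf f (mv u) (mi u) \<noteq> 0" by (simp add: cf_rown)
  then show ?thesis using u(2) by blast
qed

text \<open>One M serves finitely many forms. In a finished state no row contains variables of kind
  3, so the conditions t \<notin> F that still contain such variables can always be met and may be
  dropped.\<close>

lemma large_values_list:
  assumes e: "valid e" and ts: "\<And>t. t \<in> set ts \<Longrightarrow> xpart (canon t) \<noteq> []"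
  shows "\<exists>e'. valid e' \<and> (\<forall>v. v mod 5 \<noteq> 3 \<longrightarrow> e' v = e v) \<and> (\<forall>t\<in>set ts. ev e' t \<notin> F)"
proof -
  define s where "s = Suc (sum_list (map (\<lambda>u. mi u) (concat ts)))"
  have s: "mi u < s" if "t \<in> set ts" "u \<in> set t" for t u
    unfolding s_def less_Suc_eq_le using that by (intro sum_list_ge) auto
  have "\<forall>t. \<exists>M0. t \<in> set ts \<longrightarrow> (\<forall>M\<ge>M0. ev (\<lambda>v. if v mod 5 = 3 then z_rf ^ (M * p ^ (s * v)) else e v) t \<notin> F)"
  proof
    fix t
    show "\<exists>M0. t \<in> set ts \<longrightarrow> (\<forall>M\<ge>M0. ev (\<lambda>v. if v mod 5 = 3 then z_rf ^ (M * p ^ (s * v)) else e v) t \<notin> F)"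
    proof (cases "t \<in> set ts")
      case True
      obtain v i where "v mod 5 = 3" "cf t v i \<noteq> 0" using xpart_canon_cf[OF ts[OF True]] by blast
      from large_values[where e = e, OF validD(1)[OF e] this(2,1) s[OF True]] show ?thesis by blast
    qed simp
  qed
  from choice[OF this] obtain M0 where M0: "\<And>t M. t \<in> set ts \<Longrightarrow> M \<ge> M0 t \<Longrightarrow>
      ev (\<lambda>v. if v mod 5 = 3 then z_rf ^ (M * p ^ (s * v)) else e v) t \<notin> F" by blast
  define M where "M = sum_list (map M0 ts)"
  have "M0 t \<le> M" if "t \<in> set ts" for t unfolding M_def using that by (intro sum_list_ge) auto
  then show ?thesis using M0 e
    by (intro exI[of _ "\<lambda>v. if v mod 5 = 3 then z_rf ^ (M * p ^ (s * v)) else e v"])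
      (auto simp: valid_def)
qed

subsection \<open>Coordinates for the parameter part\<close>

text \<open>For all values of its variables in F, \<open>fpart t\<close> lies in
  \<open>V (cn t)\<close>; the exponent \<open>cm t\<close> makes p^(cm t) exceed cn t * E, as
  \<open>bounded_components\<close> demands.\<close>

definition cn :: "form \<Rightarrow> nat" where "cn t = sum_list (map (\<lambda>u. mn u + md u) (fpart t))"
definition cm :: "form \<Rightarrow> nat" where "cm t = Suc (cn t * E)"
text \<open>The parameter part of \<open>t\<close> written through its components in R
  (\<open>wfm\<close>), and the same expression with variables for elements of F
  (\<open>dfm\<close>). The form can have a value in F only if the former components are of the
  latter sort.\<close>

definition wfm :: "nat \<Rightarrow> form \<Rightarrow> form" where
  "wfm K t = map (\<lambda>l. (5 * (K + l) + 1, cm t, l, cn t)) [0..<p ^ cm t]"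
definition dfm :: "nat \<Rightarrow> form \<Rightarrow> form" where
  "dfm K t = map (\<lambda>l. (5 * (K + l) + 2, cm t, l, cn t)) [0..<p ^ cm t]"
text \<open>A flag that is 0 if all components lie in F and 1 if some component does not. It makes
  this distinction, which concerns R, visible to a formula about F.\<close>

definition gv :: "nat \<Rightarrow> form \<Rightarrow> nat" where "gv K t = 5 * (K + p ^ cm t) + 2"
definition wrow :: "nat \<Rightarrow> form \<Rightarrow> form" where "wrow K t = upart t @ negf (wfm K t)"
definition cform :: "nat \<Rightarrow> form \<Rightarrow> form" where "cform K t = fpart t @ dfm K t"

text \<open>The case distinction in existential form: either each component equals its F-variable
  and the flag is 0, or a particular component lies outside F and the flag is 1.\<close>

definition calts :: "nat \<Rightarrow> form \<Rightarrow> alt list" where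
  "calts K t = (wrow K t # [(gv K t, 0, 0, 0)]
      # map (\<lambda>l. (5 * (K + l) + 1, 0, 0, 0) # negf [(5 * (K + l) + 2, 0, 0, 0)]) [0..<p ^ cm t], [], [])
    # map (\<lambda>l. ([wrow K t], [5 * (K + l) + 1], [gv K t])) [0..<p ^ cm t]"

definition combine :: "alt list \<Rightarrow> alt list \<Rightarrow> alt list" where
  "combine A C = concat (map (\<lambda>a. map (\<lambda>c. (fst a @ fst c, fst (snd a) @ fst (snd c), snd (snd a) @ snd (snd c))) C) A)"

lemma altsem_combine: "(\<exists>b\<in>set (combine A C). altsem e b) \<longleftrightarrow> (\<exists>a\<in>set A. altsem e a) \<and> (\<exists>c\<in>set C. altsem e c)"
proof -
  have key: "altsem e (fst a @ fst c, fst (snd a) @ fst (snd c), snd (snd a) @ snd (snd c)) \<longleftrightarrow> altsem e a \<and> altsem e c" for a c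
    unfolding altsem_def by auto
  have "(\<exists>b\<in>set (combine A C). altsem e b) \<longleftrightarrow> (\<exists>a\<in>set A. \<exists>c\<in>set C. altsem e a \<and> altsem e c)"
    by (simp add: combine_def key)
  then show ?thesis by blast
qed

lemma p_power_cm: "cn t * E < p ^ cm t"
proof -
  have "cm t < p ^ cm t" using p_gt_1 power_gt_expt[of p "cm t"] by simp
  then show ?thesis by (simp add: cm_def)
qed

lemma ev_wfm: "ev e (wfm K t) = inverse D ^ cn t * (\<Sum>l<p ^ cm t. z_rf ^ l * e (5 * (K + l) + 1) ^ (p ^ cm t))"
  and ev_dfm: "ev e (dfm K t) = inverse D ^ cn t * (\<Sum>l<p ^ cm t. z_rf ^ l * e (5 * (K + l) + 2) ^ (p ^ cm t))"
  unfolding wfm_def dfm_def ev_map_upt by (simp_all add: emon_def sum_distrib_left mult_ac)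

lemma calts_exists:
  assumes e: "valid e" and t: "\<And>u. u \<in> set t \<Longrightarrow> mv u < K"
  shows "\<exists>e'. valid e' \<and> (\<forall>v. v < K \<or> v mod 5 = 0 \<longrightarrow> e' v = e v) \<and> (\<exists>c\<in>set (calts K t). altsem e' c)"
proof -
  define w where "w = D ^ cn t * ev e (upart t)"
  have "w \<in> R" unfolding w_def using ev_R[OF validD(1)[OF e], where f = "upart t"] by simp
  then obtain n where n: "w \<in> V n" using R_V by blast
  have "n \<le> p ^ cm t * n" by (simp add: Suc_leI)
  then obtain y where y: "\<And>l. y l \<in> V n" "w = (\<Sum>l<p ^ cm t. z_rf ^ l * y l ^ (p ^ cm t))"
    using components[OF n] by metis
  define inF where "inF \<longleftrightarrow> (\<forall>l<p ^ cm t. y l \<in> F)"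
  define e' where "e' v = (if v < 5 * K then e v
     else if v mod 5 = 1 then y (v div 5 - K)
     else if v mod 5 = 2 then (if inF then (if v div 5 - K < p ^ cm t then y (v div 5 - K) else 0)
        else (if v div 5 - K = p ^ cm t then 1 else 0))
     else e v)" for v
  have e'1: "e' (5 * (K + l) + 1) = y l" for l
  proof -
    have "(5 * (K + l) + 1) div 5 - K = l" "(5 * (K + l) + 1) mod 5 = 1" by (simp_all only: mod5 diff_add_inverse)
    moreover have "\<not> 5 * (K + l) + 1 < 5 * K" using mod5(3)[of K l 1] by (simp only: not_less)
    ultimately show ?thesis unfolding e'_def by simp
  qed
  have e'2: "e' (5 * (K + l) + 2) = (if inF then (if l < p ^ cm t then y l else 0) else (if l = p ^ cm t then 1 else 0))" for l
  proof -
    have "(5 * (K + l) + 2) div 5 - K = l" "(5 * (K + l) + 2) mod 5 = 2" by (simp_all only: mod5 diff_add_inverse)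
    moreover have "\<not> 5 * (K + l) + 2 < 5 * K" using mod5(3)[of K l 2] by (simp only: not_less)
    ultimately show ?thesis unfolding e'_def by simp
  qed
  have F01: "0 \<in> F" "1 \<in> F" using rangeI[of const_rf 0] rangeI[of const_rf 1] by simp_all
  have "e' v \<in> R \<and> (v mod 5 = 2 \<or> v mod 5 = 4 \<longrightarrow> e' v \<in> F)" for v
    unfolding e'_def using validD[OF e, of v] V_R[OF y(1)] F01 by (simp add: inF_def del: image_iff)
  then have val: "valid e'" unfolding valid_def by blast
  have same: "e' v = e v" if "v < K \<or> v mod 5 = 0" for v using that unfolding e'_def by auto
  have "ev e' (upart t) = ev e (upart t)" by (rule ev_cong) (use t same in \<open>auto simp: upart_def\<close>)
  moreover have "ev e' (wfm K t) = ev e (upart t)"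
    unfolding ev_wfm e'1 y(2)[symmetric] w_def by (simp add: field_simps)
  ultimately have wr: "ev e' (wrow K t) = 0" by (simp add: wrow_def)
  have "\<exists>c\<in>set (calts K t). altsem e' c"
  proof (cases inF)
    case True
    have "e' (gv K t) = 0" unfolding gv_def e'2 using True by simp
    moreover have "e' (5 * (K + l) + 1) = e' (5 * (K + l) + 2)" if "l < p ^ cm t" for l
      unfolding e'1 e'2 using True that by simp
    ultimately show ?thesis using wr unfolding calts_def altsem_def
      by (intro bexI[of _ "hd (calts K t)"]) (auto simp: emon_def calts_def simp del: distrib_left_numeral One_nat_def)
  next
    case False
    then obtain l where l: "l < p ^ cm t" "y l \<notin> F" unfolding inF_def by blast
    have "e' (gv K t) = 1" unfolding gv_def e'2 using False by simp
    moreover have "e' (5 * (K + l) + 1) \<notin> F" unfolding e'1 by fact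
    ultimately have "altsem e' ([wrow K t], [5 * (K + l) + 1], [gv K t])" using wr unfolding altsem_def by simp
    moreover have "([wrow K t], [5 * (K + l) + 1], [gv K t]) \<in> set (calts K t)" using l(1) unfolding calts_def by auto
    ultimately show ?thesis by blast
  qed
  then show ?thesis using val same by blast
qed

text \<open>If \<open>t\<close> had a value in F, its parameter part would lie in
  \<open>V (cn t)\<close>, and by \<open>bounded_components\<close> all components would be
  constants. So a component outside F refutes both t \<in> F and t = 0; in the remaining alternative
  \<open>cform\<close> has the same value as \<open>t\<close>.\<close>

lemma calts_sound:
  assumes e: "valid e" "c \<in> set (calts K t)" "altsem e c" and e': "valid e'" "agree e e'"
    and t: "xpart t = []"
  shows "ev e' t \<in> F \<longleftrightarrow> e (gv K t) = 0 \<and> ev e' (cform K t) \<in> F"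
    and "ev e' t = 0 \<longleftrightarrow> e (gv K t) = 0 \<and> ev e' (cform K t) = 0"
proof -
  have agr: "ev e' g = ev e g" if "\<And>u. u \<in> set g \<Longrightarrow> mv u mod 5 \<noteq> 3 \<and> mv u mod 5 \<noteq> 4" for g
    by (rule ev_cong) (use that e'(2) in \<open>auto simp: agree_def\<close>)
  have kinds: "u \<in> set (wfm K t) \<Longrightarrow> mv u mod 5 = 1" "u \<in> set (dfm K t) \<Longrightarrow> mv u mod 5 = 2" for u
    by (auto simp: wfm_def dfm_def mod5_Suc simp del: distrib_left_numeral)
  have up: "ev e' (upart t) = ev e (upart t)" "ev e' (dfm K t) = ev e (dfm K t)"
    by (rule agr; auto simp: upart_def dest: kinds)+
  have ev_t: "ev e' t = ev e (upart t) + ev e' (fpart t)"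
    unfolding ev_parts[of e' t] t up(1) by simp
  have ev_c: "ev e' (cform K t) = ev e (dfm K t) + ev e' (fpart t)" by (simp add: cform_def up)
  have "wrow K t \<in> set (fst c)" using e(2) unfolding calts_def by auto
  then have "ev e (wrow K t) = 0" using e(3) unfolding altsem_def by blast
  then have w: "ev e (upart t) = ev e (wfm K t)" by (simp add: wrow_def)
  have F01: "(0 :: 'a poly fract) \<in> F" using rangeI[of const_rf 0] by simp
  have "(ev e' t \<in> F \<longleftrightarrow> e (gv K t) = 0 \<and> ev e' (cform K t) \<in> F) \<and>
        (ev e' t = 0 \<longleftrightarrow> e (gv K t) = 0 \<and> ev e' (cform K t) = 0)"
  proof (cases "c = hd (calts K t)")
    case True
    then have c: "fst c = wrow K t # [(gv K t, 0, 0, 0)]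
      # map (\<lambda>l. (5 * (K + l) + 1, 0, 0, 0) # negf [(5 * (K + l) + 2, 0, 0, 0)]) [0..<p ^ cm t]"
      by (simp add: calts_def)
    have "e (gv K t) = 0" using e(3) c unfolding altsem_def by (simp add: emon_def)
    moreover have "e (5 * (K + l) + 1) = e (5 * (K + l) + 2)" if "l < p ^ cm t" for l
    proof -
      have "(5 * (K + l) + 1, 0, 0, 0) # negf [(5 * (K + l) + 2, 0, 0, 0)] \<in> set (fst c)"
        unfolding c using that by (intro list.set_intros(2) image_eqI[of _ _ l]) simp_all
      then have "ev e ((5 * (K + l) + 1, 0, 0, 0) # negf [(5 * (K + l) + 2, 0, 0, 0)]) = 0"
        using e(3) unfolding altsem_def by blast
      then show ?thesis by (simp add: emon_def del: distrib_left_numeral One_nat_def)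
    qed
    then have "ev e (wfm K t) = ev e (dfm K t)" unfolding ev_wfm ev_dfm by simp
    ultimately show ?thesis unfolding ev_t ev_c w by simp
  next
    case False
    then obtain l where l: "l < p ^ cm t" "c = ([wrow K t], [5 * (K + l) + 1], [gv K t])"
      using e(2) unfolding calts_def by auto
    have "e (gv K t) = 1" "e (5 * (K + l) + 1) \<notin> F" using e(3) l(2) unfolding altsem_def by simp_all
    moreover have "ev e' t \<notin> F"
    proof
      assume tF: "ev e' t \<in> F"
      have "ev e' (fpart t) \<in> V (cn t)"
      proof (rule ev_V)
        fix u assume "u \<in> set (fpart t)"
        then show "mn u + md u \<le> cn t \<and> e' (mv u) \<in> F"
          using validD(2)[OF e'(1), of "mv u"] unfolding cn_def by (auto intro!: sum_list_ge simp: fpart_def)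
      qed
      then have "ev e (upart t) \<in> V (cn t)"
        using V_diff[OF V_F[OF tF]] unfolding ev_t by (metis add_diff_cancel_right')
      from bounded_components[OF this w[unfolded ev_wfm] p_power_cm validD(1)[OF e(1)] l(1)]
      show False using \<open>e (5 * (K + l) + 1) \<notin> F\<close> by blast
    qed
    ultimately show ?thesis using F01 by auto
  qed
  then show "ev e' t \<in> F \<longleftrightarrow> e (gv K t) = 0 \<and> ev e' (cform K t) \<in> F"
    and "ev e' t = 0 \<longleftrightarrow> e (gv K t) = 0 \<and> ev e' (cform K t) = 0" by blast+
qed

section \<open>Coordinates for a list of forms\<close>

definition alts_below :: "alt list \<Rightarrow> nat \<Rightarrow> bool" where
  "alts_below A K \<longleftrightarrow> (\<forall>a\<in>set A. (\<forall>r\<in>set (fst a). \<forall>u\<in>set r. mv u < K) \<and> (\<forall>v\<in>set (fst (snd a)). v < K)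
     \<and> (\<forall>v\<in>set (snd (snd a)). v < K))"

lemma alts_below_sbound: "alts_below alts (sbound (todo, fin, ineqs, alts, k))"
  unfolding alts_below_def
proof
  fix a assume "a \<in> set alts"
  then have "(fst a, fst (snd a), snd (snd a)) \<in> set alts" by simp
  from abound[OF this] show "(\<forall>r\<in>set (fst a). \<forall>u\<in>set r. mv u < sbound (todo, fin, ineqs, alts, k))
     \<and> (\<forall>v\<in>set (fst (snd a)). v < sbound (todo, fin, ineqs, alts, k))
     \<and> (\<forall>v\<in>set (snd (snd a)). v < sbound (todo, fin, ineqs, alts, k))" by blast
qed

lemma altsem_cong:
  assumes "alts_below A K" "a \<in> set A" "\<And>v. v < K \<Longrightarrow> e' v = e v"
  shows "altsem e' a = altsem e a"
proof -
  have "ev e' r = ev e r" if "r \<in> set (fst a)" for r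
    by (rule ev_cong) (use assms that in \<open>auto simp: alts_below_def\<close>)
  then show ?thesis using assms unfolding altsem_def alts_below_def by auto
qed

definition coord_step :: "form \<Rightarrow> alt list \<times> (nat \<times> form) list \<times> nat \<Rightarrow> alt list \<times> (nat \<times> form) list \<times> nat" where
  "coord_step t st = (combine (fst st) (calts (snd (snd st)) t),
     fst (snd st) @ [(gv (snd (snd st)) t, cform (snd (snd st)) t)], 5 * (snd (snd st) + p ^ cm t) + 3)"

definition coord_eq :: "(nat \<Rightarrow> 'a poly fract) \<Rightarrow> form \<Rightarrow> nat \<times> form \<Rightarrow> bool" where
  "coord_eq e t g \<longleftrightarrow> (\<forall>e'. valid e' \<and> agree e e' \<longrightarrow>
     (ev e' t \<in> F \<longleftrightarrow> e (fst g) = 0 \<and> ev e' (snd g) \<in> F) \<and> (ev e' t = 0 \<longleftrightarrow> e (fst g) = 0 \<and> ev e' (snd g) = 0))"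

lemma calts_below:
  assumes "\<And>u. u \<in> set t \<Longrightarrow> mv u < K"
  shows "alts_below (calts K t) (5 * (K + p ^ cm t) + 3)"
proof -
  have w: "mv u < 5 * (K + p ^ cm t) + 3" if "u \<in> set (wrow K t)" for u
    using that assms set_negf[of "wfm K t"]
    by (fastforce simp: wrow_def upart_def wfm_def)
  have n: "mv u < 5 * (K + p ^ cm t) + 3" if "u \<in> set (negf [(5 * (K + l) + 2, 0, 0, 0)])" "l < p ^ cm t" for u l
    using that set_negf[of "[(5 * (K + l) + 2, 0, 0, 0)]"] by auto
  show ?thesis
    unfolding alts_below_def calts_def using w n by (auto simp: gv_def)
qed

lemma kinds_cform: "u \<in> set (cform K t) \<Longrightarrow> mv u mod 5 = 2 \<or> mv u mod 5 = 4"
  unfolding cform_def fpart_def dfm_def by (auto simp: mod5_Suc simp del: distrib_left_numeral)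

lemma cform_below:
  assumes "\<And>u. u \<in> set t \<Longrightarrow> mv u < K" "u \<in> set (cform K t)"
  shows "mv u < 5 * (K + p ^ cm t) + 3"
  using assms by (fastforce simp: cform_def fpart_def dfm_def)

lemma combine_below: "alts_below A K \<Longrightarrow> alts_below C K' \<Longrightarrow> K \<le> K' \<Longrightarrow> alts_below (combine A C) K'"
  unfolding alts_below_def combine_def by (fastforce dest: order.strict_trans2)

text \<open>Invariant of the fold. Each form receives coordinates above the current bound, so that
  choosing them leaves the alternatives collected before intact, and each value of the parameters
  that satisfies the final alternatives yields the reduction of every form.\<close>

lemma coords_sound:
  assumes "\<forall>t\<in>set ts. xpart t = []" "\<forall>t\<in>set ts. \<forall>u\<in>set t. mv u < K" "alts_below A K"
    "fold coord_step ts (A, ps, K) = (A', ps', K')"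
  shows "K \<le> K' \<and> alts_below A' K'
   \<and> (\<forall>e. valid e \<and> (\<exists>a\<in>set A. altsem e a) \<longrightarrow>
        (\<exists>e'. valid e' \<and> (\<forall>v. v < K \<or> v mod 5 = 0 \<longrightarrow> e' v = e v) \<and> (\<exists>a\<in>set A'. altsem e' a)))
   \<and> (\<exists>qs. ps' = ps @ qs \<and> (\<forall>g\<in>set qs. fst g mod 5 = 2 \<and> fst g < K' \<and> (\<forall>u\<in>set (snd g). (mv u mod 5 = 2 \<or> mv u mod 5 = 4) \<and> mv u < K'))
        \<and> (\<forall>e. valid e \<and> (\<exists>a\<in>set A'. altsem e a) \<longrightarrow> (\<exists>a\<in>set A. altsem e a) \<and> list_all2 (coord_eq e) ts qs))"
  using assms
proof (induction ts arbitrary: A ps K)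
  case (Cons t ts)
  define A1 where "A1 = combine A (calts K t)"
  define K1 where "K1 = 5 * (K + p ^ cm t) + 3"
  define ps1 where "ps1 = ps @ [(gv K t, cform K t)]"
  have t: "xpart t = []" "\<And>u. u \<in> set t \<Longrightarrow> mv u < K"
    using Cons.prems(1,2) by auto
  have "K \<le> K1" unfolding K1_def by simp
  have bel1: "alts_below A1 K1" unfolding A1_def K1_def
    by (rule combine_below[OF Cons.prems(3) calts_below[OF t(2)]]) simp_all
  have fold1: "fold coord_step ts (A1, ps1, K1) = (A', ps', K')"
    using Cons.prems(4) unfolding A1_def K1_def ps1_def by (simp add: coord_step_def[of t])
  have xp: "\<forall>t'\<in>set ts. xpart t' = []" using Cons.prems(1) by simp
  have bd: "\<forall>t'\<in>set ts. \<forall>u\<in>set t'. mv u < K1"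
  proof (intro ballI)
    fix t' u assume "t' \<in> set ts" "u \<in> set t'"
    then have "mv u < K" using Cons.prems(2) by simp
    then show "mv u < K1" using \<open>K \<le> K1\<close> by simp
  qed
  from Cons.IH[OF xp bd bel1 fold1]
  have IH: "K1 \<le> K'" "alts_below A' K'"
    "\<And>e. valid e \<Longrightarrow> \<exists>a\<in>set A1. altsem e a \<Longrightarrow>
        \<exists>e'. valid e' \<and> (\<forall>v. v < K1 \<or> v mod 5 = 0 \<longrightarrow> e' v = e v) \<and> (\<exists>a\<in>set A'. altsem e' a)"
    "\<exists>qs. ps' = ps1 @ qs \<and> (\<forall>g\<in>set qs. fst g mod 5 = 2 \<and> fst g < K' \<and> (\<forall>u\<in>set (snd g). (mv u mod 5 = 2 \<or> mv u mod 5 = 4) \<and> mv u < K'))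
        \<and> (\<forall>e. valid e \<and> (\<exists>a\<in>set A'. altsem e a) \<longrightarrow> (\<exists>a\<in>set A1. altsem e a) \<and> list_all2 (coord_eq e) ts qs)"
    by blast+
  obtain qs where qs: "ps' = ps1 @ qs"
     "\<And>g. g \<in> set qs \<Longrightarrow> fst g mod 5 = 2 \<and> fst g < K' \<and> (\<forall>u\<in>set (snd g). (mv u mod 5 = 2 \<or> mv u mod 5 = 4) \<and> mv u < K')"
     "\<And>e. valid e \<Longrightarrow> \<exists>a\<in>set A'. altsem e a \<Longrightarrow> (\<exists>a\<in>set A1. altsem e a) \<and> list_all2 (coord_eq e) ts qs"
    using IH(4) by blast
  have ex: "\<exists>e'. valid e' \<and> (\<forall>v. v < K \<or> v mod 5 = 0 \<longrightarrow> e' v = e v) \<and> (\<exists>a\<in>set A'. altsem e' a)"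
    if e: "valid e" "\<exists>a\<in>set A. altsem e a" for e
  proof -
    obtain e1 where e1: "valid e1" "\<And>v. v < K \<or> v mod 5 = 0 \<Longrightarrow> e1 v = e v" "\<exists>c\<in>set (calts K t). altsem e1 c"
      using calts_exists[OF e(1) t(2)] by blast
    have "\<exists>a\<in>set A. altsem e1 a" using e(2) altsem_cong[OF Cons.prems(3), of _ e1 e] e1(2) by blast
    then have "\<exists>a\<in>set A1. altsem e1 a" unfolding A1_def altsem_combine using e1(3) by blast
    from IH(3)[OF e1(1) this] obtain e2 where e2: "valid e2" "\<And>v. v < K1 \<or> v mod 5 = 0 \<Longrightarrow> e2 v = e1 v"
      "\<exists>a\<in>set A'. altsem e2 a" by blast
    have "e2 v = e v" if "v < K \<or> v mod 5 = 0" for v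
      using that e1(2)[of v] e2(2)[of v] \<open>K \<le> K1\<close> by auto
    then show ?thesis using e2 by blast
  qed
  have bck: "(\<exists>a\<in>set A. altsem e a) \<and> list_all2 (coord_eq e) (t # ts) ((gv K t, cform K t) # qs)"
    if e: "valid e" "\<exists>a\<in>set A'. altsem e a" for e
  proof -
    have q: "\<exists>a\<in>set A1. altsem e a" "list_all2 (coord_eq e) ts qs" using qs(3)[OF e] by blast+
    then obtain c where c: "c \<in> set (calts K t)" "altsem e c" unfolding A1_def altsem_combine by blast
    have "coord_eq e t (gv K t, cform K t)"
      unfolding coord_eq_def using calts_sound[OF e(1) c _ _ t(1)] by simp
    moreover have "\<exists>a\<in>set A. altsem e a" using q(1) unfolding A1_def altsem_combine by blast
    ultimately show ?thesis using q(2) by simp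
  qed
  have "gv K t mod 5 = 2" "gv K t < K'"
    unfolding gv_def using IH(1) by (simp_all add: mod5_Suc K1_def del: distrib_left_numeral)
  moreover have "mv u mod 5 = 2 \<or> mv u mod 5 = 4" "mv u < K'" if "u \<in> set (cform K t)" for u
    using kinds_cform[OF that] cform_below[OF t(2) that] IH(1) unfolding K1_def by simp_all
  ultimately have qs': "ps' = ps @ ((gv K t, cform K t) # qs)"
     "\<forall>g\<in>set ((gv K t, cform K t) # qs). fst g mod 5 = 2 \<and> fst g < K' \<and> (\<forall>u\<in>set (snd g). (mv u mod 5 = 2 \<or> mv u mod 5 = 4) \<and> mv u < K')"
    using qs(1,2) unfolding ps1_def by auto
  show ?case
  proof (intro conjI)
    show "K \<le> K'" using IH(1) \<open>K \<le> K1\<close> by simp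
    show "alts_below A' K'" by (rule IH(2))
    show "\<forall>e. valid e \<and> (\<exists>a\<in>set A. altsem e a) \<longrightarrow> (\<exists>e'. valid e' \<and> (\<forall>v. v < K \<or> v mod 5 = 0 \<longrightarrow> e' v = e v) \<and> (\<exists>a\<in>set A'. altsem e' a))"
      using ex by blast
  qed (intro exI[of _ "(gv K t, cform K t) # qs"] conjI qs' allI impI bck; blast)
qed auto

text \<open>The conditions t \<notin> F are sorted by their canonical form, because variables of
  kind 3 whose coefficient vanishes must not count as unconstrained; the ones that keep such a
  variable are dropped on the strength of \<open>large_values_list\<close>.\<close>

definition finalize :: "state \<Rightarrow> (alt list \<times> (nat \<times> form) list) \<times> (nat \<times> form) list \<times> nat" where
  "finalize s = (let st1 = fold coord_step (fst (snd s)) (fst (snd (snd (snd s))), [], sbound s);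
     st2 = fold coord_step (filter (\<lambda>t. xpart t = []) (map canon (fst (snd (snd s))))) (fst st1, [], snd (snd st1))
     in ((fst st2, fst (snd st1)), fst (snd st2), snd (snd st2)))"

definition finished :: "state \<Rightarrow> bool" where
  "finished s \<longleftrightarrow> fst s = [] \<and> list_all (\<lambda>t. xpart t = []) (fst (snd s))"

text \<open>The leading number selects the kind of step; the remaining fields hold the data of all
  kinds. The type is made of numbers, pairs and lists, so every number codes a certificate. Data
  that fail the test of their step leave the state unchanged, hence every sequence is sound.\<close>

type_synonym cert = "nat \<times> nat \<times> nat list \<times> (nat \<times> nat \<times> nat) list \<times> nat \<times> chart_data"

definition step :: "cert \<Rightarrow> state \<Rightarrow> state" where
  "step c s = (if fst c = 0 then stepA (fst (snd c)) (fst (snd (snd c))) (fst (snd (snd (snd c)))) s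
     else if fst c = 1 then stepS (fst (snd (snd (snd (snd c))))) s
     else stepC (fst (snd (snd (snd (snd c))))) (snd (snd (snd (snd (snd c))))) s)"

definition run :: "cert list \<Rightarrow> state \<Rightarrow> state" where "run cs s = fold step cs s"

lemma valid_parts_cong:
  assumes "\<And>v. v mod 5 \<noteq> 3 \<Longrightarrow> e1 v = e2 v" "xpart t = []"
  shows "ev e1 t = ev e2 t"
proof (rule ev_cong)
  fix u assume "u \<in> set t"
  then have "mv u mod 5 \<noteq> 3" using assms(2) unfolding xpart_def filter_empty_conv by blast
  then show "e1 (mv u) = e2 (mv u)" by (rule assms(1))
qed

end

context elimination
begin

text \<open>The system that remains for the output of \<open>finalize\<close>: its forms contain
  only F-variables, of kind 2 for parameters and of kind 4 for bound ones.\<close>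

definition FS :: "(nat \<times> form) list \<Rightarrow> (nat \<times> form) list \<Rightarrow> (nat \<Rightarrow> 'a poly fract) \<Rightarrow> bool" where
  "FS rp ip e \<longleftrightarrow> (\<exists>e'. valid e' \<and> agree e e' \<and> (\<forall>g\<in>set rp. e (fst g) = 0 \<and> ev e' (snd g) = 0)
     \<and> (\<forall>g\<in>set ip. \<not> (e (fst g) = 0 \<and> ev e' (snd g) \<in> F)) \<and> sg e')"

lemma finalize_sound:
  assumes "finished s" "finalize s = ((A, rp), ip, K)"
  shows "\<And>e. valid e \<Longrightarrow> \<exists>a\<in>set (fst (snd (snd (snd s)))). altsem e a \<Longrightarrow>
        \<exists>e'. valid e' \<and> (\<forall>v. v mod 5 = 0 \<longrightarrow> e' v = e v) \<and> (\<exists>a\<in>set A. altsem e' a)"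
    and "\<And>e. valid e \<Longrightarrow> \<exists>a\<in>set A. altsem e a \<Longrightarrow>
        (\<exists>a\<in>set (fst (snd (snd (snd s)))). altsem e a) \<and> (St s e \<longleftrightarrow> FS rp ip e)"
    and "\<And>g. g \<in> set rp \<union> set ip \<Longrightarrow> fst g mod 5 = 2 \<and> fst g < K \<and> (\<forall>u\<in>set (snd g). (mv u mod 5 = 2 \<or> mv u mod 5 = 4) \<and> mv u < K)"
proof -
  obtain todo fin ineqs alts k where s: "s = (todo, fin, ineqs, alts, k)" by (cases s) auto
  have fin: "todo = []" "\<forall>t\<in>set fin. xpart t = []"
    using assms(1) unfolding finished_def s by (auto simp: list_all_iff)
  define ui where "ui = filter (\<lambda>t. xpart t = []) (map canon ineqs)"
  define K0 where "K0 = sbound s"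
  obtain A1 ps1 K1 where st1: "fold coord_step fin (alts, [], K0) = (A1, ps1, K1)"
    by (metis prod.collapse)
  obtain A2 ps2 K2 where st2: "fold coord_step ui (A1, [], K1) = (A2, ps2, K2)"
    by (metis prod.collapse)
  have res: "A = A2" "rp = ps1" "ip = ps2" "K = K2"
    using assms(2) st1 st2 unfolding finalize_def s K0_def ui_def by (auto simp: Let_def)
  have finb: "\<forall>t\<in>set fin. \<forall>u\<in>set t. mv u < K0"
    unfolding K0_def s by (intro ballI) (rule sbound(2))
  have ab: "alts_below alts K0" unfolding K0_def s by (rule alts_below_sbound)
  from coords_sound[OF fin(2) finb ab st1, unfolded append_Nil ex_simps simp_thms(39)]
  have c1: "K0 \<le> K1" "alts_below A1 K1"
    "\<And>e. valid e \<Longrightarrow> \<exists>a\<in>set alts. altsem e a \<Longrightarrow>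
        \<exists>e'. valid e' \<and> (\<forall>v. v < K0 \<or> v mod 5 = 0 \<longrightarrow> e' v = e v) \<and> (\<exists>a\<in>set A1. altsem e' a)"
    "\<And>g. g \<in> set ps1 \<Longrightarrow> fst g mod 5 = 2 \<and> fst g < K1 \<and> (\<forall>u\<in>set (snd g). (mv u mod 5 = 2 \<or> mv u mod 5 = 4) \<and> mv u < K1)"
    "\<And>e. valid e \<Longrightarrow> \<exists>a\<in>set A1. altsem e a \<Longrightarrow> (\<exists>a\<in>set alts. altsem e a) \<and> list_all2 (coord_eq e) fin ps1"
    by blast+
  have uib: "mv u < K1" if "t \<in> set ui" "u \<in> set t" for t u
  proof -
    obtain t' where t': "t' \<in> set ineqs" "t = canon t'" using \<open>t \<in> set ui\<close> unfolding ui_def by auto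
    then obtain u' where "u' \<in> set t'" "mv u = mv u'"
      using \<open>u \<in> set t\<close> set_rown[of _ t'] unfolding canon_def by fastforce
    then have "mv u < K0" unfolding K0_def s using sbound(3)[OF t'(1)] by metis
    then show ?thesis using c1(1) by simp
  qed
  have "\<forall>t\<in>set ui. xpart t = []" "\<forall>t\<in>set ui. \<forall>u\<in>set t. mv u < K1" using uib unfolding ui_def by auto
  from coords_sound[OF this c1(2) st2, unfolded append_Nil ex_simps simp_thms(39)]
  have c2: "K1 \<le> K2" "alts_below A2 K2"
    "\<And>e. valid e \<Longrightarrow> \<exists>a\<in>set A1. altsem e a \<Longrightarrow>
        \<exists>e'. valid e' \<and> (\<forall>v. v < K1 \<or> v mod 5 = 0 \<longrightarrow> e' v = e v) \<and> (\<exists>a\<in>set A2. altsem e' a)"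
    "\<And>g. g \<in> set ps2 \<Longrightarrow> fst g mod 5 = 2 \<and> fst g < K2 \<and> (\<forall>u\<in>set (snd g). (mv u mod 5 = 2 \<or> mv u mod 5 = 4) \<and> mv u < K2)"
    "\<And>e. valid e \<Longrightarrow> \<exists>a\<in>set A2. altsem e a \<Longrightarrow> (\<exists>a\<in>set A1. altsem e a) \<and> list_all2 (coord_eq e) ui ps2"
    by blast+
  show "\<exists>e'. valid e' \<and> (\<forall>v. v mod 5 = 0 \<longrightarrow> e' v = e v) \<and> (\<exists>a\<in>set A. altsem e' a)"
    if e: "valid e" "\<exists>a\<in>set (fst (snd (snd (snd s)))). altsem e a" for e
  proof -
    have "\<exists>a\<in>set alts. altsem e a" using e(2) unfolding s by simp
    from c1(3)[OF e(1) this] obtain e1 where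
      e1: "valid e1" "\<forall>v. v < K0 \<or> v mod 5 = 0 \<longrightarrow> e1 v = e v" "\<exists>a\<in>set A1. altsem e1 a" by (elim exE conjE)
    from c2(3)[OF e1(1,3)] obtain e2 where
      "valid e2" "\<forall>v. v < K1 \<or> v mod 5 = 0 \<longrightarrow> e2 v = e1 v" "\<exists>a\<in>set A2. altsem e2 a" by (elim exE conjE)
    then show ?thesis using e1(2) unfolding res by (intro exI[of _ e2]) simp
  qed
  show "fst g mod 5 = 2 \<and> fst g < K \<and> (\<forall>u\<in>set (snd g). (mv u mod 5 = 2 \<or> mv u mod 5 = 4) \<and> mv u < K)"
    if "g \<in> set rp \<union> set ip" for g
    using that c1(4)[of g] c2(4)[of g] c2(1) unfolding res by fastforce
  show "(\<exists>a\<in>set (fst (snd (snd (snd s)))). altsem e a) \<and> (St s e \<longleftrightarrow> FS rp ip e)"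
    if e: "valid e" "\<exists>a\<in>set A. altsem e a" for e
  proof
    have A1: "\<exists>a\<in>set A1. altsem e a" and l2: "list_all2 (coord_eq e) ui ps2" using c2(5)[of e] e unfolding res by blast+
    have A0: "\<exists>a\<in>set alts. altsem e a" and l1: "list_all2 (coord_eq e) fin ps1" using c1(5)[OF e(1) A1] by blast+
    show "\<exists>a\<in>set (fst (snd (snd (snd s)))). altsem e a" using A0 unfolding s by simp
    have rows: "(\<forall>t\<in>set fin. ev e' t = 0) \<longleftrightarrow> (\<forall>g\<in>set ps1. e (fst g) = 0 \<and> ev e' (snd g) = 0)"
      if "valid e'" "agree e e'" for e'
      using l1
    proof (induction rule: list_all2_induct)
      case (Cons x xs y ys)
      then show ?case using that unfolding coord_eq_def by simp
    qed simp
    have ins: "(\<forall>t\<in>set ui. ev e' t \<notin> F) \<longleftrightarrow> (\<forall>g\<in>set ps2. \<not> (e (fst g) = 0 \<and> ev e' (snd g) \<in> F))"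
      if "valid e'" "agree e e'" for e'
      using l2
    proof (induction rule: list_all2_induct)
      case (Cons x xs y ys)
      then show ?case using that unfolding coord_eq_def by simp
    qed simp
    show "St s e \<longleftrightarrow> FS rp ip e"
    proof
      assume "St s e"
      then obtain e' where e': "valid e'" "agree e e'" "hold s e'" "sg e'" unfolding St_def by blast
      have "\<forall>t\<in>set fin. ev e' t = 0" using e'(3) unfolding s by simp
      moreover have "\<forall>t\<in>set ui. ev e' t \<notin> F" using e'(3) unfolding s ui_def by (auto simp: ev_canon)
      ultimately show "FS rp ip e" unfolding FS_def res using rows[OF e'(1,2)] ins[OF e'(1,2)] e' by blast
    next
      assume "FS rp ip e"
      then obtain e' where e': "valid e'" "agree e e'" "\<forall>g\<in>set ps1. e (fst g) = 0 \<and> ev e' (snd g) = 0"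
        "\<forall>g\<in>set ps2. \<not> (e (fst g) = 0 \<and> ev e' (snd g) \<in> F)" "sg e'" unfolding FS_def res by blast
      have f: "\<forall>t\<in>set fin. ev e' t = 0" and u: "\<forall>t\<in>set ui. ev e' t \<notin> F"
        using rows[OF e'(1,2)] ins[OF e'(1,2)] e'(3,4) by blast+
      \<comment> \<open>The variables of kind 3 are given large values now; this changes neither the
        rows nor the conditions that were kept.\<close>
      obtain e2 where e2: "valid e2" "\<And>v. v mod 5 \<noteq> 3 \<Longrightarrow> e2 v = e' v"
        "\<And>t. t \<in> set (filter (\<lambda>t. xpart (canon t) \<noteq> []) ineqs) \<Longrightarrow> ev e2 t \<notin> F"
        using large_values_list[OF e'(1), of "filter (\<lambda>t. xpart (canon t) \<noteq> []) ineqs"] by auto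
      have "ev e2 t = 0" if "t \<in> set fin" for t
        using f that valid_parts_cong[of e2 e', OF e2(2) fin(2)[rule_format, OF that]] by simp
      moreover have "ev e2 t \<notin> F" if t: "t \<in> set ineqs" for t
      proof (cases "xpart (canon t) = []")
        case True
        then have "canon t \<in> set ui" using t unfolding ui_def by simp
        then have "ev e' (canon t) \<notin> F" using u by blast
        then show ?thesis using valid_parts_cong[of e2 e', OF e2(2) True] by (simp add: ev_canon)
      next
        case False
        then show ?thesis using e2(3) t by simp
      qed
      moreover have "sg e2 = sg e'" by (rule sg_cong) (use e2(2) in auto)
      moreover have "agree e e2" using e'(2) e2(2) unfolding agree_def by auto
      ultimately show "St s e" unfolding St_def s using e2(1) e'(5) fin(1)
        by (intro exI[of _ e2]) simp
    qed
  qed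
qed

text \<open>Existence is claimed for some parameters over given values of the free variables,
  equivalence with the initial system for all parameters that satisfy an alternative.\<close>

definition sound_state :: "state \<Rightarrow> state \<Rightarrow> bool" where
  "sound_state s0 s \<longleftrightarrow> k0 \<le> snd (snd (snd (snd s)))
   \<and> (\<forall>e. valid e \<longrightarrow> (\<exists>e'. valid e' \<and> (\<forall>v. v mod 5 = 0 \<longrightarrow> e' v = e v) \<and> (\<exists>a\<in>set (fst (snd (snd (snd s)))). altsem e' a)))
   \<and> (\<forall>e. valid e \<and> (\<exists>a\<in>set (fst (snd (snd (snd s)))). altsem e a) \<longrightarrow> (St s e \<longleftrightarrow> St s0 e))"

lemma sound_state_same_alts:
  assumes "sound_state s0 s" "fst (snd (snd (snd s'))) = fst (snd (snd (snd s)))"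
    "snd (snd (snd (snd s))) \<le> snd (snd (snd (snd s')))" "\<And>e. St s' e \<longleftrightarrow> St s e"
  shows "sound_state s0 s'"
  using assms unfolding sound_state_def by auto

lemma sound_state_step:
  assumes "sound_state s0 s"
  shows "sound_state s0 (step c s)"
proof -
  obtain todo fin ineqs alts k where s: "s = (todo, fin, ineqs, alts, k)" by (cases s) auto
  have k0: "k0 \<le> k" using assms unfolding sound_state_def s by simp
  have kle: "k \<le> sbound s" unfolding s by (rule sbound(4))
  have sub: "fst (snd (snd (snd (subst_state \<theta> s)))) = alts" "snd (snd (snd (snd (subst_state \<theta> s)))) = sbound s" for \<theta>
    unfolding subst_state_def s by simp_all
  have A: "sound_state s0 (stepA v b gs s)" for v b gs
  proof (rule sound_state_same_alts[OF assms])
    show "St (stepA v b gs s) e \<longleftrightarrow> St s e" for e by (rule St_stepA[OF s k0])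
  qed (use sub kle in \<open>auto simp: stepA_def s\<close>)
  have S: "sound_state s0 (stepS m s)" for m
  proof (rule sound_state_same_alts[OF assms])
    show "St (stepS m s) e \<longleftrightarrow> St s e" for e by (rule St_stepS[OF s k0])
  qed (use sub kle in \<open>auto simp: stepS_def s\<close>)
  have C: "sound_state s0 (stepC m ch s)" for m ch
  proof (cases "\<exists>r rs. todo = r # rs \<and> chart_ok r m ch")
    case False
    then have "stepC m ch s = s" unfolding stepC_def s by (auto split: list.split)
    then show ?thesis using assms by simp
  next
    case True
    then obtain r rs where r: "todo = r # rs" "chart_ok r m ch" by blast
    define K where "K = sbound s"
    define s' where "s' = chart_state K r m ch s"
    have s': "stepC m ch s = s'" unfolding stepC_def s'_def K_def s r(1) using r(2) by simp
    have s1: "s = (r # rs, fin, ineqs, alts, k)" using s r(1) by simp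
    have alts': "fst (snd (snd (snd s'))) = map (\<lambda>a. (altrow K r m ch # fst a, snd a)) alts"
      "snd (snd (snd (snd s'))) = K"
      unfolding s'_def chart_state_def s1 by (simp_all add: Let_def)
    have sem: "(\<exists>a\<in>set (fst (snd (snd (snd s')))). altsem e a) \<longleftrightarrow> ev e (altrow K r m ch) = 0 \<and> (\<exists>a\<in>set alts. altsem e a)" for e
      unfolding alts' by (auto simp: altsem_def)
    note snd1 = stepC_sound[OF s1 k0 r(2), folded K_def]
    show ?thesis unfolding s' sound_state_def
    proof (intro conjI allI impI)
      show "k0 \<le> snd (snd (snd (snd s')))" unfolding alts' K_def using k0 kle by simp
    next
      fix e assume e: "valid e"
      obtain e1 where e1: "valid e1" "\<And>v. v mod 5 = 0 \<Longrightarrow> e1 v = e v" "\<exists>a\<in>set alts. altsem e1 a"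
      proof -
        have "\<forall>e. valid e \<longrightarrow> (\<exists>e'. valid e' \<and> (\<forall>v. v mod 5 = 0 \<longrightarrow> e' v = e v) \<and> (\<exists>a\<in>set alts. altsem e' a))"
          using assms unfolding sound_state_def s by simp
        then show ?thesis using e that by blast
      qed
      obtain e2 where e2: "valid e2" "\<And>v. v < K \<or> v mod 5 = 0 \<Longrightarrow> e2 v = e1 v" "ev e2 (altrow K r m ch) = 0"
        using snd1(1)[OF e1(1)] by blast
      have "alts_below alts K" unfolding K_def s by (rule alts_below_sbound)
      then have "\<exists>a\<in>set alts. altsem e2 a" using e1(3) altsem_cong[of alts K _ e2 e1] e2(2) by blast
      then show "\<exists>e'. valid e' \<and> (\<forall>v. v mod 5 = 0 \<longrightarrow> e' v = e v) \<and> (\<exists>a\<in>set (fst (snd (snd (snd s')))). altsem e' a)"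
        unfolding sem using e2 e1(2) by (intro exI[of _ e2]) auto
    next
      fix e assume "valid e \<and> (\<exists>a\<in>set (fst (snd (snd (snd s')))). altsem e a)"
      then have e: "valid e" "ev e (altrow K r m ch) = 0" "\<exists>a\<in>set alts. altsem e a" unfolding sem by blast+
      have "St s e \<longleftrightarrow> St s0 e" using assms e unfolding sound_state_def s by simp
      then show "St s' e \<longleftrightarrow> St s0 e" using snd1(2)[OF e(1,2)] unfolding s'_def by simp
    qed
  qed
  show ?thesis unfolding step_def using A S C by simp
qed

lemma sound_state_run: "sound_state s0 s \<Longrightarrow> sound_state s0 (run cs s)"
  unfolding run_def by (induction cs arbitrary: s) (simp_all add: sound_state_step)

theorem elimination:
  assumes "k0 \<le> k" "finished (run cs (todo, [], ineqs, [([], [], [])], k))"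
    "finalize (run cs (todo, [], ineqs, [([], [], [])], k)) = ((A, rp), ip, K)"
  shows "\<And>e. valid e \<Longrightarrow> \<exists>e'. valid e' \<and> (\<forall>v. v mod 5 = 0 \<longrightarrow> e' v = e v) \<and> (\<exists>a\<in>set A. altsem e' a)"
    and "\<And>e. valid e \<Longrightarrow> \<exists>a\<in>set A. altsem e a \<Longrightarrow> St (todo, [], ineqs, [([], [], [])], k) e \<longleftrightarrow> FS rp ip e"
    and "\<And>g. g \<in> set rp \<union> set ip \<Longrightarrow> fst g mod 5 = 2 \<and> fst g < K \<and> (\<forall>u\<in>set (snd g). (mv u mod 5 = 2 \<or> mv u mod 5 = 4) \<and> mv u < K)"
proof -
  let ?a = "(todo, [], ineqs, [([], [], [])], k)" and ?b = "run cs (todo, [], ineqs, [([], [], [])], k)"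
  have "sound_state ?a ?a" using assms(1) unfolding sound_state_def by (auto simp: altsem_def)
  then have i: "sound_state ?a ?b" by (rule sound_state_run)
  note f = finalize_sound[OF assms(2,3)]
  show "\<exists>e'. valid e' \<and> (\<forall>v. v mod 5 = 0 \<longrightarrow> e' v = e v) \<and> (\<exists>a\<in>set A. altsem e' a)" if v: "valid e" for e
  proof -
    obtain e1 where e1: "valid e1" "\<And>v. v mod 5 = 0 \<Longrightarrow> e1 v = e v" "\<exists>a\<in>set (fst (snd (snd (snd ?b)))). altsem e1 a"
      using i[unfolded sound_state_def, THEN conjunct2, THEN conjunct1] v by blast
    from f(1)[OF e1(1,3)] show ?thesis using e1(2) by metis
  qed
  show "St ?a e \<longleftrightarrow> FS rp ip e" if "valid e" "\<exists>a\<in>set A. altsem e a" for e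
    using f(2)[OF that] i[unfolded sound_state_def, THEN conjunct2, THEN conjunct2] that(1) by blast
  show "fst g mod 5 = 2 \<and> fst g < K \<and> (\<forall>u\<in>set (snd g). (mv u mod 5 = 2 \<or> mv u mod 5 = 4) \<and> mv u < K)"
    if "g \<in> set rp \<union> set ip" for g using f(3)[OF that] .
qed

end

section \<open>Existence of an elimination sequence\<close>

context setting
begin

text \<open>The ring F_p[z]. Dependence relations and bases are sought here, so that every
  coefficient found has a list of exponents.\<close>

abbreviation PP :: "'a poly fract set" where "PP \<equiv> range pl"

lemma PP_closed [simp]:
  "0 \<in> PP" "1 \<in> PP" "x \<in> PP \<Longrightarrow> y \<in> PP \<Longrightarrow> x + y \<in> PP" "x \<in> PP \<Longrightarrow> y \<in> PP \<Longrightarrow> x * y \<in> PP"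
  "x \<in> PP \<Longrightarrow> - x \<in> PP" "x \<in> PP \<Longrightarrow> y \<in> PP \<Longrightarrow> x - y \<in> PP" "z_rf ^ n \<in> PP"
proof -
  show 0: "0 \<in> PP" by (rule image_eqI[of _ _ "[]"]) auto
  show 1: "1 \<in> PP" by (rule image_eqI[of _ _ "[0]"]) auto
  show add: "x + y \<in> PP" if "x \<in> PP" "y \<in> PP" for x y
    using that by (auto simp flip: pl_simps(3))
  show "x * y \<in> PP" if "x \<in> PP" "y \<in> PP" for x y
    using that by (auto simp flip: pl_concat_add)
  show neg: "- x \<in> PP" if "x \<in> PP" for x
    using that by (auto simp flip: pl_negf)
  show "x - y \<in> PP" if "x \<in> PP" "y \<in> PP" for x y
    using add[OF that(1) neg[OF that(2)]] by simp
  show "z_rf ^ n \<in> PP" by (rule image_eqI[of _ _ "[n]"]) auto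
qed

lemma PP_power [simp]: "x \<in> PP \<Longrightarrow> x ^ n \<in> PP"
  by (induction n) simp_all

lemma PP_sum [simp]: "(\<And>i. i \<in> A \<Longrightarrow> f i \<in> PP) \<Longrightarrow> sum f A \<in> PP"
  by (induction A rule: infinite_finite_induct) simp_all

lemma PP_E: "x \<in> PP \<Longrightarrow> \<exists>ns. pl ns = x" by auto

lemma PP_R: "x \<in> PP \<Longrightarrow> x \<in> R" by auto

text \<open>A power z^n contributes z^(n div q) to the component with index n mod q, so no roots of
  elements of F enter and the components stay in F_p[z].\<close>

lemma PP_components:
  assumes "w \<in> PP"
  obtains c where "\<And>l. c l \<in> PP" "w = (\<Sum>l<p ^ m. z_rf ^ l * c l ^ (p ^ m))"
proof -
  obtain ns where ns: "w = pl ns" using assms by blast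
  have "\<exists>c. (\<forall>l. c l \<in> PP) \<and> (pl ns :: 'a poly fract) = (\<Sum>l<p ^ m. z_rf ^ l * c l ^ (p ^ m))"
  proof (induction ns)
    case Nil
    have "(\<Sum>l<p ^ m. z_rf ^ l * 0 ^ (p ^ m)) = (0 :: 'a poly fract)" by (simp add: power_0_left)
    then show ?case by (intro exI[of _ "\<lambda>_. 0"]) simp
  next
    case (Cons n ns)
    then obtain c where c: "\<forall>l. c l \<in> PP" "(pl ns :: 'a poly fract) = (\<Sum>l<p ^ m. z_rf ^ l * c l ^ (p ^ m))" by blast
    define b where "b l = (if l = n mod p ^ m then z_rf ^ (n div p ^ m) else 0 :: 'a poly fract)" for l
    have "(\<Sum>l<p ^ m. z_rf ^ l * b l ^ (p ^ m)) = (\<Sum>l<p ^ m. if l = n mod p ^ m then z_rf ^ l * z_rf ^ (n div p ^ m * p ^ m) else 0)"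
      by (intro sum.cong) (auto simp: b_def power_0_left power_mult)
    also have "\<dots> = z_rf ^ n"
      by (simp add: mod_div_mult_eq flip: power_add)
    finally have "(\<Sum>l<p ^ m. z_rf ^ l * (b l + c l) ^ (p ^ m)) = pl (n # ns)"
      using c(2) by (simp add: frob_add distrib_left sum.distrib)
    moreover have "b l + c l \<in> PP" for l using c(1) unfolding b_def by simp
    ultimately show ?case by (intro exI[of _ "\<lambda>l. b l + c l"]) auto
  qed
  then show ?thesis using that ns by blast
qed

text \<open>Steinitz' exchange lemma over the field of \<open>p\<^sup>m\<close>-th powers, with denominators cleared.\<close>

lemma steinitz:
  fixes \<alpha> :: "nat \<Rightarrow> 'a poly fract"
  assumes "finite I" "\<And>i. i \<in> I \<Longrightarrow> \<alpha> i \<in> PP"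
    and "\<And>\<beta>. (\<And>i. \<beta> i \<in> PP) \<Longrightarrow> (\<Sum>i\<in>I. \<alpha> i * \<beta> i ^ (p ^ m)) = 0 \<Longrightarrow> (\<forall>i\<in>I. \<beta> i = 0)"
  shows "\<exists>J. J \<subseteq> {..<p ^ m} \<and> card I + card J = p ^ m \<and> (\<exists>\<delta>\<in>PP. \<delta> \<noteq> 0 \<and> (\<forall>l<p ^ m. \<exists>b c. (\<forall>i. b i \<in> PP \<and> c i \<in> PP) \<and>
     (\<Sum>i\<in>I. \<alpha> i * b i ^ (p ^ m)) + (\<Sum>e\<in>J. z_rf ^ e * c e ^ (p ^ m)) = \<delta> ^ (p ^ m) * z_rf ^ l))"
  using assms
proof (induction I rule: finite_induct)
  case empty
  have "(\<Sum>e<p ^ m. z_rf ^ e * (if e = l then 1 else 0) ^ (p ^ m)) = (z_rf ^ l :: 'a poly fract)" if "l < p ^ m" for l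
  proof -
    have "(\<Sum>e<p ^ m. z_rf ^ e * (if e = l then 1 else 0) ^ (p ^ m)) = (\<Sum>e<p ^ m. if e = l then z_rf ^ e else (0 :: 'a poly fract))"
      by (intro sum.cong) (auto simp: power_0_left)
    then show ?thesis using that by simp
  qed
  then have "\<forall>l<p ^ m. \<exists>b c. (\<forall>i. b i \<in> PP \<and> c i \<in> PP) \<and>
     (\<Sum>i\<in>{}. \<alpha> i * b i ^ (p ^ m)) + (\<Sum>e\<in>{..<p ^ m}. z_rf ^ e * c e ^ (p ^ m)) = 1 ^ (p ^ m) * z_rf ^ l"
    by (intro allI impI exI[of _ "\<lambda>_. 0"] exI[of _ "\<lambda>e. if e = _ then 1 else 0"]) simp
  then show ?case by (intro exI[of _ "{..<p ^ m}"] conjI bexI[of _ 1]) auto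
next
  case (insert x I)
  let ?q = "p ^ m"
  have ind: "\<forall>i\<in>I. \<beta> i = 0" if "\<And>i. \<beta> i \<in> PP" "(\<Sum>i\<in>I. \<alpha> i * \<beta> i ^ ?q) = 0" for \<beta>
  proof -
    have "(\<Sum>i\<in>insert x I. \<alpha> i * (\<beta>(x := 0)) i ^ ?q) = (\<Sum>i\<in>I. \<alpha> i * \<beta> i ^ ?q)"
      using insert(1,2) by (simp add: power_0_left) (intro sum.cong, auto)
    then have "\<forall>i\<in>insert x I. (\<beta>(x := 0)) i = 0" using that by (intro insert.prems(2)) auto
    then show ?thesis using insert(2) by (metis fun_upd_other insertI2)
  qed
  have "\<exists>J. J \<subseteq> {..<p ^ m} \<and> card I + card J = p ^ m \<and> (\<exists>\<delta>\<in>PP. \<delta> \<noteq> 0 \<and> (\<forall>l<p ^ m. \<exists>b c. (\<forall>i. b i \<in> PP \<and> c i \<in> PP) \<and>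
     (\<Sum>i\<in>I. \<alpha> i * b i ^ (p ^ m)) + (\<Sum>e\<in>J. z_rf ^ e * c e ^ (p ^ m)) = \<delta> ^ (p ^ m) * z_rf ^ l))"
    by (rule insert.IH) (use insert.prems(1) in blast, rule ind)
  then obtain J \<delta> where J: "J \<subseteq> {..<?q}" "card I + card J = ?q" and \<delta>: "\<delta> \<in> PP" "\<delta> \<noteq> 0"
    and sp: "\<forall>l<?q. \<exists>b c. (\<forall>i. b i \<in> PP \<and> c i \<in> PP) \<and>
       (\<Sum>i\<in>I. \<alpha> i * b i ^ ?q) + (\<Sum>e\<in>J. z_rf ^ e * c e ^ ?q) = \<delta> ^ ?q * z_rf ^ l"
    by (elim exE conjE bexE)
  have fin: "finite J" using J(1) finite_subset by blast
  define Q where "Q l b c \<longleftrightarrow> (\<forall>i. b i \<in> PP \<and> c i \<in> PP) \<and>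
       (\<Sum>i\<in>I. \<alpha> i * b i ^ ?q) + (\<Sum>e\<in>J. z_rf ^ e * c e ^ ?q) = \<delta> ^ ?q * z_rf ^ l" for l b c
  have "\<forall>l. \<exists>bc. l < ?q \<longrightarrow> Q l (fst bc) (snd bc)"
  proof
    fix l
    show "\<exists>bc. l < ?q \<longrightarrow> Q l (fst bc) (snd bc)"
    proof (cases "l < ?q")
      case True
      then obtain b c where "Q l b c" using sp unfolding Q_def by (elim allE impE exE)
      then show ?thesis by (intro exI[of _ "(b, c)"]) simp
    qed simp
  qed
  from choice[OF this] obtain bc where QQ: "\<forall>l. l < ?q \<longrightarrow> Q l (fst (bc l)) (snd (bc l))" ..
  define b where "b l = fst (bc l)" for l
  define c where "c l = snd (bc l)" for l
  have Q: "Q l (b l) (c l)" if "l < ?q" for l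
    using QQ that unfolding b_def c_def by simp
  have bc: "\<And>l i. l < ?q \<Longrightarrow> b l i \<in> PP" "\<And>l i. l < ?q \<Longrightarrow> c l i \<in> PP"
    "\<And>l. l < ?q \<Longrightarrow> (\<Sum>i\<in>I. \<alpha> i * b l i ^ ?q) + (\<Sum>e\<in>J. z_rf ^ e * c l e ^ ?q) = \<delta> ^ ?q * z_rf ^ l"
    using Q unfolding Q_def by (blast, blast, simp)
  obtain w where w: "\<And>l. w l \<in> PP" "\<alpha> x = (\<Sum>l<?q. z_rf ^ l * w l ^ ?q)"
    using PP_components[of "\<alpha> x" m] insert.prems(1) by blast
  \<comment> \<open>Coefficients of the new vector \<alpha>_x, multiplied by \<delta>^q, in the
    basis found so far.\<close>
  define u where "u i = (\<Sum>l<?q. b l i * w l)" for i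
  define t where "t e = (\<Sum>l<?q. c l e * w l)" for e
  have ut: "u i \<in> PP" "t e \<in> PP" for i e unfolding u_def t_def using bc(1,2) w(1) by (auto intro!: PP_sum PP_closed(4))
  have "\<delta> ^ ?q * \<alpha> x = (\<Sum>l<?q. (\<delta> ^ ?q * z_rf ^ l) * w l ^ ?q)"
    unfolding w(2) by (simp add: sum_distrib_left mult.assoc)
  also have "\<dots> = (\<Sum>l<?q. ((\<Sum>i\<in>I. \<alpha> i * b l i ^ ?q) + (\<Sum>e\<in>J. z_rf ^ e * c l e ^ ?q)) * w l ^ ?q)"
    by (intro sum.cong) (simp_all add: bc(3))
  also have "\<dots> = (\<Sum>i\<in>I. \<alpha> i * u i ^ ?q) + (\<Sum>e\<in>J. z_rf ^ e * t e ^ ?q)"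
    unfolding u_def t_def frob_sum
    by (simp add: distrib_right sum.distrib sum_distrib_left sum_distrib_right power_mult_distrib mult.assoc sum.swap[of _ "{..<?q}"])
  finally have rel: "\<delta> ^ ?q * \<alpha> x = (\<Sum>i\<in>I. \<alpha> i * u i ^ ?q) + (\<Sum>e\<in>J. z_rf ^ e * t e ^ ?q)" .
  \<comment> \<open>Some power z^e must occur with a nonzero coefficient, since otherwise
    \<open>rel\<close> is a relation among the \<alpha>_i with the nonzero coefficient -\<delta> at
    x.\<close>
  obtain e0 where e0: "e0 \<in> J" "t e0 \<noteq> 0"
  proof (rule ccontr)
    assume "\<not> thesis"
    then have "\<And>e. e \<in> J \<Longrightarrow> t e = 0" using that by blast
    then have rel0: "\<delta> ^ ?q * \<alpha> x = (\<Sum>i\<in>I. \<alpha> i * u i ^ ?q)" using rel by (simp add: power_0_left)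
    define \<beta> where "\<beta> i = (if i = x then - \<delta> else u i)" for i
    have "(\<Sum>i\<in>I. \<alpha> i * \<beta> i ^ ?q) = (\<Sum>i\<in>I. \<alpha> i * u i ^ ?q)"
      using insert(2) by (intro sum.cong) (auto simp: \<beta>_def)
    then have "(\<Sum>i\<in>insert x I. \<alpha> i * \<beta> i ^ ?q) = 0"
      using insert(1,2) rel0 by (simp add: \<beta>_def frob_minus mult.commute)
    moreover have "\<And>i. \<beta> i \<in> PP" using ut \<delta>(1) unfolding \<beta>_def by auto
    ultimately have "\<beta> x = 0" using insert.prems(2)[of \<beta>] by blast
    then show False using \<delta>(2) by (simp add: \<beta>_def)
  qed
  have "\<exists>b' c'. (\<forall>i. b' i \<in> PP \<and> c' i \<in> PP) \<and>
     (\<Sum>i\<in>insert x I. \<alpha> i * b' i ^ ?q) + (\<Sum>e\<in>J - {e0}. z_rf ^ e * c' e ^ ?q) = (\<delta> * t e0) ^ ?q * z_rf ^ l" if l: "l < ?q" for l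
  proof -
    \<comment> \<open>The identity for z^l is multiplied by t(e0)^q, and the multiple of z^(e0) in
      it is replaced by means of \<open>rel\<close>; accordingly c' vanishes at e0.\<close>
    define b' where "b' i = (if i = x then \<delta> * c l e0 else t e0 * b l i - c l e0 * u i)" for i
    define c' where "c' e = t e0 * c l e - c l e0 * t e" for e
    have "b' i \<in> PP \<and> c' i \<in> PP" for i
      unfolding b'_def c'_def using bc(1,2)[OF l] ut \<delta>(1) by simp
    moreover have "(\<Sum>i\<in>insert x I. \<alpha> i * b' i ^ ?q) + (\<Sum>e\<in>J - {e0}. z_rf ^ e * c' e ^ ?q) = (\<delta> * t e0) ^ ?q * z_rf ^ l"
    proof -
      have "(\<Sum>i\<in>I. \<alpha> i * b' i ^ ?q) = (\<Sum>i\<in>I. \<alpha> i * (t e0 * b l i - c l e0 * u i) ^ ?q)"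
        using insert(2) by (intro sum.cong) (auto simp: b'_def)
      also have "\<dots> = t e0 ^ ?q * (\<Sum>i\<in>I. \<alpha> i * b l i ^ ?q) - c l e0 ^ ?q * (\<Sum>i\<in>I. \<alpha> i * u i ^ ?q)"
        by (simp add: frob_diff power_mult_distrib right_diff_distrib sum_subtractf sum_distrib_left mult.left_commute)
      finally have s1: "(\<Sum>i\<in>I. \<alpha> i * b' i ^ ?q) = t e0 ^ ?q * (\<Sum>i\<in>I. \<alpha> i * b l i ^ ?q) - c l e0 ^ ?q * (\<Sum>i\<in>I. \<alpha> i * u i ^ ?q)" .
      have "(\<Sum>e\<in>J. z_rf ^ e * c' e ^ ?q) = t e0 ^ ?q * (\<Sum>e\<in>J. z_rf ^ e * c l e ^ ?q) - c l e0 ^ ?q * (\<Sum>e\<in>J. z_rf ^ e * t e ^ ?q)"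
        by (simp add: c'_def frob_diff power_mult_distrib right_diff_distrib sum_subtractf sum_distrib_left mult.left_commute)
      moreover have "(\<Sum>e\<in>J. z_rf ^ e * c' e ^ ?q) = (\<Sum>e\<in>J - {e0}. z_rf ^ e * c' e ^ ?q)"
        by (subst sum.remove[OF fin e0(1)]) (simp add: c'_def mult.commute power_0_left)
      ultimately have s2: "(\<Sum>e\<in>J - {e0}. z_rf ^ e * c' e ^ ?q) = t e0 ^ ?q * (\<Sum>e\<in>J. z_rf ^ e * c l e ^ ?q) - c l e0 ^ ?q * (\<Sum>e\<in>J. z_rf ^ e * t e ^ ?q)"
        by simp
      have "(\<Sum>i\<in>insert x I. \<alpha> i * b' i ^ ?q) + (\<Sum>e\<in>J - {e0}. z_rf ^ e * c' e ^ ?q)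
          = \<alpha> x * (\<delta> * c l e0) ^ ?q + t e0 ^ ?q * ((\<Sum>i\<in>I. \<alpha> i * b l i ^ ?q) + (\<Sum>e\<in>J. z_rf ^ e * c l e ^ ?q))
            - c l e0 ^ ?q * ((\<Sum>i\<in>I. \<alpha> i * u i ^ ?q) + (\<Sum>e\<in>J. z_rf ^ e * t e ^ ?q))"
        unfolding sum.insert[OF insert(1,2)] s1 s2 by (simp add: b'_def algebra_simps)
      also have "\<dots> = (\<delta> * t e0) ^ ?q * z_rf ^ l"
        unfolding bc(3)[OF l] rel[symmetric] by (simp add: power_mult_distrib mult_ac)
      finally show ?thesis .
    qed
    ultimately show ?thesis by blast
  qed
  moreover have "card (insert x I) + card (J - {e0}) = ?q"
    using J(2) insert(1,2) e0(1) fin card_gt_0_iff[of J] by auto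
  moreover have "\<delta> * t e0 \<in> PP" "\<delta> * t e0 \<noteq> 0" using \<delta> e0(2) ut by simp_all
  ultimately show ?case using J(1) by (intro exI[of _ "J - {e0}"] conjI bexI[of _ "\<delta> * t e0"]) auto
qed

lemma set_rown_mi: "m \<in> set (rown f) \<Longrightarrow> \<exists>m'\<in>set f. mv m = mv m' \<and> mi m = mi m'"
proof -
  assume "m \<in> set (rown f)"
  then have "m \<in> set (clr (maxd f) f)" unfolding rown_def using set_nrm by blast
  then show ?thesis unfolding clr_def by force
qed

lemma cf_subst:
  "cf (subst \<theta> f) w i = (\<Sum>m\<leftarrow>f. if mi m \<le> i
     then z_rf ^ mn m * inverse D ^ md m * cf (\<theta> (mv m)) w (i - mi m) ^ (p ^ mi m) else 0)"
proof (induction f)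
  case (Cons m f)
  have "cf (map (\<lambda>u. (mv u, mi u + mi m, mn m + p ^ mi m * mn u, md m + p ^ mi m * md u)) g) w i
      = (if mi m \<le> i then z_rf ^ mn m * inverse D ^ md m * cf g w (i - mi m) ^ (p ^ mi m) else 0)" for g
  proof (induction g)
    case (Cons u g)
    have "mi u + mi m = i \<longleftrightarrow> mi m \<le> i \<and> mi u = i - mi m" by auto
    moreover have "z_rf ^ (mn m + p ^ mi m * mn u) * inverse D ^ (md m + p ^ mi m * md u)
        = z_rf ^ mn m * inverse D ^ md m * (z_rf ^ mn u * inverse D ^ md u) ^ (p ^ mi m)"
      by (simp add: power_add power_mult_distrib mult_ac flip: power_mult)
    ultimately show ?case using Cons by (auto simp: frob_add algebra_simps power_0_left)
  qed (simp add: power_0_left)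
  then show ?case using Cons by (simp add: subst_def)
qed (simp add: subst_def)

section \<open>Leading exponents and the termination measure\<close>

lemma foldr_max_ge: "(x::nat) \<in> set xs \<Longrightarrow> x \<le> foldr max xs 0"
  by (induction xs) auto

lemma foldr_max_in: "xs \<noteq> [] \<Longrightarrow> foldr max xs (0::nat) \<in> set xs"
proof (induction xs)
  case (Cons x xs)
  then show ?case by (cases "xs = []") (auto simp: max_def)
qed simp

lemma dg_ge: "u \<in> set r \<Longrightarrow> mv u = v \<Longrightarrow> mi u \<le> dg v r"
  unfolding dg_def by (rule foldr_max_ge) auto

lemma dg_ex:
  assumes "u \<in> set r" "mv u = v"
  obtains u' where "u' \<in> set r" "mv u' = v" "mi u' = dg v r"
proof -
  have "dg v r \<in> set (map (\<lambda>m. mi m) (filter (\<lambda>m. mv m = v) r))"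
    unfolding dg_def by (rule foldr_max_in) (use assms in \<open>auto simp: filter_empty_conv\<close>)
  then show ?thesis using that by auto
qed

definition xv :: "form \<Rightarrow> nat set" where "xv r = (\<lambda>u. mv u) ` set (xpart r)"

text \<open>The successor makes the disappearance of a variable count as well as the decrease of its
  leading exponent.\<close>

definition mu :: "form \<Rightarrow> nat" where "mu r = (\<Sum>v\<in>xv r. Suc (dg v r))"

lemma finite_xv [simp]: "finite (xv r)" unfolding xv_def by simp

lemma xv_kind: "v \<in> xv r \<Longrightarrow> v mod 5 = 3" unfolding xv_def xpart_def by auto

lemma xv_I: "u \<in> set r \<Longrightarrow> mv u mod 5 = 3 \<Longrightarrow> mv u \<in> xv r" unfolding xv_def xpart_def by auto

lemma xv_E:
  assumes "v \<in> xv r"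
  obtains u where "u \<in> set r" "mv u = v"
  using assms unfolding xv_def xpart_def by auto

lemma mu_less:
  assumes "\<And>u. u \<in> set r' \<Longrightarrow> mv u mod 5 = 3 \<Longrightarrow> mv u \<in> xv r \<and> mi u \<le> dg (mv u) r"
    and "v0 \<in> xv r" "\<And>u. u \<in> set r' \<Longrightarrow> mv u = v0 \<Longrightarrow> mi u < dg v0 r"
  shows "mu r' < mu r"
proof -
  have sub: "xv r' \<subseteq> xv r"
  proof
    fix v assume v: "v \<in> xv r'"
    then obtain u where "u \<in> set r'" "mv u = v" by (rule xv_E)
    then show "v \<in> xv r" using assms(1)[of u] xv_kind[OF v] by simp
  qed
  define h where "h v = (if v \<in> xv r' then Suc (dg v r') else 0)" for v
  have le: "h v \<le> Suc (dg v r)" if "v \<in> xv r" for v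
  proof (cases "v \<in> xv r'")
    case True
    then obtain u where "u \<in> set r'" "mv u = v" by (rule xv_E)
    then obtain u' where "u' \<in> set r'" "mv u' = v" "mi u' = dg v r'" by (rule dg_ex)
    then show ?thesis using assms(1)[of u'] True xv_kind[OF True] by (simp add: h_def)
  qed (simp add: h_def)
  have less: "h v0 < Suc (dg v0 r)"
  proof (cases "v0 \<in> xv r'")
    case True
    then obtain u where "u \<in> set r'" "mv u = v0" by (rule xv_E)
    then obtain u' where "u' \<in> set r'" "mv u' = v0" "mi u' = dg v0 r'" by (rule dg_ex)
    then show ?thesis using assms(3)[of u'] True by (simp add: h_def)
  qed (simp add: h_def)
  have "mu r' = (\<Sum>v\<in>xv r. h v)"
    unfolding mu_def by (rule sum.mono_neutral_cong_left) (use sub in \<open>auto simp: h_def\<close>)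
  also have "\<dots> < mu r" unfolding mu_def
    by (rule sum_strict_mono_ex1) (use le less assms(2) in auto)
  finally show ?thesis .
qed

lemma sum_list_cf:
  assumes "finite A"
  shows "(\<Sum>m\<leftarrow>f. if mv m \<in> A \<and> mi m = d (mv m) then z_rf ^ mn m * inverse D ^ md m * h (mv m) else 0)
    = (\<Sum>v\<in>A. cf f v (d v) * h v)"
proof (induction f)
  case (Cons m f)
  have "(\<Sum>v\<in>A. cf (m # f) v (d v) * h v) = (\<Sum>v\<in>A. (if v = mv m then
      (if mi m = d (mv m) then z_rf ^ mn m * inverse D ^ md m * h (mv m) else 0) else 0) + cf f v (d v) * h v)"
    by (intro sum.cong) (auto simp: algebra_simps)
  then show ?case using Cons assms by (simp add: sum.distrib)
qed simp

lemma filter_concat_pairs: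
  assumes "distinct xs"
  shows "filter (\<lambda>g. fst g = v) (concat (map (\<lambda>w. map (\<lambda>n. (w, h w, n)) (k w)) xs))
    = (if v \<in> set xs then map (\<lambda>n. (v, h v, n)) (k v) else [])"
  using assms
proof (induction xs)
  case (Cons w xs)
  have "filter (\<lambda>g. fst g = v) (map (\<lambda>n. (w, h w, n)) ns) = (if v = w then map (\<lambda>n. (w, h w, n)) ns else [])" for ns
    by (induction ns) auto
  then show ?case using Cons by (cases "v = w") auto
qed simp

text \<open>A relation between the leading coefficients allows to lower the degree in one of the variables.\<close>

lemma stepA_decreases:
  assumes r: "r = rown f" and dep: "(\<Sum>v\<in>xv r. cf r v (dg v r) * pl (\<gamma> v) ^ (p ^ dg v r)) = 0"
    and v1: "v1 \<in> xv r" "\<not> plz (\<gamma> v1)"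
  obtains v0 b gs where "v0 mod 5 = 3" "\<not> plz b" "\<And>K. mu (rown (subst (thA K v0 b gs) r)) < mu r"
proof -
  define N where "N = {v \<in> xv r. \<not> plz (\<gamma> v)}"
  have N: "finite N" "N \<noteq> {}" using v1 unfolding N_def by auto
  \<comment> \<open>The variable v0 has the largest leading exponent among those with a nonzero
    multiplier, so that the powers p^(d0 - dg v r) needed for the others exist.\<close>
  define d0 where "d0 = Max ((\<lambda>v. dg v r) ` N)"
  have "d0 \<in> (\<lambda>v. dg v r) ` N" unfolding d0_def by (rule Max_in) (use N in auto)
  then obtain v0 where v0: "v0 \<in> N" "d0 = dg v0 r" by auto
  have max: "dg v r \<le> d0" if "v \<in> N" for v
    unfolding d0_def by (rule Max_ge) (use N that in auto)
  \<comment> \<open>A variable whose multiplier vanishes may have a leading exponent above d0, where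
    the truncated difference would produce too high a degree; the empty list keeps it out of
    \<open>gs\<close>.\<close>
  define g' where "g' v = (if plz (\<gamma> v) then [] else \<gamma> v)" for v
  define gs where "gs = concat (map (\<lambda>v. map (\<lambda>n. (v, d0 - dg v r, n)) (g' v)) (sorted_list_of_set (xv r - {v0})))"
  have v0x: "v0 \<in> xv r" "v0 mod 5 = 3" "\<not> plz (\<gamma> v0)" using v0 xv_kind unfolding N_def by auto
  have gs: "filter (\<lambda>g. fst g = v) gs = (if v \<in> xv r - {v0} then map (\<lambda>n. (v, d0 - dg v r, n)) (g' v) else [])" for v
    unfolding gs_def by (subst filter_concat_pairs) auto
  have "mu (rown (subst (thA K v0 (\<gamma> v0) gs) r)) < mu r" for K
  proof -
    define \<theta> where "\<theta> = thA K v0 (\<gamma> v0) gs"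
    have th0: "\<theta> v0 = map (\<lambda>n. (v0, 0, n, 0)) (\<gamma> v0) @ map (\<lambda>l. (5 * (K + l) + 4, 0, l, 0)) [0..<Suc (sum_list (\<gamma> v0))]"
      unfolding \<theta>_def thA_def by simp
    have th1: "\<theta> v = (v, 0, 0, 0) # map (\<lambda>n. (v0, d0 - dg v r, n, 0)) (g' v)" if "v \<in> xv r" "v \<noteq> v0" for v
      unfolding \<theta>_def thA_def using that xv_kind[OF that(1)] by (simp add: gs comp_def)
    have th2: "\<theta> v = [(v, 0, 0, 0)]" if "v mod 5 \<noteq> 3" for v
      unfolding \<theta>_def thA_def using that v0x(2) by auto
    have cf0: "cf (\<theta> v0) v0 i = (if i = 0 then pl (\<gamma> v0) else 0)" for i
    proof -
      have "cf (map (\<lambda>n. (v0, 0, n, 0)) ns) v0 i = (if i = 0 then pl ns else 0)" for ns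
        by (induction ns) auto
      moreover have "cf (map (\<lambda>l. (5 * (K + l) + 4, 0, l, 0)) ls) v0 i = 0" for ls
        by (rule cf_notin) (use v0x(2) mod5(1)[of 4] in \<open>auto simp del: distrib_left_numeral\<close>)
      ultimately show ?thesis unfolding th0 by (simp del: upt_Suc distrib_left_numeral)
    qed
    have cf1: "cf (\<theta> v) v0 i = (if i = d0 - dg v r then pl (g' v) else 0)" if "v \<in> xv r" "v \<noteq> v0" for v i
    proof -
      have "cf (map (\<lambda>n. (v0, d0 - dg v r, n, 0)) ns) v0 i = (if i = d0 - dg v r then pl ns else 0)" for ns
        by (induction ns) auto
      then show ?thesis unfolding th1[OF that] using that(2) by simp
    qed
    have cf2: "cf (\<theta> v) v0 i = 0" if "v mod 5 \<noteq> 3" for v i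
      unfolding th2[OF that] using that v0x(2) by auto
    have pg: "pl (g' v) = (pl (\<gamma> v) :: 'a poly fract)" for v unfolding g'_def by (simp add: plz_iff)
    have trm: "(if mi m \<le> d0 then z_rf ^ mn m * inverse D ^ md m * cf (\<theta> (mv m)) v0 (d0 - mi m) ^ (p ^ mi m) else 0)
      = (if mv m \<in> xv r \<and> mi m = dg (mv m) r then z_rf ^ mn m * inverse D ^ md m * pl (g' (mv m)) ^ (p ^ dg (mv m) r) else 0)"
      if m: "m \<in> set r" for m
    proof -
      consider "mv m mod 5 \<noteq> 3" | "mv m = v0" | "mv m \<in> xv r" "mv m \<noteq> v0" using xv_I[OF m] by blast
      then show ?thesis
      proof cases
        case 1
        then have "mv m \<notin> xv r" using xv_kind by blast
        then show ?thesis by (simp add: cf2[OF 1] power_0_left)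
      next
        case 2
        have "mi m \<le> d0" using dg_ge[OF m 2] v0(2) by simp
        then show ?thesis using 2 v0(2) v0x(1) by (simp add: cf0 pg power_0_left)
      next
        case 3
        have le: "mi m \<le> dg (mv m) r" using dg_ge[OF m refl] .
        show ?thesis
        proof (cases "plz (\<gamma> (mv m))")
          case True
          then show ?thesis using 3 by (simp add: cf1 pg plz_iff power_0_left)
        next
          case False
          then have "dg (mv m) r \<le> d0" using max 3(1) unfolding N_def by blast
          then have "d0 - mi m = d0 - dg (mv m) r \<longleftrightarrow> mi m = dg (mv m) r" using le by auto
          then show ?thesis using 3 le \<open>dg (mv m) r \<le> d0\<close> by (auto simp add: cf1 power_0_left)
        qed
      qed
    qed
    \<comment> \<open>The new coefficient of x_(v0)^(p^d0) is exactly the given relation, hence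
      zero, and the normal form of the row no longer contains this power.\<close>
    have "cf (subst \<theta> r) v0 d0 = (\<Sum>v\<in>xv r. cf r v (dg v r) * pl (g' v) ^ (p ^ dg v r))"
      unfolding cf_subst sum_list_cf[OF finite_xv, symmetric] by (intro arg_cong[of _ _ sum_list] map_cong refl trm)
    then have zero: "cf (rown (subst \<theta> r)) v0 d0 = 0" unfolding pg dep by (simp add: cf_rown)
    have mono: "(mv u \<in> xv r \<and> mi u \<le> dg (mv u) r)" if u: "u \<in> set (rown (subst \<theta> r))" "mv u mod 5 = 3" for u
    proof -
      obtain u' where u': "u' \<in> set (subst \<theta> r)" "mv u = mv u'" "mi u = mi u'" using set_rown_mi[OF u(1)] by blast
      then obtain m w where m: "m \<in> set r" "w \<in> set (\<theta> (mv m))" "mv u = mv w" "mi u = mi w + mi m"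
        unfolding subst_def by auto
      consider "mv m mod 5 \<noteq> 3" | "mv m = v0" | "mv m \<in> xv r" "mv m \<noteq> v0" using xv_I[OF m(1)] by blast
      then show ?thesis
      proof cases
        case 1
        then show ?thesis using m u(2) th2[OF 1] by simp
      next
        case 2
        have "w \<notin> set (map (\<lambda>l. (5 * (K + l) + 4, 0, l, 0)) ls)" for ls
        proof
          assume "w \<in> set (map (\<lambda>l. (5 * (K + l) + 4, 0, l, 0)) ls)"
          then have "mv w mod 5 = 4" by (auto simp: mod5 simp del: distrib_left_numeral)
          then show False using u(2) m(3) by simp
        qed
        then have "w \<in> set (map (\<lambda>n. (v0, 0, n, 0)) (\<gamma> v0))" using m(2) unfolding 2 th0 set_append by blast
        then have "mv w = v0" "mi w = 0" by auto
        then show ?thesis using m v0x(1) dg_ge[OF m(1) 2] by simp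
      next
        case 3
        have le: "mi m \<le> dg (mv m) r" using dg_ge[OF m(1) refl] .
        from m(2) consider "w = (mv m, 0, 0, 0)" | "mv w = v0" "mi w = d0 - dg (mv m) r" "g' (mv m) \<noteq> []"
          unfolding th1[OF 3] by force
        then show ?thesis
        proof cases
          case 1
          then show ?thesis using m(3,4) le 3 by simp
        next
          case 2
          then have "dg (mv m) r \<le> d0" using max 3(1) unfolding N_def g'_def by (auto split: if_splits)
          then show ?thesis using m(3,4) 2 le v0x(1) v0(2) by simp
        qed
      qed
    qed
    have "mi u < dg v0 r" if u: "u \<in> set (rown (subst \<theta> r))" "mv u = v0" for u
      using mono[OF u(1)] cf_rown_0[OF zero u] u(2) v0x(2) v0(2) by fastforce
    then show ?thesis using mu_less[OF mono v0x(1)] unfolding \<theta>_def by blast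
  qed
  then show ?thesis using that v0x(2,3) by blast
qed

lemma pl_filter_cf:
  "(\<And>u. u \<in> set r \<Longrightarrow> md u = 0) \<Longrightarrow> pl (map (\<lambda>u. mn u) (filter (\<lambda>u. mv u = w \<and> mi u = m) r)) = cf r w m"
  by (induction r) auto

lemma sum_nth_sorted:
  assumes "finite I"
  shows "(\<Sum>i<card I. g (sorted_list_of_set I ! i)) = (\<Sum>i\<in>I. (g i :: 'a poly fract))"
  using sum.reindex_bij_betw[OF bij_betw_nth[of "sorted_list_of_set I" "{..<card I}" I], of g] assms by simp

lemma sum_split_lessThan: "(\<Sum>i<k + (n::nat). (h i :: 'a poly fract)) = (\<Sum>i<k. h i) + (\<Sum>j<n. h (k + j))"
  by (induction n) (simp_all add: add.assoc)

text \<open>If there is no relation between the leading coefficients, they form part of a chart.\<close>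

lemma chart_exists:
  assumes r: "r = rown f"
    and ind: "\<And>\<gamma>. (\<Sum>v\<in>xv r. cf r v (dg v r) * pl (\<gamma> v) ^ (p ^ dg v r)) = 0 \<Longrightarrow> \<forall>v\<in>xv r. plz (\<gamma> v)"
  shows "\<exists>m. \<forall>K. \<exists>ch. chart_ok (rown (subst (thS K m r) r)) m ch"
proof -
  \<comment> \<open>Any common upper bound of the leading exponents serves.\<close>
  define m where "m = (\<Sum>v\<in>xv r. dg v r)"
  have dm: "dg v r \<le> m" if "v \<in> xv r" for v unfolding m_def using that by (intro member_le_sum) auto
  have "\<exists>ch. chart_ok (rown (subst (thS K m r) r)) m ch" for K
  proof -
    define \<theta> where "\<theta> = thS K m r"
    define r' where "r' = rown (subst \<theta> r)"
    define q where "q = p ^ m"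
    \<comment> \<open>The variable that \<open>thS\<close> introduces for the j-th component of
      x_v.\<close>
    define w where "w = (\<lambda>(v, j). 5 * (K + (v * q + j)) + 3)"
    define X where "X = (SIGMA v:xv r. {..<p ^ (m - dg v r)})"
    define I where "I = w ` X"
    have q0: "q > 0" unfolding q_def by simp
    have jq: "j < q" if "(v, j) \<in> X" for v j
    proof -
      have "p ^ (m - dg v r) \<le> q" unfolding q_def using p_gt_1 by (intro power_increasing) auto
      then show ?thesis using that unfolding X_def by simp
    qed
    have w_inj: "w (v, j) = w (v', j') \<longleftrightarrow> v = v' \<and> j = j'" if "j < q" "j' < q" for v v' j j'
    proof
      assume "w (v, j) = w (v', j')"
      then have e: "v * q + j = v' * q + j'" unfolding w_def by simp
      have "v = v'" using arg_cong[OF e, of "\<lambda>x. x div q"] that by simp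
      then show "v = v' \<and> j = j'" using e by simp
    qed simp
    have injw: "inj_on w X" using w_inj jq by (force intro!: inj_onI)
    have finX: "finite X" unfolding X_def by auto
    have w_kind: "w x mod 5 = 3" for x unfolding w_def by (cases x) (simp add: mod5 del: distrib_left_numeral)
    have th1: "\<theta> v = map (\<lambda>j. (w (v, j), m - dg v r, j, 0)) [0..<p ^ (m - dg v r)]" if "v mod 5 = 3" for v
      unfolding \<theta>_def thS_def w_def q_def using that by simp
    have th2: "\<theta> v = [(v, 0, 0, 0)]" if "v mod 5 \<noteq> 3" for v unfolding \<theta>_def thS_def using that by simp
    have md0: "md u = 0" if "u \<in> set r'" for u using set_rown that unfolding r'_def by blast
    have mono: "mv u \<in> I \<and> mi u \<le> m" if u: "u \<in> set r'" "mv u mod 5 = 3" for u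
    proof -
      obtain u' where u': "u' \<in> set (subst \<theta> r)" "mv u = mv u'" "mi u = mi u'" using set_rown_mi u(1) unfolding r'_def by blast
      then obtain mo y where mo: "mo \<in> set r" "y \<in> set (\<theta> (mv mo))" "mv u = mv y" "mi u = mi y + mi mo"
        unfolding subst_def by auto
      have k: "mv mo mod 5 = 3"
      proof (rule ccontr)
        assume "mv mo mod 5 \<noteq> 3"
        then show False using mo u(2) th2[of "mv mo"] by simp
      qed
      have x: "mv mo \<in> xv r" using xv_I[OF mo(1) k] .
      from mo(2) obtain j where j: "j < p ^ (m - dg (mv mo) r)" "y = (w (mv mo, j), m - dg (mv mo) r, j, 0)"
        unfolding th1[OF k] by auto
      then show ?thesis using mo(3,4) dg_ge[OF mo(1) refl] dm[OF x] x unfolding I_def X_def by auto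
    qed
    define \<alpha> where "\<alpha> u = cf r' u m" for u
    have pl_\<alpha>: "pl (map (\<lambda>u. mn u) (filter (\<lambda>u. mv u = x \<and> mi u = m) r')) = \<alpha> x" for x
      unfolding \<alpha>_def by (rule pl_filter_cf) (rule md0)
    have \<alpha>_PP: "\<alpha> x \<in> PP" for x unfolding pl_\<alpha>[symmetric] by blast
    define C where "C = D ^ maxd (subst \<theta> r)"
    \<comment> \<open>The leading coefficient of the j-th component is that of x_v times z^(j p^d)
      with d = dg v r, up to the common factor \<open>C\<close> from clearing denominators.\<close>
    have \<alpha>_w: "\<alpha> (w (v, j)) = C * (z_rf ^ (j * p ^ dg v r) * cf r v (dg v r))" if vj: "(v, j) \<in> X" for v j
    proof -
      have v: "v \<in> xv r" "j < p ^ (m - dg v r)" using vj unfolding X_def by auto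
      have cft: "cf (\<theta> v') (w (v, j)) i = (if v' = v \<and> i = m - dg v r then z_rf ^ j else 0)" if "v' \<in> xv r" for v' i
      proof -
        have "cf (\<theta> v') (w (v, j)) i = (\<Sum>l<p ^ (m - dg v' r). if w (v', l) = w (v, j) \<and> m - dg v' r = i then z_rf ^ l else 0)"
          unfolding th1[OF xv_kind[OF that]] cf_def
          by (simp add: comp_def interv_sum_list_conv_sum_set_nat atLeast0LessThan cong: if_cong)
        also have "\<dots> = (\<Sum>l<p ^ (m - dg v' r). if l = j then (if v' = v \<and> i = m - dg v r then z_rf ^ l else 0) else 0)"
        proof (intro sum.cong refl)
          fix l assume "l \<in> {..<p ^ (m - dg v' r)}"
          then have "l < q" using jq[of v' l] that unfolding X_def by simp
          then show "(if w (v', l) = w (v, j) \<and> m - dg v' r = i then z_rf ^ l else 0)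
              = (if l = j then (if v' = v \<and> i = m - dg v r then z_rf ^ l else 0) else (0 :: 'a poly fract))"
            using w_inj[of l j v' v] jq[OF vj] by auto
        qed
        also have "\<dots> = (if v' = v \<and> i = m - dg v r then z_rf ^ j else 0)"
          using v(2) by auto
        finally show ?thesis .
      qed
      have cft2: "cf (\<theta> v') (w (v, j)) i = 0" if "v' mod 5 \<noteq> 3" for v' i
        unfolding th2[OF that] using that w_kind[of "(v, j)"] by auto
      have trm: "(if mi u \<le> m then z_rf ^ mn u * inverse D ^ md u * cf (\<theta> (mv u)) (w (v, j)) (m - mi u) ^ (p ^ mi u) else 0)
        = (if mv u \<in> {v} \<and> mi u = dg (mv u) r then z_rf ^ mn u * inverse D ^ md u * (z_rf ^ j) ^ (p ^ dg v r) else 0)"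
        if u: "u \<in> set r" for u
      proof (cases "mv u mod 5 = 3")
        case True
        note x = xv_I[OF u True]
        have "mi u \<le> dg (mv u) r" using dg_ge[OF u refl] .
        then have "mi u \<le> m" "m - mi u = m - dg (mv u) r \<longleftrightarrow> mi u = dg (mv u) r" using dm[OF x] by auto
        then show ?thesis by (auto simp: cft[OF x] power_0_left)
      next
        case False
        then have "mv u \<noteq> v" using xv_kind[OF v(1)] by blast
        then show ?thesis by (simp add: cft2[OF False] power_0_left)
      qed
      have "cf (subst \<theta> r) (w (v, j)) m = (\<Sum>v'\<in>{v}. cf r v' (dg v' r) * (z_rf ^ j) ^ (p ^ dg v r))"
        unfolding cf_subst sum_list_cf[symmetric, of "{v}", simplified finite.intros]
        by (subst sum_list_cf[symmetric]) (simp, intro arg_cong[of _ _ sum_list] map_cong refl trm)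
      then show ?thesis unfolding \<alpha>_def r'_def C_def by (simp add: cf_rown power_mult mult_ac)
    qed
    have "\<exists>J. J \<subseteq> {..<p ^ m} \<and> card I + card J = p ^ m \<and> (\<exists>\<delta>\<in>PP. \<delta> \<noteq> 0 \<and> (\<forall>l<p ^ m. \<exists>b c. (\<forall>i. b i \<in> PP \<and> c i \<in> PP) \<and>
       (\<Sum>i\<in>I. \<alpha> i * b i ^ (p ^ m)) + (\<Sum>e\<in>J. z_rf ^ e * c e ^ (p ^ m)) = \<delta> ^ (p ^ m) * z_rf ^ l))"
    proof (rule steinitz)
      show "finite I" unfolding I_def using finX by simp
      show "\<alpha> i \<in> PP" for i by (rule \<alpha>_PP)
      fix \<beta> :: "nat \<Rightarrow> 'a poly fract" assume \<beta>: "\<And>i. \<beta> i \<in> PP" "(\<Sum>i\<in>I. \<alpha> i * \<beta> i ^ (p ^ m)) = 0"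
      \<comment> \<open>Reassembles the coefficients of a relation over q-th powers into one
        multiplier for each old variable. This gives a relation of the kind excluded by
        \<open>ind\<close>, so the multipliers vanish, and uniqueness of components makes every
        \<beta> vanish.\<close>
      define \<gamma> where "\<gamma> v = (SOME ns. pl ns = (\<Sum>j<p ^ (m - dg v r). z_rf ^ j * \<beta> (w (v, j)) ^ (p ^ (m - dg v r))))" for v
      have \<gamma>: "pl (\<gamma> v) = (\<Sum>j<p ^ (m - dg v r). z_rf ^ j * \<beta> (w (v, j)) ^ (p ^ (m - dg v r)))" for v
      proof -
        have "(\<Sum>j<p ^ (m - dg v r). z_rf ^ j * \<beta> (w (v, j)) ^ (p ^ (m - dg v r))) \<in> PP" using \<beta>(1) by simp
        then have "\<exists>ns. pl ns = (\<Sum>j<p ^ (m - dg v r). z_rf ^ j * \<beta> (w (v, j)) ^ (p ^ (m - dg v r)))" by (rule PP_E)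
        then show ?thesis unfolding \<gamma>_def by (rule someI_ex)
      qed
      have "0 = (\<Sum>x\<in>X. \<alpha> (w x) * \<beta> (w x) ^ (p ^ m))"
        using \<beta>(2) unfolding I_def sum.reindex[OF injw] comp_def by simp
      also have "\<dots> = (\<Sum>(v, j)\<in>X. C * (cf r v (dg v r) * (z_rf ^ j * \<beta> (w (v, j)) ^ (p ^ (m - dg v r))) ^ (p ^ dg v r)))"
      proof (intro sum.cong refl)
        fix x assume x: "x \<in> X"
        obtain v j where vj: "x = (v, j)" by (cases x)
        have "v \<in> xv r" using x vj unfolding X_def by simp
        from dm[OF this] have "p ^ m = p ^ (m - dg v r) * p ^ dg v r" by (simp flip: power_add)
        then have pw: "b ^ (p ^ m) = (b ^ (p ^ (m - dg v r))) ^ (p ^ dg v r)" for b :: "'a poly fract"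
          by (simp only: power_mult)
        show "\<alpha> (w x) * \<beta> (w x) ^ (p ^ m) = (case x of (v, j) \<Rightarrow>
            C * (cf r v (dg v r) * (z_rf ^ j * \<beta> (w (v, j)) ^ (p ^ (m - dg v r))) ^ (p ^ dg v r)))"
          using \<alpha>_w x unfolding vj pw by (simp add: power_mult_distrib power_mult mult_ac)
      qed
      also have "\<dots> = (\<Sum>v\<in>xv r. \<Sum>j<p ^ (m - dg v r). C * (cf r v (dg v r) * (z_rf ^ j * \<beta> (w (v, j)) ^ (p ^ (m - dg v r))) ^ (p ^ dg v r)))"
        unfolding X_def by (subst sum.Sigma) auto
      also have "\<dots> = C * (\<Sum>v\<in>xv r. cf r v (dg v r) * pl (\<gamma> v) ^ (p ^ dg v r))"
        by (simp add: \<gamma> frob_sum sum_distrib_left)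
      finally have "(\<Sum>v\<in>xv r. cf r v (dg v r) * pl (\<gamma> v) ^ (p ^ dg v r)) = 0" unfolding C_def by simp
      from ind[OF this] have z: "\<forall>v\<in>xv r. pl (\<gamma> v) = (0 :: 'a poly fract)" by (simp add: plz_iff)
      show "\<forall>i\<in>I. \<beta> i = 0"
      proof
        fix i assume "i \<in> I"
        then obtain v j where i: "i = w (v, j)" "v \<in> xv r" "j < p ^ (m - dg v r)" unfolding I_def X_def by auto
        have "(\<Sum>j<p ^ (m - dg v r). z_rf ^ j * \<beta> (w (v, j)) ^ (p ^ (m - dg v r))) = 0" using z i(2) \<gamma> by simp
        from components_unique[OF this _ i(3)] show "\<beta> i = 0" using \<beta>(1) PP_R unfolding i(1) by blast
      qed
    qed
    then obtain J \<delta> where J: "J \<subseteq> {..<q}" "card I + card J = q" and \<delta>: "\<delta> \<in> PP" "\<delta> \<noteq> 0"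
      and sp: "\<forall>l<q. \<exists>b c. (\<forall>i. b i \<in> PP \<and> c i \<in> PP) \<and>
       (\<Sum>i\<in>I. \<alpha> i * b i ^ q) + (\<Sum>e\<in>J. z_rf ^ e * c e ^ q) = \<delta> ^ q * z_rf ^ l"
      unfolding q_def by (elim exE conjE bexE)
    define Q where "Q l b c \<longleftrightarrow> (\<forall>i. b i \<in> PP \<and> c i \<in> PP) \<and>
       (\<Sum>i\<in>I. \<alpha> i * b i ^ q) + (\<Sum>e\<in>J. z_rf ^ e * c e ^ q) = \<delta> ^ q * z_rf ^ l" for l b c
    define xs where "xs = sorted_list_of_set I"
    define es where "es = sorted_list_of_set J"
    have finI: "finite I" "finite J" unfolding I_def using finX J(1) finite_subset by auto
    have len: "length xs = card I" "length es = card J" unfolding xs_def es_def using finI by simp_all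
    have "\<forall>l. \<exists>Bl. l < q \<longrightarrow> length Bl = q \<and>
       (\<Sum>i<q. pl (fam r' m xs es i) * pl (Bl ! i) ^ q) = \<delta> ^ q * z_rf ^ l"
    proof
      fix l
      show "\<exists>Bl. l < q \<longrightarrow> length Bl = q \<and> (\<Sum>i<q. pl (fam r' m xs es i) * pl (Bl ! i) ^ q) = \<delta> ^ q * z_rf ^ l"
      proof (cases "l < q")
        case True
        then obtain b c where bc: "Q l b c" using sp unfolding Q_def by (elim allE impE exE)
        define lst where "lst x = (SOME ns. pl ns = (x :: 'a poly fract))" for x
        have lst: "pl (lst x) = x" if "x \<in> PP" for x
        proof -
          have "\<exists>ns. pl ns = x" using that by (rule PP_E)
          then show ?thesis unfolding lst_def by (rule someI_ex)
        qed
        \<comment> \<open>The order of the entries follows \<open>fam\<close>: the variables of the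
          chart, then the completing exponents.\<close>
        define Bl where "Bl = map (\<lambda>i. lst (if i < card I then b (xs ! i) else c (es ! (i - card I)))) [0..<q]"
        have Bl: "pl (Bl ! i) = (if i < card I then b (xs ! i) else c (es ! (i - card I)))" if "i < q" for i
          using bc that unfolding Bl_def Q_def by (simp add: lst)
        have "(\<Sum>i<q. pl (fam r' m xs es i) * pl (Bl ! i) ^ q)
            = (\<Sum>i<q. (if i < card I then \<alpha> (xs ! i) * b (xs ! i) ^ q else z_rf ^ (es ! (i - card I)) * c (es ! (i - card I)) ^ q))"
        proof (intro sum.cong refl)
          fix i assume "i \<in> {..<q}"
          then show "pl (fam r' m xs es i) * pl (Bl ! i) ^ q
            = (if i < card I then \<alpha> (xs ! i) * b (xs ! i) ^ q else z_rf ^ (es ! (i - card I)) * c (es ! (i - card I)) ^ q)"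
            using J(2) by (auto simp: Bl fam_def len lnth_eq pl_\<alpha>)
        qed
        also have "\<dots> = (\<Sum>i<card I. \<alpha> (xs ! i) * b (xs ! i) ^ q) + (\<Sum>j<card J. z_rf ^ (es ! j) * c (es ! j) ^ q)"
          unfolding J(2)[symmetric] sum_split_lessThan by simp
        also have "\<dots> = (\<Sum>i\<in>I. \<alpha> i * b i ^ q) + (\<Sum>e\<in>J. z_rf ^ e * c e ^ q)"
          unfolding xs_def es_def
          using sum_nth_sorted[OF finI(1), of "\<lambda>i. \<alpha> i * b i ^ q"] sum_nth_sorted[OF finI(2), of "\<lambda>e. z_rf ^ e * c e ^ q"] by simp
        also have "\<dots> = \<delta> ^ q * z_rf ^ l" using bc unfolding Q_def by simp
        finally show ?thesis by (intro exI[of _ Bl]) (simp add: Bl_def)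
      qed simp
    qed
    from choice[OF this] obtain Bf where Bf: "\<And>l. l < q \<Longrightarrow> length (Bf l) = q"
      "\<And>l. l < q \<Longrightarrow> (\<Sum>i<q. pl (fam r' m xs es i) * pl (Bf l ! i) ^ q) = \<delta> ^ q * z_rf ^ l" by blast
    obtain d where d: "\<delta> = pl d" using \<delta>(1) by blast
    define B where "B = map Bf [0..<q]"
    have Bl: "lnth [] (lnth [] B l) i = Bf l ! i" if "l < q" "i < q" for l i
      using that Bf(1) by (simp add: B_def lnth_eq)
    have "chart_ok r' m (xs, es, B, d)"
      unfolding chart_ok_def Let_def list_all_iff fst_conv snd_conv q_def[symmetric]
    proof (intro conjI)
      show "distinct xs" unfolding xs_def by simp
      show "\<forall>v\<in>set xs. v mod 5 = 3" unfolding xs_def using finI w_kind by (auto simp: I_def)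
      show "\<forall>u\<in>set (xpart r'). mv u \<in> set xs \<and> mi u \<le> m"
        unfolding xs_def xpart_def using finI mono by auto
      show "\<forall>u\<in>set r'. md u = 0" using md0 by blast
      show "length xs + length es = q" using len J(2) by simp
      show "\<not> plz d" using \<delta>(2) d by (simp add: plz_iff)
      show "\<forall>l\<in>set [0..<q]. plz (concat (map (\<lambda>i. conv q (fam r' m xs es i) (lnth [] (lnth [] B l) i)) [0..<q])
          @ negf (map (\<lambda>k. l + q * k) d))"
      proof
        fix l assume "l \<in> set [0..<q]"
        then have l: "l < q" by simp
        have "(\<Sum>i<q. pl (fam r' m xs es i) * pl (lnth [] (lnth [] B l) i) ^ q) = z_rf ^ l * \<delta> ^ q"
          using Bf(2)[OF l] by (simp add: Bl[OF l] mult.commute)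
        then show "plz (concat (map (\<lambda>i. conv q (fam r' m xs es i) (lnth [] (lnth [] B l) i)) [0..<q])
          @ negf (map (\<lambda>k. l + q * k) d))"
          unfolding plz_iff q_def
          by (simp add: pl_concat_map pl_conv pl_map_add d interv_sum_list_conv_sum_set_nat atLeast0LessThan)
      qed
    qed
    then show ?thesis unfolding r'_def \<theta>_def by blast
  qed
  then show ?thesis by blast
qed

section \<open>Termination of the elimination\<close>

definition normal :: "state \<Rightarrow> bool" where
  "normal s \<longleftrightarrow> (\<forall>r\<in>set (fst s). \<exists>f. r = rown f) \<and> (\<forall>t\<in>set (fst (snd s)). xpart t = [])"

lemma run_append: "run (cs @ ds) s = run ds (run cs s)"
  unfolding run_def by simp

lemma subst_xfree: "(\<And>v. v mod 5 \<noteq> 3 \<Longrightarrow> \<theta> v = [(v, 0, 0, 0)]) \<Longrightarrow> xpart t = [] \<Longrightarrow> subst \<theta> t = t"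
  by (rule subst_id) (auto simp: xpart_def filter_empty_conv)

lemma normal_subst:
  assumes "normal s" "\<And>v. v mod 5 \<noteq> 3 \<Longrightarrow> \<theta> v = [(v, 0, 0, 0)]"
  shows "normal (subst_state \<theta> s)"
  using assms subst_xfree[of \<theta>] unfolding normal_def subst_state_def by auto

lemma xpart_newrow: "xpart (newrow K r m ch) = []"
proof -
  have "mv u mod 5 \<noteq> 3" if "u \<in> set (newrow K r m ch)" for u
  proof -
    have "mv u mod 5 = 4" if g: "u \<in> set (subst (bxf K n) g)" for n g
    proof -
      obtain mo y where "y \<in> set (bxf K n mo)" "mv u = mv y" using g unfolding subst_def by fastforce
      then show ?thesis using kind_bxf[of y K n mo] by simp
    qed
    then show ?thesis using that kind_exf[of u] kind_vfm[of u] unfolding newrow_def fpart_def by fastforce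
  qed
  then show ?thesis unfolding xpart_def filter_empty_conv by blast
qed

text \<open>Induction on \<open>mu\<close> of the leading row. Dependent leading coefficients allow
  a step that lowers it; independent ones allow a splitting followed by a chart, which moves the row
  to the treated ones.\<close>

lemma progress:
  assumes "normal s" "fst s = r # rs"
  shows "\<exists>cs. normal (run cs s) \<and> length (fst (run cs s)) = length rs"
  using assms
proof (induction "mu r" arbitrary: s r rs rule: less_induct)
  case less
  obtain f where r: "r = rown f" using less.prems unfolding normal_def by auto
  show ?case
  proof (cases "\<exists>\<gamma>. (\<Sum>v\<in>xv r. cf r v (dg v r) * pl (\<gamma> v) ^ (p ^ dg v r)) = 0 \<and> \<not> (\<forall>v\<in>xv r. plz (\<gamma> v))")
    case True
    then obtain \<gamma> v1 where "(\<Sum>v\<in>xv r. cf r v (dg v r) * pl (\<gamma> v) ^ (p ^ dg v r)) = 0" "v1 \<in> xv r" "\<not> plz (\<gamma> v1)" by blast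
    note dep = this
    obtain v0 b gs where A: "v0 mod 5 = 3" "\<not> plz b" "\<And>K. mu (rown (subst (thA K v0 b gs) r)) < mu r"
      by (rule stepA_decreases[OF r dep]) (rule that)
    define \<theta> where "\<theta> = thA (sbound s) v0 b gs"
    define c :: cert where "c = (0, v0, b, gs, 0, [], [], [], [])"
    have st: "step c s = subst_state \<theta> s" unfolding step_def c_def stepA_def \<theta>_def using A(1,2) by simp
    have "normal (subst_state \<theta> s)" using less.prems(1) A(1) by (intro normal_subst) (auto simp: \<theta>_def thA_def)
    moreover have "fst (subst_state \<theta> s) = rown (subst \<theta> r) # map (\<lambda>r. rown (subst \<theta> r)) rs"
      unfolding subst_state_def using less.prems(2) by simp
    ultimately obtain cs where cs: "normal (run cs (subst_state \<theta> s))" "length (fst (run cs (subst_state \<theta> s))) = length rs"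
      using less.hyps[of "rown (subst \<theta> r)" "subst_state \<theta> s"] A(3) unfolding \<theta>_def by fastforce
    have "run (c # cs) s = run cs (subst_state \<theta> s)" unfolding run_def by (simp add: st)
    then show ?thesis using cs by (intro exI[of _ "c # cs"]) simp
  next
    case False
    then obtain m where m: "\<And>K. \<exists>ch. chart_ok (rown (subst (thS K m r) r)) m ch"
      using chart_exists[OF r] by blast
    define \<theta> where "\<theta> = thS (sbound s) m r"
    obtain ch where ch: "chart_ok (rown (subst \<theta> r)) m ch" using m unfolding \<theta>_def by blast
    define s1 where "s1 = subst_state \<theta> s"
    define c1 :: cert where "c1 = (1, 0, [], [], m, [], [], [], [])"
    define c2 :: cert where "c2 = (2, 0, [], [], m, ch)"
    have st1: "step c1 s = s1" unfolding step_def c1_def stepS_def s1_def \<theta>_def using less.prems(2) by simp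
    have n1: "normal s1" unfolding s1_def using less.prems(1) by (intro normal_subst) (auto simp: \<theta>_def thS_def)
    have f1: "fst s1 = rown (subst \<theta> r) # map (\<lambda>r. rown (subst \<theta> r)) rs"
      unfolding s1_def subst_state_def using less.prems(2) by simp
    define s2 where "s2 = chart_state (sbound s1) (rown (subst \<theta> r)) m ch s1"
    have st2: "step c2 s1 = s2" unfolding step_def c2_def stepC_def s2_def using f1 ch by simp
    have kinds: "\<forall>v\<in>set (fst ch). v mod 5 = 3"
      using ch unfolding chart_ok_def Let_def list_all_iff by blast
    have id: "thC K n (fst ch) v = [(v, 0, 0, 0)]" if "v mod 5 \<noteq> 3" for K n v
      using kinds that unfolding thC_def by auto
    have "normal s2" using n1 f1 subst_xfree[OF id] xpart_newrow
      unfolding normal_def s2_def chart_state_def Let_def by auto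
    moreover have "length (fst s2) = length rs" unfolding s2_def chart_state_def Let_def f1 by simp
    moreover have "run [c1, c2] s = s2" unfolding run_def by (simp add: st1 st2)
    ultimately show ?thesis by (intro exI[of _ "[c1, c2]"]) simp
  qed
qed

theorem elimination_sequence:
  "normal s \<Longrightarrow> \<exists>cs. finished (run cs s)"
proof (induction "length (fst s)" arbitrary: s)
  case 0
  then show ?case by (intro exI[of _ "[]"]) (auto simp: run_def finished_def normal_def list_all_iff)
next
  case (Suc n)
  then obtain r rs where s: "fst s = r # rs" by (cases "fst s") auto
  from progress[OF Suc.prems s] obtain cs where cs: "normal (run cs s)" "length (fst (run cs s)) = length rs" by blast
  moreover have "n = length rs" using Suc.hyps(2) s by simp
  ultimately obtain ds where "finished (run ds (run cs s))" using Suc.hyps(1)[of "run cs s"] by metis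
  then show ?case by (intro exI[of _ "cs @ ds"]) (simp add: run_append)
qed

end

section \<open>Renaming and free variables\<close>

text \<open>Written with the recursor, like the following functions on syntax, so that the
  computability rules for recursors apply; free variables are returned as lists for the same
  reason.\<close>

definition ren_tm :: "(nat \<Rightarrow> nat) \<Rightarrow> lp_tm \<Rightarrow> lp_tm" where
  "ren_tm f t = rec_lp_tm (\<lambda>i. LVar (f i)) LZero LOne (\<lambda>_ _ r s. LAdd r s) (\<lambda>_ r. LFrob r) t"

definition ren_fm :: "(nat \<Rightarrow> nat) \<Rightarrow> lp_fm \<Rightarrow> lp_fm" where
  "ren_fm f \<phi> = rec_fm (\<lambda>a. Atom (case a of LEq s t \<Rightarrow> LEq (ren_tm f s) (ren_tm f t))) (\<lambda>_ r. Neg r)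
     (\<lambda>_ _ r s. Conj r s) (\<lambda>_ _ r s. Disj r s) (\<lambda>_ _ r s. Imp r s) (\<lambda>x _ r. Ex (f x) r) (\<lambda>x _ r. All (f x) r) \<phi>"

definition ltv :: "lp_tm \<Rightarrow> nat list" where
  "ltv t = rec_lp_tm (\<lambda>i. [i]) [] [] (\<lambda>_ _ r s. r @ s) (\<lambda>_ r. r) t"

definition lfv :: "lp_fm \<Rightarrow> nat list" where
  "lfv \<phi> = rec_fm (\<lambda>a. case a of LEq s t \<Rightarrow> ltv s @ ltv t) (\<lambda>_ r. r) (\<lambda>_ _ r s. r @ s) (\<lambda>_ _ r s. r @ s) (\<lambda>_ _ r s. r @ s)
     (\<lambda>x _ r. filter (\<lambda>y. y \<noteq> x) r) (\<lambda>x _ r. filter (\<lambda>y. y \<noteq> x) r) \<phi>"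

definition ztv :: "lpz_tm \<Rightarrow> nat list" where
  "ztv t = rec_lpz_tm (\<lambda>i. [i]) [] [] (\<lambda>_ _ r s. r @ s) (\<lambda>_ r. r) (\<lambda>_ r. r) t"

definition zfv :: "lpze_fm \<Rightarrow> nat list" where
  "zfv \<phi> = rec_fm (\<lambda>a. case a of Eq s t \<Rightarrow> ztv s @ ztv t | InF t \<Rightarrow> ztv t | P \<sigma> ts \<Rightarrow> concat (map ztv ts)) (\<lambda>_ r. r)
     (\<lambda>_ _ r s. r @ s) (\<lambda>_ _ r s. r @ s) (\<lambda>_ _ r s. r @ s)
     (\<lambda>x _ r. filter (\<lambda>y. y \<noteq> x) r) (\<lambda>x _ r. filter (\<lambda>y. y \<noteq> x) r) \<phi>"

lemma set_ltv: "set (ltv t) = lp_tm_vars t"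
  by (induction t) (auto simp: ltv_def)

lemma set_lfv: "set (lfv \<phi>) = lp_fv \<phi>"
proof (induction \<phi>)
  case (Atom a)
  then show ?case by (cases a) (simp add: lfv_def set_ltv)
qed (auto simp: lfv_def)

lemma set_ztv: "set (ztv t) = lpz_tm_vars t"
  by (induction t) (auto simp: ztv_def)

lemma set_zfv: "set (zfv \<phi>) = lpze_fv \<phi>"
proof (induction \<phi>)
  case (Atom a)
  then show ?case by (cases a) (simp_all add: zfv_def set_ztv)
qed (auto simp: zfv_def)

lemma lp_eval_ren: "lp_eval p e (ren_tm f t) = lp_eval p (\<lambda>i. e (f i)) t"
  by (induction t) (auto simp: ren_tm_def)

text \<open>Bound variables are renamed too. Injectivity prevents capture and lets renaming commute
  with updates of the valuation.\<close>

lemma sat_ren: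
  assumes "inj f"
  shows "lp_sat p e (ren_fm f \<phi>) \<longleftrightarrow> lp_sat p (\<lambda>i. e (f i)) \<phi>"
proof (induction \<phi> arbitrary: e)
  case (Atom a)
  then show ?case by (cases a) (simp add: lp_sat_def ren_fm_def lp_eval_ren)
next
  case (Ex x \<phi>)
  have "(\<lambda>i. (e(f x := u)) (f i)) = (\<lambda>i. e (f i))(x := u)" for u
    using assms by (auto simp: fun_eq_iff dest: injD)
  then show ?case using Ex by (simp add: lp_sat_def ren_fm_def)
next
  case (All x \<phi>)
  have "(\<lambda>i. (e(f x := u)) (f i)) = (\<lambda>i. e (f i))(x := u)" for u
    using assms by (auto simp: fun_eq_iff dest: injD)
  then show ?case using All by (simp add: lp_sat_def ren_fm_def)
qed (simp_all add: lp_sat_def ren_fm_def)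

lemma fv_ren_tm: "lp_tm_vars (ren_tm f t) = f ` lp_tm_vars t"
  by (induction t) (auto simp: ren_tm_def)

lemma fv_ren:
  assumes "inj f"
  shows "lp_fv (ren_fm f \<phi>) = f ` lp_fv \<phi>"
proof (induction \<phi>)
  case (Atom a)
  then show ?case by (cases a) (auto simp: ren_fm_def fv_ren_tm)
qed (use assms in \<open>auto simp: ren_fm_def dest: injD\<close>)

lemma sat_cong:
  assumes "\<And>a e e'. (\<And>v. v \<in> av a \<Longrightarrow> e v = e' v) \<Longrightarrow> I e a = I e' a"
    and "\<And>v. v \<in> fv av \<phi> \<Longrightarrow> e v = e' v"
  shows "sat U I e \<phi> = sat U I e' \<phi>"
  using assms(2)
proof (induction \<phi> arbitrary: e e')
  case (Atom a)
  then show ?case using assms(1)[of a e e'] by simp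
next
  case (Ex x \<phi>)
  have "sat U I (e(x := u)) \<phi> = sat U I (e'(x := u)) \<phi>" for u
    by (rule Ex.IH) (use Ex.prems in auto)
  then show ?case by simp
next
  case (All x \<phi>)
  have "sat U I (e(x := u)) \<phi> = sat U I (e'(x := u)) \<phi>" for u
    by (rule All.IH) (use All.prems in auto)
  then show ?case by simp
next
  case (Neg \<phi>)
  have "sat U I e \<phi> = sat U I e' \<phi>" by (rule Neg.IH) (use Neg.prems in auto)
  then show ?case by simp
next
  case (Conj \<phi> \<psi>)
  have "sat U I e \<phi> = sat U I e' \<phi>" by (rule Conj.IH) (use Conj.prems in auto)
  moreover have "sat U I e \<psi> = sat U I e' \<psi>" by (rule Conj.IH) (use Conj.prems in auto)
  ultimately show ?case by simp
next
  case (Disj \<phi> \<psi>)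
  have "sat U I e \<phi> = sat U I e' \<phi>" by (rule Disj.IH) (use Disj.prems in auto)
  moreover have "sat U I e \<psi> = sat U I e' \<psi>" by (rule Disj.IH) (use Disj.prems in auto)
  ultimately show ?case by simp
next
  case (Imp \<phi> \<psi>)
  have "sat U I e \<phi> = sat U I e' \<phi>" by (rule Imp.IH) (use Imp.prems in auto)
  moreover have "sat U I e \<psi> = sat U I e' \<psi>" by (rule Imp.IH) (use Imp.prems in auto)
  ultimately show ?case by simp
qed

lemma lp_eval_cong: "(\<And>v. v \<in> lp_tm_vars t \<Longrightarrow> e v = e' v) \<Longrightarrow> lp_eval p e t = lp_eval p e' t"
  by (induction t) auto

lemma lp_sat_cong:
  assumes "\<And>v. v \<in> lp_fv \<phi> \<Longrightarrow> e v = e' v"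
  shows "lp_sat p e \<phi> = lp_sat p e' \<phi>"
  unfolding lp_sat_def
proof (rule sat_cong[OF _ assms])
  fix a and e e' :: "nat \<Rightarrow> 'a" assume "\<And>v. v \<in> lp_atom_vars a \<Longrightarrow> e v = e' v"
  then show "lp_atom_holds p e a = lp_atom_holds p e' a"
    by (cases a) (auto intro!: arg_cong2[of _ _ _ _ "(=)"] lp_eval_cong)
qed

lemma lpz_eval_cong: "(\<And>v. v \<in> lpz_tm_vars t \<Longrightarrow> e v = e' v) \<Longrightarrow> lpz_eval p e t = lpz_eval p e' t"
  by (induction t) auto

lemma lpze_sat_cong:
  assumes "\<And>v. v \<in> lpze_fv \<phi> \<Longrightarrow> e v = e' v"
  shows "lpze_sat p S e \<phi> = lpze_sat p S e' \<phi>"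
  unfolding lpze_sat_def
proof (rule sat_cong[OF _ assms])
  fix a and e e' :: "nat \<Rightarrow> 'a poly fract" assume e: "\<And>v. v \<in> lpze_atom_vars a \<Longrightarrow> e v = e' v"
  show "lpze_atom_holds p e a = lpze_atom_holds p e' a"
  proof (cases a)
    case (Eq s t)
    then show ?thesis using e lpz_eval_cong[of s e e' p] lpz_eval_cong[of t e e' p] by simp
  next
    case (InF t)
    then show ?thesis using e lpz_eval_cong[of t e e' p] by simp
  next
    case (P \<sigma> ts)
    then have "map (lpz_eval p e) ts = map (lpz_eval p e') ts"
      using e by (intro map_cong refl lpz_eval_cong) auto
    then show ?thesis unfolding P by (simp only: lpze_atom_holds.simps)
  qed
qed

lemma sat_foldr_Ex:
  "sat U I e (foldr Ex vs \<psi>) \<longleftrightarrow>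
     (\<exists>e'. (\<forall>v. v \<notin> set vs \<longrightarrow> e' v = e v) \<and> (\<forall>v\<in>set vs. e' v \<in> U) \<and> sat U I e' \<psi>)"
proof (induction vs arbitrary: e)
  case Nil
  have "(\<forall>v. e' v = e v) \<longleftrightarrow> e' = e" for e' by (auto simp: fun_eq_iff)
  then show ?case by simp
next
  case (Cons x vs)
  show ?case (is "?l \<longleftrightarrow> ?r")
  proof
    assume ?l
    then obtain u e' where "u \<in> U" "\<forall>v. v \<notin> set vs \<longrightarrow> e' v = (e(x := u)) v" "\<forall>v\<in>set vs. e' v \<in> U" "sat U I e' \<psi>"
      using Cons by auto
    then show ?r by (intro exI[of _ e']) (auto split: if_splits)
  next
    assume ?r
    then obtain e' where e': "\<forall>v. v \<notin> set (x # vs) \<longrightarrow> e' v = e v" "\<forall>v\<in>set (x # vs). e' v \<in> U" "sat U I e' \<psi>" by blast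
    then have "sat U I (e(x := e' x)) (foldr Ex vs \<psi>)" unfolding Cons by (intro exI[of _ e']) auto
    then show ?l using e'(2) by auto
  qed
qed

lemma fv_foldr_Ex: "fv av (foldr Ex vs \<psi>) = fv av \<psi> - set vs"
  by (induction vs) auto

section \<open>Vanishing and constancy of forms as L_p-formulas\<close>

definition ltrue :: lp_fm where "ltrue = Atom (LEq LZero LZero)"

definition lconj :: "lp_fm list \<Rightarrow> lp_fm" where "lconj \<phi>s = foldr Conj \<phi>s ltrue"

lemma sat_ltrue [simp]: "lp_sat p c ltrue" and fv_ltrue [simp]: "lp_fv ltrue = {}"
  by (simp_all add: ltrue_def lp_sat_def)

lemma sat_lconj: "lp_sat p c (lconj \<phi>s) \<longleftrightarrow> (\<forall>\<phi>\<in>set \<phi>s. lp_sat p c \<phi>)"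
  by (induction \<phi>s) (auto simp: lconj_def ltrue_def lp_sat_def)

lemma fv_lconj: "lp_fv (lconj \<phi>s) = (\<Union>\<phi>\<in>set \<phi>s. lp_fv \<phi>)"
  by (induction \<phi>s) (auto simp: lconj_def)

lemma lp_sat_simps [simp]:
  "lp_sat p c (Neg \<phi>) \<longleftrightarrow> \<not> lp_sat p c \<phi>"
  "lp_sat p c (Conj \<phi> \<psi>) \<longleftrightarrow> lp_sat p c \<phi> \<and> lp_sat p c \<psi>"
  "lp_sat p c (Ex x \<phi>) \<longleftrightarrow> (\<exists>u. lp_sat p (c(x := u)) \<phi>)"
  "lp_sat p c (Atom (LEq s t)) \<longleftrightarrow> lp_eval p c s = lp_eval p c t"
  by (simp_all add: lp_sat_def)

definition lsum :: "form \<Rightarrow> lp_tm" where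
  "lsum t = foldr (\<lambda>u r. LAdd (rec_nat (LVar (mv u)) (\<lambda>_ r. LFrob r) (mi u)) r) t LZero"

lemma lp_eval_lsum: "lp_eval p c (lsum t) = (\<Sum>u\<leftarrow>t. c (mv u) ^ (p ^ mi u))"
proof -
  have "lp_eval p c (rec_nat (LVar v) (\<lambda>_ r. LFrob r) i) = c v ^ (p ^ i)" for v i
    by (induction i) (simp_all add: mult.commute flip: power_mult)
  then show ?thesis by (induction t) (simp_all add: lsum_def)
qed

lemma vars_lsum: "lp_tm_vars (lsum t) = (\<lambda>u. mv u) ` set t"
proof -
  have "lp_tm_vars (rec_nat (LVar v) (\<lambda>_ r. LFrob r) i) = {v}" for v i by (induction i) simp_all
  then show ?thesis by (induction t) (simp_all add: lsum_def)
qed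

context setting
begin

text \<open>Powers of z are linearly independent over F, so for values in F a row splits into one
  additive L_p-equation for each exponent of z.\<close>

definition rowfm :: "form \<Rightarrow> lp_fm" where
  "rowfm t = lconj (map (\<lambda>n. Atom (LEq (lsum (filter (\<lambda>u. mn u = n) (rown t))) LZero)) (map (\<lambda>u. mn u) (rown t)))"

text \<open>The quantified variable stands for the constant value; its number exceeds all variables
  of \<open>t\<close>.\<close>

definition Fcond :: "form \<Rightarrow> lp_fm" where
  "Fcond t = Ex (5 * fbound t + 4) (rowfm (t @ negf [(5 * fbound t + 4, 0, 0, 0)]))"

lemma sat_rowfm:
  assumes "\<And>u. u \<in> set t \<Longrightarrow> e (mv u) = const_rf (c (mv u))"
  shows "lp_sat p c (rowfm t) \<longleftrightarrow> ev e t = 0"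
proof -
  define d where "d n = (\<Sum>u\<leftarrow>filter (\<lambda>u. mn u = n) (rown t). c (mv u) ^ (p ^ mi u))" for n
  define N where "N = Suc (sum_list (map (\<lambda>u. mn u) (rown t)))"
  have N: "mn u < N" if "u \<in> set (rown t)" for u
    using sum_list_ge[of "mn u" "map (\<lambda>u. mn u) (rown t)"] that unfolding N_def by auto
  have ec: "e (mv u) = const_rf (c (mv u))" "md u = 0" if "u \<in> set (rown t)" for u
    using set_rown[OF that] assms by auto
  have "ev e g = (\<Sum>n<N. z_rf ^ n * const_rf (\<Sum>u\<leftarrow>filter (\<lambda>u. mn u = n) g. c (mv u) ^ (p ^ mi u)))"
    if "\<And>u. u \<in> set g \<Longrightarrow> u \<in> set (rown t)" for g
    using that
  proof (induction g)
    case (Cons u g)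
    have "(\<Sum>n<N. z_rf ^ n * const_rf (\<Sum>u\<leftarrow>filter (\<lambda>u. mn u = n) (u # g). c (mv u) ^ (p ^ mi u)))
        = (\<Sum>n<N. (if n = mn u then z_rf ^ n * const_rf (c (mv u)) ^ (p ^ mi u) else 0)
            + z_rf ^ n * const_rf (\<Sum>u\<leftarrow>filter (\<lambda>u. mn u = n) g. c (mv u) ^ (p ^ mi u)))"
      by (intro sum.cong) (auto simp: distrib_left)
    also have "\<dots> = emon e u + ev e g"
      using Cons N[of u] ec[of u] by (simp add: sum.distrib emon_def)
    finally show ?case by simp
  qed simp
  from this[of "rown t"] have evr: "ev e (rown t) = (\<Sum>n<N. z_rf ^ n * const_rf (d n))" unfolding d_def by simp
  have "lp_sat p c (rowfm t) \<longleftrightarrow> (\<forall>u\<in>set (rown t). d (mn u) = 0)"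
    unfolding rowfm_def sat_lconj d_def by (simp add: lp_eval_lsum)
  also have "\<dots> \<longleftrightarrow> (\<forall>n<N. d n = 0)"
  proof
    assume a: "\<forall>u\<in>set (rown t). d (mn u) = 0"
    show "\<forall>n<N. d n = 0"
    proof (intro allI impI)
      fix n
      show "d n = 0"
      proof (cases "\<exists>u\<in>set (rown t). mn u = n")
        case False
        then have "filter (\<lambda>u. mn u = n) (rown t) = []" by (auto simp: filter_empty_conv)
        then show ?thesis unfolding d_def by simp
      qed (use a in auto)
    qed
  qed (use N in blast)
  also have "\<dots> \<longleftrightarrow> ev e (rown t) = 0"
  proof
    assume "ev e (rown t) = 0"
    then show "\<forall>n<N. d n = 0" unfolding evr using coords_unique[where N = N and d = d] by blast
  qed (simp add: evr)
  finally show ?thesis by simp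
qed

lemma fv_rowfm: "lp_fv (rowfm t) \<subseteq> (\<lambda>u. mv u) ` set t"
proof
  fix v assume "v \<in> lp_fv (rowfm t)"
  then obtain u where "u \<in> set (rown t)" "v = mv u" unfolding rowfm_def by (auto simp: fv_lconj vars_lsum)
  then show "v \<in> (\<lambda>u. mv u) ` set t" using set_rown[of u t] by auto
qed

lemma sat_Fcond:
  assumes "\<And>u. u \<in> set t \<Longrightarrow> e (mv u) = const_rf (c (mv u))"
  shows "lp_sat p c (Fcond t) \<longleftrightarrow> ev e t \<in> F"
proof -
  let ?w = "5 * fbound t + 4"
  have w: "mv u \<noteq> ?w" if "u \<in> set t" for u using fbound[OF that] by simp
  have "lp_sat p (c(?w := a)) (rowfm (t @ negf [(?w, 0, 0, 0)])) \<longleftrightarrow> ev e t = const_rf a" for a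
  proof -
    have "ev (e(?w := const_rf a)) t = ev e t" by (rule ev_cong) (use w in simp)
    then have "ev (e(?w := const_rf a)) (t @ negf [(?w, 0, 0, 0)]) = ev e t - const_rf a"
      by (simp add: emon_def)
    moreover have "lp_sat p (c(?w := a)) (rowfm (t @ negf [(?w, 0, 0, 0)]))
        \<longleftrightarrow> ev (e(?w := const_rf a)) (t @ negf [(?w, 0, 0, 0)]) = 0"
    proof (rule sat_rowfm)
      fix u assume "u \<in> set (t @ negf [(?w, 0, 0, 0)])"
      then have "u \<in> set t \<or> u = (?w, 0, 0, 0)" using set_negf[of "[(?w, 0, 0, 0)]"] by auto
      then show "(e(?w := const_rf a)) (mv u) = const_rf ((c(?w := a)) (mv u))"
        using assms[of u] w[of u] by (elim disjE) simp_all
    qed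
    ultimately show ?thesis by simp
  qed
  then show ?thesis unfolding Fcond_def by auto
qed

lemma fv_Fcond: "lp_fv (Fcond t) \<subseteq> (\<lambda>u. mv u) ` set t"
  using fv_rowfm[of "t @ negf [(5 * fbound t + 4, 0, 0, 0)]"] set_negf[of "[(5 * fbound t + 4, 0, 0, 0)]"]
  unfolding Fcond_def by fastforce

end

section \<open>Translation of formulas\<close>

text \<open>A problem consists of rows, of variables that are not in \<open>F\<close>, of variables equal to 1, and of an
  \<open>L\<^sub>p\<close>-formula in variables for elements of \<open>F\<close>; all variables of kind different from 0 are existentially quantified.\<close>

type_synonym prob = "alt \<times> lp_fm"

abbreviation Fkind :: "nat \<Rightarrow> bool" where "Fkind v \<equiv> v mod 5 = 2 \<or> v mod 5 = 4"

definition prename :: "(nat \<Rightarrow> nat) \<Rightarrow> prob \<Rightarrow> prob" where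
  "prename f Q = ((map (map (\<lambda>u. (f (mv u), snd u))) (fst (fst Q)), map f (fst (snd (fst Q))), map f (snd (snd (fst Q)))),
     ren_fm f (snd Q))"

definition wf_prob :: "prob \<Rightarrow> bool" where
  "wf_prob Q \<longleftrightarrow> (\<forall>v\<in>set (snd (snd (fst Q))) \<union> lp_fv (snd Q). Fkind v)"

text \<open>All quantified variables become variables in the scope of the negation: kinds 1 and 3 go
  to 3, kinds 2 and 4 go to 4. Doubling the index keeps the two sources apart.\<close>

definition nren :: "nat \<Rightarrow> nat" where
  "nren v = (if v mod 5 = 0 then v
     else 5 * (2 * (v div 5) + (if v mod 5 < 3 then 0 else 1)) + (if v mod 5 = 1 \<or> v mod 5 = 3 then 3 else 4))"

text \<open>For b = 0 and b = 1 two disjoint copies of the quantified variables, with the free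
  variables shared.\<close>

definition mren :: "nat \<Rightarrow> nat \<Rightarrow> nat" where
  "mren b v = (if v mod 5 = 0 then v else 5 * (2 * (v div 5) + b) + v mod 5)"

text \<open>The free variable 5 x becomes the variable 1, of kind 1; the quantified variables move
  up by 5 and vacate this number.\<close>

definition qren :: "nat \<Rightarrow> nat \<Rightarrow> nat" where
  "qren x v = (if v mod 5 = 0 then (if v = 5 * x then 1 else v) else v + 5)"

lemma kind_cases: "(v::nat) mod 5 = 0 \<or> v mod 5 = 1 \<or> v mod 5 = 2 \<or> v mod 5 = 3 \<or> v mod 5 = 4"
proof -
  have "v mod 5 < 5" by simp
  then show ?thesis by linarith
qed

lemma nren_mod: "nren v mod 5 = (if v mod 5 = 0 then 0 else if v mod 5 = 1 \<or> v mod 5 = 3 then 3 else 4)"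
  unfolding nren_def by (simp add: mod5 del: distrib_left_numeral)

lemma double_if_eq:
  "2 * a + (if P1 then 0 else 1) = 2 * b + (if P2 then 0 else (1::nat)) \<Longrightarrow> a = b \<and> (P1 \<longleftrightarrow> P2)"
  by (cases P1; cases P2) (simp_all, presburger+)

lemma nren_inj: "inj nren"
proof (rule injI)
  fix v w assume e: "nren v = nren w"
  have m: "nren v mod 5 = nren w mod 5" and d: "nren v div 5 = nren w div 5" using e by simp_all
  show "v = w"
  proof (cases "v mod 5 = 0")
    case True
    then have "w mod 5 = 0" using m unfolding nren_mod by (auto split: if_splits)
    then show ?thesis using e True by (simp add: nren_def)
  next
    case False
    then have w: "w mod 5 \<noteq> 0" using m unfolding nren_mod by (auto split: if_splits)
    have "2 * (v div 5) + (if v mod 5 < 3 then 0 else 1) = 2 * (w div 5) + (if w mod 5 < 3 then 0 else (1::nat))"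
      using d False w unfolding nren_def by (simp add: mod5 del: distrib_left_numeral)
    then have "v div 5 = w div 5 \<and> (v mod 5 < 3 \<longleftrightarrow> w mod 5 < 3)" by (rule double_if_eq)
    moreover from this have "v mod 5 = w mod 5"
      using kind_cases[of v] kind_cases[of w] m False w unfolding nren_mod by (elim disjE) simp_all
    ultimately show ?thesis by (metis div_mult_mod_eq)
  qed
qed

lemma mren_mod: "mren b v mod 5 = v mod 5"
  unfolding mren_def by (simp add: mod5 del: distrib_left_numeral)

lemma double_add_eq: "2 * a + b = 2 * c + d \<Longrightarrow> b < 2 \<Longrightarrow> d < 2 \<Longrightarrow> a = c \<and> b = (d::nat)"
  by presburger

lemma mren_eq: "b < 2 \<Longrightarrow> b' < 2 \<Longrightarrow> mren b v = mren b' w \<longleftrightarrow> v = w \<and> (v mod 5 = 0 \<or> b = b')"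
proof
  assume b: "b < 2" "b' < 2" and e: "mren b v = mren b' w"
  have m: "v mod 5 = w mod 5" using arg_cong[OF e, of "\<lambda>x. x mod 5"] by (simp add: mren_mod)
  show "v = w \<and> (v mod 5 = 0 \<or> b = b')"
  proof (cases "v mod 5 = 0")
    case True
    then show ?thesis using e m by (simp add: mren_def)
  next
    case False
    then have "2 * (v div 5) + b = 2 * (w div 5) + b'" using e m by (simp add: mren_def)
    then have "v div 5 = w div 5 \<and> b = b'" using b by (rule double_add_eq)
    then show ?thesis using m by (metis div_mult_mod_eq)
  qed
qed (auto simp: mren_def)

lemma mren_inj: "b < 2 \<Longrightarrow> inj (mren b)" by (rule injI) (simp add: mren_eq)

lemma qren_mod: "qren x v mod 5 = (if v = 5 * x then 1 else v mod 5)"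
  unfolding qren_def by auto

lemma qren_inj: "inj (qren x)"
proof (rule injI)
  fix v w assume "qren x v = qren x w"
  then show "v = w" unfolding qren_def by (cases "v mod 5 = 0"; cases "w mod 5 = 0") (auto split: if_splits)
qed

context setting
begin

definition cst :: "'a poly fract \<Rightarrow> 'a" where "cst x = (SOME c. const_rf c = x)"

lemma cst_const [simp]: "cst (const_rf c) = c" unfolding cst_def by simp

lemma const_cst: "x \<in> F \<Longrightarrow> const_rf (cst x) = x" by auto

definition core :: "(nat \<Rightarrow> 'a poly fract) \<Rightarrow> prob \<Rightarrow> bool" where
  "core e Q \<longleftrightarrow> altsem e (fst Q) \<and> lp_sat p (\<lambda>v. cst (e v)) (snd Q)"

definition psem :: "prob \<Rightarrow> (nat \<Rightarrow> 'a poly fract) \<Rightarrow> bool" where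
  "psem Q e \<longleftrightarrow> (\<exists>e'. valid e' \<and> (\<forall>v. v mod 5 = 0 \<longrightarrow> e' v = e v) \<and> core e' Q)"

lemma psem_cong: "(\<And>v. v mod 5 = 0 \<Longrightarrow> e v = e' v) \<Longrightarrow> psem Q e = psem Q e'"
  unfolding psem_def by auto

lemma core_prename:
  assumes "inj f"
  shows "core e (prename f Q) \<longleftrightarrow> core (\<lambda>v. e (f v)) Q"
proof -
  have "ev e (map (\<lambda>u. (f (mv u), snd u)) r) = ev (\<lambda>v. e (f v)) r" for r
    by (induction r) (simp_all add: emon_def)
  then show ?thesis unfolding core_def prename_def altsem_def by (simp add: sat_ren[OF assms])
qed

lemma wf_prob_prename:
  assumes "inj f" "\<And>v. Fkind (f v) \<longleftrightarrow> Fkind v"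
  shows "wf_prob (prename f Q) \<longleftrightarrow> wf_prob Q"
  unfolding wf_prob_def prename_def using assms(2) by (simp add: fv_ren[OF assms(1)] ball_Un)

definition ext :: "(nat \<Rightarrow> nat) \<Rightarrow> (nat \<Rightarrow> 'a poly fract) \<Rightarrow> (nat \<Rightarrow> 'a poly fract) \<Rightarrow> nat \<Rightarrow> 'a poly fract" where
  "ext f e2 e0 w = (if w \<in> range f then e2 (inv_into UNIV f w) else e0 w)"

lemma ext_range: "inj f \<Longrightarrow> ext f e2 e0 (f v) = e2 v"
  unfolding ext_def by simp

lemma valid_ext:
  assumes "inj f" "\<And>v. Fkind (f v) \<longleftrightarrow> Fkind v" "valid e2" "valid e0"
  shows "valid (ext f e2 e0)"
  unfolding valid_def
proof (intro conjI allI impI)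
  fix w
  show "ext f e2 e0 w \<in> R" unfolding ext_def using validD(1)[OF assms(3)] validD(1)[OF assms(4)] by simp
  assume w: "Fkind w"
  show "ext f e2 e0 w \<in> F"
  proof (cases "w \<in> range f")
    case True
    then obtain v where v: "w = f v" by blast
    then have "Fkind v" using w assms(2)[of v] by simp
    then show ?thesis unfolding v ext_range[OF assms(1)] by (rule validD(2)[OF assms(3)])
  next
    case False
    then show ?thesis unfolding ext_def using validD(2)[OF assms(4) w] by simp
  qed
qed

lemma valid_comp: "(\<And>v. Fkind v \<Longrightarrow> Fkind (f v)) \<Longrightarrow> valid e \<Longrightarrow> valid (\<lambda>v. e (f v))"
  unfolding valid_def by blast

definition base :: "(nat \<Rightarrow> 'a poly fract) \<Rightarrow> nat \<Rightarrow> 'a poly fract" where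
  "base e v = (if v mod 5 = 0 then e v else 0)"

lemma zero_F: "0 \<in> F"
  by (rule image_eqI[of _ _ 0]) simp_all

lemma valid_base: "(\<And>v. e v \<in> R) \<Longrightarrow> valid (base e)"
  unfolding valid_def base_def using zero_F by auto

subsection \<open>Existential quantifier and conjunction\<close>

lemma psem_qren:
  assumes "\<And>v. e v \<in> R"
  shows "psem (prename (qren x) Q) e \<longleftrightarrow> (\<exists>u\<in>R. psem Q (e(5 * x := u)))"
proof
  assume "psem (prename (qren x) Q) e"
  then obtain e' where e': "valid e'" "\<forall>v. v mod 5 = 0 \<longrightarrow> e' v = e v" "core (\<lambda>v. e' (qren x v)) Q"
    unfolding psem_def core_prename[OF qren_inj] by blast
  have "valid (\<lambda>v. e' (qren x v))" by (rule valid_comp[OF _ e'(1)]) (auto simp: qren_mod)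
  moreover have "e' (qren x v) = (e(5 * x := e' 1)) v" if "v mod 5 = 0" for v
    using e'(2) that by (simp add: qren_def)
  ultimately have "psem Q (e(5 * x := e' 1))" unfolding psem_def using e'(3) by blast
  then show "\<exists>u\<in>R. psem Q (e(5 * x := u))" using validD(1)[OF e'(1)] by blast
next
  assume "\<exists>u\<in>R. psem Q (e(5 * x := u))"
  then obtain u e2 where u: "u \<in> R" "valid e2" "\<forall>v. v mod 5 = 0 \<longrightarrow> e2 v = (e(5 * x := u)) v" "core e2 Q"
    unfolding psem_def by blast
  have k: "Fkind (qren x v) \<longleftrightarrow> Fkind v" for v by (auto simp: qren_mod)
  have "core (ext (qren x) e2 (base e)) (prename (qren x) Q)"
    unfolding core_prename[OF qren_inj] ext_range[OF qren_inj] by (rule u(4))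
  moreover have "ext (qren x) e2 (base e) w = e w" if w: "w mod 5 = 0" for w
  proof (cases "w \<in> range (qren x)")
    case True
    then obtain v where v: "w = qren x v" by blast
    then have "v mod 5 = 0" "v \<noteq> 5 * x" using w qren_mod[of x v] by (auto split: if_splits)
    then have "e2 v = e v" "w = v" using u(3) v by (simp_all add: qren_def)
    then show ?thesis unfolding v ext_range[OF qren_inj] using v by simp
  qed (simp add: ext_def base_def w)
  moreover have "valid (ext (qren x) e2 (base e))" by (rule valid_ext[OF qren_inj k u(2) valid_base[OF assms]])
  ultimately show "psem (prename (qren x) Q) e" unfolding psem_def by blast
qed

definition merge :: "prob \<Rightarrow> prob \<Rightarrow> prob" where
  "merge Pr Q = (let Pr' = prename (mren 0) Pr; Q' = prename (mren 1) Q in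
     ((fst (fst Pr') @ fst (fst Q'), fst (snd (fst Pr')) @ fst (snd (fst Q')), snd (snd (fst Pr')) @ snd (snd (fst Q'))),
      Conj (snd Pr') (snd Q')))"

lemma core_merge: "core e (merge Pr Q) \<longleftrightarrow> core (\<lambda>v. e (mren 0 v)) Pr \<and> core (\<lambda>v. e (mren 1 v)) Q"
proof -
  have "core e (merge Pr Q) \<longleftrightarrow> core e (prename (mren 0) Pr) \<and> core e (prename (mren 1) Q)"
    unfolding core_def merge_def Let_def altsem_def by auto
  then show ?thesis by (simp add: core_prename mren_inj)
qed

lemma wf_prob_merge: "wf_prob Pr \<Longrightarrow> wf_prob Q \<Longrightarrow> wf_prob (merge Pr Q)"
proof -
  assume "wf_prob Pr" "wf_prob Q"
  then have "wf_prob (prename (mren 0) Pr)" "wf_prob (prename (mren 1) Q)"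
    by (subst wf_prob_prename; simp add: mren_inj mren_mod)+
  then show ?thesis unfolding merge_def wf_prob_def Let_def by auto
qed

lemma psem_merge:
  assumes "\<And>v. e v \<in> R"
  shows "psem (merge Pr Q) e \<longleftrightarrow> psem Pr e \<and> psem Q e"
proof
  assume "psem (merge Pr Q) e"
  then obtain e' where e': "valid e'" "\<forall>v. v mod 5 = 0 \<longrightarrow> e' v = e v"
    "core (\<lambda>v. e' (mren 0 v)) Pr" "core (\<lambda>v. e' (mren 1 v)) Q" unfolding psem_def core_merge by blast
  have v: "valid (\<lambda>v. e' (mren b v))" for b by (rule valid_comp[OF _ e'(1)]) (simp add: mren_mod)
  have k: "e' (mren b v) = e v" if "v mod 5 = 0" for b v using e'(2) that by (simp add: mren_def)
  show "psem Pr e \<and> psem Q e"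
  proof
    show "psem Pr e" unfolding psem_def by (rule exI[of _ "\<lambda>v. e' (mren 0 v)"]) (use v k e'(3) in auto)
    show "psem Q e" unfolding psem_def by (rule exI[of _ "\<lambda>v. e' (mren 1 v)"]) (use v k e'(4) in auto)
  qed
next
  assume "psem Pr e \<and> psem Q e"
  then obtain e1 e2 where e1: "valid e1" "\<forall>v. v mod 5 = 0 \<longrightarrow> e1 v = e v" "core e1 Pr"
    and e2: "valid e2" "\<forall>v. v mod 5 = 0 \<longrightarrow> e2 v = e v" "core e2 Q" unfolding psem_def by blast
  have inj: "inj (mren 0)" "inj (mren 1)" by (simp_all add: mren_inj)
  define e' where "e' = ext (mren 0) e1 (ext (mren 1) e2 (base e))"
  have v: "valid e'" unfolding e'_def
    by (intro valid_ext inj e1(1) e2(1) valid_base assms) (simp_all add: mren_mod)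
  have l: "e' (mren 0 v) = e1 v" for v unfolding e'_def by (rule ext_range[OF inj(1)])
  have r: "e' (mren 1 v) = e2 v" for v
  proof (cases "mren 1 v \<in> range (mren 0)")
    case True
    then obtain w where "mren 1 v = mren 0 w" by blast
    moreover from this have "v = w" "v mod 5 = 0" by (auto simp: mren_eq)
    ultimately show ?thesis using l[of w] e1(2) e2(2) by simp
  next
    case False
    then show ?thesis unfolding e'_def ext_def[of "mren 0"] by (simp add: ext_range[OF inj(2), unfolded One_nat_def])
  qed
  have "e' v = e v" if "v mod 5 = 0" for v
    using l[of v] e1(2) that by (simp add: mren_def)
  then show "psem (merge Pr Q) e" unfolding psem_def core_merge
    by (intro exI[of _ e'] conjI v) (simp_all only: l r e1(3) e2(3), blast)
qed

subsection \<open>Negation\<close>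

definition istate :: "form list \<times> form list \<times> nat \<Rightarrow> state" where
  "istate x = (map rown (fst x), [], fst (snd x), [([], [], [])], snd (snd x))"

text \<open>Solvability of the final system as an L_p-formula in the parameters of kind 2. The
  quantifiers cover all variables of kind 4 below k + K, hence those of the original condition,
  which lie below k, and those of the final forms, which lie below K.\<close>

definition SF :: "prob \<Rightarrow> nat \<Rightarrow> (alt list \<times> (nat \<times> form) list) \<times> (nat \<times> form) list \<times> nat \<Rightarrow> lp_fm" where
  "SF Q k r = foldr Ex (map (\<lambda>i. 5 * i + 4) [0..<k + snd (snd r)]) (lconj (snd Q
     # map (\<lambda>v. Atom (LEq (LVar v) LOne)) (snd (snd (fst Q)))
     @ map (\<lambda>g. Conj (Atom (LEq (LVar (fst g)) LZero)) (rowfm (snd g))) (snd (fst r))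
     @ map (\<lambda>g. Neg (Conj (Atom (LEq (LVar (fst g)) LZero)) (Fcond (snd g)))) (fst (snd r))))"

definition nbnd :: "prob \<Rightarrow> nat" where
  "nbnd Q = Suc (sum_list (snd (snd (fst Q)) @ lfv (snd Q)))"

definition ninp :: "prob \<Rightarrow> form list \<times> form list \<times> nat" where
  "ninp Q = (fst (fst Q), map (\<lambda>v. [(v, 0, 0, 0)]) (fst (snd (fst Q))), nbnd Q)"

definition nres :: "(form list \<times> form list \<times> nat \<Rightarrow> cert list) \<Rightarrow> prob \<Rightarrow> prob list" where
  "nres sr Q = (let r = finalize (run (sr (ninp Q)) (istate (ninp Q))) in
     map (\<lambda>a. (a, Neg (SF Q (nbnd Q) r))) (fst (fst r)))"

lemma nbnd: "v \<in> set (snd (snd (fst Q))) \<union> lp_fv (snd Q) \<Longrightarrow> v < nbnd Q"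
  using sum_list_ge[of v "snd (snd (fst Q)) @ lfv (snd Q)"] unfolding nbnd_def by (auto simp: set_lfv)

text \<open>The variables that alternatives require to be 1 are flags, hence range over F;
  \<open>wf_prob\<close> needs this for the problems produced by negation.\<close>

definition oskind :: "alt list \<Rightarrow> bool" where
  "oskind A \<longleftrightarrow> (\<forall>a\<in>set A. \<forall>v\<in>set (snd (snd a)). v mod 5 = 2)"

lemma oskind_step: "oskind (fst (snd (snd (snd s)))) \<Longrightarrow> oskind (fst (snd (snd (snd (step c s)))))"
  unfolding step_def stepA_def stepS_def stepC_def subst_state_def chart_state_def oskind_def Let_def
  by (auto split: list.split)

lemma oskind_run: "oskind (fst (snd (snd (snd s)))) \<Longrightarrow> oskind (fst (snd (snd (snd (run cs s)))))"
  unfolding run_def by (induction cs arbitrary: s) (simp_all add: oskind_step)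

lemma oskind_coords: "oskind (fst st) \<Longrightarrow> oskind (fst (fold coord_step ts st))"
proof (induction ts arbitrary: st)
  case (Cons t ts)
  have "oskind (calts K t)" for K
    unfolding oskind_def calts_def gv_def by (auto simp: mod5_Suc simp del: distrib_left_numeral)
  then have "oskind (fst (coord_step t st))"
    using Cons.prems unfolding coord_step_def oskind_def combine_def by fastforce
  then show ?case using Cons.IH by simp
qed simp

lemma oskind_finalize: "oskind (fst (snd (snd (snd s)))) \<Longrightarrow> oskind (fst (fst (finalize s)))"
  unfolding finalize_def Let_def by (simp add: oskind_coords)

lemma nren_Fkind: "Fkind (nren v) \<longleftrightarrow> Fkind v"
  using kind_cases[of v] by (auto simp: nren_mod)

text \<open>After renaming to kinds 3 and 4 the problem is a system in the scope of the negation.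
  Elimination makes its solvability equivalent to the formula \<open>SF\<close> for any parameters
  that satisfy an alternative, so each alternative together with the negation of \<open>SF\<close>
  is one of the problems of the result.\<close>

lemma negation:
  assumes sr: "\<And>x. finished (run (sr x) (istate x))" and wf: "wf_prob Q" and e: "\<And>v. e v \<in> R"
  shows "(\<exists>Q'\<in>set (nres sr (prename nren Q)). psem Q' e) \<longleftrightarrow> \<not> psem Q e"
    and "\<And>Q'. Q' \<in> set (nres sr (prename nren Q)) \<Longrightarrow> wf_prob Q'"
proof -
  define N where "N = prename nren Q"
  define k where "k = nbnd N"
  define os where "os = snd (snd (fst N))"
  define rows where "rows = fst (fst N)"
  define iv where "iv = fst (snd (fst N))"
  define \<sigma> where "\<sigma> = snd N"
  define sg where "sg e \<longleftrightarrow> (\<forall>v\<in>set os. e v = 1) \<and> lp_sat p (\<lambda>v. cst (e v)) \<sigma>" for e :: "nat \<Rightarrow> 'a poly fract"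
  have wfN: "wf_prob N" unfolding N_def by (subst wf_prob_prename) (simp_all add: nren_inj nren_Fkind wf)
  have kinds: "Fkind v" "v < k" if "v \<in> set os \<union> lp_fv \<sigma>" for v
    using wfN that nbnd[of v N] unfolding wf_prob_def os_def \<sigma>_def k_def by blast+
  interpret el: elimination p S k sg
  proof
    fix e e' :: "nat \<Rightarrow> 'a poly fract"
    assume ee: "\<And>v. v < k \<Longrightarrow> Fkind v \<Longrightarrow> e v = e' v"
    have "lp_sat p (\<lambda>v. cst (e v)) \<sigma> = lp_sat p (\<lambda>v. cst (e' v)) \<sigma>"
      by (rule lp_sat_cong) (use ee kinds in auto)
    then show "sg e = sg e'" unfolding sg_def using ee kinds by auto
  qed
  define s0 where "s0 = istate (ninp N)"
  have s0: "s0 = (map rown rows, [], map (\<lambda>v. [(v, 0, 0, 0)]) iv, [([], [], [])], k)"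
    unfolding s0_def istate_def ninp_def rows_def iv_def k_def by simp
  define res where "res = finalize (run (sr (ninp N)) s0)"
  obtain A rp ip K where res: "res = ((A, rp), ip, K)" by (metis prod.collapse)
  have fin: "finished (run (sr (ninp N)) s0)" unfolding s0_def by (rule sr)
  note elim = el.elimination[OF order.refl fin[unfolded s0] res[unfolded res_def s0], folded s0]
  have core_iff: "core e' N \<longleftrightarrow> hold s0 e' \<and> sg e'" for e'
    unfolding core_def altsem_def s0 sg_def rows_def iv_def os_def \<sigma>_def by (auto simp: emon_def)
  have St_iff: "el.St s0 e1 \<longleftrightarrow> psem Q e1" if e1: "valid e1" for e1
  proof
    assume "el.St s0 e1"
    then obtain e' where e': "valid e'" "agree e1 e'" "core e' N" unfolding el.St_def core_iff by blast
    have "core (\<lambda>v. e' (nren v)) Q" using e'(3) unfolding N_def core_prename[OF nren_inj] .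
    moreover have "valid (\<lambda>v. e' (nren v))" by (rule valid_comp[OF _ e'(1)]) (simp add: nren_Fkind)
    moreover have "e' (nren v) = e1 v" if "v mod 5 = 0" for v
      using e'(2) that unfolding agree_def by (simp add: nren_def)
    ultimately show "psem Q e1" unfolding psem_def by blast
  next
    assume "psem Q e1"
    then obtain e2 where e2: "valid e2" "\<forall>v. v mod 5 = 0 \<longrightarrow> e2 v = e1 v" "core e2 Q" unfolding psem_def by blast
    define e' where "e' = ext nren e2 e1"
    have "core e' N" unfolding N_def core_prename[OF nren_inj] e'_def ext_range[OF nren_inj] by (rule e2(3))
    moreover have "valid e'" unfolding e'_def by (rule valid_ext[OF nren_inj nren_Fkind e2(1) e1])
    moreover have "e' w = e1 w" if w: "w mod 5 \<noteq> 3" "w mod 5 \<noteq> 4" for w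
    proof (cases "w \<in> range nren")
      case True
      then obtain v where v: "w = nren v" by blast
      then have "v mod 5 = 0" using w nren_mod[of v] by (auto split: if_splits)
      then show ?thesis unfolding e'_def v ext_range[OF nren_inj] using e2(2) by (simp add: nren_def)
    qed (simp add: e'_def ext_def)
    ultimately show "el.St s0 e1" unfolding el.St_def agree_def using core_iff by blast
  qed
  let ?vs = "map (\<lambda>i. 5 * i + 4) [0..<k + K]"
  have vs: "v \<in> set ?vs \<longleftrightarrow> v mod 5 = 4 \<and> v div 5 < k + K" for v
  proof
    assume "v \<in> set ?vs"
    then obtain i where "i < k + K" "v = 5 * i + 4" by auto
    then show "v mod 5 = 4 \<and> v div 5 < k + K" using mod5(1,2)[of 4 i] by simp
  next
    assume "v mod 5 = 4 \<and> v div 5 < k + K"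
    then show "v \<in> set ?vs" using div_mult_mod_eq[of v 5] unfolding set_map by (intro image_eqI[of _ _ "v div 5"]) auto
  qed
  have bnd: "v mod 5 = 4 \<Longrightarrow> v < k + K \<Longrightarrow> v \<in> set ?vs" for v unfolding vs using div_le_dividend[of v 5] by simp
  define sf where "sf = SF N k res"
  define body where "body = lconj (\<sigma> # map (\<lambda>v. Atom (LEq (LVar v) LOne)) os
     @ map (\<lambda>g. Conj (Atom (LEq (LVar (fst g)) LZero)) (rowfm (snd g))) rp
     @ map (\<lambda>g. Neg (Conj (Atom (LEq (LVar (fst g)) LZero)) (Fcond (snd g)))) ip)"
  have sf: "sf = foldr Ex ?vs body" unfolding sf_def SF_def body_def res os_def \<sigma>_def by simp
  have body: "lp_sat p c body \<longleftrightarrow> sg e' \<and> (\<forall>g\<in>set rp. e' (fst g) = 0 \<and> ev e' (snd g) = 0)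
       \<and> (\<forall>g\<in>set ip. \<not> (e' (fst g) = 0 \<and> ev e' (snd g) \<in> F))"
    if c: "\<And>v. Fkind v \<Longrightarrow> v < k + K \<Longrightarrow> e' v = const_rf (c v)" for c e'
  proof -
    have g: "fst g < k + K" "Fkind (fst g)" "u \<in> set (snd g) \<Longrightarrow> e' (mv u) = const_rf (c (mv u))"
      if "g \<in> set rp \<union> set ip" for g u
      using elim(3)[OF that] c[of "mv u"] by auto
    have "cst (e' v) = c v" if "v \<in> lp_fv \<sigma>" for v
      using c[of v] kinds[of v] that by simp
    then have "lp_sat p (\<lambda>v. cst (e' v)) \<sigma> = lp_sat p c \<sigma>" by (rule lp_sat_cong)
    moreover have "e' v = 1 \<longleftrightarrow> c v = 1" if "v \<in> set os" for v
      using c[of v] kinds[of v] that const_rf_inj[of "c v" 1] by auto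
    moreover have "e' (fst g) = 0 \<longleftrightarrow> c (fst g) = 0" if "g \<in> set rp \<union> set ip" for g
      using c[of "fst g"] g(1,2)[OF that] const_rf_inj[of "c (fst g)" 0] by auto
    moreover have "lp_sat p c (rowfm (snd g)) \<longleftrightarrow> ev e' (snd g) = 0" if "g \<in> set rp" for g
      by (rule sat_rowfm) (use g(3)[of g] that in blast)
    moreover have "lp_sat p c (Fcond (snd g)) \<longleftrightarrow> ev e' (snd g) \<in> F" if "g \<in> set ip" for g
      by (rule sat_Fcond) (use g(3)[of g] that in blast)
    ultimately show ?thesis unfolding body_def sat_lconj sg_def by (auto simp: ball_Un)
  qed
  have FS_iff: "el.FS rp ip e1 \<longleftrightarrow> lp_sat p (\<lambda>v. cst (e1 v)) sf" if e1: "valid e1" for e1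
  proof
    assume "el.FS rp ip e1"
    then obtain e' where e': "valid e'" "agree e1 e'" "\<forall>g\<in>set rp. e1 (fst g) = 0 \<and> ev e' (snd g) = 0"
      "\<forall>g\<in>set ip. \<not> (e1 (fst g) = 0 \<and> ev e' (snd g) \<in> F)" "sg e'" unfolding el.FS_def by blast
    have ge: "e' (fst g) = e1 (fst g)" if "g \<in> set rp \<union> set ip" for g
      using elim(3)[OF that] e'(2) unfolding agree_def by simp
    define c where "c v = (if v \<in> set ?vs then cst (e' v) else cst (e1 v))" for v
    have "lp_sat p c body"
    proof (subst body)
      show "e' v = const_rf (c v)" if "Fkind v" "v < k + K" for v
        using that(1)
      proof
        assume v: "v mod 5 = 2"
        then have "v \<notin> set ?vs" "e' v = e1 v" using vs e'(2) unfolding agree_def by auto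
        then show ?thesis using const_cst[OF validD(2)[OF e1 that(1)]] unfolding c_def by simp
      next
        assume "v mod 5 = 4"
        then show ?thesis using bnd[OF _ that(2)] const_cst[OF validD(2)[OF e'(1) that(1)]] unfolding c_def by simp
      qed
    qed (use e'(3-5) ge in auto)
    then show "lp_sat p (\<lambda>v. cst (e1 v)) sf" unfolding sf lp_sat_def sat_foldr_Ex
      by (intro exI[of _ c]) (auto simp: c_def simp del: set_map)
  next
    assume "lp_sat p (\<lambda>v. cst (e1 v)) sf"
    then obtain c where c: "\<forall>v. v \<notin> set ?vs \<longrightarrow> c v = cst (e1 v)" "lp_sat p c body"
      unfolding sf lp_sat_def sat_foldr_Ex by blast
    define e' where "e' v = (if v \<in> set ?vs then const_rf (c v) else e1 v)" for v
    have "valid e'" using e1 unfolding valid_def e'_def by (simp del: set_map)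
    moreover have ag: "agree e1 e'" unfolding agree_def e'_def vs by simp
    moreover have "e' v = const_rf (c v)" if "Fkind v" "v < k + K" for v
      using c(1) const_cst[OF validD(2)[OF e1 that(1)]] unfolding e'_def by (simp del: set_map)
    note b = body[of e' c, OF this]
    moreover have "e' (fst g) = e1 (fst g)" if "g \<in> set rp \<union> set ip" for g
      using elim(3)[OF that] ag unfolding agree_def by simp
    ultimately show "el.FS rp ip e1" unfolding el.FS_def using c(2) by (intro exI[of _ e']) auto
  qed
  have out: "nres sr N = map (\<lambda>a. (a, Neg sf)) A"
    unfolding nres_def s0_def[symmetric] res_def[symmetric] sf_def k_def Let_def by (simp add: res)
  show "(\<exists>Q'\<in>set (nres sr (prename nren Q)). psem Q' e) \<longleftrightarrow> \<not> psem Q e"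
    unfolding N_def[symmetric] out
  proof
    assume "\<exists>Q'\<in>set (map (\<lambda>a. (a, Neg sf)) A). psem Q' e"
    then obtain a e1 where a: "a \<in> set A" "valid e1" "\<forall>v. v mod 5 = 0 \<longrightarrow> e1 v = e v" "altsem e1 a"
      "\<not> lp_sat p (\<lambda>v. cst (e1 v)) sf" unfolding psem_def core_def by auto
    then have "\<not> el.St s0 e1" using elim(2)[OF a(2)] FS_iff[OF a(2)] by blast
    then show "\<not> psem Q e" using St_iff[OF a(2)] psem_cong[of e1 e Q] a(3) by blast
  next
    assume n: "\<not> psem Q e"
    obtain e1 where e1: "valid e1" "\<forall>v. v mod 5 = 0 \<longrightarrow> e1 v = base e v" "\<exists>a\<in>set A. altsem e1 a"
      using elim(1)[OF valid_base[of e, OF e]] by blast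
    have "\<forall>v. v mod 5 = 0 \<longrightarrow> e1 v = e v" using e1(2) unfolding base_def by simp
    moreover from this have "\<not> el.St s0 e1" using n St_iff[OF e1(1)] psem_cong[of e1 e Q] by blast
    then have "\<not> lp_sat p (\<lambda>v. cst (e1 v)) sf" using elim(2)[OF e1(1,3)] FS_iff[OF e1(1)] by blast
    ultimately show "\<exists>Q'\<in>set (map (\<lambda>a. (a, Neg sf)) A). psem Q' e"
      using e1(1,3) unfolding psem_def core_def by auto
  qed
  show "wf_prob Q'" if Q': "Q' \<in> set (nres sr (prename nren Q))" for Q'
  proof -
    obtain a where a: "Q' = (a, Neg sf)" "a \<in> set A" using Q' unfolding N_def[symmetric] out by auto
    have "oskind (fst (fst res))" unfolding res_def
      by (intro oskind_finalize oskind_run) (simp add: s0 oskind_def)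
    then have "oskind A" by (simp add: res)
    moreover have "Fkind v" if "v \<in> lp_fv sf" for v
    proof -
      have "v \<in> lp_fv body" using that unfolding sf fv_foldr_Ex by blast
      then consider "v \<in> lp_fv \<sigma>" | "v \<in> set os" | g where "g \<in> set rp \<union> set ip" "v = fst g \<or> v \<in> lp_fv (rowfm (snd g)) \<or> v \<in> lp_fv (Fcond (snd g))"
        unfolding body_def fv_lconj by auto
      then show ?thesis
      proof cases
        case 3
        then show ?thesis using elim(3)[OF 3(1)] fv_rowfm[of "snd g"] fv_Fcond[of "snd g"] by fastforce
      qed (use kinds in blast)+
    qed
    ultimately show ?thesis using a unfolding wf_prob_def oskind_def by auto
  qed
qed

subsection \<open>The translation\<close>

definition land :: "prob list \<Rightarrow> prob list \<Rightarrow> prob list" where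
  "land A C = concat (map (\<lambda>a. map (merge a) C) A)"

text \<open>De Morgan: the negation of a disjunction is the conjunction of the negations, started
  from a problem without conditions.\<close>

definition lneg :: "(form list \<times> form list \<times> nat \<Rightarrow> cert list) \<Rightarrow> prob list \<Rightarrow> prob list" where
  "lneg sr A = foldr (\<lambda>Q r. land (nres sr (prename nren Q)) r) A [(([], [], []), ltrue)]"

text \<open>The variable i of a formula is the variable 5 i, of kind 0. The constant 1 is the
  variable 2, which every atomic problem requires to be 1.\<close>

definition tform :: "lpz_tm \<Rightarrow> form" where
  "tform t = rec_lpz_tm (\<lambda>i. [(5 * i, 0, 0, 0)]) [] [(2, 0, 0, 0)] (\<lambda>_ _ r s. r @ s)
     (\<lambda>_ r. map (\<lambda>u. (mv u, Suc (mi u), p * mn u, p * md u)) r) (\<lambda>_ r. map (\<lambda>u. (mv u, mi u, Suc (mn u), md u)) r) t"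

text \<open>Membership in F is equality with a variable of kind 2. The numbers 7 and 5 (i + 1) + 2
  avoid the variable 2 reserved for the constant.\<close>

definition atom_prob :: "lpze_atom \<Rightarrow> prob" where
  "atom_prob a = (case a of Eq s t \<Rightarrow> (([tform s @ negf (tform t)], [], [2]), ltrue)
     | InF t \<Rightarrow> (([tform t @ negf [(7, 0, 0, 0)]], [], [2]), ltrue)
     | P \<sigma> ts \<Rightarrow> ((map (\<lambda>i. tform (lnth Zero ts i) @ negf [(5 * Suc i + 2, 0, 0, 0)]) [0..<length ts], [], [2]),
         ren_fm (\<lambda>i. 5 * Suc i + 2) \<sigma>))"

definition tr :: "(form list \<times> form list \<times> nat \<Rightarrow> cert list) \<Rightarrow> lpze_fm \<Rightarrow> prob list" where
  "tr sr \<phi> = rec_fm (\<lambda>a. [atom_prob a]) (\<lambda>_ r. lneg sr r) (\<lambda>_ _ r s. land r s) (\<lambda>_ _ r s. r @ s)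
     (\<lambda>_ _ r s. lneg sr r @ s) (\<lambda>x _ r. map (prename (qren x)) r) (\<lambda>x _ r. lneg sr (map (prename (qren x)) (lneg sr r))) \<phi>"

definition lsem :: "prob list \<Rightarrow> (nat \<Rightarrow> 'a poly fract) \<Rightarrow> bool" where
  "lsem A e \<longleftrightarrow> (\<exists>Q\<in>set A. psem Q e)"

definition lwf :: "prob list \<Rightarrow> bool" where "lwf A \<longleftrightarrow> (\<forall>Q\<in>set A. wf_prob Q)"

lemma lsem_land: "(\<And>v. e v \<in> R) \<Longrightarrow> lsem (land A C) e \<longleftrightarrow> lsem A e \<and> lsem C e"
  unfolding lsem_def land_def by (auto simp: psem_merge)

lemma lwf_land: "lwf A \<Longrightarrow> lwf C \<Longrightarrow> lwf (land A C)"
  unfolding lwf_def land_def by (auto simp: wf_prob_merge)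

lemma lneg:
  assumes sr: "\<And>x. finished (run (sr x) (istate x))" and "lwf A"
  shows "lwf (lneg sr A) \<and> (\<forall>e. (\<forall>v. e v \<in> R) \<longrightarrow> (lsem (lneg sr A) e \<longleftrightarrow> \<not> lsem A e))"
  using assms(2)
proof (induction A)
  case Nil
  have "psem (([], [], []), ltrue) e" if e: "\<forall>v. e v \<in> R" for e
    unfolding psem_def by (rule exI[of _ "base e"]) (use e in \<open>simp add: valid_base core_def altsem_def base_def\<close>)
  then show ?case by (simp add: lneg_def lsem_def lwf_def wf_prob_def)
next
  case (Cons Q A)
  have wf: "wf_prob Q" and A: "lwf A" using Cons.prems unfolding lwf_def by auto
  have eq: "lneg sr (Q # A) = land (nres sr (prename nren Q)) (lneg sr A)" unfolding lneg_def by simp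
  have "lwf (nres sr (prename nren Q))"
    unfolding lwf_def
  proof
    fix Q' assume "Q' \<in> set (nres sr (prename nren Q))"
    then show "wf_prob Q'" by (rule negation(2)[OF sr wf, of "\<lambda>_. 0", OF R_0])
  qed
  moreover have "lsem (nres sr (prename nren Q)) e \<longleftrightarrow> \<not> psem Q e" if "\<forall>v. e v \<in> R" for e
    unfolding lsem_def by (rule negation(1)[OF sr wf]) (use that in blast)
  ultimately show ?case unfolding eq using Cons.IH[OF A] by (auto simp: lsem_land lwf_land lsem_def[of "Q # A"] lsem_def[of A])
qed

lemma lsem_qren: "(\<And>v. e v \<in> R) \<Longrightarrow> lsem (map (prename (qren x)) A) e \<longleftrightarrow> (\<exists>u\<in>R. lsem A (e(5 * x := u)))"
  unfolding lsem_def by (auto simp: psem_qren)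

lemma lwf_qren: "lwf A \<Longrightarrow> lwf (map (prename (qren x)) A)"
  unfolding lwf_def using wf_prob_prename[OF qren_inj[of x]] by (auto simp: qren_mod)

lemma ev_tform: "e 2 = 1 \<Longrightarrow> ev e (tform t) = lpz_eval p (\<lambda>i. e (5 * i)) t"
proof (induction t)
  case (Frob t)
  have "ev e (map (\<lambda>u. (mv u, Suc (mi u), p * mn u, p * md u)) r) = ev e r ^ p" for r
  proof (induction r)
    case (Cons u r)
    have "emon e (mv u, Suc (mi u), p * mn u, p * md u) = emon e u ^ p"
      by (simp add: emon_def power_mult_distrib power_mult[symmetric] mult.commute)
    then show ?case using Cons frob_add[of _ _ 1] by simp
  qed (use p_gt_0 in \<open>simp add: power_0_left\<close>)
  then show ?case using Frob by (simp add: tform_def)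
next
  case (MulZ t)
  have "ev e (map (\<lambda>u. (mv u, mi u, Suc (mn u), md u)) r) = z_rf * ev e r" for r
    by (induction r) (simp_all add: emon_def algebra_simps)
  then show ?case using MulZ by (simp add: tform_def)
qed (simp_all add: tform_def emon_def)

lemma atom_prob:
  assumes "wf_atom a" "\<And>v. e v \<in> R"
  shows "psem (atom_prob a) e \<longleftrightarrow> lpze_atom_holds p (\<lambda>i. e (5 * i)) a" and "wf_prob (atom_prob a)"
proof -
  have one: "1 \<in> F" by (rule image_eqI[of _ _ 1]) simp_all
  have t: "ev e' (tform t) = lpz_eval p (\<lambda>i. e (5 * i)) t"
    if "\<forall>v. v mod 5 = 0 \<longrightarrow> e' v = e v" "e' 2 = 1" for e' t
  proof -
    have "(\<lambda>i. e' (5 * i)) = (\<lambda>i. e (5 * i))" using that(1) by auto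
    then show ?thesis using ev_tform[of e', OF that(2)] by simp
  qed
  have *: "inj (\<lambda>i. 5 * Suc i + 2)" by (auto intro: injI)
  have m: "(5 * Suc i + 2) mod 5 = 2" for i by (rule mod5) simp
  show "wf_prob (atom_prob a)"
  proof (cases a)
    case (P \<sigma> ts)
    have "\<forall>v\<in>lp_fv (ren_fm (\<lambda>i. 5 * Suc i + 2) \<sigma>). v mod 5 = 2" unfolding fv_ren[OF *] using m by blast
    then show ?thesis by (auto simp: wf_prob_def atom_prob_def P simp del: mult_Suc_right)
  qed (simp_all add: wf_prob_def atom_prob_def)
  show "psem (atom_prob a) e \<longleftrightarrow> lpze_atom_holds p (\<lambda>i. e (5 * i)) a"
  proof (cases a)
    case (Eq s u)
    have "psem (atom_prob a) e \<longleftrightarrow> (\<exists>e'. valid e' \<and> (\<forall>v. v mod 5 = 0 \<longrightarrow> e' v = e v) \<and> e' 2 = 1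
        \<and> lpz_eval p (\<lambda>i. e (5 * i)) s = lpz_eval p (\<lambda>i. e (5 * i)) u)"
      unfolding psem_def core_def altsem_def Eq atom_prob_def by (auto simp: t)
    moreover have "valid ((base e)(2 := 1))" using valid_base[OF assms(2)] one unfolding valid_def by auto
    then have "\<exists>e'. valid e' \<and> (\<forall>v. v mod 5 = 0 \<longrightarrow> e' v = e v) \<and> e' 2 = 1"
      by (intro exI[of _ "(base e)(2 := 1)"]) (simp add: base_def)
    ultimately show ?thesis unfolding Eq by auto
  next
    case (InF u)
    have eq: "psem (atom_prob a) e \<longleftrightarrow> (\<exists>e'. valid e' \<and> (\<forall>v. v mod 5 = 0 \<longrightarrow> e' v = e v) \<and> e' 2 = 1
        \<and> lpz_eval p (\<lambda>i. e (5 * i)) u = e' 7)"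
      unfolding psem_def core_def altsem_def InF atom_prob_def by (auto simp: t emon_def)
    show ?thesis
    proof
      assume "psem (atom_prob a) e"
      then obtain e' where e': "valid e'" "lpz_eval p (\<lambda>i. e (5 * i)) u = e' 7" unfolding eq by blast
      then show "lpze_atom_holds p (\<lambda>i. e (5 * i)) a" unfolding InF using validD(2)[OF e'(1), of 7] by simp
    next
      assume h: "lpze_atom_holds p (\<lambda>i. e (5 * i)) a"
      define e' where "e' = (base e)(2 := 1, 7 := lpz_eval p (\<lambda>i. e (5 * i)) u)"
      have "valid e'" using valid_base[OF assms(2)] one h F_R unfolding valid_def e'_def InF by auto
      then show "psem (atom_prob a) e" unfolding eq by (intro exI[of _ e']) (simp add: e'_def base_def)
    qed
  next
    case (P \<sigma> ts)
    have fv: "lp_fv \<sigma> \<subseteq> {..<length ts}" using assms(1) unfolding P by simp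
    define g where "g i = 5 * Suc i + 2" for i
    have g: "inj g" "g i mod 5 = 2" "g i div 5 = Suc i" "g i \<noteq> 2" for i
    proof -
      show "inj g" unfolding g_def by (rule *)
      show "g i mod 5 = 2" unfolding g_def by (rule m)
      show "g i div 5 = Suc i" unfolding g_def by (rule mod5) simp
      show "g i \<noteq> 2" unfolding g_def by simp
    qed
    have ap: "atom_prob a = ((map (\<lambda>i. tform (lnth Zero ts i) @ negf [(g i, 0, 0, 0)]) [0..<length ts], [], [2]), ren_fm g \<sigma>)"
      unfolding P atom_prob_def g_def[abs_def] by simp
    have "core e' (atom_prob a) \<longleftrightarrow> e' 2 = 1 \<and> (\<forall>i<length ts. lpz_eval p (\<lambda>i. e (5 * i)) (ts ! i) = e' (g i))
        \<and> lp_sat p (\<lambda>i. cst (e' (g i))) \<sigma>" if k: "\<forall>v. v mod 5 = 0 \<longrightarrow> e' v = e v" for e'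
    proof (cases "e' 2 = 1")
      case True
      then show ?thesis unfolding core_def altsem_def ap
        by (auto simp: t[OF k True] emon_def lnth_eq sat_ren[OF g(1)])
    qed (simp add: core_def altsem_def ap)
    then have eq: "psem (atom_prob a) e \<longleftrightarrow> (\<exists>e'. valid e' \<and> (\<forall>v. v mod 5 = 0 \<longrightarrow> e' v = e v) \<and> e' 2 = 1
        \<and> (\<forall>i<length ts. lpz_eval p (\<lambda>i. e (5 * i)) (ts ! i) = e' (g i)) \<and> lp_sat p (\<lambda>i. cst (e' (g i))) \<sigma>)"
      unfolding psem_def by blast
    show ?thesis
    proof
      assume "psem (atom_prob a) e"
      then obtain e' where e': "valid e'" "\<forall>i<length ts. lpz_eval p (\<lambda>i. e (5 * i)) (ts ! i) = e' (g i)"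
        "lp_sat p (\<lambda>i. cst (e' (g i))) \<sigma>" unfolding eq by blast
      define cs where "cs = map (\<lambda>i. cst (e' (g i))) [0..<length ts]"
      have "const_rf (cst (e' (g i))) = e' (g i)" for i
        by (rule const_cst, rule validD(2)[OF e'(1)]) (use g(2) in blast)
      then have "map (lpz_eval p (\<lambda>i. e (5 * i))) ts = map const_rf cs"
        using e'(2) by (intro nth_equalityI) (simp_all add: cs_def)
      moreover have "lp_sat p (\<lambda>i. cs ! i) \<sigma> = lp_sat p (\<lambda>i. cst (e' (g i))) \<sigma>"
        by (rule lp_sat_cong) (use fv in \<open>auto simp: cs_def\<close>)
      ultimately show "lpze_atom_holds p (\<lambda>i. e (5 * i)) a" unfolding P lpze_atom_holds.simps using e'(3) by (intro exI[of _ cs]) simp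
    next
      assume "lpze_atom_holds p (\<lambda>i. e (5 * i)) a"
      then obtain cs where cs: "map (lpz_eval p (\<lambda>i. e (5 * i))) ts = map const_rf cs" "lp_sat p (\<lambda>i. cs ! i) \<sigma>"
        unfolding P lpze_atom_holds.simps by blast
      have len: "length cs = length ts" using arg_cong[OF cs(1), of length] by simp
      define e' where "e' v = (if v mod 5 = 0 then e v else if v = 2 then 1 else const_rf (cs ! (v div 5 - 1)))" for v
      have ei: "e' (g i) = const_rf (cs ! i)" for i
        unfolding e'_def using g(2-4)[of i] by simp
      have "valid e'" using assms(2) one F_R unfolding valid_def e'_def by auto
      moreover have "lpz_eval p (\<lambda>i. e (5 * i)) (ts ! i) = e' (g i)" if "i < length ts" for i
        using arg_cong[OF cs(1), of "\<lambda>xs. xs ! i"] that len unfolding ei by simp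
      moreover have "lp_sat p (\<lambda>i. cst (e' (g i))) \<sigma>" unfolding ei cst_const by (rule cs(2))
      ultimately show "psem (atom_prob a) e" unfolding eq by (intro exI[of _ e']) (simp add: e'_def)
    qed
  qed
qed

theorem translation:
  assumes sr: "\<And>x. finished (run (sr x) (istate x))" and "lpze_formula \<phi>"
  shows "lwf (tr sr \<phi>) \<and> (\<forall>e. (\<forall>v. e v \<in> R) \<longrightarrow> (lsem (tr sr \<phi>) e \<longleftrightarrow> lpze_sat p S (\<lambda>i. e (5 * i)) \<phi>))"
  using assms(2)
proof (induction \<phi>)
  case (Atom a)
  then have "wf_atom a" by (simp add: lpze_formula_def)
  then show ?case using atom_prob[of a] by (auto simp: tr_def lsem_def lwf_def lpze_sat_def atom_prob(2)[of a "\<lambda>_. 0"])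
next
  case (Neg \<phi>)
  then have "lwf (tr sr \<phi>)" by (simp add: lpze_formula_def)
  from lneg[OF sr this] show ?case using Neg by (simp add: tr_def lpze_formula_def lpze_sat_def)
next
  case (Conj \<phi> \<psi>)
  then show ?case by (auto simp: tr_def lpze_formula_def lpze_sat_def lsem_land lwf_land)
next
  case (Disj \<phi> \<psi>)
  have ap: "lsem (A @ C) e \<longleftrightarrow> lsem A e \<or> lsem C e" "lwf (A @ C) \<longleftrightarrow> lwf A \<and> lwf C" for A C e
    unfolding lsem_def lwf_def by auto
  show ?case using Disj by (auto simp: tr_def lpze_formula_def lpze_sat_def ap)
next
  case (Imp \<phi> \<psi>)
  have ap: "lsem (A @ C) e \<longleftrightarrow> lsem A e \<or> lsem C e" "lwf (A @ C) \<longleftrightarrow> lwf A \<and> lwf C" for A C e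
    unfolding lsem_def lwf_def by auto
  have "lwf (tr sr \<phi>)" using Imp by (simp add: lpze_formula_def)
  from lneg[OF sr this] show ?case using Imp by (auto simp: tr_def lpze_formula_def lpze_sat_def ap)
next
  case (Ex x \<phi>)
  have up: "(\<lambda>i. (e(5 * x := u)) (5 * i)) = (\<lambda>i. e (5 * i))(x := u)" for e :: "nat \<Rightarrow> 'a poly fract" and u by auto
  have IH: "lwf (tr sr \<phi>)" "\<And>e. \<forall>v. e v \<in> R \<Longrightarrow> lsem (tr sr \<phi>) e \<longleftrightarrow> lpze_sat p S (\<lambda>i. e (5 * i)) \<phi>"
    using Ex by (simp_all add: lpze_formula_def)
  have "lsem (map (prename (qren x)) (tr sr \<phi>)) e \<longleftrightarrow> lpze_sat p S (\<lambda>i. e (5 * i)) (Ex x \<phi>)" if e: "\<forall>v. e v \<in> R" for e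
  proof -
    have "lsem (map (prename (qren x)) (tr sr \<phi>)) e \<longleftrightarrow> (\<exists>u\<in>R. lsem (tr sr \<phi>) (e(5 * x := u)))"
      by (rule lsem_qren) (use e in blast)
    also have "\<dots> \<longleftrightarrow> (\<exists>u\<in>R. lpze_sat p S ((\<lambda>i. e (5 * i))(x := u)) \<phi>)"
    proof (rule bex_cong[OF refl])
      fix u assume "u \<in> R"
      then have "\<forall>v. (e(5 * x := u)) v \<in> R" using e by simp
      then show "lsem (tr sr \<phi>) (e(5 * x := u)) \<longleftrightarrow> lpze_sat p S ((\<lambda>i. e (5 * i))(x := u)) \<phi>"
        using IH(2)[of "e(5 * x := u)"] unfolding up by blast
    qed
    finally show ?thesis by (simp add: lpze_sat_def)
  qed
  then show ?case using lwf_qren[OF IH(1)] by (simp add: tr_def)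
next
  case (All x \<phi>)
  have up: "(\<lambda>i. (e(5 * x := u)) (5 * i)) = (\<lambda>i. e (5 * i))(x := u)" for e :: "nat \<Rightarrow> 'a poly fract" and u by auto
  have IH: "lwf (tr sr \<phi>)" "\<And>e. \<forall>v. e v \<in> R \<Longrightarrow> lsem (tr sr \<phi>) e \<longleftrightarrow> lpze_sat p S (\<lambda>i. e (5 * i)) \<phi>"
    using All by (simp_all add: lpze_formula_def)
  note n1 = lneg[OF sr IH(1)]
  have w2: "lwf (map (prename (qren x)) (lneg sr (tr sr \<phi>)))" using lwf_qren n1 by blast
  note n2 = lneg[OF sr w2]
  have "lsem (map (prename (qren x)) (lneg sr (tr sr \<phi>))) e \<longleftrightarrow> \<not> lpze_sat p S (\<lambda>i. e (5 * i)) (All x \<phi>)" if e: "\<forall>v. e v \<in> R" for e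
  proof -
    have "lsem (map (prename (qren x)) (lneg sr (tr sr \<phi>))) e \<longleftrightarrow> (\<exists>u\<in>R. lsem (lneg sr (tr sr \<phi>)) (e(5 * x := u)))"
      by (rule lsem_qren) (use e in blast)
    also have "\<dots> \<longleftrightarrow> (\<exists>u\<in>R. \<not> lpze_sat p S ((\<lambda>i. e (5 * i))(x := u)) \<phi>)"
    proof (rule bex_cong[OF refl])
      fix u assume "u \<in> R"
      then have "\<forall>v. (e(5 * x := u)) v \<in> R" using e by simp
      then show "lsem (lneg sr (tr sr \<phi>)) (e(5 * x := u)) \<longleftrightarrow> \<not> lpze_sat p S ((\<lambda>i. e (5 * i))(x := u)) \<phi>"
        using n1 IH(2)[of "e(5 * x := u)"] unfolding up by blast
    qed
    finally show ?thesis by (simp add: lpze_sat_def)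
  qed
  then show ?case using n2 by (simp add: tr_def)
qed

end

subsection \<open>The existential formula\<close>

text \<open>Back to variables of formulas: 5 i with i < M returns to i, and all other variables are
  moved to M or above, out of the way of the original free variables when M exceeds them.\<close>

definition hmap :: "nat \<Rightarrow> nat \<Rightarrow> nat" where
  "hmap M v = (if v mod 5 = 0 \<and> v div 5 < M then v div 5 else M + v)"

lemma hmap_inj: "inj (hmap M)"
proof (rule injI)
  fix v w assume e: "hmap M v = hmap M w"
  show "v = w"
  proof (cases "v mod 5 = 0 \<and> v div 5 < M"; cases "w mod 5 = 0 \<and> w div 5 < M")
    assume a: "v mod 5 = 0 \<and> v div 5 < M" "w mod 5 = 0 \<and> w div 5 < M"
    then have "v div 5 = w div 5" using e by (simp add: hmap_def)
    then show ?thesis using a by (metis div_mult_mod_eq)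
  qed (use e in \<open>auto simp: hmap_def\<close>)
qed

lemma hmap_less: "hmap M v < M \<Longrightarrow> v mod 5 = 0 \<and> hmap M v = v div 5"
  unfolding hmap_def by (auto split: if_splits)

definition zconj :: "lpze_fm list \<Rightarrow> lpze_fm" where
  "zconj \<phi>s = foldr Conj \<phi>s (Atom (Eq Zero Zero))"

definition zdisj :: "lpze_fm list \<Rightarrow> lpze_fm" where
  "zdisj \<phi>s = foldr Disj \<phi>s (Neg (Atom (Eq Zero Zero)))"

lemma sat_zconj: "lpze_sat p S d (zconj \<phi>s) \<longleftrightarrow> (\<forall>\<phi>\<in>set \<phi>s. lpze_sat p S d \<phi>)"
  by (induction \<phi>s) (auto simp: zconj_def lpze_sat_def)

lemma sat_zdisj: "lpze_sat p S d (zdisj \<phi>s) \<longleftrightarrow> (\<exists>\<phi>\<in>set \<phi>s. lpze_sat p S d \<phi>)"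
  by (induction \<phi>s) (auto simp: zdisj_def lpze_sat_def)

lemma fv_zconj: "lpze_fv (zconj \<phi>s) = (\<Union>\<phi>\<in>set \<phi>s. lpze_fv \<phi>)"
  by (induction \<phi>s) (auto simp: zconj_def)

lemma fv_zdisj: "lpze_fv (zdisj \<phi>s) = (\<Union>\<phi>\<in>set \<phi>s. lpze_fv \<phi>)"
  by (induction \<phi>s) (auto simp: zdisj_def)

lemma formula_zconj: "lpze_formula (zconj \<phi>s) \<longleftrightarrow> (\<forall>\<phi>\<in>set \<phi>s. lpze_formula \<phi>)"
  by (induction \<phi>s) (auto simp: zconj_def lpze_formula_def)

lemma formula_zdisj: "lpze_formula (zdisj \<phi>s) \<longleftrightarrow> (\<forall>\<phi>\<in>set \<phi>s. lpze_formula \<phi>)"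
  by (induction \<phi>s) (auto simp: zdisj_def lpze_formula_def)

lemma qf_zconj: "quantifier_free (zconj \<phi>s) \<longleftrightarrow> (\<forall>\<phi>\<in>set \<phi>s. quantifier_free \<phi>)"
  by (induction \<phi>s) (auto simp: zconj_def)

lemma qf_zdisj: "quantifier_free (zdisj \<phi>s) \<longleftrightarrow> (\<forall>\<phi>\<in>set \<phi>s. quantifier_free \<phi>)"
  by (induction \<phi>s) (auto simp: zdisj_def)

lemma formula_foldr_Ex: "lpze_formula (foldr Ex vs \<psi>) \<longleftrightarrow> lpze_formula \<psi>"
  by (induction vs) (auto simp: lpze_formula_def)

definition rterm :: "nat \<Rightarrow> form \<Rightarrow> lpz_tm" where
  "rterm M r = foldr (\<lambda>u t. Add (rec_nat (rec_nat (Var (hmap M (mv u))) (\<lambda>_ t. Frob t) (mi u)) (\<lambda>_ t. MulZ t) (mn u)) t) r Zero"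

lemma vars_rterm: "lpz_tm_vars (rterm M r) = (\<lambda>u. hmap M (mv u)) ` set r"
proof -
  have "lpz_tm_vars (rec_nat t (\<lambda>_ t. Frob t) i) = lpz_tm_vars t" "lpz_tm_vars (rec_nat t (\<lambda>_ t. MulZ t) i) = lpz_tm_vars t" for t i
    by (induction i) simp_all
  then show ?thesis by (induction r) (simp_all add: rterm_def)
qed

context setting
begin

definition qv :: "prob \<Rightarrow> nat list" where
  "qv Q = concat (map (\<lambda>r. map (\<lambda>u. mv u) (rown r)) (fst (fst Q))) @ fst (snd (fst Q)) @ snd (snd (fst Q)) @ lfv (snd Q)"

text \<open>Rows are taken in normal form because L_p(z)-terms cannot divide by D. The ranges of the
  F-variables are made explicit. Positions of the last atom that are not free in its formula are
  filled with \<open>Zero\<close>, since all arguments of P_\<sigma> have to lie in F.\<close>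

definition matrix_fm :: "nat \<Rightarrow> prob \<Rightarrow> lpze_fm" where
  "matrix_fm M Q = zconj (map (\<lambda>r. Atom (Eq (rterm M (rown r)) Zero)) (fst (fst Q))
     @ map (\<lambda>v. Neg (Atom (InF (Var (hmap M v))))) (fst (snd (fst Q)))
     @ map (\<lambda>v. Atom (Eq (Var (hmap M v)) One)) (snd (snd (fst Q)))
     @ map (\<lambda>v. Atom (InF (Var (hmap M v)))) (filter (\<lambda>v. \<not> (v mod 5 \<noteq> 2 \<and> v mod 5 \<noteq> 4)) (qv Q))
     @ [Atom (P (snd Q) (map (\<lambda>v. if v \<in> set (lfv (snd Q)) then Var (hmap M v) else Zero) [0..<Suc (sum_list (lfv (snd Q)))]))])"

text \<open>The equations x = x restore free variables that the translation may have lost, so that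
  the free variables of the result are those of \<phi>.\<close>

definition efm :: "(form list \<times> form list \<times> nat \<Rightarrow> cert list) \<Rightarrow> lpze_fm \<Rightarrow> lpze_fm" where
  "efm sr \<phi> = (let \<chi> = zdisj (map (matrix_fm (Suc (sum_list (zfv \<phi>)))) (tr sr \<phi>)) in
     foldr Ex (filter (\<lambda>v. v \<notin> set (zfv \<phi>)) (zfv \<chi>)) (Conj \<chi> (zconj (map (\<lambda>x. Atom (Eq (Var x) (Var x))) (zfv \<phi>)))))"

lemma core_cong:
  assumes "\<And>v. v \<in> set (qv Q) \<Longrightarrow> e v = e' v"
  shows "core e Q = core e' Q"
proof -
  have "ev e (rown r) = ev e' (rown r)" if "r \<in> set (fst (fst Q))" for r
    by (rule ev_cong) (use assms that in \<open>auto simp: qv_def\<close>)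
  then have "ev e r = 0 \<longleftrightarrow> ev e' r = 0" if "r \<in> set (fst (fst Q))" for r
    using that by (metis ev_rown_0)
  moreover have "lp_sat p (\<lambda>v. cst (e v)) (snd Q) = lp_sat p (\<lambda>v. cst (e' v)) (snd Q)"
    by (rule lp_sat_cong) (use assms in \<open>auto simp: qv_def set_lfv\<close>)
  moreover have "e v = e' v" if "v \<in> set (fst (snd (fst Q))) \<union> set (snd (snd (fst Q)))" for v
    using assms that by (auto simp: qv_def)
  ultimately show ?thesis unfolding core_def altsem_def by auto
qed

lemma eval_rterm: "(\<And>u. u \<in> set r \<Longrightarrow> md u = 0) \<Longrightarrow> lpz_eval p d (rterm M r) = ev (\<lambda>v. d (hmap M v)) r"
proof (induction r)
  case (Cons u r)
  have f: "lpz_eval p d (rec_nat t (\<lambda>_ t. Frob t) i) = lpz_eval p d t ^ (p ^ i)" for t i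
    by (induction i) (simp_all add: mult.commute flip: power_mult)
  have m: "lpz_eval p d (rec_nat t (\<lambda>_ t. MulZ t) i) = z_rf ^ i * lpz_eval p d t" for t i
    by (induction i) (simp_all add: mult.assoc)
  show ?case using Cons by (simp add: rterm_def f m emon_def)
qed (simp add: rterm_def)

lemma sat_mat:
  assumes "wf_prob Q"
  shows "lpze_sat p S d (matrix_fm M Q) \<longleftrightarrow> (\<forall>v\<in>set (qv Q). Fkind v \<longrightarrow> d (hmap M v) \<in> F) \<and> core (\<lambda>v. d (hmap M v)) Q"
proof -
  define N where "N = Suc (sum_list (lfv (snd Q)))"
  define ts where "ts = map (\<lambda>v. if v \<in> set (lfv (snd Q)) then Var (hmap M v) else Zero) [0..<N]"
  have N: "v < N" if "v \<in> lp_fv (snd Q)" for v using sum_list_ge[of v "lfv (snd Q)"] that unfolding N_def by (simp add: set_lfv)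
  have P: "lpze_sat p S d (Atom (P (snd Q) ts)) \<longleftrightarrow> lp_sat p (\<lambda>v. cst (d (hmap M v))) (snd Q)"
    if F: "\<forall>v\<in>set (qv Q). Fkind v \<longrightarrow> d (hmap M v) \<in> F"
  proof -
    have dF: "d (hmap M v) \<in> F" if "v \<in> lp_fv (snd Q)" for v
      using assms F that unfolding wf_prob_def qv_def by (auto simp: set_lfv)
    have "lp_sat p (\<lambda>i. cs ! i) (snd Q) = lp_sat p (\<lambda>v. cst (d (hmap M v))) (snd Q)"
      if cs: "map (lpz_eval p d) ts = map const_rf cs" for cs
    proof (rule lp_sat_cong)
      fix v assume v: "v \<in> lp_fv (snd Q)"
      have "length cs = N" using arg_cong[OF cs, of length] by (simp add: ts_def)
      then have "d (hmap M v) = const_rf (cs ! v)"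
        using arg_cong[OF cs, of "\<lambda>xs. xs ! v"] N[OF v] v by (simp add: ts_def set_lfv del: upt_Suc)
      then show "cs ! v = cst (d (hmap M v))" by simp
    qed
    moreover have "map (lpz_eval p d) ts = map const_rf (map (\<lambda>v. cst (lpz_eval p d (ts ! v))) [0..<N])"
    proof (rule nth_equalityI)
      fix i assume "i < length (map (lpz_eval p d) ts)"
      then have i: "i < N" by (simp add: ts_def)
      have "lpz_eval p d (ts ! i) \<in> F" using i dF zero_F by (simp add: ts_def set_lfv del: upt_Suc)
      from const_cst[OF this] show "map (lpz_eval p d) ts ! i = map const_rf (map (\<lambda>v. cst (lpz_eval p d (ts ! v))) [0..<N]) ! i"
        using i by (simp add: ts_def del: upt_Suc)
    qed (simp add: ts_def)
    ultimately show ?thesis by (auto simp only: lpze_sat_def sat.simps lpze_atom_holds.simps)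
  qed
  have "lpze_sat p S d (Atom (Eq (rterm M (rown r)) Zero)) \<longleftrightarrow> ev (\<lambda>v. d (hmap M v)) r = 0" for r
    using eval_rterm[of "rown r"] set_rown[of _ r] by (simp add: lpze_sat_def)
  moreover have "lpze_sat p S d (Neg (Atom (InF (Var v)))) \<longleftrightarrow> d v \<notin> F" "lpze_sat p S d (Atom (Eq (Var v) One)) \<longleftrightarrow> d v = 1"
    "lpze_sat p S d (Atom (InF (Var v))) \<longleftrightarrow> d v \<in> F" for v
    by (simp_all add: lpze_sat_def)
  ultimately show ?thesis
    unfolding matrix_fm_def sat_zconj N_def[symmetric] ts_def[symmetric] core_def altsem_def using P
    by (auto simp: ball_Un simp del: lp_sat_simps)
qed

lemma lfv_less: "v \<in> lp_fv \<sigma> \<Longrightarrow> v < Suc (sum_list (lfv \<sigma>))"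
  using sum_list_ge[of v "lfv \<sigma>"] by (simp add: set_lfv)

lemma fv_mat: "v \<in> set (qv Q) \<Longrightarrow> hmap M v \<in> lpze_fv (matrix_fm M Q)"
  unfolding matrix_fm_def fv_zconj qv_def
  by (auto simp: vars_rterm set_lfv lfv_less simp del: upt_Suc sum_list.Cons
     intro!: bexI[of _ v] exI[of _ v])

lemma formula_mat: "lpze_formula (matrix_fm M Q)"
  unfolding matrix_fm_def formula_zconj using lfv_less by (auto simp: lpze_formula_def)

lemma qf_mat: "quantifier_free (matrix_fm M Q)"
  unfolding matrix_fm_def qf_zconj by auto

lemma efm_properties: "lpze_formula (efm sr \<phi>)" "existential (efm sr \<phi>)" "lpze_fv (efm sr \<phi>) = lpze_fv \<phi>"
proof -
  have "lpze_formula (Atom (Eq (Var x) (Var x)))" for x by (simp add: lpze_formula_def)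
  then have "lpze_formula (zdisj (map (matrix_fm M) A))" "lpze_formula (zconj (map (\<lambda>x. Atom (Eq (Var x) (Var x))) B))" for M A B
    by (simp_all add: formula_zdisj formula_zconj formula_mat)
  then show "lpze_formula (efm sr \<phi>)" unfolding efm_def Let_def formula_foldr_Ex
    by (simp add: lpze_formula_def ball_Un)
  have q: "quantifier_free (Conj (zdisj (map (matrix_fm M) A)) (zconj (map (\<lambda>x. Atom (Eq (Var x) (Var x))) B)))" for M A B
    by (simp add: qf_zdisj qf_zconj qf_mat)
  show "existential (efm sr \<phi>)" unfolding existential_def efm_def Let_def
    by (rule exI, rule exI, rule conjI, rule refl, rule q)
  show "lpze_fv (efm sr \<phi>) = lpze_fv \<phi>" unfolding efm_def Let_def fv_foldr_Ex
    by (auto simp: fv_zconj set_zfv)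
qed

lemma efm_equivalent:
  assumes sr: "\<And>x. finished (run (sr x) (istate x))" and \<phi>: "lpze_formula \<phi>"
  shows "equivalent_in p S \<phi> (efm sr \<phi>)"
  unfolding equivalent_in_def
proof (intro allI impI)
  fix d0 :: "nat \<Rightarrow> 'a poly fract" assume d0: "\<forall>i. d0 i \<in> R"
  define M where "M = Suc (sum_list (zfv \<phi>))"
  define \<chi> where "\<chi> = zdisj (map (matrix_fm M) (tr sr \<phi>))"
  define vs where "vs = filter (\<lambda>v. v \<notin> set (zfv \<phi>)) (zfv \<chi>)"
  note tr = translation[OF sr \<phi>]
  have wf: "wf_prob Q" if "Q \<in> set (tr sr \<phi>)" for Q using tr that unfolding lwf_def by blast
  have M: "x < M" if "x \<in> lpze_fv \<phi>" for x using sum_list_ge[of x "zfv \<phi>"] that unfolding M_def by (simp add: set_zfv)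
  have Ex: "lpze_sat p S d0 (efm sr \<phi>) \<longleftrightarrow>
      (\<exists>d. (\<forall>v. v \<notin> set vs \<longrightarrow> d v = d0 v) \<and> (\<forall>v\<in>set vs. d v \<in> R) \<and> lpze_sat p S d \<chi>)"
  proof -
    have "efm sr \<phi> = foldr Ex vs (Conj \<chi> (zconj (map (\<lambda>x. Atom (Eq (Var x) (Var x))) (zfv \<phi>))))"
      unfolding efm_def Let_def vs_def \<chi>_def M_def ..
    moreover have "lpze_sat p S d (Conj \<chi> (zconj (map (\<lambda>x. Atom (Eq (Var x) (Var x))) B))) \<longleftrightarrow> lpze_sat p S d \<chi>" for d B
      using sat_zconj[of p S d "map (\<lambda>x. Atom (Eq (Var x) (Var x))) B"] by (auto simp: lpze_sat_def)
    ultimately show ?thesis unfolding lpze_sat_def by (simp only: sat_foldr_Ex)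
  qed
  have fv\<chi>: "hmap M v \<in> lpze_fv \<chi>" if "Q \<in> set (tr sr \<phi>)" "v \<in> set (qv Q)" for Q v
    using that fv_mat[of v Q M] unfolding \<chi>_def fv_zdisj by auto
  have vs: "v \<in> set vs \<longleftrightarrow> v \<in> lpze_fv \<chi> \<and> v \<notin> lpze_fv \<phi>" for v unfolding vs_def by (simp add: set_zfv)
  have sat\<chi>: "lpze_sat p S d \<chi> \<longleftrightarrow> (\<exists>Q\<in>set (tr sr \<phi>). (\<forall>v\<in>set (qv Q). Fkind v \<longrightarrow> d (hmap M v) \<in> F) \<and> core (\<lambda>v. d (hmap M v)) Q)" for d
    unfolding \<chi>_def sat_zdisj using sat_mat[OF wf] by auto
  show "lpze_sat p S d0 \<phi> \<longleftrightarrow> lpze_sat p S d0 (efm sr \<phi>)"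
  proof
    assume s: "lpze_sat p S d0 \<phi>"
    define e where "e v = (if v mod 5 = 0 then d0 (v div 5) else 0)" for v
    have "\<forall>v. e v \<in> R" "(\<lambda>i. e (5 * i)) = d0" using d0 by (auto simp: e_def)
    then have "lsem (tr sr \<phi>) e" using tr s by auto
    then obtain Q e' where Q: "Q \<in> set (tr sr \<phi>)" and e': "valid e'" "\<forall>v. v mod 5 = 0 \<longrightarrow> e' v = e v" "core e' Q"
      unfolding lsem_def psem_def by blast
    define d where "d w = (if w \<in> set vs then e' (inv_into UNIV (hmap M) w) else d0 w)" for w
    have dv: "d (hmap M v) = e' v" if v: "v \<in> set (qv Q)" for v
    proof (cases "hmap M v \<in> set vs")
      case True
      then show ?thesis by (simp add: d_def hmap_inj)
    next
      case False
      \<comment> \<open>A number that is not quantified is a free variable of \<phi>, hence below M,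
        and can only come from a variable of kind 0.\<close>
      then have "hmap M v < M" using fv\<chi>[OF Q v] vs M by blast
      then have "v mod 5 = 0" "hmap M v = v div 5" using hmap_less by blast+
      then show ?thesis using False e'(2) by (simp add: d_def e_def)
    qed
    have "core (\<lambda>v. d (hmap M v)) Q" using core_cong[of Q "\<lambda>v. d (hmap M v)" e'] dv e'(3) by blast
    moreover have "Fkind v \<longrightarrow> d (hmap M v) \<in> F" if "v \<in> set (qv Q)" for v
      using dv[OF that] validD(2)[OF e'(1), of v] by simp
    ultimately have "lpze_sat p S d \<chi>" unfolding sat\<chi> using Q by blast
    moreover have "d v \<in> R" for v unfolding d_def using validD(1)[OF e'(1)] d0 by simp
    ultimately show "lpze_sat p S d0 (efm sr \<phi>)" unfolding Ex
    proof (intro exI[of _ d] conjI)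
      show "\<forall>v. v \<notin> set vs \<longrightarrow> d v = d0 v" by (simp add: d_def)
    qed blast+
  next
    assume "lpze_sat p S d0 (efm sr \<phi>)"
    then obtain d where d: "\<forall>v. v \<notin> set vs \<longrightarrow> d v = d0 v" "\<forall>v\<in>set vs. d v \<in> R" "lpze_sat p S d \<chi>" unfolding Ex by blast
    then obtain Q where Q: "Q \<in> set (tr sr \<phi>)" "\<forall>v\<in>set (qv Q). Fkind v \<longrightarrow> d (hmap M v) \<in> F" "core (\<lambda>v. d (hmap M v)) Q"
      unfolding sat\<chi> by blast
    have dR: "d v \<in> R" for v using d(1,2) d0 by (cases "v \<in> set vs") auto
    \<comment> \<open>Variables absent from the problem do not influence it; those of kind 0 follow
      the given valuation, the others are 0, which is admissible for every kind.\<close>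
    define e' where "e' v = (if v \<in> set (qv Q) then d (hmap M v) else if v mod 5 = 0 then d0 (v div 5) else 0)" for v
    have v: "valid e'" unfolding valid_def e'_def using dR d0 Q(2) zero_F by auto
    have "core e' Q" using core_cong[of Q "\<lambda>v. d (hmap M v)" e'] Q(3) unfolding e'_def by simp
    then have "lsem (tr sr \<phi>) e'" unfolding lsem_def psem_def using Q(1) v by blast
    then have "lpze_sat p S (\<lambda>i. e' (5 * i)) \<phi>" using tr validD(1)[OF v] by blast
    moreover have "e' (5 * x) = d0 x" if x: "x \<in> lpze_fv \<phi>" for x
    proof -
      have "hmap M (5 * x) = x" using M[OF x] by (simp add: hmap_def)
      then show ?thesis using d(1) vs x unfolding e'_def by simp
    qed
    ultimately show "lpze_sat p S d0 \<phi>" using lpze_sat_cong[of \<phi> "\<lambda>i. e' (5 * i)" d0] by blast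
  qed
qed

end

section \<open>Computability of the translation\<close>

lemma cmp_comp4:
  assumes "cmp (\<lambda>p. g (fst p) (fst (snd p)) (fst (snd (snd p))) (snd (snd (snd p))))" "cmp f1" "cmp f2" "cmp f3" "cmp f4"
  shows "cmp (\<lambda>x. g (f1 x) (f2 x) (f3 x) (f4 x))"
  using cmp_comp[OF assms(1) cmp_Pair[OF assms(2) cmp_Pair[OF assms(3) cmp_Pair[OF assms(4,5)]]]] by simp

lemma cmp_comp5:
  assumes "cmp (\<lambda>p. g (fst p) (fst (snd p)) (fst (snd (snd p))) (fst (snd (snd (snd p)))) (snd (snd (snd (snd p)))))"
    "cmp f1" "cmp f2" "cmp f3" "cmp f4" "cmp f5"
  shows "cmp (\<lambda>x. g (f1 x) (f2 x) (f3 x) (f4 x) (f5 x))"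
  using cmp_comp[OF assms(1) cmp_Pair[OF assms(2) cmp_Pair[OF assms(3) cmp_Pair[OF assms(4) cmp_Pair[OF assms(5,6)]]]]] by simp

lemma cmp_disj [cmp_intros]: "cmp f \<Longrightarrow> cmp g \<Longrightarrow> cmp (\<lambda>x. f x \<or> g x)"
proof -
  assume "cmp f" "cmp g"
  then have "cmp (\<lambda>x. \<not> (\<not> f x \<and> \<not> g x))" by (intro cmp_intros)
  then show ?thesis by simp
qed

lemma cmp_ren_tm [cmp_intros]:
  assumes "cmp (\<lambda>p. f (fst p) (snd p))" "cmp t"
  shows "cmp (\<lambda>x. ren_tm (f x) (t x))"
  unfolding ren_tm_def by (intro cmp_intros assms cmp_comp2[OF assms(1)])

lemma cmp_ren_fm [cmp_intros]:
  assumes "cmp (\<lambda>p. f (fst p) (snd p))" "cmp t"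
  shows "cmp (\<lambda>x. ren_fm (f x) (t x))"
  unfolding ren_fm_def by (intro cmp_intros assms cmp_comp2[OF assms(1)])

lemma cmp_prename [cmp_intros]:
  assumes "cmp (\<lambda>p. f (fst p) (snd p))" "cmp t"
  shows "cmp (\<lambda>x. prename (f x) (t x))"
  unfolding prename_def by (intro cmp_intros assms cmp_comp2[OF assms(1)] assms(2)[THEN cmp_comp])

lemma cmp_fbound [cmp_intros]: "cmp a \<Longrightarrow> cmp (\<lambda>x. fbound (a x))"
  by (rule cmp_comp[where f = fbound], unfold fbound_def Let_def, intro cmp_intros)

lemma cmp_abound [cmp_intros]: "cmp a \<Longrightarrow> cmp (\<lambda>x. abound (a x))"
  by (rule cmp_comp[where f = abound], unfold abound_def Let_def, intro cmp_intros)

lemma cmp_sbound [cmp_intros]: "cmp a \<Longrightarrow> cmp (\<lambda>x. sbound (a x))"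
  by (rule cmp_comp[where f = sbound], unfold sbound_def Let_def, intro cmp_intros)

lemma cmp_xpart [cmp_intros]: "cmp a \<Longrightarrow> cmp (\<lambda>x. xpart (a x))"
  by (rule cmp_comp[where f = xpart], unfold xpart_def Let_def, intro cmp_intros)

lemma cmp_fpart [cmp_intros]: "cmp a \<Longrightarrow> cmp (\<lambda>x. fpart (a x))"
  by (rule cmp_comp[where f = fpart], unfold fpart_def Let_def, intro cmp_intros)

lemma cmp_upart [cmp_intros]: "cmp a \<Longrightarrow> cmp (\<lambda>x. upart (a x))"
  by (rule cmp_comp[where f = upart], unfold upart_def Let_def, intro cmp_intros)

lemma cmp_ltv [cmp_intros]: "cmp a \<Longrightarrow> cmp (\<lambda>x. ltv (a x))"
  by (rule cmp_comp[where f = ltv], unfold ltv_def Let_def, intro cmp_intros)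

lemma cmp_lfv [cmp_intros]: "cmp a \<Longrightarrow> cmp (\<lambda>x. lfv (a x))"
  by (rule cmp_comp[where f = lfv], unfold lfv_def Let_def, intro cmp_intros)

lemma cmp_ztv [cmp_intros]: "cmp a \<Longrightarrow> cmp (\<lambda>x. ztv (a x))"
  by (rule cmp_comp[where f = ztv], unfold ztv_def Let_def, intro cmp_intros)

lemma cmp_zfv [cmp_intros]: "cmp a \<Longrightarrow> cmp (\<lambda>x. zfv (a x))"
  by (rule cmp_comp[where f = zfv], unfold zfv_def Let_def, intro cmp_intros)

lemma cmp_lconj [cmp_intros]: "cmp a \<Longrightarrow> cmp (\<lambda>x. lconj (a x))"
  by (rule cmp_comp[where f = lconj], unfold lconj_def Let_def, intro cmp_intros)

lemma cmp_lsum [cmp_intros]: "cmp a \<Longrightarrow> cmp (\<lambda>x. lsum (a x))"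
  by (rule cmp_comp[where f = lsum], unfold lsum_def Let_def, intro cmp_intros)

lemma cmp_nren [cmp_intros]: "cmp a \<Longrightarrow> cmp (\<lambda>x. nren (a x))"
  by (rule cmp_comp[where f = nren], unfold nren_def Let_def, intro cmp_intros)

lemma cmp_mren [cmp_intros]: "cmp a \<Longrightarrow> cmp b \<Longrightarrow> cmp (\<lambda>x. mren (a x) (b x))"
  by (rule cmp_comp2[where g = mren], unfold mren_def Let_def, intro cmp_intros)

lemma cmp_qren [cmp_intros]: "cmp a \<Longrightarrow> cmp b \<Longrightarrow> cmp (\<lambda>x. qren (a x) (b x))"
  by (rule cmp_comp2[where g = qren], unfold qren_def Let_def, intro cmp_intros)

lemma cmp_hmap [cmp_intros]: "cmp a \<Longrightarrow> cmp b \<Longrightarrow> cmp (\<lambda>x. hmap (a x) (b x))"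
  by (rule cmp_comp2[where g = hmap], unfold hmap_def Let_def, intro cmp_intros)

lemma cmp_zconj [cmp_intros]: "cmp a \<Longrightarrow> cmp (\<lambda>x. zconj (a x))"
  by (rule cmp_comp[where f = zconj], unfold zconj_def Let_def, intro cmp_intros)

lemma cmp_zdisj [cmp_intros]: "cmp a \<Longrightarrow> cmp (\<lambda>x. zdisj (a x))"
  by (rule cmp_comp[where f = zdisj], unfold zdisj_def Let_def, intro cmp_intros)

lemma cmp_rterm [cmp_intros]: "cmp a \<Longrightarrow> cmp b \<Longrightarrow> cmp (\<lambda>x. rterm (a x) (b x))"
  by (rule cmp_comp2[where g = rterm], unfold rterm_def Let_def, intro cmp_intros)

context setting
begin

lemma cmp_subst [cmp_intros]:
  assumes "cmp (\<lambda>p. f (fst p) (snd p))" "cmp t"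
  shows "cmp (\<lambda>x. subst (f x) (t x))"
  unfolding subst_def by (intro cmp_intros assms cmp_comp2[OF assms(1)] assms(2)[THEN cmp_comp])

text \<open>The number \<open>p\<close>, like \<open>E\<close> and the list \<open>Dl\<close> below,
  is fixed by the setting and enters as a constant; only the syntax varies.\<close>

lemma cmp_negf [cmp_intros]: "cmp a \<Longrightarrow> cmp (\<lambda>x. negf (a x))"
  by (rule cmp_comp[where f = negf], unfold negf_def Let_def, intro cmp_intros)

lemma cmp_Dpow [cmp_intros]: "cmp a \<Longrightarrow> cmp (\<lambda>x. Dpow (a x))"
  by (rule cmp_comp[where f = Dpow], unfold Dpow_def Let_def, intro cmp_intros)

lemma cmp_clr [cmp_intros]: "cmp a \<Longrightarrow> cmp b \<Longrightarrow> cmp (\<lambda>x. clr (a x) (b x))"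
  by (rule cmp_comp2[where g = clr], unfold clr_def Let_def, intro cmp_intros)

lemma cmp_maxd [cmp_intros]: "cmp a \<Longrightarrow> cmp (\<lambda>x. maxd (a x))"
  by (rule cmp_comp[where f = maxd], unfold maxd_def Let_def, intro cmp_intros)

lemma cmp_nrm [cmp_intros]: "cmp a \<Longrightarrow> cmp (\<lambda>x. nrm (a x))"
  by (rule cmp_comp[where f = nrm], unfold nrm_def Let_def, intro cmp_intros)

lemma cmp_rown [cmp_intros]: "cmp a \<Longrightarrow> cmp (\<lambda>x. rown (a x))"
  by (rule cmp_comp[where f = rown], unfold rown_def Let_def, intro cmp_intros)

lemma cmp_subst_state [cmp_intros]:
  assumes "cmp (\<lambda>p. f (fst p) (snd p))" "cmp t"
  shows "cmp (\<lambda>x. subst_state (f x) (t x))"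
  unfolding subst_state_def by (intro cmp_intros assms cmp_comp2[OF assms(1)] assms(2)[THEN cmp_comp])

lemma cmp_canon [cmp_intros]: "cmp a \<Longrightarrow> cmp (\<lambda>x. canon (a x))"
  by (rule cmp_comp[where f = canon], unfold canon_def Let_def, intro cmp_intros)

lemma cmp_plz [cmp_intros]: "cmp a \<Longrightarrow> cmp (\<lambda>x. plz (a x))"
  by (rule cmp_comp[where f = plz], unfold plz_def Let_def, intro cmp_intros)

lemma cmp_thA [cmp_intros]: "cmp a \<Longrightarrow> cmp b \<Longrightarrow> cmp c \<Longrightarrow> cmp d \<Longrightarrow> cmp e \<Longrightarrow> cmp (\<lambda>x. thA (a x) (b x) (c x) (d x) (e x))"
  by (rule cmp_comp5[where g = thA], unfold thA_def Let_def, intro cmp_intros)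

lemma cmp_dg [cmp_intros]: "cmp a \<Longrightarrow> cmp b \<Longrightarrow> cmp (\<lambda>x. dg (a x) (b x))"
  by (rule cmp_comp2[where g = dg], unfold dg_def Let_def, intro cmp_intros)

lemma cmp_thS [cmp_intros]: "cmp a \<Longrightarrow> cmp b \<Longrightarrow> cmp c \<Longrightarrow> cmp d \<Longrightarrow> cmp (\<lambda>x. thS (a x) (b x) (c x) (d x))"
  by (rule cmp_comp4[where g = thS], unfold thS_def Let_def, intro cmp_intros)

lemma cmp_stepA [cmp_intros]: "cmp a \<Longrightarrow> cmp b \<Longrightarrow> cmp c \<Longrightarrow> cmp d \<Longrightarrow> cmp (\<lambda>x. stepA (a x) (b x) (c x) (d x))"
  by (rule cmp_comp4[where g = stepA], unfold stepA_def Let_def, intro cmp_intros)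

lemma cmp_stepS [cmp_intros]: "cmp a \<Longrightarrow> cmp b \<Longrightarrow> cmp (\<lambda>x. stepS (a x) (b x))"
  by (rule cmp_comp2[where g = stepS], unfold stepS_def Let_def, intro cmp_intros)

lemma cmp_conv [cmp_intros]: "cmp a \<Longrightarrow> cmp b \<Longrightarrow> cmp c \<Longrightarrow> cmp (\<lambda>x. conv (a x) (b x) (c x))"
  by (rule cmp_comp3[where g = conv], unfold conv_def Let_def, intro cmp_intros)

lemma cmp_fam [cmp_intros]: "cmp a \<Longrightarrow> cmp b \<Longrightarrow> cmp c \<Longrightarrow> cmp d \<Longrightarrow> cmp e \<Longrightarrow> cmp (\<lambda>x. fam (a x) (b x) (c x) (d x) (e x))"
  by (rule cmp_comp5[where g = fam], unfold fam_def Let_def, intro cmp_intros)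

lemma cmp_chart_ok [cmp_intros]: "cmp a \<Longrightarrow> cmp b \<Longrightarrow> cmp c \<Longrightarrow> cmp (\<lambda>x. chart_ok (a x) (b x) (c x))"
  by (rule cmp_comp3[where g = chart_ok], unfold chart_ok_def Let_def, intro cmp_intros)

lemma cmp_kap [cmp_intros]: "cmp a \<Longrightarrow> cmp b \<Longrightarrow> cmp (\<lambda>x. kap (a x) (b x))"
  by (rule cmp_comp2[where g = kap], unfold kap_def Let_def, intro cmp_intros)

lemma cmp_s00 [cmp_intros]: "cmp a \<Longrightarrow> cmp b \<Longrightarrow> cmp (\<lambda>x. s00 (a x) (b x))"
  by (rule cmp_comp2[where g = s00], unfold s00_def Let_def, intro cmp_intros)

lemma cmp_n00 [cmp_intros]: "cmp a \<Longrightarrow> cmp b \<Longrightarrow> cmp (\<lambda>x. n00 (a x) (b x))"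
  by (rule cmp_comp2[where g = n00], unfold n00_def Let_def, intro cmp_intros)

lemma cmp_exf [cmp_intros]: "cmp a \<Longrightarrow> cmp b \<Longrightarrow> cmp c \<Longrightarrow> cmp (\<lambda>x. exf (a x) (b x) (c x))"
  by (rule cmp_comp3[where g = exf], unfold exf_def Let_def, intro cmp_intros)

lemma cmp_vfm [cmp_intros]: "cmp a \<Longrightarrow> cmp b \<Longrightarrow> cmp (\<lambda>x. vfm (a x) (b x))"
  by (rule cmp_comp2[where g = vfm], unfold vfm_def Let_def, intro cmp_intros)

lemma cmp_xyf [cmp_intros]: "cmp a \<Longrightarrow> cmp b \<Longrightarrow> cmp (\<lambda>x. xyf (a x) (b x))"
  by (rule cmp_comp2[where g = xyf], unfold xyf_def Let_def, intro cmp_intros)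

lemma cmp_bxf [cmp_intros]: "cmp a \<Longrightarrow> cmp b \<Longrightarrow> cmp c \<Longrightarrow> cmp (\<lambda>x. bxf (a x) (b x) (c x))"
  by (rule cmp_comp3[where g = bxf], unfold bxf_def Let_def, intro cmp_intros)

lemma cmp_thC [cmp_intros]: "cmp a \<Longrightarrow> cmp b \<Longrightarrow> cmp c \<Longrightarrow> cmp d \<Longrightarrow> cmp (\<lambda>x. thC (a x) (b x) (c x) (d x))"
  by (rule cmp_comp4[where g = thC], unfold thC_def Let_def, intro cmp_intros)

lemma cmp_altrow [cmp_intros]: "cmp a \<Longrightarrow> cmp b \<Longrightarrow> cmp c \<Longrightarrow> cmp d \<Longrightarrow> cmp (\<lambda>x. altrow (a x) (b x) (c x) (d x))"
  by (rule cmp_comp4[where g = altrow], unfold altrow_def Let_def, intro cmp_intros)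

lemma cmp_newrow [cmp_intros]: "cmp a \<Longrightarrow> cmp b \<Longrightarrow> cmp c \<Longrightarrow> cmp d \<Longrightarrow> cmp (\<lambda>x. newrow (a x) (b x) (c x) (d x))"
  by (rule cmp_comp4[where g = newrow], unfold newrow_def Let_def, intro cmp_intros)

lemma cmp_chart_state [cmp_intros]: "cmp a \<Longrightarrow> cmp b \<Longrightarrow> cmp c \<Longrightarrow> cmp d \<Longrightarrow> cmp e \<Longrightarrow> cmp (\<lambda>x. chart_state (a x) (b x) (c x) (d x) (e x))"
  by (rule cmp_comp5[where g = chart_state], unfold chart_state_def Let_def, intro cmp_intros)

lemma cmp_stepC [cmp_intros]: "cmp a \<Longrightarrow> cmp b \<Longrightarrow> cmp c \<Longrightarrow> cmp (\<lambda>x. stepC (a x) (b x) (c x))"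
  by (rule cmp_comp3[where g = stepC], unfold stepC_def Let_def, intro cmp_intros)

lemma cmp_cn [cmp_intros]: "cmp a \<Longrightarrow> cmp (\<lambda>x. cn (a x))"
  by (rule cmp_comp[where f = cn], unfold cn_def Let_def, intro cmp_intros)

lemma cmp_cm [cmp_intros]: "cmp a \<Longrightarrow> cmp (\<lambda>x. cm (a x))"
  by (rule cmp_comp[where f = cm], unfold cm_def Let_def, intro cmp_intros)

lemma cmp_wfm [cmp_intros]: "cmp a \<Longrightarrow> cmp b \<Longrightarrow> cmp (\<lambda>x. wfm (a x) (b x))"
  by (rule cmp_comp2[where g = wfm], unfold wfm_def Let_def, intro cmp_intros)

lemma cmp_dfm [cmp_intros]: "cmp a \<Longrightarrow> cmp b \<Longrightarrow> cmp (\<lambda>x. dfm (a x) (b x))"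
  by (rule cmp_comp2[where g = dfm], unfold dfm_def Let_def, intro cmp_intros)

lemma cmp_gv [cmp_intros]: "cmp a \<Longrightarrow> cmp b \<Longrightarrow> cmp (\<lambda>x. gv (a x) (b x))"
  by (rule cmp_comp2[where g = gv], unfold gv_def Let_def, intro cmp_intros)

lemma cmp_wrow [cmp_intros]: "cmp a \<Longrightarrow> cmp b \<Longrightarrow> cmp (\<lambda>x. wrow (a x) (b x))"
  by (rule cmp_comp2[where g = wrow], unfold wrow_def Let_def, intro cmp_intros)

lemma cmp_cform [cmp_intros]: "cmp a \<Longrightarrow> cmp b \<Longrightarrow> cmp (\<lambda>x. cform (a x) (b x))"
  by (rule cmp_comp2[where g = cform], unfold cform_def Let_def, intro cmp_intros)

lemma cmp_calts [cmp_intros]: "cmp a \<Longrightarrow> cmp b \<Longrightarrow> cmp (\<lambda>x. calts (a x) (b x))"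
  by (rule cmp_comp2[where g = calts], unfold calts_def Let_def, intro cmp_intros)

lemma cmp_combine [cmp_intros]: "cmp a \<Longrightarrow> cmp b \<Longrightarrow> cmp (\<lambda>x. combine (a x) (b x))"
  by (rule cmp_comp2[where g = combine], unfold combine_def Let_def, intro cmp_intros)

lemma cmp_coord_step [cmp_intros]: "cmp a \<Longrightarrow> cmp b \<Longrightarrow> cmp (\<lambda>x. coord_step (a x) (b x))"
  by (rule cmp_comp2[where g = coord_step], unfold coord_step_def Let_def, intro cmp_intros)

lemma cmp_finalize [cmp_intros]: "cmp a \<Longrightarrow> cmp (\<lambda>x. finalize (a x))"
  by (rule cmp_comp[where f = finalize], unfold finalize_def Let_def, intro cmp_intros)

lemma cmp_finished [cmp_intros]: "cmp a \<Longrightarrow> cmp (\<lambda>x. finished (a x))"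
  by (rule cmp_comp[where f = finished], unfold finished_def Let_def, intro cmp_intros)

lemma cmp_step [cmp_intros]: "cmp a \<Longrightarrow> cmp b \<Longrightarrow> cmp (\<lambda>x. step (a x) (b x))"
  by (rule cmp_comp2[where g = step], unfold step_def Let_def, intro cmp_intros)

lemma cmp_run [cmp_intros]: "cmp a \<Longrightarrow> cmp b \<Longrightarrow> cmp (\<lambda>x. run (a x) (b x))"
  by (rule cmp_comp2[where g = run], unfold run_def Let_def, intro cmp_intros)

lemma cmp_rowfm [cmp_intros]: "cmp a \<Longrightarrow> cmp (\<lambda>x. rowfm (a x))"
  by (rule cmp_comp[where f = rowfm], unfold rowfm_def Let_def, intro cmp_intros)

lemma cmp_Fcond [cmp_intros]: "cmp a \<Longrightarrow> cmp (\<lambda>x. Fcond (a x))"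
  by (rule cmp_comp[where f = Fcond], unfold Fcond_def Let_def, intro cmp_intros)

lemma cmp_merge [cmp_intros]: "cmp a \<Longrightarrow> cmp b \<Longrightarrow> cmp (\<lambda>x. merge (a x) (b x))"
  by (rule cmp_comp2[where g = merge], unfold merge_def Let_def, intro cmp_intros)

lemma cmp_istate [cmp_intros]: "cmp a \<Longrightarrow> cmp (\<lambda>x. istate (a x))"
  by (rule cmp_comp[where f = istate], unfold istate_def Let_def, intro cmp_intros)

lemma cmp_SF [cmp_intros]: "cmp a \<Longrightarrow> cmp b \<Longrightarrow> cmp c \<Longrightarrow> cmp (\<lambda>x. SF (a x) (b x) (c x))"
  by (rule cmp_comp3[where g = SF], unfold SF_def Let_def, intro cmp_intros)

lemma cmp_nbnd [cmp_intros]: "cmp a \<Longrightarrow> cmp (\<lambda>x. nbnd (a x))"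
  by (rule cmp_comp[where f = nbnd], unfold nbnd_def Let_def, intro cmp_intros)

lemma cmp_ninp [cmp_intros]: "cmp a \<Longrightarrow> cmp (\<lambda>x. ninp (a x))"
  by (rule cmp_comp[where f = ninp], unfold ninp_def Let_def, intro cmp_intros)

lemma cmp_land [cmp_intros]: "cmp a \<Longrightarrow> cmp b \<Longrightarrow> cmp (\<lambda>x. land (a x) (b x))"
  by (rule cmp_comp2[where g = land], unfold land_def Let_def, intro cmp_intros)

lemma cmp_tform [cmp_intros]: "cmp a \<Longrightarrow> cmp (\<lambda>x. tform (a x))"
  by (rule cmp_comp[where f = tform], unfold tform_def Let_def, intro cmp_intros)

lemma cmp_atom_prob [cmp_intros]: "cmp a \<Longrightarrow> cmp (\<lambda>x. atom_prob (a x))"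
  by (rule cmp_comp[where f = atom_prob], unfold atom_prob_def Let_def, intro cmp_intros)

lemma cmp_qv [cmp_intros]: "cmp a \<Longrightarrow> cmp (\<lambda>x. qv (a x))"
  by (rule cmp_comp[where f = qv], unfold qv_def Let_def, intro cmp_intros)

lemma cmp_matrix_fm [cmp_intros]: "cmp a \<Longrightarrow> cmp b \<Longrightarrow> cmp (\<lambda>x. matrix_fm (a x) (b x))"
  by (rule cmp_comp2[where g = matrix_fm], unfold matrix_fm_def Let_def, intro cmp_intros)

lemma cmp_nres:
  assumes "cmp sr" "cmp Q"
  shows "cmp (\<lambda>x. nres sr (Q x))"
proof -
  have "cmp (nres sr)" unfolding nres_def[abs_def] Let_def by (intro cmp_intros cmp_comp[OF assms(1)])
  then show ?thesis using assms(2) by (rule cmp_comp)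
qed

lemma cmp_lneg:
  assumes "cmp sr" "cmp A"
  shows "cmp (\<lambda>x. lneg sr (A x))"
proof -
  have "cmp (lneg sr)" unfolding lneg_def[abs_def] by (intro cmp_intros cmp_nres[OF assms(1)])
  then show ?thesis using assms(2) by (rule cmp_comp)
qed

lemma cmp_tr:
  assumes "cmp sr" "cmp A"
  shows "cmp (\<lambda>x. tr sr (A x))"
proof -
  have "cmp (tr sr)" unfolding tr_def[abs_def] by (intro cmp_intros cmp_lneg[OF assms(1)])
  then show ?thesis using assms(2) by (rule cmp_comp)
qed

lemma cmp_efm: "cmp sr \<Longrightarrow> cmp (efm sr)"
  unfolding efm_def[abs_def] Let_def by (intro cmp_intros cmp_tr)

text \<open>The search has to succeed on every coded input, also on triples that come from no
  formula. This is guaranteed because \<open>istate\<close> normalises its rows and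
  \<open>elimination_sequence\<close> covers every normal state.\<close>

lemma elimination_search:
  obtains sr where "cmp sr" "\<And>x. finished (run (sr x) (istate x))"
proof -
  have "\<exists>cs. finished (run cs (istate x))" for x
    by (rule elimination_sequence) (auto simp: normal_def istate_def)
  moreover have "cmp (\<lambda>q. finished (run (snd q) (istate (fst q))))" by (intro cmp_intros)
  ultimately show ?thesis
    using cmp_search[where Q = "\<lambda>x cs. finished (run cs (istate x))"] that by blast
qed

theorem model_complete: "effectively_model_complete p S"
proof -
  obtain sr where sr: "cmp sr" "\<And>x. finished (run (sr x) (istate x))" by (rule elimination_search) (rule that)
  obtain h where h: "computable h" "\<And>\<phi>. h (enc \<phi>) = enc (efm sr \<phi>)"
    using cmp_efm[OF sr(1)] by (rule cmpE) (rule that)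
  show ?thesis unfolding effectively_model_complete_def
    using h efm_properties efm_equivalent[OF sr(2)] unfolding enc_lpze_code by blast
qed

text \<open>A sentence is true or false in the structure, hence equivalent to a true or to a false \<open>L\<^sub>p\<close>-sentence.\<close>

theorem sentence_equivalent:
  assumes "lpze_sentence \<phi>"
  shows "\<exists>\<sigma>. lp_sentence \<sigma> \<and> equivalent_in p S \<phi> (Atom (P \<sigma> []))"
proof -
  define \<sigma> where "\<sigma> = (if lpze_sat p S (\<lambda>_. 0) \<phi> then ltrue else Neg ltrue)"
  have "lpze_sat p S e \<phi> = lpze_sat p S (\<lambda>_. 0) \<phi>" for e
    by (rule lpze_sat_cong) (use assms in \<open>simp add: lpze_sentence_def\<close>)
  moreover have "lpze_sat p S e (Atom (P \<sigma> [])) = lpze_sat p S (\<lambda>_. 0) \<phi>" for e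
    by (simp add: \<sigma>_def lpze_sat_def[of p S e])
  ultimately have "equivalent_in p S \<phi> (Atom (P \<sigma> []))" unfolding equivalent_in_def by blast
  moreover have "lp_sentence \<sigma>" by (simp add: \<sigma>_def lp_sentence_def)
  ultimately show ?thesis by blast
qed

end

theorem theorem1p1:
  fixes p :: nat and S :: "'a::field poly set"
  assumes "prime p"
    and "CHAR('a) = p"
    and "\<forall>x::'a. algebraic_over_prime_field x"
    and "finite S"
    and "\<forall>s\<in>S. irreducible_in prime_field_polys s"
    and "\<forall>s\<in>S. irreducible s"
  shows "effectively_model_complete p S \<and>
    (\<forall>\<phi>. lpze_sentence \<phi> \<longrightarrow>
      (\<exists>\<sigma>. lp_sentence \<sigma> \<and> equivalent_in p S \<phi> (Atom (P \<sigma> []))))"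
proof -
  interpret setting p S
    by unfold_locales (use assms in \<open>auto simp: irreducible_in_def\<close>)
  show ?thesis using model_complete sentence_equivalent by blast
qed

end
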